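(* For $k$ a positive integer, let $p=tq^{2k}$. Then for each $\sigma\in\{0,1\}$, $$\sum_{\lambda} q^{(\sigma+1)|\lambda|/2}\,t^{l(\lambda^{\mathrm{o}})/2}\Biggl(\prod_{i=1}^{2k-1}\bigl(t;t^2\bigr)_{\lceil m_i(\lambda)/2\rceil}\Biggr)P_{\lambda}\bigl(1,q,q^2,\dots;t\bigr)$$ $$=\frac{(p^2;p^2)_{\infty}(p;p)_{\infty}^{k-1}}{(q;q)_{\infty}^k}\prod_{i=1}^k\theta\bigl(q^{2i-\sigma};p^2\bigr)\prod_{1\leq i<j\leq k}\theta\bigl(q^{j-i};p\bigr)\,\theta\bigl(q^{i+j-\sigma};p\bigr),$$ where the sum is over all partitions $\lambda$ with $\lambda_1\le 2k$ in which every odd part has even multiplicity.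
   Context: $(a;q)_m=\prod_{i=0}^{m-1}(1-aq^i)$, $(a;q)_\infty=\prod_{i\ge0}(1-aq^i)$ and $\theta(a;p)=(a;p)_\infty(p/a;p)_\infty$. The identity is understood for complex $q,t$ with $|q|,|t|<1$, or as an identity of formal power series in $q$ with coefficients polynomial in $t$. For a partition $\lambda$: $|\lambda|=\sum_i\lambda_i$, $l(\lambda)$ is the number of parts, $m_i(\lambda)$ the multiplicity of parts equal to $i$, and $l(\lambda^{\mathrm{o}})$ is the number of odd parts of $\lambda$ ($\lambda^{\mathrm{o}}$ being the partition formed by the odd parts). The Hall–Littlewood polynomial in $x=(x_1,\dots,x_n)$, $l(\lambda)\le n$, is $$P_{\lambda}(x;t)=\frac{1}{v_{\lambda}(t)}\sum_{w\in S_n} w\biggl(x_1^{\lambda_1}\cdots x_n^{\lambda_n}\prod_{1\leq i<j\leq n}\frac{x_i-tx_j}{x_i-x_j}\biggr),\qquad v_{\lambda}(t)=\frac{(t;t)_{n-l(\lambda)}}{(1-t)^{n-l(\lambda)}}\prod_{i\geq 1}\frac{(t;t)_{m_i(\lambda)}}{(1-t)^{m_i(\lambda)}},$$ and $P_\lambda(x;t)=0$ if $l(\lambda)>n$. Since $P_\lambda(x_1,\dots,x_n,0;t)=P_\lambda(x_1,\dots,x_n;t)$, it extends to infinitely many variables; $P_\lambda(1,q,q^2,\dots;t)=\lim_{n\to\infty}P_\lambda(1,q,\dots,q^{n-1};t)$. *)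

theory Defs
  imports "HOL-Analysis.Analysis" "HOL-Library.Multiset" "HOL-Combinatorics.Permutations"
begin

definition qpoch :: "complex \<Rightarrow> complex \<Rightarrow> nat \<Rightarrow> complex" where
  "qpoch a q m = (\<Prod>i<m. 1 - a * q ^ i)"

definition qpoch_inf :: "complex \<Rightarrow> complex \<Rightarrow> complex" where
  "qpoch_inf a q = (\<Prod>i. 1 - a * q ^ i)"

text \<open>For \<open>a = 0\<close> the quotient \<open>p / a\<close> is 0, so \<open>theta 0 p = 1\<close>. When \<open>a\<close> and \<open>p / a\<close> are monomials
  in \<open>q\<close> and \<open>t\<close> with positive exponent of \<open>q\<close>, this is the correct value at \<open>q = 0\<close>.\<close>

definition theta :: "complex \<Rightarrow> complex \<Rightarrow> complex" where
  "theta a p = qpoch_inf a p * qpoch_inf (p / a) p"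

text \<open>
  A partition is the multiset of its (positive) parts, so that \<open>\<bar>\<mu>\<bar>\<close> is \<^term>\<open>sum_mset\<close>,
  \<open>l(\<mu>)\<close> is \<^term>\<open>size\<close>, and \<open>m\<^sub>i(\<mu>)\<close> is \<^term>\<open>count\<close>.
\<close>

definition is_partition :: "nat multiset \<Rightarrow> bool" where
  "is_partition \<mu> \<longleftrightarrow> 0 \<notin># \<mu>"

definition odd_parts :: "nat multiset \<Rightarrow> nat multiset" where
  "odd_parts \<mu> = filter_mset odd \<mu>"

text \<open>Parts in weakly decreasing order, counted from 0 and padded with zeros:
  \<open>part \<mu> i\<close> is \<open>\<mu>\<^sub>i\<^sub>+\<^sub>1\<close>.\<close>

definition part :: "nat multiset \<Rightarrow> nat \<Rightarrow> nat" where
  "part \<mu> i = (if i < size \<mu> then rev (sorted_list_of_multiset \<mu>) ! i else 0)"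

text \<open>The factors of \<open>v\<^sub>\<mu>(t)\<close> with \<open>m\<^sub>i(\<mu>) = 0\<close> are 1, so the product runs over the
  distinct parts only.\<close>

definition hl_norm :: "nat \<Rightarrow> nat multiset \<Rightarrow> complex \<Rightarrow> complex" where
  "hl_norm n \<mu> t =
     qpoch t t (n - size \<mu>) / (1 - t) ^ (n - size \<mu>) *
     (\<Prod>i\<in>set_mset \<mu>. qpoch t t (count \<mu> i) / (1 - t) ^ count \<mu> i)"

text \<open>The symmetrization formula in the variables \<open>x 0, \<dots>, x (n - 1)\<close>. As an expression in
  complex numbers it is meaningful only where these are pairwise distinct.\<close>

definition hl_formula :: "nat \<Rightarrow> nat multiset \<Rightarrow> complex \<Rightarrow> (nat \<Rightarrow> complex) \<Rightarrow> complex" where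
  "hl_formula n \<mu> t x =
     (1 / hl_norm n \<mu> t) *
     (\<Sum>w | w permutes {..<n}.
        (\<Prod>i<n. x (w i) ^ part \<mu> i) *
        (\<Prod>j<n. \<Prod>i<j. (x (w i) - t * x (w j)) / (x (w i) - x (w j))))"

text \<open>
  The Hall--Littlewood polynomial, as a polynomial function on all of complex \<open>n\<close>-space: the
  symmetrization is a polynomial, so its value at a point with coinciding coordinates is the limit
  of the formula along points with distinct coordinates. Where the coordinates are distinct this
  is the formula itself (lemma \<open>hall_littlewood_eq_formula\<close> below).
  Only \<open>x 0, \<dots>, x (n - 1)\<close> matter.
\<close>

definition hall_littlewood ::
    "nat \<Rightarrow> nat multiset \<Rightarrow> complex \<Rightarrow> (nat \<Rightarrow> complex) \<Rightarrow> complex" where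
  "hall_littlewood n \<mu> t x =
     (if size \<mu> \<le> n
      then Lim (at x within {y. inj_on y {..<n}}) (hl_formula n \<mu> t)
      else 0)"

text \<open>\<open>P\<^sub>\<mu>(1,q,q\<^sup>2,\<dots>;t)\<close>\<close>

definition hall_littlewood_principal ::
    "nat multiset \<Rightarrow> complex \<Rightarrow> complex \<Rightarrow> complex" where
  "hall_littlewood_principal \<mu> q t = lim (\<lambda>n. hall_littlewood n \<mu> t (\<lambda>i. q ^ i))"

lemma tendsto_coordinate:
  fixes x :: "nat \<Rightarrow> complex"
  shows "((\<lambda>y. y i) \<longlongrightarrow> x i) (at x within S)"
proof -
  have "continuous_on UNIV (\<lambda>y :: nat \<Rightarrow> complex. y i)"
    by (rule continuous_on_product_coordinates)
  then show ?thesis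
    by (meson UNIV_I continuous_on_def subset_UNIV tendsto_within_subset)
qed

lemma distinct_points_not_isolated:
  fixes x :: "nat \<Rightarrow> complex"
  assumes "inj_on x {..<n}"
  shows "at x within {y. inj_on y {..<n}} \<noteq> bot"
proof -
  define f where "f m = x(n := x n + 1 / of_nat (Suc m))" for m
  have "(\<lambda>m. f m i) \<longlonglongrightarrow> x i" for i
  proof (cases "i = n")
    case True
    have "(\<lambda>m. x n + 1 / of_nat (Suc m)) \<longlonglongrightarrow> x n + 0"
      by (intro tendsto_intros LIMSEQ_Suc[OF lim_1_over_n])
    then show ?thesis using True by (simp add: f_def)
  next
    case False
    then show ?thesis by (simp add: f_def)
  qed
  then have lim: "f \<longlonglongrightarrow> x"
    using limitin_componentwise[of "\<lambda>_. euclidean" UNIV f x sequentially]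
    by (simp add: euclidean_product_topology)
  have ne: "f m \<in> {y. inj_on y {..<n}} - {x}" for m
  proof -
    have "f m n \<noteq> x n"
      unfolding f_def by (simp del: of_nat_Suc)
    moreover have "inj_on (f m) {..<n}"
      using assms unfolding f_def by (auto simp: inj_on_def)
    ultimately show ?thesis by auto
  qed
  have "x islimpt {y. inj_on y {..<n}}"
    unfolding islimpt_def
  proof (intro allI impI)
    fix T assume "x \<in> T" "open T"
    then obtain m where "f m \<in> T"
      using lim by (metis eventually_sequentially topological_tendstoD order_refl)
    then show "\<exists>y\<in>{y. inj_on y {..<n}}. y \<in> T \<and> y \<noteq> x"
      using ne[of m] by blast
  qed
  then show ?thesis
    by (simp add: trivial_limit_within)
qed

lemma hall_littlewood_eq_formula:
  assumes "size \<mu> \<le> n" and inj: "inj_on x {..<n}"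
  shows "hall_littlewood n \<mu> t x = hl_formula n \<mu> t x"
proof -
  have neq: "x (w i) \<noteq> x (w j)" if "w permutes {..<n}" "i < j" "j < n" for w i j
  proof -
    have "w i < n" "w j < n" "w i \<noteq> w j"
      using that permutes_in_image[OF that(1)] permutes_inj[OF that(1)]
      by (auto dest: injD)
    then show ?thesis
      using inj by (auto dest: inj_onD)
  qed
  have "(hl_formula n \<mu> t \<longlongrightarrow> hl_formula n \<mu> t x) (at x within {y. inj_on y {..<n}})"
    unfolding hl_formula_def
    by (intro tendsto_intros tendsto_coordinate) (use neq in auto)
  then show ?thesis
    using assms distinct_points_not_isolated[OF inj]
    by (simp add: hall_littlewood_def tendsto_Lim)
qed

end

(*
  Write P_mu as a sum over functions f from variables to parts; the weighted sum over mu then factors,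
  level by level, into an iterated shuffle product.  For parts bounded by 2k, the products over
  consecutive levels collapse (both sides of each step are rational functions of one variable with the
  same poles), which gives a sum over sign changes of the variables.  This sum obeys a recursion in the
  number of variables that is also satisfied, by partial fractions, by a k x k determinant of linear
  functionals applied to PROD (1 + x y)(x + y).

  At x = (r^(s+1) q^i) with r^2 = q that product expands by the q-binomial theorem, and as the number of
  variables grows the determinant tends to det F_j(r^(2i-s)), where F_1, ..., F_k are odd theta functions
  of nome p = t q^(2k).  As a function of any one argument, the expected product of theta functions lies
  in the span of the F_j and vanishes at the remaining arguments, so the determinant is the product up to
  a constant depending only on p.  The constant is found at t = 1, where the sum is trivial, with q
  replaced by a 2k-th root of p.  The case t = 0 follows by continuity and q = 0 is immediate.
*)

theory Submission
  imports Defs "Jordan_Normal_Form.Determinant" "HOL-Complex_Analysis.Complex_Analysis"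
    "HOL-Combinatorics.Multiset_Permutations"
begin

section \<open>Shuffle products\<close>

text \<open>The sum over signs has 2^n terms and no visible limit; the determinant has size k
  whatever n is, so its limit can be taken entry by entry. Its functionals are dictated by the
  recursion: they have to undo the dilations y -> t y and y -> y / t of the kernel, which leads to
  the coefficients (-1)^m t^(k m^2 + j m) at y^(j + 2 k m). At geometric arguments the kernel has
  Gaussian coefficients, and completing the square merges them with those of the functionals; this
  is where t and q combine into p = t q^(2k). Up to explicit powers of r and of (q;q)_inf the limit
  therefore depends on t only through p and the arguments, and its constant may be found at another
  pair (t', q') with the same p.

  In the collapse of levels the obstacle is that odd and even parts carry different weights. A
  square root s of t removes it: the odd weight is the t-binomial convolution of s^m and (-s)^m, the
  even weight that of (-t)^m and 1, and the four geometric factors are absorbed one after another.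
  The half-integral power of q is absorbed into the variables by homogeneity.\<close>

definition rho :: "complex \<Rightarrow> complex \<Rightarrow> complex \<Rightarrow> complex" where
  "rho t u v = (u - t * v) / (u - v)"

definition cross :: "complex \<Rightarrow> ('i \<Rightarrow> complex) \<Rightarrow> 'i set \<Rightarrow> 'i set \<Rightarrow> complex" where
  "cross t x A B = (\<Prod>i\<in>A. \<Prod>j\<in>B. rho t (x i) (x j))"

text \<open>Functions of finite sets of variables, multiplied as in the shuffle algebra: the Hall--Littlewood
  symmetrization is an iterated product of functions supported on singletons.\<close>

definition shuffle :: "complex \<Rightarrow> ('i \<Rightarrow> complex) \<Rightarrow> ('i set \<Rightarrow> complex) \<Rightarrow> ('i set \<Rightarrow> complex) \<Rightarrow> 'i set \<Rightarrow> complex" where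
  "shuffle t x f g S = (\<Sum>A\<in>Pow S. f A * g (S - A) * cross t x A (S - A))"

lemma cross_empty [simp]: "cross t x {} B = 1" "cross t x A {} = 1"
  by (simp_all add: cross_def)

lemma cross_Un_left: "finite A \<Longrightarrow> finite B \<Longrightarrow> A \<inter> B = {} \<Longrightarrow> cross t x (A \<union> B) C = cross t x A C * cross t x B C"
  by (simp add: cross_def prod.union_disjoint)

lemma cross_Un_right: "finite B \<Longrightarrow> finite C \<Longrightarrow> B \<inter> C = {} \<Longrightarrow> cross t x A (B \<union> C) = cross t x A B * cross t x A C"
  by (simp add: cross_def prod.union_disjoint prod.distrib)

lemma cross_insert_left: "finite A \<Longrightarrow> a \<notin> A \<Longrightarrow>
    cross t x (insert a A) B = (\<Prod>j\<in>B. rho t (x a) (x j)) * cross t x A B"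
  by (simp add: cross_def)

lemma cross_insert_right: "finite B \<Longrightarrow> b \<notin> B \<Longrightarrow>
    cross t x A (insert b B) = (\<Prod>i\<in>A. rho t (x i) (x b)) * cross t x A B"
  by (simp add: cross_def prod.distrib del: times_divide_eq_left times_divide_eq_right)

text \<open>Both sides are sums over ordered splittings of S into three blocks. The bijection sends
  a pair of nested sets A and D to the blocks A and D - A, and the cross factors are multiplicative
  over disjoint unions.\<close>

lemma shuffle_assoc:
  assumes "finite S"
  shows "shuffle t x (shuffle t x f g) h S = shuffle t x f (shuffle t x g h) S"
proof -
  define u where "u = (\<lambda>D A. f A * g (D - A) * cross t x A (D - A) * h (S - D) * cross t x D (S - D))"
  define v where "v = (\<lambda>A B. f A * (g B * h (S - A - B) * cross t x B (S - A - B)) * cross t x A (S - A))"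
  have "shuffle t x (shuffle t x f g) h S = (\<Sum>D\<in>Pow S. \<Sum>A\<in>Pow D. u D A)"
    unfolding shuffle_def u_def by (simp add: sum_distrib_right)
  also have "\<dots> = (\<Sum>(D, A)\<in>(SIGMA D:Pow S. Pow D). u D A)"
    by (rule sum.Sigma) (use assms finite_subset in blast)+
  also have "\<dots> = (\<Sum>(A, B)\<in>(SIGMA A:Pow S. Pow (S - A)). v A B)"
  proof (rule sum.reindex_bij_witness[where i = "\<lambda>(A, B). (A \<union> B, A)" and j = "\<lambda>(D, A). (A, D - A)"], goal_cases)
    case (5 a)
    obtain D A where a: "a = (D, A)" by force
    with 5 have sub: "A \<subseteq> D" "D \<subseteq> S" by auto
    then have "finite D" by (intro finite_subset[OF _ assms])
    then have fin: "finite A" "finite D" "finite (S - D)" using assms sub(1) by (auto dest: finite_subset)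
    have d: "A \<union> (D - A) = D" and s: "(D - A) \<union> (S - D) = S - A" and e: "S - A - (D - A) = S - D"
      using sub by auto
    have "cross t x (A \<union> (D - A)) (S - D) = cross t x A (S - D) * cross t x (D - A) (S - D)"
      by (rule cross_Un_left) (use fin in auto)
    moreover have "cross t x A ((D - A) \<union> (S - D)) = cross t x A (D - A) * cross t x A (S - D)"
      by (rule cross_Un_right) (use fin in auto)
    ultimately show ?case unfolding d s by (simp add: a e u_def v_def mult_ac)
  qed auto
  also have "\<dots> = (\<Sum>A\<in>Pow S. \<Sum>B\<in>Pow (S - A). v A B)"
    by (rule sum.Sigma[symmetric]) (use assms in auto)
  also have "\<dots> = shuffle t x f (shuffle t x g h) S"
    unfolding shuffle_def v_def by (simp add: sum_distrib_right sum_distrib_left)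
  finally show ?thesis .
qed

lemma shuffle_cong:
  assumes "\<And>A. A \<subseteq> S \<Longrightarrow> f A = f' A" "\<And>A. A \<subseteq> S \<Longrightarrow> g A = g' A"
  shows "shuffle t x f g S = shuffle t x f' g' S"
  unfolding shuffle_def using assms by (intro sum.cong refl) auto

text \<open>Splitting by the factor that receives \<open>a\<close> exposes the dependence on the
  single variable x a, so that the product can be studied as a rational function of it.\<close>

lemma shuffle_insert:
  assumes "finite S" "a \<notin> S"
  shows "shuffle t x f g (insert a S) =
    (\<Sum>A\<in>Pow S. (f (insert a A) * g (S - A) * (\<Prod>j\<in>S - A. rho t (x a) (x j)) +
                f A * g (insert a (S - A)) * (\<Prod>i\<in>A. rho t (x i) (x a))) * cross t x A (S - A))"
proof -
  have *: "Pow (insert a S) = insert a ` Pow S \<union> Pow S" by (simp add: Pow_insert Un_commute)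
  have inj: "inj_on (insert a) (Pow S)" using assms by (auto simp: inj_on_def)
  have "shuffle t x f g (insert a S) = (\<Sum>A\<in>insert a ` Pow S. f A * g (insert a S - A) * cross t x A (insert a S - A))
     + (\<Sum>A\<in>Pow S. f A * g (insert a S - A) * cross t x A (insert a S - A))"
    unfolding shuffle_def * by (rule sum.union_disjoint) (use assms in auto)
  moreover have "(\<Sum>A\<in>insert a ` Pow S. f A * g (insert a S - A) * cross t x A (insert a S - A)) =
    (\<Sum>A\<in>Pow S. f (insert a A) * g (S - A) * (\<Prod>j\<in>S - A. rho t (x a) (x j)) * cross t x A (S - A))"
  proof (subst sum.reindex[OF inj], unfold o_def, intro sum.cong refl)
    fix A assume "A \<in> Pow S"
    then have A: "A \<subseteq> S" "finite A" "a \<notin> A" using assms finite_subset by auto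
    then have "insert a S - insert a A = S - A" using assms by auto
    then show "f (insert a A) * g (insert a S - insert a A) * cross t x (insert a A) (insert a S - insert a A) =
      f (insert a A) * g (S - A) * (\<Prod>j\<in>S - A. rho t (x a) (x j)) * cross t x A (S - A)"
      using A by (simp add: cross_insert_left mult_ac)
  qed
  moreover have "(\<Sum>A\<in>Pow S. f A * g (insert a S - A) * cross t x A (insert a S - A)) =
    (\<Sum>A\<in>Pow S. f A * g (insert a (S - A)) * (\<Prod>i\<in>A. rho t (x i) (x a)) * cross t x A (S - A))"
  proof (intro sum.cong refl)
    fix A assume "A \<in> Pow S"
    then have A: "A \<subseteq> S" "finite A" "a \<notin> A" using assms finite_subset by auto
    then have "insert a S - A = insert a (S - A)" using assms by auto
    then show "f A * g (insert a S - A) * cross t x A (insert a S - A) =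
      f A * g (insert a (S - A)) * (\<Prod>i\<in>A. rho t (x i) (x a)) * cross t x A (S - A)"
      using A assms by (simp add: cross_insert_right mult_ac)
  qed
  ultimately show ?thesis by (simp add: sum.distrib[symmetric] distrib_right)
qed

lemma cross_inverse:
  assumes "A \<inter> B = {}" "inj_on x (A \<union> B)" "\<And>i. i \<in> A \<union> B \<Longrightarrow> x i \<noteq> 0"
  shows "cross t (\<lambda>i. 1 / x i) A B = cross t x B A"
proof -
  have "rho t (1 / x i) (1 / x j) = rho t (x j) (x i)" if "i \<in> A" "j \<in> B" for i j
  proof -
    have "x i \<noteq> x j" using that assms by (auto dest: inj_onD)
    then show ?thesis using that assms by (auto simp: rho_def field_simps)
  qed
  then show ?thesis unfolding cross_def by (subst prod.swap) simp
qed

text \<open>Since rho(1/u, 1/v) = rho(v, u), inverting the variables reverses the order of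
  multiplication. This moves a factor depending only on the cardinality from the right to the
  left.\<close>

lemma shuffle_inverse:
  assumes "finite S" "inj_on x S" "\<And>i. i \<in> S \<Longrightarrow> x i \<noteq> 0"
  shows "shuffle t (\<lambda>i. 1 / x i) f g S = shuffle t x g f S"
  unfolding shuffle_def
proof (rule sum.reindex_bij_witness[where i = "\<lambda>A. S - A" and j = "\<lambda>A. S - A"], goal_cases)
  case (5 A)
  then have "cross t (\<lambda>i. 1 / x i) A (S - A) = cross t x (S - A) A"
    by (intro cross_inverse) (use assms in \<open>auto simp: inj_on_def\<close>)
  moreover have "S - (S - A) = A" using 5 by auto
  ultimately show ?case by (simp add: mult_ac)
qed auto

section \<open>Liouville's theorem in the presence of finitely many removable poles\<close>

lemma extend_over_finite:
  assumes "finite P" "f holomorphic_on - P" "\<And>p. p \<in> P \<Longrightarrow> ((\<lambda>z. (z - p) * f z) \<longlongrightarrow> 0) (at p)"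
  shows "\<exists>g. g holomorphic_on UNIV \<and> (\<forall>z. z \<notin> P \<longrightarrow> g z = f z)"
  using assms
proof (induction P arbitrary: f rule: finite_induct)
  case empty
  then show ?case by auto
next
  case (insert p P)
  have op: "open (- P)" using insert.hyps by (simp add: finite_imp_closed open_Compl)
  have "\<exists>g. g holomorphic_on (- P) \<and> (\<forall>z\<in>- P - {p}. g z = f z)"
  proof (subst holomorphic_on_extend_lim)
    show "f holomorphic_on - P - {p}" by (rule holomorphic_on_subset[OF insert.prems(1)]) auto
    show "p \<in> interior (- P)" using op insert.hyps by (simp add: interior_open)
    show "((\<lambda>z. (z - p) * f z) \<longlongrightarrow> 0) (at p)" by (rule insert.prems(2)) simp
  qed
  then obtain g where g: "g holomorphic_on (- P)" "\<And>z. z \<in> - P - {p} \<Longrightarrow> g z = f z" by blast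
  have "\<exists>h. h holomorphic_on UNIV \<and> (\<forall>z. z \<notin> P \<longrightarrow> h z = g z)"
  proof (rule insert.IH[OF g(1)])
    fix r assume r: "r \<in> P"
    have "((\<lambda>z. (z - r) * f z) \<longlongrightarrow> 0) (at r)" by (rule insert.prems(2)) (use r in simp)
    moreover have "\<forall>\<^sub>F z in at r. z \<in> - insert p (P - {r})"
      by (rule eventually_at_in_open') (use insert.hyps r in \<open>auto simp: finite_imp_closed open_Compl\<close>)
    then have "\<forall>\<^sub>F z in at r. (z - r) * f z = (z - r) * g z"
      by (rule eventually_mono[OF eventually_conj[OF _ eventually_neq_at_within[of r]]]) (use g(2) in auto)
    ultimately show "((\<lambda>z. (z - r) * g z) \<longlongrightarrow> 0) (at r)" by (rule Lim_transform_eventually)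
  qed
  then show ?case using g(2) by (metis Compl_iff DiffI insert_iff singletonD)
qed

text \<open>Once the poles are removed, (g(z) - g(w)) / (z - w) is entire and tends to 0 at
  infinity, so it vanishes. Asking for growth o(z) instead of boundedness spares second-order
  asymptotics when a factor z is present.\<close>

lemma liouville_finite_poles:
  assumes P: "finite P" "f holomorphic_on - P" "\<And>p. p \<in> P \<Longrightarrow> ((\<lambda>z. (z - p) * f z) \<longlongrightarrow> 0) (at p)"
    and inf: "((\<lambda>z. f z / z) \<longlongrightarrow> 0) at_infinity" and z: "z \<notin> P" "w \<notin> P"
  shows "f z = f w"
proof -
  obtain g where g: "g holomorphic_on UNIV" "\<And>z. z \<notin> P \<Longrightarrow> g z = f z"
    using extend_over_finite[OF P] by blast
  obtain h where h: "h holomorphic_on UNIV" "\<And>z. z \<noteq> w \<Longrightarrow> h z = (g z - g w) / (z - w)"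
  proof -
    have "\<exists>h. h holomorphic_on UNIV \<and> (\<forall>z\<in>UNIV-{w}. h z = (g z - g w) / (z - w))"
    proof (subst holomorphic_on_extend_lim)
      show "(\<lambda>z. (g z - g w) / (z - w)) holomorphic_on UNIV - {w}"
        by (intro holomorphic_intros holomorphic_on_subset[OF g(1)]) auto
      have "isCont g w"
        using holomorphic_on_imp_continuous_on[OF g(1)] by (simp add: continuous_on_eq_continuous_at)
      then have "((\<lambda>z. g z - g w) \<longlongrightarrow> g w - g w) (at w)"
        by (intro tendsto_intros isContD)
      then have *: "((\<lambda>z. g z - g w) \<longlongrightarrow> 0) (at w)" by simp
      show "((\<lambda>z. (z - w) * ((g z - g w) / (z - w))) \<longlongrightarrow> 0) (at w)"
        by (rule Lim_transform_eventually[OF *]) (auto simp: eventually_at intro!: exI[of _ 1])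
    qed auto
    then show ?thesis using that by auto
  qed
  have evP: "\<forall>\<^sub>F z in at_infinity. z \<notin> insert 0 (insert w P)"
  proof -
    obtain B where B: "\<And>z. z \<in> insert 0 (insert w P) \<Longrightarrow> norm z \<le> B"
      using finite_imp_bounded[of "insert 0 (insert w P)"] P(1) unfolding bounded_iff by (meson finite.insertI)
    have "z \<notin> insert 0 (insert w P)" if "B + 1 \<le> norm z" for z
      using B[of z] that by linarith
    then show ?thesis unfolding eventually_at_infinity by blast
  qed
  have inv: "((\<lambda>z. c / z) \<longlongrightarrow> 0) at_infinity" for c :: complex
    by (intro tendsto_divide_0[OF tendsto_const] filterlim_ident)
  have "((\<lambda>z. (f z / z - g w / z) / (1 - w / z)) \<longlongrightarrow> (0 - 0) / (1 - 0)) at_infinity"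
    by (intro tendsto_intros inf inv) simp
  then have l: "((\<lambda>z. (f z / z - g w / z) / (1 - w / z)) \<longlongrightarrow> 0) at_infinity" by simp
  have "(h \<longlongrightarrow> 0) at_infinity"
    by (rule Lim_transform_eventually[OF l], rule eventually_mono[OF evP])
       (use g(2) h(2) in \<open>auto simp: divide_simps\<close>)
  then have "h z = 0" for z by (rule Liouville_weak_0[OF h(1)])
  then show ?thesis using h(2)[of z] g(2) z by (cases "z = w") auto
qed

lemma tendsto_rho_left: "u \<noteq> v \<Longrightarrow> ((\<lambda>z. rho t z v) \<longlongrightarrow> rho t u v) (at u within T)"
  unfolding rho_def by (intro tendsto_intros) auto

lemma tendsto_rho_right: "u \<noteq> v \<Longrightarrow> ((\<lambda>z. rho t u z) \<longlongrightarrow> rho t u v) (at v within T)"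
  unfolding rho_def by (intro tendsto_intros) auto

text \<open>The poles of a shuffle product at coinciding arguments cancel in pairs.\<close>

lemma shuffle_pole_coincident:
  assumes S: "finite S" "inj_on x S" "b \<in> S"
    and p: "\<And>A. A \<subseteq> S \<Longrightarrow> ((\<lambda>z. p z A) \<longlongrightarrow> P A) (at (x b))"
    and r: "\<And>A. A \<subseteq> S \<Longrightarrow> ((\<lambda>z. r z A) \<longlongrightarrow> R A) (at (x b))"
    and PR: "\<And>A. A \<subseteq> S - {b} \<Longrightarrow> P A = R (insert b A)"
  shows "((\<lambda>z. (z - x b) * (\<Sum>A\<in>Pow S. (p z A * (\<Prod>j\<in>S - A. rho t z (x j)) +
            r z A * (\<Prod>i\<in>A. rho t (x i) z)) * cross t x A (S - A))) \<longlongrightarrow> 0) (at (x b))"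
proof -
  define S0 where "S0 = S - {b}"
  have S0: "S = insert b S0" "b \<notin> S0" "finite S0" using S by (auto simp: S0_def)
  have ne: "x j \<noteq> x b" "x b \<noteq> x j" if "j \<in> S0" for j
    using that S(2) S0 by (auto simp: inj_on_def)
  \<comment> \<open>The only singular factors come from z and x b lying on different sides, once in
    the term of A and once in that of insert b A. \<open>sg\<close> is z - x b times these two
    terms; \<open>rg\<close> is regular at x b and still carries the factor z - x b.\<close>
  define sg where "sg z A = ((z - t * x b) * p z A * (\<Prod>j\<in>S0 - A. rho t z (x j)) * (\<Prod>i\<in>A. rho t (x i) (x b))
      - (x b - t * z) * r z (insert b A) * (\<Prod>i\<in>A. rho t (x i) z) * (\<Prod>j\<in>S0 - A. rho t (x b) (x j))) * cross t x A (S0 - A)" for z A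
  define rg where "rg z A = r z A * (\<Prod>i\<in>A. rho t (x i) z) * cross t x A (S - A)
      + p z (insert b A) * (\<Prod>j\<in>S0 - A. rho t z (x j)) * cross t x (insert b A) (S0 - A)" for z A
  have eq: "(\<Sum>A\<in>Pow S. (p z A * (\<Prod>j\<in>S - A. rho t z (x j)) +
            r z A * (\<Prod>i\<in>A. rho t (x i) z)) * cross t x A (S - A)) * (z - x b)
        = (\<Sum>A\<in>Pow S0. sg z A + rg z A * (z - x b))" if "z \<noteq> x b" for z
  proof -
    let ?F = "\<lambda>A. (p z A * (\<Prod>j\<in>S - A. rho t z (x j)) + r z A * (\<Prod>i\<in>A. rho t (x i) z)) * cross t x A (S - A)"
    have *: "Pow S = insert b ` Pow S0 \<union> Pow S0" unfolding S0(1) by (simp add: Pow_insert Un_commute)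
    have "sum ?F (Pow S) = (\<Sum>A\<in>insert b ` Pow S0. ?F A) + (\<Sum>A\<in>Pow S0. ?F A)"
      unfolding * by (rule sum.union_disjoint) (use S0 in auto)
    also have "(\<Sum>A\<in>insert b ` Pow S0. ?F A) = (\<Sum>A\<in>Pow S0. ?F (insert b A))"
      by (subst sum.reindex) (use S0 in \<open>auto simp: inj_on_def\<close>)
    finally have "sum ?F (Pow S) * (z - x b) = (\<Sum>A\<in>Pow S0. (?F A + ?F (insert b A)) * (z - x b))"
      by (simp add: sum.distrib sum_distrib_right distrib_right)
    also have "\<dots> = (\<Sum>A\<in>Pow S0. sg z A + rg z A * (z - x b))"
    proof (intro sum.cong refl)
      fix A assume "A \<in> Pow S0"
      then have A: "A \<subseteq> S0" "finite A" "b \<notin> A" "finite (S0 - A)" "b \<notin> S0 - A" using S0 finite_subset by auto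
      have s: "S - A = insert b (S0 - A)" "S - insert b A = S0 - A" using S0 A by auto
      have z: "rho t z (x b) * (z - x b) = z - t * x b" "rho t (x b) z * (z - x b) = - (x b - t * z)"
        using that by (simp_all add: rho_def divide_simps) (simp_all add: algebra_simps)
      have c: "cross t x A (S - A) = (\<Prod>i\<in>A. rho t (x i) (x b)) * cross t x A (S0 - A)"
        "cross t x (insert b A) (S0 - A) = (\<Prod>j\<in>S0 - A. rho t (x b) (x j)) * cross t x A (S0 - A)"
        unfolding s using A by (simp_all add: cross_insert_left cross_insert_right)
      have f1: "?F A * (z - x b) = p z A * (rho t z (x b) * (z - x b)) * (\<Prod>j\<in>S0 - A. rho t z (x j)) * cross t x A (S - A)
          + r z A * (\<Prod>i\<in>A. rho t (x i) z) * cross t x A (S - A) * (z - x b)"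
        unfolding s using A by (simp add: algebra_simps)
      have f2: "?F (insert b A) * (z - x b) = p z (insert b A) * (\<Prod>j\<in>S0 - A. rho t z (x j)) * cross t x (insert b A) (S0 - A) * (z - x b)
          + r z (insert b A) * (rho t (x b) z * (z - x b)) * (\<Prod>i\<in>A. rho t (x i) z) * cross t x (insert b A) (S0 - A)"
        unfolding s using A by (simp add: algebra_simps)
      have "(?F A + ?F (insert b A)) * (z - x b) = ?F A * (z - x b) + ?F (insert b A) * (z - x b)"
        by (rule distrib_right)
      also have "\<dots> = sg z A + rg z A * (z - x b)"
        unfolding f1 f2 unfolding z sg_def rg_def c by (simp add: algebra_simps)
      finally show "(?F A + ?F (insert b A)) * (z - x b) = sg z A + rg z A * (z - x b)" .
    qed
    finally show ?thesis .
  qed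
  have "((\<lambda>z. \<Sum>A\<in>Pow S0. sg z A + rg z A * (z - x b)) \<longlongrightarrow> (\<Sum>A\<in>Pow S0. 0)) (at (x b))"
  proof (rule tendsto_sum)
    fix A assume "A \<in> Pow S0"
    then have A: "A \<subseteq> S0" "A \<subseteq> S" "insert b A \<subseteq> S" "A \<subseteq> S - {b}" using S0 by auto
    define SG where "SG = ((x b - t * x b) * P A * (\<Prod>j\<in>S0 - A. rho t (x b) (x j)) * (\<Prod>i\<in>A. rho t (x i) (x b))
      - (x b - t * x b) * R (insert b A) * (\<Prod>i\<in>A. rho t (x i) (x b)) * (\<Prod>j\<in>S0 - A. rho t (x b) (x j))) * cross t x A (S0 - A)"
    have 1: "((\<lambda>z. sg z A) \<longlongrightarrow> SG) (at (x b))" unfolding sg_def SG_def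
      by (intro tendsto_intros p r A tendsto_prod tendsto_rho_left tendsto_rho_right) (use A ne in auto)
    have "SG = 0" unfolding SG_def using PR[OF A(4)] by simp
    obtain L where 2: "((\<lambda>z. rg z A) \<longlongrightarrow> L) (at (x b))"
    proof
      show "((\<lambda>z. rg z A) \<longlongrightarrow> R A * (\<Prod>i\<in>A. rho t (x i) (x b)) * cross t x A (S - A)
        + P (insert b A) * (\<Prod>j\<in>S0 - A. rho t (x b) (x j)) * cross t x (insert b A) (S0 - A)) (at (x b))"
        unfolding rg_def
        by (intro tendsto_intros p r A tendsto_prod tendsto_rho_left tendsto_rho_right) (use A ne in auto)
    qed
    have "((\<lambda>z. sg z A + rg z A * (z - x b)) \<longlongrightarrow> SG + L * (x b - x b)) (at (x b))"
      by (intro tendsto_intros 1 2)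
    then show "((\<lambda>z. sg z A + rg z A * (z - x b)) \<longlongrightarrow> 0) (at (x b))" using \<open>SG = 0\<close> by simp
  qed
  then have *: "((\<lambda>z. \<Sum>A\<in>Pow S0. sg z A + rg z A * (z - x b)) \<longlongrightarrow> 0) (at (x b))" by simp
  show ?thesis
    by (rule Lim_transform_eventually[OF *], unfold eventually_at_filter, rule always_eventually)
       (use eq in \<open>auto simp: mult.commute\<close>)
qed

text \<open>The t-binomial convolution: the sum over j of [n choose j]_t f(j) g(n - j). The clauses
  are the t-Pascal rule, the form in which \<open>shuffle_const\<close> delivers it.\<close>

fun conv :: "complex \<Rightarrow> (nat \<Rightarrow> complex) \<Rightarrow> (nat \<Rightarrow> complex) \<Rightarrow> nat \<Rightarrow> complex" where
  "conv t f g 0 = f 0 * g 0"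
| "conv t f g (Suc n) = conv t (\<lambda>m. f (Suc m)) (\<lambda>m. t ^ m * g m) n + conv t f (\<lambda>m. g (Suc m)) n"

lemma rho_at_infinity: "((\<lambda>z. rho t z v) \<longlongrightarrow> 1) at_infinity" "((\<lambda>z. rho t u z) \<longlongrightarrow> t) at_infinity"
proof -
  have inv: "((\<lambda>z. c / z) \<longlongrightarrow> 0) at_infinity" for c :: complex
    by (intro tendsto_divide_0[OF tendsto_const] filterlim_ident)
  have ev: "\<forall>\<^sub>F z in at_infinity. z \<noteq> (0::complex)"
    by (rule eventually_at_infinityI[of 1]) auto
  have 1: "((\<lambda>z. (1 - t * v / z) / (1 - v / z)) \<longlongrightarrow> (1 - 0) / (1 - 0)) at_infinity"
    by (intro tendsto_intros inv) simp
  have 2: "((\<lambda>z. (u / z - t) / (u / z - 1)) \<longlongrightarrow> (0 - t) / (0 - 1)) at_infinity"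
    by (intro tendsto_intros inv) simp
  have "((\<lambda>z. rho t z v) \<longlongrightarrow> (1 - 0) / (1 - 0)) at_infinity"
    by (rule Lim_transform_eventually[OF 1], rule eventually_mono[OF ev]) (simp add: rho_def diff_divide_eq_iff)
  then show "((\<lambda>z. rho t z v) \<longlongrightarrow> 1) at_infinity" by simp
  have "((\<lambda>z. rho t u z) \<longlongrightarrow> (0 - t) / (0 - 1)) at_infinity"
    by (rule Lim_transform_eventually[OF 2], rule eventually_mono[OF ev]) (simp add: rho_def divide_diff_eq_iff)
  then show "((\<lambda>z. rho t u z) \<longlongrightarrow> t) at_infinity" by simp
qed

lemma inverse_at_infinity: "((\<lambda>z. c / z) \<longlongrightarrow> 0) (at_infinity :: complex filter)"
  by (intro tendsto_divide_0[OF tendsto_const] filterlim_ident)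

text \<open>As a function of one variable the product has only removable poles and is bounded at
  infinity, hence it is constant. At 0 the factors are rho(0, v) = t and rho(u, 0) = 1, which gives
  the two terms of the recursion of \<open>conv\<close>.\<close>

lemma shuffle_const:
  assumes "finite S" "inj_on x S" "\<And>i. i \<in> S \<Longrightarrow> x i \<noteq> 0"
  shows "shuffle t x (\<lambda>A. f (card A)) (\<lambda>A. g (card A)) S = conv t f g (card S)"
  using assms
proof (induction S arbitrary: f g rule: finite_induct)
  case empty
  then show ?case by (simp add: shuffle_def)
next
  case (insert a S)
  note fin = insert.hyps(1) and a = insert.hyps(2)
  have inj: "inj_on x S" and nz: "\<And>i. i \<in> S \<Longrightarrow> x i \<noteq> 0" and ia: "x a \<notin> x ` S"
    using insert.prems a by (auto simp: inj_on_def)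
  define D where "D z = (\<Sum>A\<in>Pow S. (f (Suc (card A)) * g (card (S - A)) * (\<Prod>j\<in>S - A. rho t z (x j)) +
            f (card A) * g (Suc (card (S - A))) * (\<Prod>i\<in>A. rho t (x i) z)) * cross t x A (S - A))" for z
  have card: "card (insert a A) = Suc (card A)" "card (insert a (S - A)) = Suc (card (S - A))" if "A \<in> Pow S" for A
    using that fin a finite_subset[of A S] by (auto simp: card_insert_if)
  have "shuffle t x (\<lambda>A. f (card A)) (\<lambda>A. g (card A)) (insert a S) = D (x a)"
    unfolding shuffle_insert[OF fin a] D_def by (intro sum.cong refl) (simp add: card)
  also have "D (x a) = D 0"
  proof (rule liouville_finite_poles[where f = D and P = "x ` S"])
    show "D holomorphic_on - (x ` S)" unfolding D_def rho_def
      by (intro holomorphic_intros) auto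
    show "((\<lambda>z. (z - p) * D z) \<longlongrightarrow> 0) (at p)" if "p \<in> x ` S" for p
    proof -
      from that obtain b where b: "p = x b" "b \<in> S" by auto
      show ?thesis unfolding b(1) D_def
      proof (rule shuffle_pole_coincident[OF fin inj b(2)], rule tendsto_const, rule tendsto_const)
        fix A assume "A \<subseteq> S - {b}"
        then have A: "finite A" "b \<notin> A" "A \<subseteq> S" "finite (S - A)" using fin finite_subset by auto
        have "S - A = insert b (S - insert b A)" using A b by auto
        then have "card (S - A) = Suc (card (S - insert b A))"
          by (metis A(4) Diff_insert_absorb Diff_iff card_insert_disjoint finite_insert insertI1)
        then show "f (Suc (card A)) * g (card (S - A)) = f (card (insert b A)) * g (Suc (card (S - insert b A)))"
          using A by simp
      qed
    qed
    define L where "L = (\<Sum>A\<in>Pow S. (f (Suc (card A)) * g (card (S - A)) * (\<Prod>j\<in>S - A. 1) +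
            f (card A) * g (Suc (card (S - A))) * (\<Prod>i\<in>A. t)) * cross t x A (S - A))"
    have "(D \<longlongrightarrow> L) at_infinity" unfolding D_def L_def
      by (intro tendsto_intros tendsto_sum tendsto_prod rho_at_infinity)
    then have "((\<lambda>z. D z * (1 / z)) \<longlongrightarrow> L * 0) at_infinity"
      by (intro tendsto_intros inverse_at_infinity)
    then show "((\<lambda>z. D z / z) \<longlongrightarrow> 0) at_infinity" by simp
  qed (use ia fin nz in auto)
  also have "D 0 = shuffle t x (\<lambda>A. f (Suc (card A))) (\<lambda>A. t ^ card A * g (card A)) S + shuffle t x (\<lambda>A. f (card A)) (\<lambda>A. g (Suc (card A))) S"
  proof -
    have "(\<Prod>j\<in>S - A. rho t 0 (x j)) = t ^ card (S - A)" "(\<Prod>i\<in>A. rho t (x i) 0) = 1" if "A \<subseteq> S" for A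
    proof -
      have "(\<Prod>j\<in>S - A. rho t 0 (x j)) = (\<Prod>j\<in>S - A. t)"
        by (intro prod.cong refl) (use nz in \<open>auto simp: rho_def\<close>)
      then show "(\<Prod>j\<in>S - A. rho t 0 (x j)) = t ^ card (S - A)" by simp
      have "(\<Prod>i\<in>A. rho t (x i) 0) = (\<Prod>i\<in>A. 1)"
        by (intro prod.cong refl) (use nz that in \<open>auto simp: rho_def\<close>)
      then show "(\<Prod>i\<in>A. rho t (x i) 0) = 1" by simp
    qed
    then show ?thesis unfolding D_def shuffle_def sum.distrib[symmetric]
      by (intro sum.cong refl) (auto simp: algebra_simps)
  qed
  also have "\<dots> = conv t f g (card (insert a S))"
    using insert.IH[OF inj nz, of "\<lambda>m. f (Suc m)" "\<lambda>m. t ^ m * g m"] insert.IH[OF inj nz, of f "\<lambda>m. g (Suc m)"] fin a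
    by simp
  finally show ?case .
qed

section \<open>A bounded Littlewood identity\<close>

text \<open>This is rho(1/u, v), the interaction of an inverted variable with another one; see
  \<open>psi_inverse\<close>.\<close>

definition psi :: "complex \<Rightarrow> complex \<Rightarrow> complex \<Rightarrow> complex" where
  "psi t u v = (1 - t * (u * v)) / (1 - u * v)"

text \<open>A Littlewood product. The order on the indices makes every unordered pair occur once; as
  psi is symmetric, the value does not depend on the order.\<close>

definition lw :: "complex \<Rightarrow> ('i :: linorder \<Rightarrow> complex) \<Rightarrow> (complex \<Rightarrow> complex) \<Rightarrow> 'i set \<Rightarrow> complex" where
  "lw t x \<phi> A = (\<Prod>i\<in>A. \<phi> (x i)) * (\<Prod>(i, j)\<in>{(i, j). i \<in> A \<and> j \<in> A \<and> j < i}. psi t (x i) (x j))"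

text \<open>The case i = j of the last condition excludes x i = 1 and x i = -1, the poles of the
  one-variable weights.\<close>

definition generic :: "('i \<Rightarrow> complex) \<Rightarrow> 'i set \<Rightarrow> bool" where
  "generic x S \<longleftrightarrow> inj_on x S \<and> (\<forall>i\<in>S. x i \<noteq> 0) \<and> (\<forall>i\<in>S. \<forall>j\<in>S. x i * x j \<noteq> 1)"

lemma generic_subset: "generic x S \<Longrightarrow> T \<subseteq> S \<Longrightarrow> generic x T"
  unfolding generic_def by (auto intro: inj_on_subset)

lemma psi_commute: "psi t u v = psi t v u"
  by (simp add: psi_def mult.commute)

lemma lw_empty [simp]: "lw t x \<phi> {} = 1"
  by (simp add: lw_def)

lemma lw_insert:
  assumes "finite A" "a \<notin> A"
  shows "lw t x \<phi> (insert a A) = \<phi> (x a) * (\<Prod>j\<in>A. psi t (x a) (x j)) * lw t x \<phi> A"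
proof -
  let ?T = "\<lambda>A. {(i, j). i \<in> A \<and> j \<in> A \<and> j < i}"
  have fin: "finite (?T A)" using finite_subset[of "?T A" "A \<times> A"] assms by auto
  have "?T (insert a A) = ?T A \<union> ((Pair a) ` {j\<in>A. j < a} \<union> (\<lambda>i. (i, a)) ` {i\<in>A. a < i})" by auto
  then have "(\<Prod>(i, j)\<in>?T (insert a A). psi t (x i) (x j)) =
      (\<Prod>(i, j)\<in>?T A. psi t (x i) (x j)) * (\<Prod>(i, j)\<in>(Pair a) ` {j\<in>A. j < a} \<union> (\<lambda>i. (i, a)) ` {i\<in>A. a < i}. psi t (x i) (x j))"
    by (simp only:) (rule prod.union_disjoint, use assms fin in auto)
  also have "(\<Prod>(i, j)\<in>(Pair a) ` {j\<in>A. j < a} \<union> (\<lambda>i. (i, a)) ` {i\<in>A. a < i}. psi t (x i) (x j))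
      = (\<Prod>(i, j)\<in>(Pair a) ` {j\<in>A. j < a}. psi t (x i) (x j)) * (\<Prod>(i, j)\<in>(\<lambda>i. (i, a)) ` {i\<in>A. a < i}. psi t (x i) (x j))"
    by (rule prod.union_disjoint) (use assms in auto)
  also have "(\<Prod>(i, j)\<in>(Pair a) ` {j\<in>A. j < a}. psi t (x i) (x j)) = (\<Prod>j\<in>{j\<in>A. j < a}. psi t (x a) (x j))"
    by (subst prod.reindex) (auto simp: inj_on_def)
  also have "(\<Prod>(i, j)\<in>(\<lambda>i. (i, a)) ` {i\<in>A. a < i}. psi t (x i) (x j)) = (\<Prod>j\<in>{j\<in>A. a < j}. psi t (x a) (x j))"
    by (subst prod.reindex) (auto simp: inj_on_def psi_commute)
  also have "(\<Prod>j\<in>{j\<in>A. j < a}. psi t (x a) (x j)) * (\<Prod>j\<in>{j\<in>A. a < j}. psi t (x a) (x j)) = (\<Prod>j\<in>A. psi t (x a) (x j))"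
    by (subst prod.union_disjoint[symmetric]) (use assms in \<open>auto intro!: prod.cong\<close>, metis linorder_cases)
  finally show ?thesis using assms by (simp add: lw_def mult_ac)
qed

lemma lw_cong: "(\<And>i. i \<in> A \<Longrightarrow> x i = y i) \<Longrightarrow> lw t x \<phi> A = lw t y \<phi> A"
  unfolding lw_def by (intro arg_cong2[where f = "(*)"] prod.cong refl) auto

text \<open>\<open>lws t x \<phi> w S z\<close> is the shuffle product of \<open>lw t x \<phi>\<close> and \<open>w \<circ> card\<close> on \<open>S\<close> together
  with a further variable \<open>z\<close>.\<close>

definition lws :: "complex \<Rightarrow> ('i :: linorder \<Rightarrow> complex) \<Rightarrow> (complex \<Rightarrow> complex) \<Rightarrow> (nat \<Rightarrow> complex) \<Rightarrow> 'i set \<Rightarrow> complex \<Rightarrow> complex" where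
  "lws t x \<phi> w S z = (\<Sum>A\<in>Pow S.
     (\<phi> z * (\<Prod>j\<in>A. psi t z (x j)) * lw t x \<phi> A * w (card (S - A)) * (\<Prod>j\<in>S - A. rho t z (x j)) +
      lw t x \<phi> A * w (Suc (card (S - A))) * (\<Prod>i\<in>A. rho t (x i) z)) * cross t x A (S - A))"

lemma shuffle_lw_insert:
  assumes "finite S" "a \<notin> S"
  shows "shuffle t x (lw t x \<phi>) (\<lambda>A. w (card A)) (insert a S) = lws t x \<phi> w S (x a)"
  unfolding shuffle_insert[OF assms] lws_def
proof (intro sum.cong refl)
  fix A assume "A \<in> Pow S"
  then have A: "finite A" "a \<notin> A" "finite (S - A)" "a \<notin> S - A" using assms finite_subset by auto
  show "(lw t x \<phi> (insert a A) * w (card (S - A)) * (\<Prod>j\<in>S - A. rho t (x a) (x j)) +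
          lw t x \<phi> A * w (card (insert a (S - A))) * (\<Prod>i\<in>A. rho t (x i) (x a))) * cross t x A (S - A) =
        (\<phi> (x a) * (\<Prod>j\<in>A. psi t (x a) (x j)) * lw t x \<phi> A * w (card (S - A)) * (\<Prod>j\<in>S - A. rho t (x a) (x j)) +
          lw t x \<phi> A * w (Suc (card (S - A))) * (\<Prod>i\<in>A. rho t (x i) (x a))) * cross t x A (S - A)"
    using A by (simp add: lw_insert)
qed

section \<open>Poles of a Littlewood product shuffled with a function of the cardinality\<close>

lemma tendsto_psi: "u * v \<noteq> 1 \<Longrightarrow> ((\<lambda>z. psi t z v) \<longlongrightarrow> psi t u v) (at u within T)"
  unfolding psi_def by (intro tendsto_intros) auto

lemma psi_inverse:
  assumes "u \<noteq> 0" "u \<noteq> v" "u * v \<noteq> 1"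
  shows "psi t (1 / u) v = rho t u v" "rho t (1 / u) v = psi t u v"
  using assms by (auto simp: psi_def rho_def divide_simps) (auto simp: algebra_simps)

lemma psi_at_infinity:
  assumes "v \<noteq> 0"
  shows "((\<lambda>z. psi t z v) \<longlongrightarrow> t) at_infinity"
proof -
  have 1: "((\<lambda>z. (1 / z - t * v) / (1 / z - v)) \<longlongrightarrow> (0 - t * v) / (0 - v)) at_infinity"
    by (intro tendsto_intros inverse_at_infinity) (use assms in auto)
  have "(1 / z - t * v) / (1 / z - v) = psi t z v" if "1 \<le> norm z" for z
  proof -
    have "1 / z - c = (1 - z * c) / z" for c using that by (cases "z = 0") (auto simp: field_simps)
    then show ?thesis using that by (auto simp: psi_def mult_ac)
  qed
  then have "((\<lambda>z. psi t z v) \<longlongrightarrow> (0 - t * v) / (0 - v)) at_infinity"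
    by (intro Lim_transform_eventually[OF 1] eventually_at_infinityI[of 1]) auto
  then show ?thesis using assms by simp
qed

lemma lws_pole_coincident:
  assumes "finite S" "generic x S" "b \<in> S" and \<phi>: "isCont \<phi> (x b)"
  shows "((\<lambda>z. (z - x b) * lws t x \<phi> w S z) \<longlongrightarrow> 0) (at (x b))"
  unfolding lws_def
proof (rule shuffle_pole_coincident[OF assms(1) _ assms(3)])
  show "inj_on x S" using assms by (simp add: generic_def)
  have ne: "x b * x j \<noteq> 1" if "j \<in> S" for j using that assms by (auto simp: generic_def)
  show "((\<lambda>z. \<phi> z * (\<Prod>j\<in>A. psi t z (x j)) * lw t x \<phi> A * w (card (S - A)))
        \<longlongrightarrow> \<phi> (x b) * (\<Prod>j\<in>A. psi t (x b) (x j)) * lw t x \<phi> A * w (card (S - A))) (at (x b))"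
    if "A \<subseteq> S" for A
    by (intro tendsto_intros tendsto_prod tendsto_psi ne isContD[OF \<phi>]) (use that in auto)
  show "((\<lambda>z. lw t x \<phi> A * w (Suc (card (S - A)))) \<longlongrightarrow> lw t x \<phi> A * w (Suc (card (S - A)))) (at (x b))" for A
    by (rule tendsto_const)
  fix A assume "A \<subseteq> S - {b}"
  then have A: "finite A" "b \<notin> A" "A \<subseteq> S" "finite (S - A)" using assms(1) finite_subset by auto
  have "S - A = insert b (S - insert b A)" using A assms(3) by auto
  then have "card (S - A) = Suc (card (S - insert b A))"
    by (metis A(4) Diff_insert_absorb Diff_iff card_insert_disjoint finite_insert insertI1)
  then show "\<phi> (x b) * (\<Prod>j\<in>A. psi t (x b) (x j)) * lw t x \<phi> A * w (card (S - A)) =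
      lw t x \<phi> (insert b A) * w (Suc (card (S - insert b A)))"
    using A by (simp add: lw_insert)
qed

text \<open>Only the terms with z and x b both in the \<open>lw\<close> factor are singular. Since
  psi(1/u, v) = rho(u, v) and rho(1/u, v) = psi(u, v), an index j contributes psi(x b, x j) rho(x b,
  x j) on either side of the splitting, so the residue is a multiple of the shuffle product without
  b.\<close>

lemma lws_pole_inverse:
  assumes "finite S" "generic x (insert b S)" "b \<notin> S" and \<phi>: "isCont \<phi> (1 / x b)"
  shows "((\<lambda>z. (z - 1 / x b) * lws t x \<phi> w (insert b S) z) \<longlongrightarrow>
     - ((1 - t) / x b) * (\<phi> (1 / x b) * \<phi> (x b)) * (\<Prod>j\<in>S. psi t (x b) (x j) * rho t (x b) (x j)) *
       shuffle t x (lw t x \<phi>) (\<lambda>A. w (card A)) S) (at (1 / x b))"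
proof -
  have xb: "x b \<noteq> 0" and ne: "x b \<noteq> x j" "x b * x j \<noteq> 1" "1 / x b \<noteq> x j" "1 / x b * x j \<noteq> 1" if "j \<in> S" for j
    using that assms by (auto simp: generic_def inj_on_def field_simps)
  have neb: "1 / x b \<noteq> x b" and xb: "x b \<noteq> 0" using assms(2) by (auto simp: generic_def field_simps)
  define sg where "sg z A = \<phi> z * (- (1 - t * (z * x b)) / x b) * (\<Prod>j\<in>A. psi t z (x j)) * lw t x \<phi> (insert b A) * w (card (S - A)) *
     (\<Prod>j\<in>S - A. rho t z (x j)) * cross t x (insert b A) (S - A)" for z A
  define rg where "rg z A = lw t x \<phi> (insert b A) * w (Suc (card (S - A))) * (\<Prod>i\<in>insert b A. rho t (x i) z) * cross t x (insert b A) (S - A)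
     + (\<phi> z * (\<Prod>j\<in>A. psi t z (x j)) * lw t x \<phi> A * w (card (insert b S - A)) * (\<Prod>j\<in>insert b S - A. rho t z (x j)) +
        lw t x \<phi> A * w (Suc (card (insert b S - A))) * (\<Prod>i\<in>A. rho t (x i) z)) * cross t x A (insert b S - A)" for z A
  have eq: "lws t x \<phi> w (insert b S) z * (z - 1 / x b) = (\<Sum>A\<in>Pow S. sg z A + rg z A * (z - 1 / x b))" if "z \<noteq> 1 / x b" for z
  proof -
    let ?F = "\<lambda>A. (\<phi> z * (\<Prod>j\<in>A. psi t z (x j)) * lw t x \<phi> A * w (card (insert b S - A)) * (\<Prod>j\<in>insert b S - A. rho t z (x j)) +
      lw t x \<phi> A * w (Suc (card (insert b S - A))) * (\<Prod>i\<in>A. rho t (x i) z)) * cross t x A (insert b S - A)"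
    have *: "Pow (insert b S) = insert b ` Pow S \<union> Pow S" by (simp add: Pow_insert Un_commute)
    have "sum ?F (Pow (insert b S)) = (\<Sum>A\<in>insert b ` Pow S. ?F A) + (\<Sum>A\<in>Pow S. ?F A)"
      unfolding * by (rule sum.union_disjoint) (use assms in auto)
    also have "(\<Sum>A\<in>insert b ` Pow S. ?F A) = (\<Sum>A\<in>Pow S. ?F (insert b A))"
      by (subst sum.reindex) (use assms in \<open>auto simp: inj_on_def\<close>)
    finally have "lws t x \<phi> w (insert b S) z * (z - 1 / x b) = (\<Sum>A\<in>Pow S. ?F (insert b A) * (z - 1 / x b) + ?F A * (z - 1 / x b))"
      by (simp add: sum.distrib sum_distrib_right distrib_right lws_def)
    also have "\<dots> = (\<Sum>A\<in>Pow S. sg z A + rg z A * (z - 1 / x b))"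
    proof (intro sum.cong refl)
      fix A assume "A \<in> Pow S"
      then have A: "finite A" "b \<notin> A" "insert b S - insert b A = S - A" using assms finite_subset by auto
      have "psi t z (x b) * (z - 1 / x b) = - (1 - t * (z * x b)) / x b"
        using that xb by (simp add: psi_def divide_simps) (auto simp: algebra_simps)
      then have z: "- (1 - t * (z * x b)) / x b = psi t z (x b) * (z - 1 / x b)" ..
      show "?F (insert b A) * (z - 1 / x b) + ?F A * (z - 1 / x b) = sg z A + rg z A * (z - 1 / x b)"
        unfolding sg_def rg_def z A(3) using A(1,2) by (simp add: ring_distribs mult_ac)
    qed
    finally show ?thesis .
  qed
  define SG where "SG A = \<phi> (1 / x b) * (- (1 - t * (1 / x b * x b)) / x b) * (\<Prod>j\<in>A. psi t (1 / x b) (x j)) * lw t x \<phi> (insert b A) * w (card (S - A)) *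
     (\<Prod>j\<in>S - A. rho t (1 / x b) (x j)) * cross t x (insert b A) (S - A)" for A
  have "((\<lambda>z. \<Sum>A\<in>Pow S. sg z A + rg z A * (z - 1 / x b)) \<longlongrightarrow> (\<Sum>A\<in>Pow S. SG A)) (at (1 / x b))"
  proof (rule tendsto_sum)
    fix A assume A: "A \<in> Pow S"
    have 1: "((\<lambda>z. sg z A) \<longlongrightarrow> SG A) (at (1 / x b))" unfolding sg_def SG_def
      by (intro tendsto_intros tendsto_prod tendsto_rho_left tendsto_psi isContD[OF \<phi>]) (use A ne xb in auto)
    obtain L where 2: "((\<lambda>z. rg z A) \<longlongrightarrow> L) (at (1 / x b))"
    proof
      show "((\<lambda>z. rg z A) \<longlongrightarrow> lw t x \<phi> (insert b A) * w (Suc (card (S - A))) * (\<Prod>i\<in>insert b A. rho t (x i) (1 / x b)) * cross t x (insert b A) (S - A)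
     + (\<phi> (1 / x b) * (\<Prod>j\<in>A. psi t (1 / x b) (x j)) * lw t x \<phi> A * w (card (insert b S - A)) * (\<Prod>j\<in>insert b S - A. rho t (1 / x b) (x j)) +
        lw t x \<phi> A * w (Suc (card (insert b S - A))) * (\<Prod>i\<in>A. rho t (x i) (1 / x b))) * cross t x A (insert b S - A)) (at (1 / x b))"
        unfolding rg_def
        by (intro tendsto_intros tendsto_prod tendsto_rho_left tendsto_rho_right tendsto_psi isContD[OF \<phi>])
           (use A ne ne(3)[symmetric] neb neb[symmetric] xb in auto)
    qed
    have "((\<lambda>z. sg z A + rg z A * (z - 1 / x b)) \<longlongrightarrow> SG A + L * (1 / x b - 1 / x b)) (at (1 / x b))"
      by (intro tendsto_intros 1 2)
    then show "((\<lambda>z. sg z A + rg z A * (z - 1 / x b)) \<longlongrightarrow> SG A) (at (1 / x b))" by simp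
  qed
  then have "((\<lambda>z. (z - 1 / x b) * lws t x \<phi> w (insert b S) z) \<longlongrightarrow> (\<Sum>A\<in>Pow S. SG A)) (at (1 / x b))"
    by (rule Lim_transform_eventually, unfold eventually_at_filter, intro always_eventually)
       (use eq in \<open>auto simp: mult.commute\<close>)
  also have "(\<Sum>A\<in>Pow S. SG A) = - ((1 - t) / x b) * (\<phi> (1 / x b) * \<phi> (x b)) * (\<Prod>j\<in>S. psi t (x b) (x j) * rho t (x b) (x j)) *
       shuffle t x (lw t x \<phi>) (\<lambda>A. w (card A)) S"
    unfolding shuffle_def sum_distrib_left
  proof (intro sum.cong refl)
    fix A assume "A \<in> Pow S"
    then have A: "finite A" "b \<notin> A" "A \<subseteq> S" "finite (S - A)" "A \<union> (S - A) = S" using assms finite_subset by auto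
    have 1: "(\<Prod>j\<in>A. psi t (1 / x b) (x j)) = (\<Prod>j\<in>A. rho t (x b) (x j))"
      by (intro prod.cong refl psi_inverse) (use A ne xb in auto)
    have 2: "(\<Prod>j\<in>S - A. rho t (1 / x b) (x j)) = (\<Prod>j\<in>S - A. psi t (x b) (x j))"
      by (intro prod.cong refl psi_inverse) (use A ne xb in auto)
    have 3: "(\<Prod>j\<in>S. psi t (x b) (x j) * rho t (x b) (x j)) =
      (\<Prod>j\<in>A. psi t (x b) (x j)) * (\<Prod>j\<in>A. rho t (x b) (x j)) * ((\<Prod>j\<in>S - A. psi t (x b) (x j)) * (\<Prod>j\<in>S - A. rho t (x b) (x j)))"
      by (subst A(5)[symmetric], subst prod.union_disjoint) (use A in \<open>auto simp: prod.distrib\<close>)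
    have 4: "- (1 - t * (1 / x b * x b)) / x b = - ((1 - t) / x b)" using xb by (simp add: minus_divide_left)
    show "SG A = - ((1 - t) / x b) * (\<phi> (1 / x b) * \<phi> (x b)) * (\<Prod>j\<in>S. psi t (x b) (x j) * rho t (x b) (x j)) *
       (lw t x \<phi> A * w (card (S - A)) * cross t x A (S - A))"
      unfolding SG_def 1 2 3 4 lw_insert[OF A(1,2)] cross_insert_left[OF A(1,2)] by (simp only: mult_ac)
  qed
  finally show ?thesis .
qed

text \<open>At a point equal to its own inverse psi and rho agree. The factor of an index j is then
  the same on both sides of the splitting and comes out of the sum.\<close>

lemma lws_pole_unit:
  assumes "finite S" "generic x S" "\<epsilon> * \<epsilon> = 1" "\<And>j. j \<in> S \<Longrightarrow> x j * x j \<noteq> 1"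
    and \<phi>: "((\<lambda>z. (z - \<epsilon>) * \<phi> z) \<longlongrightarrow> c) (at \<epsilon>)"
  shows "((\<lambda>z. (z - \<epsilon>) * lws t x \<phi> w S z) \<longlongrightarrow>
     c * (\<Prod>j\<in>S. rho t \<epsilon> (x j)) * shuffle t x (lw t x \<phi>) (\<lambda>A. w (card A)) S) (at \<epsilon>)"
proof -
  have e0: "\<epsilon> \<noteq> 0" using assms(3) by auto
  have ne: "\<epsilon> \<noteq> x j" "\<epsilon> * x j \<noteq> 1" if "j \<in> S" for j
    using assms(3) assms(4)[OF that] by (auto, metis mult.assoc mult.commute mult.right_neutral)
  have psi: "psi t \<epsilon> (x j) = rho t \<epsilon> (x j)" if "j \<in> S" for j
  proof -
    have "1 / \<epsilon> = \<epsilon>" using assms(3) e0 by (simp add: field_simps)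
    then show ?thesis using psi_inverse(1)[OF e0 ne[OF that]] by metis
  qed
  have "((\<lambda>z. \<Sum>A\<in>Pow S. (((z - \<epsilon>) * \<phi> z) * (\<Prod>j\<in>A. psi t z (x j)) * lw t x \<phi> A * w (card (S - A)) * (\<Prod>j\<in>S - A. rho t z (x j)) +
      (z - \<epsilon>) * (lw t x \<phi> A * w (Suc (card (S - A))) * (\<Prod>i\<in>A. rho t (x i) z))) * cross t x A (S - A)) \<longlongrightarrow>
     (\<Sum>A\<in>Pow S. (c * (\<Prod>j\<in>A. psi t \<epsilon> (x j)) * lw t x \<phi> A * w (card (S - A)) * (\<Prod>j\<in>S - A. rho t \<epsilon> (x j)) +
      (\<epsilon> - \<epsilon>) * (lw t x \<phi> A * w (Suc (card (S - A))) * (\<Prod>i\<in>A. rho t (x i) \<epsilon>))) * cross t x A (S - A))) (at \<epsilon>)"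
    by (intro tendsto_intros tendsto_sum tendsto_prod tendsto_psi tendsto_rho_left tendsto_rho_right \<phi>)
       (use ne ne(1)[symmetric] in auto)
  also have "(\<lambda>z. \<Sum>A\<in>Pow S. (((z - \<epsilon>) * \<phi> z) * (\<Prod>j\<in>A. psi t z (x j)) * lw t x \<phi> A * w (card (S - A)) * (\<Prod>j\<in>S - A. rho t z (x j)) +
      (z - \<epsilon>) * (lw t x \<phi> A * w (Suc (card (S - A))) * (\<Prod>i\<in>A. rho t (x i) z))) * cross t x A (S - A)) =
      (\<lambda>z. (z - \<epsilon>) * lws t x \<phi> w S z)"
    unfolding lws_def sum_distrib_left by (intro ext sum.cong refl) (simp add: ring_distribs mult_ac)
  also have "(\<Sum>A\<in>Pow S. (c * (\<Prod>j\<in>A. psi t \<epsilon> (x j)) * lw t x \<phi> A * w (card (S - A)) * (\<Prod>j\<in>S - A. rho t \<epsilon> (x j)) +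
      (\<epsilon> - \<epsilon>) * (lw t x \<phi> A * w (Suc (card (S - A))) * (\<Prod>i\<in>A. rho t (x i) \<epsilon>))) * cross t x A (S - A)) =
      c * (\<Prod>j\<in>S. rho t \<epsilon> (x j)) * shuffle t x (lw t x \<phi>) (\<lambda>A. w (card A)) S"
    unfolding shuffle_def sum_distrib_left
  proof (intro sum.cong refl)
    fix A assume "A \<in> Pow S"
    then have A: "finite A" "A \<subseteq> S" "finite (S - A)" "A \<union> (S - A) = S" using assms finite_subset by auto
    have 1: "(\<Prod>j\<in>A. psi t \<epsilon> (x j)) = (\<Prod>j\<in>A. rho t \<epsilon> (x j))"
      by (intro prod.cong refl psi) (use A in auto)
    have 2: "(\<Prod>j\<in>S. rho t \<epsilon> (x j)) = (\<Prod>j\<in>A. rho t \<epsilon> (x j)) * (\<Prod>j\<in>S - A. rho t \<epsilon> (x j))"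
      by (subst A(4)[symmetric], subst prod.union_disjoint) (use A in auto)
    show "(c * (\<Prod>j\<in>A. psi t \<epsilon> (x j)) * lw t x \<phi> A * w (card (S - A)) * (\<Prod>j\<in>S - A. rho t \<epsilon> (x j)) +
      (\<epsilon> - \<epsilon>) * (lw t x \<phi> A * w (Suc (card (S - A))) * (\<Prod>i\<in>A. rho t (x i) \<epsilon>))) * cross t x A (S - A) =
      c * (\<Prod>j\<in>S. rho t \<epsilon> (x j)) * (lw t x \<phi> A * w (card (S - A)) * cross t x A (S - A))"
      unfolding 1 2 by simp
  qed
  finally show ?thesis .
qed

lemma lws_at_infinity:
  assumes "\<And>j. j \<in> S \<Longrightarrow> x j \<noteq> 0" and \<phi>: "(\<phi> \<longlongrightarrow> c) at_infinity"
  shows "(lws t x \<phi> w S \<longlongrightarrow>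
     (\<Sum>A\<in>Pow S. (c * (\<Prod>j\<in>A. t) * lw t x \<phi> A * w (card (S - A)) * (\<Prod>j\<in>S - A. 1) +
      lw t x \<phi> A * w (Suc (card (S - A))) * (\<Prod>i\<in>A. t)) * cross t x A (S - A))) at_infinity"
  unfolding lws_def
  by (intro tendsto_intros tendsto_sum tendsto_prod psi_at_infinity rho_at_infinity \<phi>) (use assms in auto)

lemma lws_holomorphic:
  assumes "\<phi> holomorphic_on - {1, -1}" "\<And>i. i \<in> S \<Longrightarrow> x i \<noteq> 0"
  shows "lws t x \<phi> w S holomorphic_on - (x ` S \<union> (\<lambda>i. 1 / x i) ` S \<union> {1, -1})"
  unfolding lws_def psi_def rho_def
proof (intro holomorphic_intros holomorphic_on_subset[OF assms(1)], goal_cases)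
  case (2 A j z)
  then have "x j \<noteq> 0" "z \<noteq> 1 / x j" using assms(2) by auto
  then show ?case by (auto simp: field_simps)
qed auto

text \<open>Two numerators occur, with s^2 = t: 1 - t z^2 = (1 - s z)(1 + s z), which gives psi(z,
  z), and -s + (1 - t) z + s z^2 = (z - s)(1 + s z).\<close>

definition chi :: "complex \<Rightarrow> complex \<Rightarrow> complex \<Rightarrow> complex \<Rightarrow> complex" where
  "chi a b d z = (a + b * z + d * z\<^sup>2) / (1 - z\<^sup>2)"

lemma chi_continuous: "z\<^sup>2 \<noteq> 1 \<Longrightarrow> isCont (chi a b d) z"
  unfolding chi_def by (intro continuous_intros) auto

lemma chi_holomorphic: "chi a b d holomorphic_on - {1, -1}"
  unfolding chi_def by (intro holomorphic_intros) (auto simp: power2_eq_1_iff)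

lemma chi_at_infinity: "(chi a b d \<longlongrightarrow> - d) at_infinity"
proof -
  have 1: "((\<lambda>z. (a / z * (1 / z) + b / z + d) / (1 / z * (1 / z) - 1)) \<longlongrightarrow> (0 * 0 + 0 + d) / (0 * 0 - 1)) at_infinity"
    by (intro tendsto_intros inverse_at_infinity) auto
  have "(a / z * (1 / z) + b / z + d) / (1 / z * (1 / z) - 1) = chi a b d z" if "1 \<le> norm z" for z
  proof -
    have z: "z \<noteq> 0" using that by auto
    have "a / z * (1 / z) + b / z + d = (a + b * z + d * z\<^sup>2) / z\<^sup>2" "1 / z * (1 / z) - 1 = (1 - z\<^sup>2) / z\<^sup>2"
      using z by (simp_all add: field_simps power2_eq_square)
    then show ?thesis using z by (simp add: chi_def)
  qed
  then have "(chi a b d \<longlongrightarrow> (0 * 0 + 0 + d) / (0 * 0 - 1)) at_infinity"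
    by (intro Lim_transform_eventually[OF 1] eventually_at_infinityI[of 1]) auto
  then show ?thesis by simp
qed

lemma chi_pole:
  assumes "\<epsilon> * \<epsilon> = 1"
  shows "((\<lambda>z. (z - \<epsilon>) * chi a b d z) \<longlongrightarrow> - \<epsilon> * (a + b * \<epsilon> + d) / 2) (at \<epsilon>)"
proof -
  have e: "\<epsilon> \<noteq> 0" "\<epsilon>\<^sup>2 = 1" using assms by (auto simp: power2_eq_square)
  have 1: "((\<lambda>z. - (a + b * z + d * z\<^sup>2) / (z + \<epsilon>)) \<longlongrightarrow> - (a + b * \<epsilon> + d * \<epsilon>\<^sup>2) / (\<epsilon> + \<epsilon>)) (at \<epsilon>)"
    by (intro tendsto_intros) (use e in auto)
  have "(z - \<epsilon>) * chi a b d z = - (a + b * z + d * z\<^sup>2) / (z + \<epsilon>)" if "z \<noteq> \<epsilon>" for z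
  proof -
    have "1 - z\<^sup>2 = - ((z - \<epsilon>) * (z + \<epsilon>))" using e by (simp add: algebra_simps power2_eq_square)
    then show ?thesis using that by (simp add: chi_def divide_simps)
  qed
  then have "((\<lambda>z. (z - \<epsilon>) * chi a b d z) \<longlongrightarrow> - (a + b * \<epsilon> + d * \<epsilon>\<^sup>2) / (\<epsilon> + \<epsilon>)) (at \<epsilon>)"
    by (intro Lim_transform_eventually[OF 1]) (auto simp: eventually_at_filter)
  also have "- (a + b * \<epsilon> + d * \<epsilon>\<^sup>2) / (\<epsilon> + \<epsilon>) = - \<epsilon> * (a + b * \<epsilon> + d) / 2"
  proof -
    have sq: "\<epsilon> * (\<epsilon> * z) = z" for z using assms by (simp add: mult.assoc[symmetric])
    show ?thesis using e(1) by (simp add: divide_simps power2_eq_square algebra_simps sq)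
  qed
  finally show ?thesis .
qed

text \<open>As functions of one variable both sides have the same simple poles, with residues proportional
  to the two sides for fewer variables; the difference is therefore constant, and it vanishes at 0.\<close>

lemma shuffle_lw_shift:
  assumes fin: "finite S" and gen: "generic x S"
    and ab: "a1 + d1 = b2" "b1 = a2 + d2"
    and chi: "\<And>z. z \<noteq> 0 \<Longrightarrow> chi a1 b1 d1 (1 / z) * chi a1 b1 d1 z = chi a2 b2 d2 (1 / z) * chi a2 b2 d2 z"
    and w1: "w1 0 = 1" "\<And>m. w1 (Suc m) = - a1 * t ^ m * w1 m"
    and w2: "w2 0 = 1" "\<And>m. w2 (Suc m) = d2 * w2 m"
  shows "shuffle t x (lw t x (chi a1 b1 d1)) (\<lambda>A. w1 (card A)) S =
    (\<Prod>i\<in>S. x i) * shuffle t x (lw t x (chi a2 b2 d2)) (\<lambda>A. w2 (card A)) S"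
  using fin gen
proof (induction "card S" arbitrary: S rule: less_induct)
  case less
  define X1 where "X1 = shuffle t x (lw t x (chi a1 b1 d1)) (\<lambda>A. w1 (card A))"
  define X2 where "X2 = shuffle t x (lw t x (chi a2 b2 d2)) (\<lambda>A. w2 (card A))"
  show ?case
  proof (cases "S = {}")
    case True
    then show ?thesis using w1 w2 by (simp add: shuffle_def)
  next
    case False
    then obtain a T where S: "S = insert a T" "a \<notin> T" by (meson Set.set_insert equals0I)
    have fT: "finite T" "generic x T" using less.prems S generic_subset by auto
    have IH: "X1 U = (\<Prod>i\<in>U. x i) * X2 U" if "U \<subseteq> T" for U
      unfolding X1_def X2_def
    proof (rule less.hyps)
      show "card U < card S" using that S fT less.prems(1) by (intro psubset_card_mono) auto
      show "finite U" "generic x U" using that fT finite_subset generic_subset by auto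
    qed
    have x0: "x j \<noteq> 0" if "j \<in> T" for j using fT(2) that by (auto simp: generic_def)
    have x1: "x j * x j \<noteq> 1" if "j \<in> T" for j using fT(2) that by (auto simp: generic_def)
    define P where "P = x ` T \<union> (\<lambda>i. 1 / x i) ` T \<union> {1, -1}"
    define D1 where "D1 = lws t x (chi a1 b1 d1) w1 T"
    define D2 where "D2 = lws t x (chi a2 b2 d2) w2 T"
    define D where "D z = D1 z - z * (\<Prod>i\<in>T. x i) * D2 z" for z
    have "D (x a) = D 0"
    proof (rule liouville_finite_poles[where f = D and P = P])
      show "finite P" using fT by (auto simp: P_def)
      show "D holomorphic_on - P" unfolding D_def D1_def D2_def P_def
        by (intro holomorphic_intros lws_holomorphic chi_holomorphic x0)
      \<comment> \<open>The recursion for \<open>w2\<close> cancels the two leading terms against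
        each other; this compensates the factor z in front of \<open>D2\<close>.\<close>
      have "(D2 \<longlongrightarrow> 0) at_infinity"
      proof -
        have "(D2 \<longlongrightarrow> (\<Sum>A\<in>Pow T. (- d2 * (\<Prod>j\<in>A. t) * lw t x (chi a2 b2 d2) A * w2 (card (T - A)) * (\<Prod>j\<in>T - A. 1) +
          lw t x (chi a2 b2 d2) A * w2 (Suc (card (T - A))) * (\<Prod>i\<in>A. t)) * cross t x A (T - A))) at_infinity"
          unfolding D2_def by (intro lws_at_infinity chi_at_infinity x0)
        then show ?thesis by (simp add: w2 mult_ac)
      qed
      moreover have "((\<lambda>z. D1 z * (1 / z)) \<longlongrightarrow> L * 0) at_infinity" if "(D1 \<longlongrightarrow> L) at_infinity" for L
        by (intro tendsto_intros that inverse_at_infinity)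
      then have "((\<lambda>z. D1 z * (1 / z)) \<longlongrightarrow> 0) at_infinity"
        using lws_at_infinity[OF x0 chi_at_infinity] unfolding D1_def by fastforce
      ultimately have "((\<lambda>z. D1 z * (1 / z) - (\<Prod>i\<in>T. x i) * D2 z) \<longlongrightarrow> 0 - (\<Prod>i\<in>T. x i) * 0) at_infinity"
        by (intro tendsto_intros)
      then have *: "((\<lambda>z. D1 z * (1 / z) - (\<Prod>i\<in>T. x i) * D2 z) \<longlongrightarrow> 0) at_infinity" by simp
      show "((\<lambda>z. D z / z) \<longlongrightarrow> 0) at_infinity"
      proof (rule Lim_transform_eventually[OF *], rule eventually_at_infinityI[of 1])
        fix z :: complex assume "1 \<le> norm z"
        then have "z \<noteq> 0" by auto
        then show "D1 z * (1 / z) - (\<Prod>i\<in>T. x i) * D2 z = D z / z" by (simp add: D_def field_simps)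
      qed
      have "x a * x a \<noteq> 1" "x a \<noteq> 0" using less.prems(2) S by (auto simp: generic_def)
      then have "x a \<noteq> 1" "x a \<noteq> - 1" by auto
      moreover have "x a \<noteq> x j" "x a \<noteq> 1 / x j" if "j \<in> T" for j
      proof -
        have "x a * x j \<noteq> 1" using less.prems(2) S that by (auto simp: generic_def)
        then show "x a \<noteq> 1 / x j" using x0[OF that] by auto
        show "x a \<noteq> x j" using less.prems(2) S that by (auto simp: generic_def inj_on_def)
      qed
      ultimately show "x a \<notin> P" by (auto simp: P_def)
      show "0 \<notin> P" using x0 by (auto simp: P_def)
      fix p assume "p \<in> P"
      then consider b where "b \<in> T" "p = x b" | b where "b \<in> T" "p = 1 / x b" | "p * p = 1"
        by (auto simp: P_def)
      then show "((\<lambda>z. (z - p) * D z) \<longlongrightarrow> 0) (at p)"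
      proof cases
        case 1
        have c: "isCont (chi a b d) p" for a b d
          using x1 1 by (intro chi_continuous) (auto simp: power2_eq_square)
        have l: "((\<lambda>z. (z - p) * lws t x (chi u v y) w T z) \<longlongrightarrow> 0) (at p)" for u v y w
          unfolding 1(2) by (rule lws_pole_coincident[OF fT 1(1) c[unfolded 1(2)]])
        have "((\<lambda>z. (z - p) * D1 z - z * (\<Prod>i\<in>T. x i) * ((z - p) * D2 z)) \<longlongrightarrow> 0 - p * (\<Prod>i\<in>T. x i) * 0) (at p)"
          unfolding D1_def D2_def by (intro tendsto_intros l)
        then show ?thesis by (simp add: D_def algebra_simps)
      next
        case 2
        then obtain U where U: "T = insert b U" "b \<notin> U" by (meson Set.set_insert)
        have c: "isCont (chi a b d) p" for a b d
          using x1[OF 2(1)] 2 x0 by (intro chi_continuous) (auto simp: power2_eq_square)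
        have gU: "finite U" "generic x (insert b U)" using fT U by auto
        define k where "k = - ((1 - t) / x b) * (\<Prod>j\<in>U. psi t (x b) (x j) * rho t (x b) (x j))"
        have l: "((\<lambda>z. (z - p) * lws t x (chi u v y) w T z) \<longlongrightarrow>
          k * (chi u v y (1 / x b) * chi u v y (x b)) * shuffle t x (lw t x (chi u v y)) (\<lambda>A. w (card A)) U) (at p)" for u v y w
          using lws_pole_inverse[OF gU U(2) c[unfolded 2(2)], of t _ _ _ w] unfolding 2(2) U(1) k_def by (simp add: mult_ac)
        have "((\<lambda>z. (z - p) * D1 z - z * (\<Prod>i\<in>T. x i) * ((z - p) * D2 z)) \<longlongrightarrow>
            k * (chi a1 b1 d1 (1 / x b) * chi a1 b1 d1 (x b)) * X1 U
            - p * (\<Prod>i\<in>T. x i) * (k * (chi a2 b2 d2 (1 / x b) * chi a2 b2 d2 (x b)) * X2 U)) (at p)"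
          unfolding D1_def D2_def X1_def X2_def by (intro tendsto_intros l)
        also have "k * (chi a1 b1 d1 (1 / x b) * chi a1 b1 d1 (x b)) * X1 U
            - p * (\<Prod>i\<in>T. x i) * (k * (chi a2 b2 d2 (1 / x b) * chi a2 b2 d2 (x b)) * X2 U) = 0"
        proof -
          have "p * (\<Prod>i\<in>T. x i) = (\<Prod>i\<in>U. x i)" using U gU x0 2 by simp
          then show ?thesis using IH[OF subset_insertI[of U b, folded U(1)]] chi[OF x0[OF 2(1)]] by (simp add: mult_ac)
        qed
        finally show ?thesis by (simp add: D_def algebra_simps)
      next
        case 3
        define k where "k = (\<Prod>j\<in>T. rho t p (x j))"
        have l: "((\<lambda>z. (z - p) * lws t x (chi u v y) w T z) \<longlongrightarrow>
          (- p * (u + v * p + y) / 2) * k * shuffle t x (lw t x (chi u v y)) (\<lambda>A. w (card A)) T) (at p)" for u v y w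
          unfolding k_def by (intro lws_pole_unit fT 3 x1 chi_pole)
        have "((\<lambda>z. (z - p) * D1 z - z * (\<Prod>i\<in>T. x i) * ((z - p) * D2 z)) \<longlongrightarrow>
            (- p * (a1 + b1 * p + d1) / 2) * k * X1 T
            - p * (\<Prod>i\<in>T. x i) * ((- p * (a2 + b2 * p + d2) / 2) * k * X2 T)) (at p)"
          unfolding D1_def D2_def X1_def X2_def by (intro tendsto_intros l)
        also have "(- p * (a1 + b1 * p + d1) / 2) * k * X1 T
            - p * (\<Prod>i\<in>T. x i) * ((- p * (a2 + b2 * p + d2) / 2) * k * X2 T) = 0"
        proof -
          \<comment> \<open>For p^2 = 1 the two relations \<open>ab\<close> say that the numerators
            differ by the factor p, which is the value of the factor z in front of
            \<open>D2\<close>.\<close>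
          have "a1 + b1 * p + d1 = p * (a2 + b2 * p + d2)"
          proof -
            have sq: "p * (p * z) = z" for z using 3 by (simp add: mult.assoc[symmetric])
            show ?thesis unfolding ab(2) ab(1)[symmetric] using 3 by (simp add: algebra_simps sq)
          qed
          then show ?thesis using IH[of T] by (simp add: mult_ac)
        qed
        finally show ?thesis by (simp add: D_def algebra_simps)
      qed
    qed
    also have "D 0 = 0"
    proof -
      \<comment> \<open>At 0 the factors rho become t and 1, and the recursion for \<open>w1\<close>
        is the condition that the two terms cancel.\<close>
      have "D1 0 = 0" unfolding D1_def lws_def
      proof (intro sum.neutral ballI)
        fix A assume "A \<in> Pow T"
        then have A: "A \<subseteq> T" by auto
        have "(\<Prod>j\<in>T - A. rho t 0 (x j)) = (\<Prod>j\<in>T - A. t)" "(\<Prod>i\<in>A. rho t (x i) 0) = (\<Prod>i\<in>A. 1)"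
          by (intro prod.cong refl; use A x0 in \<open>auto simp: rho_def\<close>)+
        then show "(chi a1 b1 d1 0 * (\<Prod>j\<in>A. psi t 0 (x j)) * lw t x (chi a1 b1 d1) A * w1 (card (T - A)) * (\<Prod>j\<in>T - A. rho t 0 (x j)) +
          lw t x (chi a1 b1 d1) A * w1 (Suc (card (T - A))) * (\<Prod>i\<in>A. rho t (x i) 0)) * cross t x A (T - A) = 0"
          by (simp add: w1 chi_def psi_def)
      qed
      then show ?thesis by (simp add: D_def)
    qed
    finally have "D1 (x a) = x a * (\<Prod>i\<in>T. x i) * D2 (x a)" by (simp add: D_def)
    then show ?thesis
      unfolding S(1) shuffle_lw_insert[OF fT(1) S(2)] D1_def D2_def using S fT by simp
  qed
qed

section \<open>Evaluations of t-binomial convolutions\<close>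

lemma conv_mult_left: "conv t (\<lambda>m. c * f m) g n = c * conv t f g n"
  by (induction n arbitrary: f g) (auto simp: algebra_simps)

lemma conv_mult_right: "conv t f (\<lambda>m. c * g m) n = c * conv t f g n"
  by (induction n arbitrary: f g) (auto simp: algebra_simps)

lemma conv_add_right: "conv t f (\<lambda>m. g m + h m) n = conv t f g n + conv t f h n"
  by (induction n arbitrary: f g h) (auto simp: algebra_simps)

lemma conv_unit_right: "conv t (\<lambda>_. 1) (\<lambda>m. of_bool (m = 0)) n = 1"
proof (induction n)
  case (Suc n)
  have *: "(\<lambda>m. t ^ m * of_bool (m = 0)) = (\<lambda>m. of_bool (m = 0))" by (rule ext) (simp add: of_bool_def)
  show ?case using Suc conv_mult_right[of t "\<lambda>_. 1" 0 "\<lambda>_. 0" n] by (simp add: *)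
qed simp

lemma conv_one_right: "conv t (\<lambda>_. 1) (\<lambda>m. of_bool (m = 1)) n = (\<Sum>i<n. t ^ i)"
proof (induction n)
  case (Suc n)
  have *: "(\<lambda>m. t ^ m * of_bool (m = Suc 0)) = (\<lambda>m. t * of_bool (m = Suc 0))" by (rule ext) auto
  show ?case using Suc conv_unit_right[of t n] unfolding sum.lessThan_Suc_shift
    by (simp add: * conv_mult_right sum_distrib_left)
qed simp

text \<open>In closed form c^m t^(m (m - 1) / 2). If f is encoded as the formal series of f(m) z^m /
  (t;t)_m, then \<open>conv\<close> is multiplication, c^m becomes 1 / (c z; t)_inf, and
  \<open>qexp t (- c)\<close> becomes its inverse.\<close>

primrec qexp :: "complex \<Rightarrow> complex \<Rightarrow> nat \<Rightarrow> complex" where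
  "qexp t c 0 = 1"
| "qexp t c (Suc m) = c * t ^ m * qexp t c m"

lemma conv_qexp_inverse: "conv t (\<lambda>m. c ^ m) (qexp t (- c)) n = of_bool (n = 0)"
proof (cases n)
  case (Suc m)
  have *: "(\<lambda>m. qexp t (- c) (Suc m)) = (\<lambda>m. (- c) * (t ^ m * qexp t (- c) m))" by auto
  show ?thesis unfolding Suc conv.simps * conv_mult_right power_Suc conv_mult_left by simp
qed simp

lemma conv_power_Suc: "conv t (\<lambda>m. c ^ m) (\<lambda>m. d ^ m) (Suc n) =
    c * conv t (\<lambda>m. c ^ m) (\<lambda>m. (t * d) ^ m) n + d * conv t (\<lambda>m. c ^ m) (\<lambda>m. d ^ m) n"
  by (simp add: conv_mult_left conv_mult_right power_mult_distrib)

text \<open>For the series attached to the sequences this is 1 / (d z; t)_inf - 1 / (t d z; t)_inf =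
  d z / (d z; t)_inf.\<close>

lemma conv_power_diff: "conv t (\<lambda>m. c ^ m) (\<lambda>m. d ^ m) (Suc n) - conv t (\<lambda>m. c ^ m) (\<lambda>m. (t * d) ^ m) (Suc n) =
    (1 - t ^ Suc n) * d * conv t (\<lambda>m. c ^ m) (\<lambda>m. d ^ m) n"
proof -
  define h where "h d n = conv t (\<lambda>m. c ^ m) (\<lambda>m. d ^ m) n" for d n
  have rec: "h d (Suc n) = c * h (t * d) n + d * h d n" for d n
    unfolding h_def by (rule conv_power_Suc)
  have "h d (Suc n) - h (t * d) (Suc n) = (1 - t ^ Suc n) * d * h d n"
  proof (induction n arbitrary: d)
    case 0
    have "h d 0 = 1" for d by (simp add: h_def)
    then show ?case by (simp add: rec algebra_simps)
  next
    case (Suc n)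
    have "h d (Suc (Suc n)) - h (t * d) (Suc (Suc n)) =
        c * (h (t * d) (Suc n) - h (t * (t * d)) (Suc n)) + d * h d (Suc n) - (t * d) * h (t * d) (Suc n)"
      unfolding rec[of _ "Suc n"] by (simp add: algebra_simps)
    also have "\<dots> = (c * h (t * d) n) * ((1 - t ^ Suc n) * (t * d)) + d * h d (Suc n) - (t * d) * h (t * d) (Suc n)"
      unfolding Suc by (simp add: mult_ac)
    also have "c * h (t * d) n = h d (Suc n) - d * h d n" unfolding rec[of d n] by simp
    also have "h (t * d) (Suc n) = h d (Suc n) - (1 - t ^ Suc n) * d * h d n" using Suc[of d] by (simp add: algebra_simps)
    finally show ?case unfolding power_Suc by (simp add: algebra_simps)
  qed
  then show ?thesis unfolding h_def .
qed

text \<open>The three-term recurrence of the Rogers--Szego polynomials.\<close>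

lemma conv_power_Suc_Suc: "conv t (\<lambda>m. c ^ m) (\<lambda>m. d ^ m) (Suc (Suc n)) =
    (c + d) * conv t (\<lambda>m. c ^ m) (\<lambda>m. d ^ m) (Suc n) - (1 - t ^ Suc n) * c * d * conv t (\<lambda>m. c ^ m) (\<lambda>m. d ^ m) n"
proof -
  have "conv t (\<lambda>m. c ^ m) (\<lambda>m. d ^ m) (Suc (Suc n)) =
    c * conv t (\<lambda>m. c ^ m) (\<lambda>m. (t * d) ^ m) (Suc n) + d * conv t (\<lambda>m. c ^ m) (\<lambda>m. d ^ m) (Suc n)"
    by (rule conv_power_Suc)
  moreover have "A = c * B + d * C \<Longrightarrow> C - B = e * d * F \<Longrightarrow> A = (c + d) * C - e * c * d * F" for A B C e F
  proof -
    assume "A = c * B + d * C" "C - B = e * d * F"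
    moreover from this(2) have "B = C - e * d * F" by (simp add: algebra_simps)
    ultimately show ?thesis by (simp add: algebra_simps)
  qed
  ultimately show ?thesis using conv_power_diff[of t c d n] by blast
qed

lemma qpoch_Suc: "qpoch a q (Suc m) = qpoch a q m * (1 - a * q ^ m)"
  by (simp add: qpoch_def)

lemma qpoch_0 [simp]: "qpoch a q 0 = 1"
  by (simp add: qpoch_def)

text \<open>For c = -t and d = 1 the three-term recurrence preserves the product form. Thus the
  weight of an even part splits into two geometric factors, which can be absorbed
  separately.\<close>

lemma conv_even: "conv t (\<lambda>m. (- t) ^ m) (\<lambda>m. 1 ^ m) n = qpoch t (t\<^sup>2) ((n + 1) div 2)"
proof (induction n rule: induct_nat_012)
  case (ge2 n)
  have e: "conv t (\<lambda>m. (- t) ^ m) (\<lambda>m. 1 ^ m) (Suc (Suc n)) =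
    (1 - t) * qpoch t (t\<^sup>2) ((n + 2) div 2) + (1 - t ^ Suc n) * t * qpoch t (t\<^sup>2) ((n + 1) div 2)"
    unfolding conv_power_Suc_Suc ge2 by (simp add: algebra_simps)
  show ?case
  proof (cases "even n")
    case True
    then obtain r where n: "n = 2 * r" by blast
    show ?thesis unfolding e unfolding n by (simp add: qpoch_Suc power2_eq_square power_mult_distrib power_add mult_2 mult_2_right algebra_simps)
  next
    case False
    then obtain r where n: "n = 2 * r + 1" using oddE by blast
    show ?thesis unfolding e unfolding n by (simp add: qpoch_Suc power2_eq_square power_mult_distrib power_add mult_2 mult_2_right algebra_simps)
  qed
qed (simp_all add: qpoch_def)

text \<open>Here c + d = 0, so the recurrence has step two and the values at odd n vanish. This is
  the source of the condition that odd parts have even multiplicity.\<close>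

lemma conv_odd:
  assumes "s\<^sup>2 = t"
  shows "conv t (\<lambda>m. s ^ m) (\<lambda>m. (- s) ^ m) n = (if even n then t ^ (n div 2) * qpoch t (t\<^sup>2) (n div 2) else 0)"
proof (induction n rule: induct_nat_012)
  case (ge2 n)
  have e: "conv t (\<lambda>m. s ^ m) (\<lambda>m. (- s) ^ m) (Suc (Suc n)) =
    (1 - t ^ Suc n) * t * conv t (\<lambda>m. s ^ m) (\<lambda>m. (- s) ^ m) n"
    unfolding conv_power_Suc_Suc using assms by (simp add: power2_eq_square)
  show ?case
  proof (cases "even n")
    case True
    then obtain r where n: "n = 2 * r" by blast
    show ?thesis unfolding e ge2(1) unfolding n by (simp add: qpoch_Suc power2_eq_square power_mult_distrib power_add mult_2 mult_2_right mult_ac)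
  next
    case False
    then show ?thesis unfolding e ge2(1) by simp
  qed
qed simp_all

text \<open>The factor 1 + t^(m + 1) splits the second term of the t-Pascal rule in such a way that
  one half cancels the first term.\<close>

lemma conv_power_prod: "conv t (\<lambda>m. (- t) ^ m) (\<lambda>m. \<Prod>i<m. 1 + t ^ Suc i) n = 1"
proof (induction n)
  case (Suc n)
  have *: "(\<lambda>m. \<Prod>i<Suc m. 1 + t ^ Suc i) = (\<lambda>m. (\<Prod>i<m. 1 + t ^ Suc i) + t * (t ^ m * (\<Prod>i<m. 1 + t ^ Suc i)))"
    by (simp add: algebra_simps)
  show ?case unfolding conv.simps * unfolding conv_add_right conv_mult_right power_Suc[of "- t"] conv_mult_left
    using Suc by simp
qed simp

text \<open>The case of \<open>shuffle_const\<close> in which the second factor is the indicator of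
  singletons. It distributes [n] = 1 + t + ... + t^(n - 1) over the choice of one variable, which is
  how recursions in the number of variables arise.\<close>

lemma sum_rho:
  assumes "finite S" "inj_on y S" "\<And>i. i \<in> S \<Longrightarrow> y i \<noteq> 0"
  shows "(\<Sum>i\<in>S. \<Prod>j\<in>S - {i}. rho t (y j) (y i)) = (\<Sum>i<card S. t ^ i)"
proof -
  have "(\<Sum>i<card S. t ^ i) = shuffle t y (\<lambda>A. 1) (\<lambda>A. of_bool (card A = 1)) S"
    using shuffle_const[OF assms, of t "\<lambda>_. 1" "\<lambda>m. of_bool (m = 1)"] by (simp only: conv_one_right)
  also have "\<dots> = (\<Sum>A\<in>(\<lambda>i. S - {i}) ` S. cross t y A (S - A))"
    unfolding shuffle_def
  proof (rule sum.mono_neutral_cong_right)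
    show "\<forall>A\<in>Pow S - (\<lambda>i. S - {i}) ` S. 1 * of_bool (card (S - A) = 1) * cross t y A (S - A) = 0"
    proof
      fix A assume A: "A \<in> Pow S - (\<lambda>i. S - {i}) ` S"
      have "card (S - A) \<noteq> 1"
      proof
        assume "card (S - A) = 1"
        then obtain i where i: "S - A = {i}" by (auto simp: card_1_singleton_iff)
        then have "A = S - {i}" "i \<in> S" using A by auto
        then show False using A by auto
      qed
      then show "1 * of_bool (card (S - A) = 1) * cross t y A (S - A) = 0" by simp
    qed
    fix A assume "A \<in> (\<lambda>i. S - {i}) ` S"
    then obtain i where "i \<in> S" "A = S - {i}" by auto
    moreover from this have "S - A = {i}" by auto
    ultimately show "1 * of_bool (card (S - A) = 1) * cross t y A (S - A) = cross t y A (S - A)" by simp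
  qed (use assms in auto)
  also have "\<dots> = (\<Sum>i\<in>S. cross t y (S - {i}) (S - (S - {i})))"
    by (subst sum.reindex) (auto simp: inj_on_def)
  also have "\<dots> = (\<Sum>i\<in>S. \<Prod>j\<in>S - {i}. rho t (y j) (y i))"
  proof (intro sum.cong refl)
    fix i assume "i \<in> S"
    then have "S - (S - {i}) = {i}" by auto
    then show "cross t y (S - {i}) (S - (S - {i})) = (\<Prod>j\<in>S - {i}. rho t (y j) (y i))" by (simp add: cross_def)
  qed
  finally show ?thesis ..
qed

lemma lw_Un:
  assumes "finite A" "finite B" "A \<inter> B = {}"
  shows "lw t y \<phi> (A \<union> B) = lw t y \<phi> A * lw t y \<phi> B * (\<Prod>i\<in>A. \<Prod>j\<in>B. psi t (y i) (y j))"
  using assms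
proof (induction A rule: finite_induct)
  case (insert a A)
  have "(\<Prod>j\<in>A \<union> B. psi t (y a) (y j)) = (\<Prod>j\<in>A. psi t (y a) (y j)) * (\<Prod>j\<in>B. psi t (y a) (y j))"
    by (rule prod.union_disjoint) (use insert in auto)
  then show ?case using insert by (simp add: lw_insert mult_ac)
qed simp

section \<open>The sum over sign changes and its recursion\<close>

definition flip :: "('i \<Rightarrow> complex) \<Rightarrow> 'i set \<Rightarrow> 'i \<Rightarrow> complex" where
  "flip x A i = (if i \<in> A then 1 / x i else x i)"

lemma flip_generic:
  assumes "generic x S"
  shows "inj_on (flip x A) S" "\<And>i. i \<in> S \<Longrightarrow> flip x A i \<noteq> 0"
proof -
  have "x i \<noteq> 1 / x j" if "i \<in> S" "j \<in> S" for i j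
    using assms that unfolding generic_def by (metis nonzero_divide_eq_eq)
  then show "inj_on (flip x A) S" using assms
    unfolding generic_def flip_def inj_on_def by (smt (verit) inverse_eq_divide inverse_eq_iff_eq)
  show "flip x A i \<noteq> 0" if "i \<in> S" for i using assms that by (auto simp: generic_def flip_def)
qed

definition sgn_sum :: "complex \<Rightarrow> ('i :: linorder \<Rightarrow> complex) \<Rightarrow> nat \<Rightarrow> 'i set \<Rightarrow> complex" where
  "sgn_sum t x N S = (\<Sum>A\<in>Pow S. (\<Prod>i\<in>A. x i) ^ N * lw t (flip x A) (chi 1 0 (- t)) S)"

text \<open>For i in A and j outside A, psi(1 / x i, x j) = rho(x i, x j). Hence the cross factors
  complete the two partial Littlewood products to the product for the flipped variables.\<close>

lemma shuffle_eq_sgn_sum: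
  assumes "finite S" "generic x S"
  shows "shuffle t x (\<lambda>A. (\<Prod>i\<in>A. x i) ^ N * lw t (\<lambda>i. 1 / x i) (chi 1 0 (- t)) A) (lw t x (chi 1 0 (- t))) S = sgn_sum t x N S"
  unfolding shuffle_def sgn_sum_def
proof (intro sum.cong refl)
  fix A assume "A \<in> Pow S"
  then have A: "finite A" "finite (S - A)" "A \<subseteq> S" "A \<inter> (S - A) = {}" "A \<union> (S - A) = S" using assms finite_subset by auto
  have "lw t (flip x A) (chi 1 0 (- t)) S = lw t (flip x A) (chi 1 0 (- t)) A * lw t (flip x A) (chi 1 0 (- t)) (S - A) *
      (\<Prod>i\<in>A. \<Prod>j\<in>S - A. psi t (flip x A i) (flip x A j))"
    using lw_Un[OF A(1,2,4)] unfolding A(5) .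
  also have "lw t (flip x A) (chi 1 0 (- t)) A = lw t (\<lambda>i. 1 / x i) (chi 1 0 (- t)) A"
    by (rule lw_cong) (simp add: flip_def)
  also have "lw t (flip x A) (chi 1 0 (- t)) (S - A) = lw t x (chi 1 0 (- t)) (S - A)"
    by (rule lw_cong) (simp add: flip_def)
  also have "(\<Prod>i\<in>A. \<Prod>j\<in>S - A. psi t (flip x A i) (flip x A j)) = cross t x A (S - A)"
    unfolding cross_def
  proof (intro prod.cong refl)
    fix i j assume "i \<in> A" "j \<in> S - A"
    moreover from this have "i \<in> S" "j \<in> S" "i \<noteq> j" using A(3) by auto
    ultimately show "psi t (flip x A i) (flip x A j) = rho t (x i) (x j)"
      using assms(2) A(3) psi_inverse(1)[of "x i" "x j" t] by (auto simp: generic_def flip_def inj_on_def)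
  qed
  finally show "(\<Prod>i\<in>A. x i) ^ N * lw t (\<lambda>i. 1 / x i) (chi 1 0 (- t)) A * lw t x (chi 1 0 (- t)) (S - A) * cross t x A (S - A) =
    (\<Prod>i\<in>A. x i) ^ N * lw t (flip x A) (chi 1 0 (- t)) S" by (simp add: mult_ac)
qed

text \<open>What a variable of value u contributes when it is split off. Under x j -> 1 / x j the
  factors psi and rho are exchanged, so \<open>gam\<close> does not see the signs of the other
  variables.\<close>

definition gam :: "complex \<Rightarrow> ('i \<Rightarrow> complex) \<Rightarrow> 'i set \<Rightarrow> complex \<Rightarrow> complex" where
  "gam t x T u = chi 1 0 (- t) u * (\<Prod>j\<in>T. psi t u (x j) * rho t (x j) u)"

text \<open>Every summand is multiplied by [n], written by \<open>sum_rho\<close> at the flipped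
  variables. The i-th term of that sum combines with the factors of x i into \<open>gam\<close>,
  leaving the summand for the remaining variables.\<close>

lemma sgn_sum_recursion:
  assumes "finite S" "generic x S"
  shows "(\<Sum>i<card S. t ^ i) * sgn_sum t x N S =
    (\<Sum>i\<in>S. (gam t x (S - {i}) (x i) + x i ^ N * gam t x (S - {i}) (1 / x i)) * sgn_sum t x N (S - {i}))"
proof -
  let ?L = "\<lambda>A T. lw t (flip x A) (chi 1 0 (- t)) T"
  have "(\<Sum>i<card S. t ^ i) * sgn_sum t x N S =
     (\<Sum>A\<in>Pow S. \<Sum>i\<in>S. (\<Prod>i\<in>A. x i) ^ N * (gam t x (S - {i}) (flip x A i) * ?L A (S - {i})))"
    unfolding sgn_sum_def sum_distrib_left
  proof (intro sum.cong refl)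
    fix A assume A: "A \<in> Pow S"
    have fg: "inj_on (flip x A) S" "\<And>i. i \<in> S \<Longrightarrow> flip x A i \<noteq> 0"
      by (rule flip_generic[OF assms(2)])+
    have "(\<Sum>i<card S. t ^ i) * ((\<Prod>i\<in>A. x i) ^ N * ?L A S) =
       (\<Sum>i\<in>S. (\<Prod>i\<in>A. x i) ^ N * ((\<Prod>j\<in>S - {i}. rho t (flip x A j) (flip x A i)) * ?L A S))"
    proof -
      have "(\<Sum>i<card S. t ^ i) = (\<Sum>i\<in>S. \<Prod>j\<in>S - {i}. rho t (flip x A j) (flip x A i))"
        by (rule sum_rho[symmetric]) (use assms fg in auto)
      then show ?thesis by (simp only:) (simp add: sum_distrib_left sum_distrib_right mult_ac)
    qed
    also have "\<dots> = (\<Sum>i\<in>S. (\<Prod>i\<in>A. x i) ^ N * (gam t x (S - {i}) (flip x A i) * ?L A (S - {i})))"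
    proof (intro sum.cong refl)
      fix i assume i: "i \<in> S"
      have "?L A S = ?L A (insert i (S - {i}))" using i by (simp add: insert_absorb)
      also have "\<dots> = chi 1 0 (- t) (flip x A i) * (\<Prod>j\<in>S - {i}. psi t (flip x A i) (flip x A j)) * ?L A (S - {i})"
        by (rule lw_insert) (use assms in auto)
      finally have 1: "?L A S = \<dots>" .
      have "psi t (flip x A i) (flip x A j) * rho t (flip x A j) (flip x A i) = psi t (flip x A i) (x j) * rho t (x j) (flip x A i)"
        if "j \<in> S - {i}" for j
      proof (cases "j \<in> A")
        case True
        have "x i \<noteq> 0" "x j \<noteq> 0" "x i \<noteq> x j" "x i * x j \<noteq> 1" using assms(2) i that by (auto simp: generic_def inj_on_def)
        then have ne: "x j \<noteq> 0" "x j \<noteq> flip x A i" "x j * flip x A i \<noteq> 1" by (auto simp: flip_def field_simps)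
        have fj: "flip x A j = 1 / x j" using True by (simp add: flip_def)
        show ?thesis unfolding fj psi_commute[of t "flip x A i"] psi_inverse[OF ne] by simp
      qed (simp add: flip_def)
      then have "(\<Prod>j\<in>S - {i}. rho t (flip x A j) (flip x A i)) * ?L A S = gam t x (S - {i}) (flip x A i) * ?L A (S - {i})"
        unfolding 1 gam_def by (simp add: prod.distrib[symmetric] mult_ac)
      then show "(\<Prod>i\<in>A. x i) ^ N * ((\<Prod>j\<in>S - {i}. rho t (flip x A j) (flip x A i)) * ?L A S) =
          (\<Prod>i\<in>A. x i) ^ N * (gam t x (S - {i}) (flip x A i) * ?L A (S - {i}))" by simp
    qed
    finally show "(\<Sum>i<card S. t ^ i) * ((\<Prod>i\<in>A. x i) ^ N * ?L A S) =
      (\<Sum>i\<in>S. (\<Prod>i\<in>A. x i) ^ N * (gam t x (S - {i}) (flip x A i) * ?L A (S - {i})))" .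
  qed
  also have "\<dots> = (\<Sum>i\<in>S. \<Sum>A\<in>Pow S. (\<Prod>i\<in>A. x i) ^ N * (gam t x (S - {i}) (flip x A i) * ?L A (S - {i})))"
    by (rule sum.swap)
  also have "\<dots> = (\<Sum>i\<in>S. (gam t x (S - {i}) (x i) + x i ^ N * gam t x (S - {i}) (1 / x i)) * sgn_sum t x N (S - {i}))"
  proof (intro sum.cong refl)
    fix i assume i: "i \<in> S"
    let ?F = "\<lambda>A. (\<Prod>i\<in>A. x i) ^ N * (gam t x (S - {i}) (flip x A i) * ?L A (S - {i}))"
    define T where "T = S - {i}"
    have T: "S = insert i T" "i \<notin> T" "finite T" using i assms by (auto simp: T_def)
    have *: "Pow S = insert i ` Pow T \<union> Pow T" unfolding T(1) by (simp add: Pow_insert Un_commute)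
    have "sum ?F (Pow S) = (\<Sum>A\<in>insert i ` Pow T. ?F A) + (\<Sum>A\<in>Pow T. ?F A)"
      unfolding * by (rule sum.union_disjoint) (use T in auto)
    also have "(\<Sum>A\<in>insert i ` Pow T. ?F A) = (\<Sum>A\<in>Pow T. ?F (insert i A))"
      by (subst sum.reindex) (use T in \<open>auto simp: inj_on_def\<close>)
    also have "\<dots> = (\<Sum>A\<in>Pow T. x i ^ N * gam t x T (1 / x i) * ((\<Prod>i\<in>A. x i) ^ N * ?L A T))"
    proof (intro sum.cong refl)
      fix A assume "A \<in> Pow T"
      then have A: "finite A" "i \<notin> A" using T finite_subset by auto
      have "?L (insert i A) T = ?L A T" by (rule lw_cong) (use T in \<open>auto simp: flip_def\<close>)
      then show "?F (insert i A) = x i ^ N * gam t x T (1 / x i) * ((\<Prod>i\<in>A. x i) ^ N * ?L A T)"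
        using A unfolding T_def[symmetric] by (simp add: flip_def power_mult_distrib mult_ac)
    qed
    also have "(\<Sum>A\<in>Pow T. ?F A) = (\<Sum>A\<in>Pow T. gam t x T (x i) * ((\<Prod>i\<in>A. x i) ^ N * ?L A T))"
    proof (intro sum.cong refl)
      fix A assume "A \<in> Pow T"
      then have A: "i \<notin> A" using T by auto
      then show "?F A = gam t x T (x i) * ((\<Prod>i\<in>A. x i) ^ N * ?L A T)"
        unfolding T_def[symmetric] by (simp add: flip_def mult_ac)
    qed
    finally have "sum ?F (Pow S) = x i ^ N * gam t x T (1 / x i) * sgn_sum t x N T + gam t x T (x i) * sgn_sum t x N T"
      unfolding sgn_sum_def sum_distrib_left .
    then show "sum ?F (Pow S) = (gam t x (S - {i}) (x i) + x i ^ N * gam t x (S - {i}) (1 / x i)) * sgn_sum t x N (S - {i})"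
      unfolding T_def[symmetric] by (simp add: distrib_right add.commute)
  qed
  finally show ?thesis .
qed

lemma rho_inverse_self: "u \<noteq> 0 \<Longrightarrow> u * u \<noteq> 1 \<Longrightarrow> rho t (1 / u) u = chi 1 0 (- t) u"
  by (simp add: rho_def chi_def divide_simps power2_eq_square)

text \<open>This is \<open>sum_rho\<close> for the 2n numbers x i and 1 / x i. The partner 1/u of u
  contributes rho(1/u, u), the weight of u, and a pair x j, 1 / x j contributes psi(u, x j) rho(x j,
  u).\<close>

lemma sum_gam:
  assumes "finite S" "generic x S"
  shows "(\<Sum>i\<in>S. gam t x (S - {i}) (x i) + gam t x (S - {i}) (1 / x i)) = (\<Sum>i<2 * card S. t ^ i)"
proof -
  define X where "X = (\<lambda>(i, b). if b then 1 / x i else x i)"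
  have g: "x i \<noteq> 0" "x i * x j \<noteq> 1" if "i \<in> S" "j \<in> S" for i j using assms(2) that by (auto simp: generic_def)
  have ij: "x i = x j \<Longrightarrow> i = j" if "i \<in> S" "j \<in> S" for i j using assms(2) that by (auto simp: generic_def inj_on_def)
  have ne: "x i \<noteq> 1 / x j" if "i \<in> S" "j \<in> S" for i j using g that by (metis nonzero_divide_eq_eq)
  have inj: "inj_on X (S \<times> UNIV)"
    by (rule inj_onI) (use g ne ij ne[symmetric] in \<open>auto simp: X_def split: if_splits\<close>)
  have "(\<Sum>i<2 * card S. t ^ i) = (\<Sum>i<card (S \<times> (UNIV :: bool set)). t ^ i)"
    by (simp add: card_cartesian_product mult.commute)
  also have "\<dots> = (\<Sum>c\<in>S \<times> UNIV. \<Prod>d\<in>S \<times> UNIV - {c}. rho t (X d) (X c))"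
  proof (rule sum_rho[symmetric, OF _ inj])
    fix d assume "d \<in> S \<times> (UNIV :: bool set)"
    then show "X d \<noteq> 0" using g by (cases d) (auto simp: X_def)
  qed (use assms in auto)
  also have "\<dots> = (\<Sum>i\<in>S. \<Sum>b\<in>UNIV. \<Prod>d\<in>S \<times> UNIV - {(i, b)}. rho t (X d) (X (i, b)))"
    by (subst sum.cartesian_product) (simp add: case_prod_unfold)
  also have "\<dots> = (\<Sum>i\<in>S. \<Sum>b\<in>UNIV. gam t x (S - {i}) (X (i, b)))"
  proof (intro sum.cong refl)
    fix i b assume i: "i \<in> S"
    define u where "u = X (i, b)"
    have u: "u \<noteq> 0" "u * u \<noteq> 1" using g[OF i i] by (auto simp: u_def X_def)
    have S: "S \<times> UNIV - {(i, b)} = insert (i, \<not> b) ((S - {i}) \<times> UNIV)" using i by auto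
    have "(\<Prod>d\<in>S \<times> UNIV - {(i, b)}. rho t (X d) u) = rho t (X (i, \<not> b)) u * (\<Prod>d\<in>(S - {i}) \<times> UNIV. rho t (X d) u)"
      unfolding S by (subst prod.insert) (use assms in auto)
    also have "X (i, \<not> b) = 1 / u" by (auto simp: u_def X_def)
    also have "(\<Prod>d\<in>(S - {i}) \<times> UNIV. rho t (X d) u) = (\<Prod>j\<in>S - {i}. \<Prod>b\<in>UNIV. rho t (X (j, b)) u)"
      by (subst prod.cartesian_product) (simp add: case_prod_unfold)
    also have "\<dots> = (\<Prod>j\<in>S - {i}. psi t u (x j) * rho t (x j) u)"
    proof (intro prod.cong refl)
      fix j assume j: "j \<in> S - {i}"
      then have "x j \<noteq> 0" "x j \<noteq> u" "x j * u \<noteq> 1"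
        using g ij ne i by (auto simp: u_def X_def)
      then show "(\<Prod>b\<in>UNIV. rho t (X (j, b)) u) = psi t u (x j) * rho t (x j) u"
        using psi_inverse(2)[of "x j" u t] by (simp add: UNIV_bool X_def psi_commute[of t u])
    qed
    finally show "(\<Prod>d\<in>S \<times> UNIV - {(i, b)}. rho t (X d) (X (i, b))) = gam t x (S - {i}) (X (i, b))"
      unfolding gam_def u_def[symmetric] using rho_inverse_self[OF u] by simp
  qed
  also have "\<dots> = (\<Sum>i\<in>S. gam t x (S - {i}) (x i) + gam t x (S - {i}) (1 / x i))"
    by (intro sum.cong refl) (simp add: UNIV_bool X_def)
  finally show ?thesis ..
qed

lemma geometric_nonzero:
  assumes "norm t < 1" "n > 0"
  shows "(\<Sum>i<n. t ^ i) \<noteq> (0 :: complex)"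
proof -
  have "norm (t ^ n) < 1" using assms by (simp add: norm_power power_less_one_iff)
  then have "t ^ n \<noteq> 1" by auto
  then show ?thesis using one_diff_power_eq[of t n] by auto
qed

text \<open>For N = 0 the coefficients of the recursion add up to [2n] = [n] (1 + t^n), and [n] can
  be cancelled because it is nonzero for |t| < 1.\<close>

lemma sgn_sum_0:
  assumes "finite S" "generic x S" "norm t < 1"
  shows "sgn_sum t x 0 S = (\<Prod>i<card S. 1 + t ^ Suc i)"
  using assms(1,2)
proof (induction "card S" arbitrary: S)
  case 0
  then show ?case by (simp add: sgn_sum_def)
next
  case (Suc n)
  have "sgn_sum t x 0 (S - {i}) = (\<Prod>i<n. 1 + t ^ Suc i)" if "i \<in> S" for i
  proof -
    have "n = card (S - {i})" using Suc.hyps(2) Suc.prems(1) that by simp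
    then show ?thesis using Suc.hyps(1)[of "S - {i}"] Suc.prems generic_subset[of x S "S - {i}"] by auto
  qed
  then have "(\<Sum>i<Suc n. t ^ i) * sgn_sum t x 0 S =
     (\<Sum>i\<in>S. gam t x (S - {i}) (x i) + gam t x (S - {i}) (1 / x i)) * (\<Prod>i<n. 1 + t ^ Suc i)"
    using sgn_sum_recursion[OF Suc.prems, of t 0] Suc.hyps(2) by (simp add: sum_distrib_right)
  also have "\<dots> = (\<Sum>i<2 * Suc n. t ^ i) * (\<Prod>i<n. 1 + t ^ Suc i)"
    using sum_gam[OF Suc.prems] Suc.hyps(2) by simp
  also have "(\<Sum>i<2 * Suc n. t ^ i) = (\<Sum>i<Suc n. t ^ i) * (1 + t ^ Suc n)"
  proof -
    have "t \<noteq> 1" using assms(3) by auto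
    have "(1 - t) * (\<Sum>i<2 * Suc n. t ^ i) = (1 - t) * ((\<Sum>i<Suc n. t ^ i) * (1 + t ^ Suc n))"
      unfolding mult.assoc[symmetric] one_diff_power_eq[symmetric] mult_2 power_add by (simp add: algebra_simps)
    then show ?thesis using \<open>t \<noteq> 1\<close> by simp
  qed
  finally have "(\<Sum>i<Suc n. t ^ i) * sgn_sum t x 0 S = (\<Sum>i<Suc n. t ^ i) * (\<Prod>i<Suc n. 1 + t ^ Suc i)"
    by (simp only: prod.lessThan_Suc mult_ac)
  then have "sgn_sum t x 0 S = (\<Prod>i<Suc n. 1 + t ^ Suc i)"
    using geometric_nonzero[OF assms(3), of "Suc n"] by (simp only: mult_cancel_left zero_less_Suc simp_thms)
  then show ?case using Suc.hyps(2) by simp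
qed

text \<open>Multiplication by a power of the product of the variables distributes over shuffle
  products (\<open>tau_shuffle\<close>); it shifts all levels at once.\<close>

definition tau :: "('i \<Rightarrow> complex) \<Rightarrow> nat \<Rightarrow> ('i set \<Rightarrow> complex) \<Rightarrow> 'i set \<Rightarrow> complex" where
  "tau x a f A = (\<Prod>i\<in>A. x i) ^ a * f A"

lemma tau_shuffle:
  assumes "finite S"
  shows "tau x a (shuffle t x f g) S = shuffle t x (tau x a f) (tau x a g) S"
  unfolding tau_def shuffle_def sum_distrib_left
proof (intro sum.cong refl)
  fix A assume "A \<in> Pow S"
  then have A: "finite A" "finite (S - A)" "A \<inter> (S - A) = {}" "A \<union> (S - A) = S" using assms finite_subset by auto
  have "(\<Prod>i\<in>S. x i) = (\<Prod>i\<in>A. x i) * (\<Prod>i\<in>S - A. x i)"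
    using prod.union_disjoint[OF A(1,2,3)] unfolding A(4) .
  then show "(\<Prod>i\<in>S. x i) ^ a * (f A * g (S - A) * cross t x A (S - A)) =
    (\<Prod>i\<in>A. x i) ^ a * f A * ((\<Prod>i\<in>S - A. x i) ^ a * g (S - A)) * cross t x A (S - A)"
    by (simp add: power_mult_distrib mult_ac)
qed

lemma tau_tau: "tau x a (tau x b f) = tau x (a + b) f"
  by (simp add: tau_def fun_eq_iff power_add)

lemma tau_cong: "f A = g A \<Longrightarrow> tau x a f A = tau x a g A"
  by (simp add: tau_def)

lemma tau_0 [simp]: "tau x 0 f = f"
  by (simp add: tau_def fun_eq_iff)

lemma shuffle_unit_left: "finite S \<Longrightarrow> shuffle t x (\<lambda>A. of_bool (card A = 0)) f S = f S"
proof -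
  assume fin: "finite S"
  have "shuffle t x (\<lambda>A. of_bool (card A = 0)) f S = (\<Sum>A\<in>{{}}. f (S - A))"
    unfolding shuffle_def by (rule sum.mono_neutral_cong_right) (use fin finite_subset[of _ S] in auto)
  then show ?thesis by simp
qed

primrec level_shuffle :: "complex \<Rightarrow> ('i \<Rightarrow> complex) \<Rightarrow> (nat \<Rightarrow> nat \<Rightarrow> complex) \<Rightarrow> nat \<Rightarrow> 'i set \<Rightarrow> complex" where
  "level_shuffle t x g 0 = (\<lambda>S. g 0 (card S))"
| "level_shuffle t x g (Suc a) = shuffle t x (tau x (Suc a) (\<lambda>A. g (Suc a) (card A))) (level_shuffle t x g a)"

lemma level_shuffle_Suc_Suc: "level_shuffle t x g (2 * j + 2) = shuffle t x (tau x (2 * j + 2) (\<lambda>A. g (2 * j + 2) (card A)))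
    (shuffle t x (tau x (2 * j + 1) (\<lambda>A. g (2 * j + 1) (card A))) (level_shuffle t x g (2 * j)))"
  by simp

lemma level_shuffle_cong: "(\<And>a m. a \<le> K \<Longrightarrow> g a m = g' a m) \<Longrightarrow> level_shuffle t x g K = level_shuffle t x g' K"
  by (induction K) simp_all

text \<open>The values of \<open>conv_odd\<close> and \<open>conv_even\<close>. For odd a the power
  t^(m / 2) is the share of a part a in t^(l/2), where l is the number of odd parts.\<close>

definition wt :: "complex \<Rightarrow> nat \<Rightarrow> nat \<Rightarrow> complex" where
  "wt t a m = (if odd a then (if even m then t ^ (m div 2) * qpoch t (t\<^sup>2) (m div 2) else 0)
               else qpoch t (t\<^sup>2) ((m + 1) div 2))"

text \<open>Write * for the shuffle product. Two applications of \<open>shuffle_lw_shift\<close>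
  give tau A = tau (e 1) * e s * Y and tau Y = tau (e (-s)) * B, where B = e (-t) * A. Together they
  give tau^2 B = tau^2 U' * tau O' * B, which absorbs an even and an odd level at once. With e 1 in
  place of U' the left side becomes tau^2 A.\<close>

lemma bounded_littlewood:
  assumes S0: "finite S0" "generic x S0" and t: "norm t < 1" and k: "k \<ge> 1"
  shows "level_shuffle t x (\<lambda>a m. if a = 0 \<or> a = 2 * k then 1 else wt t a m) (2 * k) S0 = sgn_sum t x (2 * k) S0"
proof -
  define s where "s = csqrt t"
  have s: "s\<^sup>2 = t" by (simp add: s_def)
  have fin: "finite S" and gen: "generic x S" if "S \<subseteq> S0" for S
    using that S0 finite_subset generic_subset by auto
  define y where "y = (\<lambda>i. 1 / x i)"
  have inj: "inj_on x S" and nz: "\<And>i. i \<in> S \<Longrightarrow> x i \<noteq> 0" if "S \<subseteq> S0" for S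
    using gen[OF that] by (auto simp: generic_def)
  have geny: "generic y S" if "S \<subseteq> S0" for S
  proof -
    have "1 / x i * (1 / x j) \<noteq> 1" if "i \<in> S0" "j \<in> S0" for i j
    proof
      assume "1 / x i * (1 / x j) = 1"
      then have "x i * x j = 1" by (simp add: divide_simps split: if_splits)
      then show False using S0(2) that by (auto simp: generic_def)
    qed
    then have "generic y S0" using S0(2) by (auto simp: generic_def y_def inj_on_def)
    then show ?thesis using generic_subset that by blast
  qed
  define P where "P = lw t x (chi 1 0 (- t))"
  define A where "A = lw t y (chi 1 0 (- t))"
  define Y where "Y = lw t y (chi (- s) (1 - t) s)"
  define e where "e c = (\<lambda>A :: 'a set. c ^ card A)" for c :: complex
  define e' where "e' c = (\<lambda>A :: 'a set. qexp t c (card A))" for c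
  define B where "B = shuffle t x (e (- t)) A"
  define U' where "U' = (\<lambda>A :: 'a set. wt t 2 (card A))"
  define O' where "O' = (\<lambda>A :: 'a set. wt t 1 (card A))"
  note sw = shuffle_cong[of _ _ _ _ _ t x]
  \<comment> \<open>The two numerators share the factor 1 + s z; the other factors, 1 - s z and z -
    s, are exchanged by z -> 1/z up to a power of z.\<close>
  have odd_theta_coeff: "chi 1 0 (- t) (1 / z) * chi 1 0 (- t) z = chi (- s) (1 - t) s (1 / z) * chi (- s) (1 - t) s z"
    if "z \<noteq> 0" for z
  proof -
    have "1 + 0 * (1 / z) + - t * (1 / z)\<^sup>2 = (z\<^sup>2 - t) / z\<^sup>2"
      "- s + (1 - t) * (1 / z) + s * (1 / z)\<^sup>2 = (- s * z\<^sup>2 + (1 - t) * z + s) / z\<^sup>2"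
      using that by (auto simp: field_simps power2_eq_square)
    moreover have "(z\<^sup>2 - t) * (1 + 0 * z + - t * z\<^sup>2) = (- s * z\<^sup>2 + (1 - t) * z + s) * (- s + (1 - t) * z + s * z\<^sup>2)"
      unfolding s[symmetric] by (simp add: algebra_simps power2_eq_square)
    moreover have "(p / w) / D * (q / E) = (p * q) / (w * D * E)" for p w D q E :: complex by simp
    ultimately show ?thesis unfolding chi_def by (simp only:)
  qed
  have mirror: "shuffle t y f g S = shuffle t x g f S" if "S \<subseteq> S0" for f g S
    unfolding y_def by (rule shuffle_inverse[OF fin[OF that] inj[OF that] nz[OF that]])
  have py: "(\<Prod>i\<in>S. x i) * (\<Prod>i\<in>S. y i) = 1" if "S \<subseteq> S0" for S
    unfolding prod.distrib[symmetric] y_def by (rule prod.neutral) (use nz[OF that] in auto)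
  have a: "tau x 1 (shuffle t x (e' (- 1)) A) S = shuffle t x (e s) Y S" if S: "S \<subseteq> S0" for S
  proof -
    have "shuffle t y (lw t y (chi 1 0 (- t))) (\<lambda>A. qexp t (- 1) (card A)) S =
      (\<Prod>i\<in>S. y i) * shuffle t y (lw t y (chi (- s) (1 - t) s)) (\<lambda>A. s ^ card A) S"
      by (rule shuffle_lw_shift[OF fin[OF S] geny[OF S]]) (use odd_theta_coeff in auto)
    then have "shuffle t x (e' (- 1)) A S = (\<Prod>i\<in>S. y i) * shuffle t x (e s) Y S"
      unfolding mirror[OF S] A_def Y_def e_def e'_def .
    then show ?thesis using py[OF S] by (simp add: tau_def mult.assoc[symmetric])
  qed
  have b: "tau x 1 (shuffle t x (e' s) Y) S = B S" if S: "S \<subseteq> S0" for S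
  proof -
    have "shuffle t y (lw t y (chi (- s) (1 - t) s)) (\<lambda>A. qexp t s (card A)) S =
      (\<Prod>i\<in>S. y i) * shuffle t y (lw t y (chi 1 0 (- t))) (\<lambda>A. (- t) ^ card A) S"
      by (rule shuffle_lw_shift[OF fin[OF S] geny[OF S]]) (use odd_theta_coeff in auto)
    then have "shuffle t x (e' s) Y S = (\<Prod>i\<in>S. y i) * B S"
      unfolding mirror[OF S] A_def B_def Y_def e_def e'_def .
    then show ?thesis using py[OF S] by (simp add: tau_def mult.assoc[symmetric])
  qed
  have conv: "shuffle t x (\<lambda>A. f (card A)) (\<lambda>A. g (card A)) S = conv t f g (card S)" if "S \<subseteq> S0" for f g S
    by (rule shuffle_const[OF fin[OF that] inj[OF that] nz[OF that]])
  have inv: "shuffle t x (e c) (shuffle t x (e' (- c)) f) S = f S" if S: "S \<subseteq> S0" for c f S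
  proof -
    have "shuffle t x (e c) (shuffle t x (e' (- c)) f) S = shuffle t x (shuffle t x (e c) (e' (- c))) f S"
      by (rule shuffle_assoc[OF fin[OF S], symmetric])
    also have "\<dots> = shuffle t x (\<lambda>A. of_bool (card A = 0)) f S"
      by (rule shuffle_cong) (use S conv[of _ "\<lambda>m. c ^ m" "qexp t (- c)"] in \<open>auto simp: e_def e'_def conv_qexp_inverse\<close>)
    finally show ?thesis using shuffle_unit_left[OF fin[OF S]] by simp
  qed
  \<comment> \<open>The factor \<open>e' (- 1)\<close> in \<open>a\<close> is cancelled by its
    shuffle inverse \<open>e 1\<close> on the left.\<close>
  have A1: "tau x 1 A S = shuffle t x (tau x 1 (e 1)) (shuffle t x (e s) Y) S" if S: "S \<subseteq> S0" for S
  proof -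
    have "tau x 1 A S = tau x 1 (shuffle t x (e 1) (shuffle t x (e' (- 1)) A)) S" using inv[OF S] by (simp add: tau_def)
    also have "\<dots> = shuffle t x (tau x 1 (e 1)) (tau x 1 (shuffle t x (e' (- 1)) A)) S" by (rule tau_shuffle[OF fin[OF S]])
    also have "\<dots> = shuffle t x (tau x 1 (e 1)) (shuffle t x (e s) Y) S" by (rule shuffle_cong) (use a S in auto)
    finally show ?thesis .
  qed
  have Y1: "tau x 1 Y S = shuffle t x (tau x 1 (e (- s))) B S" if S: "S \<subseteq> S0" for S
  proof -
    have "tau x 1 Y S = tau x 1 (shuffle t x (e (- s)) (shuffle t x (e' s) Y)) S" using inv[OF S, of "- s"] by (simp add: tau_def)
    also have "\<dots> = shuffle t x (tau x 1 (e (- s))) (tau x 1 (shuffle t x (e' s) Y)) S" by (rule tau_shuffle[OF fin[OF S]])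
    also have "\<dots> = shuffle t x (tau x 1 (e (- s))) B S" by (rule shuffle_cong) (use b S in auto)
    finally show ?thesis .
  qed
  have O: "shuffle t x (e s) (e (- s)) S = O' S" if S: "S \<subseteq> S0" for S
    using conv[OF S, of "\<lambda>m. s ^ m" "\<lambda>m. (- s) ^ m"] conv_odd[OF s, of "card S"] by (simp add: e_def O'_def wt_def)
  have U: "shuffle t x (e (- t)) (e 1) S = U' S" if S: "S \<subseteq> S0" for S
    using conv[OF S, of "\<lambda>m. (- t) ^ m" "\<lambda>m. 1 ^ m"] conv_even[of t "card S"] by (simp add: e_def U'_def wt_def)
  have A2: "tau x 2 A S = shuffle t x (tau x 2 (e 1)) (shuffle t x (tau x 1 O') B) S" if S: "S \<subseteq> S0" for S
  proof -
    have 1: "shuffle t x (tau x 1 (e s)) (tau x 1 Y) T = shuffle t x (tau x 1 O') B T" if T: "T \<subseteq> S0" for T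
    proof -
      have "shuffle t x (tau x 1 (e s)) (tau x 1 Y) T = shuffle t x (tau x 1 (e s)) (shuffle t x (tau x 1 (e (- s))) B) T"
        by (rule shuffle_cong) (use Y1 T in auto)
      also have "\<dots> = shuffle t x (shuffle t x (tau x 1 (e s)) (tau x 1 (e (- s)))) B T"
        by (rule shuffle_assoc[OF fin[OF T], symmetric])
      also have "\<dots> = shuffle t x (tau x 1 O') B T"
      proof (rule shuffle_cong)
        fix V assume "V \<subseteq> T"
        then have V: "V \<subseteq> S0" using T by auto
        show "shuffle t x (tau x 1 (e s)) (tau x 1 (e (- s))) V = tau x 1 O' V"
          unfolding tau_shuffle[OF fin[OF V], symmetric] using O[OF V] by (simp add: tau_def)
      qed simp
      finally show ?thesis .
    qed
    have "tau x 2 A S = tau x 1 (tau x 1 A) S" by (simp add: tau_tau numeral_2_eq_2)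
    also have "\<dots> = tau x 1 (shuffle t x (tau x 1 (e 1)) (shuffle t x (e s) Y)) S" using A1[OF S] by (simp add: tau_def)
    also have "\<dots> = shuffle t x (tau x 2 (e 1)) (tau x 1 (shuffle t x (e s) Y)) S"
      by (simp add: tau_shuffle[OF fin[OF S]] tau_tau numeral_2_eq_2)
    also have "\<dots> = shuffle t x (tau x 2 (e 1)) (shuffle t x (tau x 1 O') B) S"
    proof (rule shuffle_cong)
      fix V assume "V \<subseteq> S"
      then have V: "V \<subseteq> S0" using S by auto
      show "tau x 1 (shuffle t x (e s) Y) V = shuffle t x (tau x 1 O') B V"
        unfolding tau_shuffle[OF fin[OF V]] by (rule 1[OF V])
    qed simp
    finally show ?thesis .
  qed
  have B2: "tau x 2 B S = shuffle t x (tau x 2 U') (shuffle t x (tau x 1 O') B) S" if S: "S \<subseteq> S0" for S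
  proof -
    have "tau x 2 B S = shuffle t x (tau x 2 (e (- t))) (tau x 2 A) S" unfolding B_def by (rule tau_shuffle[OF fin[OF S]])
    also have "\<dots> = shuffle t x (tau x 2 (e (- t))) (shuffle t x (tau x 2 (e 1)) (shuffle t x (tau x 1 O') B)) S"
      by (rule shuffle_cong) (use A2 S in auto)
    also have "\<dots> = shuffle t x (shuffle t x (tau x 2 (e (- t))) (tau x 2 (e 1))) (shuffle t x (tau x 1 O') B) S"
      by (rule shuffle_assoc[OF fin[OF S], symmetric])
    also have "\<dots> = shuffle t x (tau x 2 U') (shuffle t x (tau x 1 O') B) S"
    proof (rule shuffle_cong)
      fix V assume "V \<subseteq> S"
      then have V: "V \<subseteq> S0" using S by auto
      show "shuffle t x (tau x 2 (e (- t))) (tau x 2 (e 1)) V = tau x 2 U' V"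
        unfolding tau_shuffle[OF fin[OF V], symmetric] using U[OF V] by (simp add: tau_def)
    qed simp
    finally show ?thesis .
  qed
  have AP: "shuffle t x A P S = (\<Prod>i<card S. 1 + t ^ Suc i)" if S: "S \<subseteq> S0" for S
    using shuffle_eq_sgn_sum[OF fin[OF S] gen[OF S], of t 0] sgn_sum_0[OF fin[OF S] gen[OF S] t]
    by (simp add: A_def P_def y_def)
  \<comment> \<open>The constant 1 is the weight of the padding zeros; writing it as the shuffle of
    \<open>B\<close> and \<open>P\<close> starts the induction for \<open>M\<close>.\<close>
  have BP: "shuffle t x B P S = 1" if S: "S \<subseteq> S0" for S
  proof -
    have "shuffle t x B P S = shuffle t x (e (- t)) (shuffle t x A P) S" unfolding B_def by (rule shuffle_assoc[OF fin[OF S]])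
    also have "\<dots> = shuffle t x (\<lambda>A. (- t) ^ card A) (\<lambda>A. \<Prod>i<card A. 1 + t ^ Suc i) S"
      by (rule shuffle_cong) (use AP S in \<open>auto simp: e_def\<close>)
    also have "\<dots> = 1" by (rule trans[OF conv[OF S, of "\<lambda>m. (- t) ^ m" "\<lambda>m. \<Prod>i<m. 1 + t ^ Suc i"] conv_power_prod])
    finally show ?thesis .
  qed
  define g where "g a m = (if a = 0 then 1 else wt t a m)" for a m
  have three: "shuffle t x (tau x j (shuffle t x F (shuffle t x G H))) P S = shuffle t x (tau x j F) (shuffle t x (tau x j G) (shuffle t x (tau x j H) P)) S"
    if S: "S \<subseteq> S0" for j F G H S
  proof -
    have "shuffle t x (tau x j (shuffle t x F (shuffle t x G H))) P S = shuffle t x (shuffle t x (tau x j F) (shuffle t x (tau x j G) (tau x j H))) P S"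
    proof (rule shuffle_cong)
      fix V assume "V \<subseteq> S"
      then have V: "V \<subseteq> S0" using S by auto
      show "tau x j (shuffle t x F (shuffle t x G H)) V = shuffle t x (tau x j F) (shuffle t x (tau x j G) (tau x j H)) V"
        unfolding tau_shuffle[OF fin[OF V]] by (rule shuffle_cong) (use V fin in \<open>auto simp: tau_shuffle\<close>)
    qed simp
    also have "\<dots> = shuffle t x (tau x j F) (shuffle t x (shuffle t x (tau x j G) (tau x j H)) P) S"
      by (rule shuffle_assoc[OF fin[OF S]])
    also have "\<dots> = shuffle t x (tau x j F) (shuffle t x (tau x j G) (shuffle t x (tau x j H) P)) S"
      by (rule shuffle_cong) (use S fin in \<open>auto intro!: shuffle_assoc\<close>)
    finally show ?thesis .
  qed
  have wt': "(\<lambda>A :: 'a set. wt t (2 * j + 1) (card A)) = O'" "(\<lambda>A :: 'a set. wt t (2 * j + 2) (card A)) = U'" for j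
    by (simp_all add: wt_def O'_def U'_def)
  have M: "level_shuffle t x g (2 * j) S = shuffle t x (tau x (2 * j) B) P S" if S: "S \<subseteq> S0" for j S
    using S
  proof (induction j arbitrary: S)
    case 0
    then show ?case using BP by (simp add: g_def)
  next
    case (Suc j)
    have "shuffle t x (tau x (2 * Suc j) B) P S = shuffle t x (tau x (2 * j) (shuffle t x (tau x 2 U') (shuffle t x (tau x 1 O') B))) P S"
    proof (rule shuffle_cong)
      fix V assume "V \<subseteq> S"
      then have 1: "tau x 2 B V = shuffle t x (tau x 2 U') (shuffle t x (tau x 1 O') B) V" using B2 Suc.prems by auto
      have 2: "tau x (2 * Suc j) B V = tau x (2 * j) (tau x 2 B) V" by (simp add: tau_tau)
      show "tau x (2 * Suc j) B V = tau x (2 * j) (shuffle t x (tau x 2 U') (shuffle t x (tau x 1 O') B)) V"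
        using 1 unfolding 2 by (rule tau_cong)
    qed simp
    also have "\<dots> = shuffle t x (tau x (2 * j + 2) U') (shuffle t x (tau x (2 * j + 1) O') (shuffle t x (tau x (2 * j) B) P)) S"
      unfolding three[OF Suc.prems] tau_tau ..
    also have "\<dots> = shuffle t x (tau x (2 * j + 2) U') (shuffle t x (tau x (2 * j + 1) O') (level_shuffle t x g (2 * j))) S"
      by (intro shuffle_cong refl) (use Suc in auto)
    also have "\<dots> = level_shuffle t x g (2 * Suc j) S"
    proof -
      have 1: "(\<lambda>A :: 'a set. g (2 * j + 2) (card A)) = U'" "(\<lambda>A :: 'a set. g (2 * j + 1) (card A)) = O'"
        unfolding wt'[of j, symmetric] by (simp_all add: g_def)
      have 2: "2 * Suc j = 2 * j + 2" by simp
      show ?thesis unfolding 2 level_shuffle_Suc_Suc 1 by (rule refl)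
    qed
    finally show ?case ..
  qed
  define h where "h = (\<lambda>a m. if a = 0 \<or> a = 2 * k then 1 else wt t a m)"
  \<comment> \<open>The part 2k has weight 1, so the top level is \<open>e 1\<close> instead of
    \<open>U'\<close>. This leaves \<open>A\<close> instead of \<open>B\<close>, and the shuffle of
    \<open>A\<close>, shifted, with \<open>P\<close> is the sum over signs.\<close>
  obtain j where j: "k = Suc j" using k by (cases k) auto
  have "sgn_sum t x (2 * k) S0 = shuffle t x (tau x (2 * k) A) P S0"
    using shuffle_eq_sgn_sum[OF S0, of t "2 * k"] by (simp add: A_def P_def y_def tau_def[abs_def])
  also have "\<dots> = shuffle t x (tau x (2 * j) (shuffle t x (tau x 2 (e 1)) (shuffle t x (tau x 1 O') B))) P S0"
  proof (rule shuffle_cong)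
    fix V assume "V \<subseteq> S0"
    then have 1: "tau x 2 A V = shuffle t x (tau x 2 (e 1)) (shuffle t x (tau x 1 O') B) V" using A2 by auto
    have 2: "tau x (2 * k) A V = tau x (2 * j) (tau x 2 A) V" by (simp add: tau_tau j)
    show "tau x (2 * k) A V = tau x (2 * j) (shuffle t x (tau x 2 (e 1)) (shuffle t x (tau x 1 O') B)) V"
      using 1 unfolding 2 by (rule tau_cong)
  qed simp
  also have "\<dots> = shuffle t x (tau x (2 * j + 2) (e 1)) (shuffle t x (tau x (2 * j + 1) O') (shuffle t x (tau x (2 * j) B) P)) S0"
    unfolding three[OF order_refl] tau_tau ..
  also have "\<dots> = shuffle t x (tau x (2 * j + 2) (e 1)) (shuffle t x (tau x (2 * j + 1) O') (level_shuffle t x g (2 * j))) S0"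
    by (intro shuffle_cong refl) (use M in auto)
  also have "level_shuffle t x g (2 * j) = level_shuffle t x h (2 * j)"
    by (rule level_shuffle_cong) (auto simp: g_def h_def j)
  also have "shuffle t x (tau x (2 * j + 2) (e 1)) (shuffle t x (tau x (2 * j + 1) O') (level_shuffle t x h (2 * j))) S0 = level_shuffle t x h (2 * k) S0"
  proof -
    have h1: "h (2 * j + 1) m = wt t (2 * j + 1) m" for m
    proof -
      have "2 * j + 1 \<noteq> 2 * k" by presburger
      then show ?thesis by (simp add: h_def)
    qed
    have 1: "(\<lambda>A :: 'a set. h (2 * j + 2) (card A)) = e 1" by (simp add: h_def e_def j)
    have 2: "(\<lambda>A :: 'a set. h (2 * j + 1) (card A)) = O'"
      unfolding wt'(1)[of j, symmetric] using h1 by simp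
    have 3: "2 * k = 2 * j + 2" by (simp add: j)
    show ?thesis unfolding 3 level_shuffle_Suc_Suc 1 2 by (rule refl)
  qed
  finally show ?thesis unfolding h_def ..
qed

section \<open>Determinants\<close>

definition detf :: "nat \<Rightarrow> (nat \<Rightarrow> nat \<Rightarrow> complex) \<Rightarrow> complex" where
  "detf k M = Determinant.det (Matrix.mat k k (\<lambda>(i, j). M i j))"

lemma detf_cong: "(\<And>i j. i < k \<Longrightarrow> j < k \<Longrightarrow> M i j = N i j) \<Longrightarrow> detf k M = detf k N"
  unfolding detf_def by (intro arg_cong[where f = Determinant.det] eq_matI) auto

lemma detf_leibniz: "detf k M = (\<Sum>p | p permutes {0..<k}. signof p * (\<Prod>i = 0..<k. M i (p i)))"
  unfolding detf_def
proof (subst Determinant.det_def', rule mat_carrier, intro sum.cong refl arg_cong2[where f = "(*)"] prod.cong refl)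
  fix p i assume "p \<in> {p. p permutes {0..<k}}" "i \<in> {0..<k}"
  then show "Matrix.mat k k (\<lambda>(i, j). M i j) $$ (i, p i) = M i (p i)"
    using permutes_in_image[of p "{0..<k}" i] by auto
qed

lemma detf_mult: "detf k (\<lambda>i j. \<Sum>l<k. L i l * M l j) = detf k L * detf k M"
proof -
  have "Matrix.mat k k (\<lambda>(i, j). \<Sum>l<k. L i l * M l j) =
      Matrix.mat k k (\<lambda>(i, j). L i j) * Matrix.mat k k (\<lambda>(i, j). M i j)"
    by (rule eq_matI) (auto simp: scalar_prod_def atLeast0LessThan)
  then show ?thesis unfolding detf_def by (simp add: Determinant.det_mult[of _ k])
qed

lemma detf_lower_triangular: "(\<And>i j. i < j \<Longrightarrow> j < k \<Longrightarrow> M i j = 0) \<Longrightarrow> detf k M = (\<Prod>i<k. M i i)"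
  unfolding detf_def
  by (subst Determinant.det_lower_triangular[where n = k])
     (auto simp: diag_mat_def interv_sum_list_conv_sum_set_nat prod.list_conv_set_nth atLeast0LessThan intro!: prod.cong)

lemma detf_upper_triangular: "(\<And>i j. j < i \<Longrightarrow> i < k \<Longrightarrow> M i j = 0) \<Longrightarrow> detf k M = (\<Prod>i<k. M i i)"
  unfolding detf_def
  by (subst Determinant.det_upper_triangular[where n = k])
     (auto simp: diag_mat_def prod.list_conv_set_nth atLeast0LessThan intro!: prod.cong)

lemma detf_sum_row0:
  assumes "k > 0"
  shows "detf k (\<lambda>i j. if i = 0 then \<Sum>s\<in>S. c s * v s j else M i j) = (\<Sum>s\<in>S. c s * detf k (\<lambda>i j. if i = 0 then v s j else M i j))"
proof -
  have split: "(\<Prod>i = 0..<k. f i) = f 0 * (\<Prod>i = 1..<k. f i)" for f :: "nat \<Rightarrow> complex"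
    using assms by (simp add: prod.atLeast_Suc_lessThan)
  have p: "(\<Prod>i = 1..<k. if i = 0 then a i else b i) = (\<Prod>i = 1..<k. b i)" for a b :: "nat \<Rightarrow> complex"
    by (intro prod.cong refl) auto
  have "detf k (\<lambda>i j. if i = 0 then \<Sum>s\<in>S. c s * v s j else M i j) =
     (\<Sum>p | p permutes {0..<k}. \<Sum>s\<in>S. c s * (signof p * (v s (p 0) * (\<Prod>i = 1..<k. M i (p i)))))"
    unfolding detf_leibniz split p by (simp add: sum_distrib_left sum_distrib_right mult_ac)
  also have "\<dots> = (\<Sum>s\<in>S. \<Sum>p | p permutes {0..<k}. c s * (signof p * (v s (p 0) * (\<Prod>i = 1..<k. M i (p i)))))"
    by (rule sum.swap)
  also have "\<dots> = (\<Sum>s\<in>S. c s * detf k (\<lambda>i j. if i = 0 then v s j else M i j))"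
    unfolding detf_leibniz split p by (simp add: sum_distrib_left)
  finally show ?thesis .
qed

lemma detf_last_row_to_front:
  assumes "k > 0"
  shows "detf k (\<lambda>i j. if i = 0 then M (k - 1) j else M (i - 1) j) = (- 1) ^ (k - 1) * detf k M"
proof -
  let ?A = "Matrix.mat k k (\<lambda>(i, j). M i j)"
  have c: "?A \<in> carrier_mat k k" by simp
  have "swap_row_to_front ?A (k - 1) = Matrix.mat k k (\<lambda>(i, j). if i = 0 then M (k - 1) j else M (i - 1) j)"
    by (subst swap_row_to_front_result[OF c]) (use assms in \<open>auto intro!: eq_matI\<close>)
  then show ?thesis using swap_row_to_front_det[OF c, of "k - 1"] assms by (simp add: detf_def)
qed

lemma detf_scale: "detf k (\<lambda>i j. r i * c j * M i j) = (\<Prod>i<k. r i) * (\<Prod>j<k. c j) * detf k M"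
  unfolding detf_leibniz sum_distrib_left
proof (intro sum.cong refl)
  fix p assume "p \<in> {p. p permutes {0..<k}}"
  then have p: "p permutes {0..<k}" by simp
  have "(\<Prod>i = 0..<k. c (p i)) = (\<Prod>j<k. c j)"
    using prod.permute[OF p, of c] by (simp add: o_def atLeast0LessThan)
  then show "signof p * (\<Prod>i = 0..<k. r i * c (p i) * M i (p i)) = (\<Prod>i<k. r i) * (\<Prod>j<k. c j) * (signof p * (\<Prod>i = 0..<k. M i (p i)))"
    by (simp add: prod.distrib atLeast0LessThan mult_ac)
qed

lemma tendsto_detf:
  assumes "\<And>i j. i < k \<Longrightarrow> j < k \<Longrightarrow> ((\<lambda>n. M n i j) \<longlongrightarrow> L i j) F"
  shows "((\<lambda>n. detf k (M n)) \<longlongrightarrow> detf k L) F"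
  unfolding detf_leibniz
proof (intro tendsto_sum tendsto_mult tendsto_const tendsto_prod)
  fix p i assume "p \<in> {p. p permutes {0..<k}}" "i \<in> {0..<k}"
  then show "((\<lambda>n. M n i (p i)) \<longlongrightarrow> L i (p i)) F"
    using permutes_in_image[of p "{0..<k}" i] by (intro assms) auto
qed

text \<open>The matrix whose row 0 is (c . u) v - (c . v) u is annihilated by the vector c. If c is
  nonzero its determinant vanishes, and linearity in row 0 gives the claim.\<close>

lemma detf_proportional:
  assumes "k > 0" and c: "\<And>i. 0 < i \<Longrightarrow> i < k \<Longrightarrow> (\<Sum>j<k. c j * M i j) = 0"
  shows "(\<Sum>j<k. c j * u j) * detf k (\<lambda>i j. if i = 0 then v j else M i j) =
         (\<Sum>j<k. c j * v j) * detf k (\<lambda>i j. if i = 0 then u j else M i j)"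
proof (cases "\<forall>j<k. c j = 0")
  case True
  then show ?thesis by simp
next
  case False
  define w where "w s = (if s then v else u)" for s
  define d where "d s = (if s then \<Sum>j<k. c j * u j else - (\<Sum>j<k. c j * v j))" for s
  let ?N = "\<lambda>i j. if i = 0 then \<Sum>s\<in>UNIV. d s * w s j else M i j"
  have "(\<Sum>j<k. c j * u j) * detf k (\<lambda>i j. if i = 0 then v j else M i j) -
         (\<Sum>j<k. c j * v j) * detf k (\<lambda>i j. if i = 0 then u j else M i j) = detf k ?N"
  proof -
    have "w True = v" "w False = u" by (simp_all add: w_def fun_eq_iff)
    then show ?thesis unfolding detf_sum_row0[OF assms(1)] by (simp add: UNIV_bool d_def cong: if_cong)
  qed
  also have "\<dots> = 0"
    unfolding detf_def
  proof (subst Determinant.det_0_iff_vec_prod_zero[of _ k], simp, intro exI conjI)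
    show "Matrix.vec k c \<in> carrier_vec k" by simp
    show "Matrix.vec k c \<noteq> 0\<^sub>v k" using False by (auto simp: vec_eq_iff)
    have 0: "(\<Sum>j<k. ?N 0 j * c j) = 0"
    proof -
      define a b where "a = (\<Sum>j<k. c j * u j)" and "b = (\<Sum>j<k. c j * v j)"
      have "(\<Sum>j<k. ?N 0 j * c j) = a * (\<Sum>j<k. c j * v j) - b * (\<Sum>j<k. c j * u j)"
        unfolding sum_distrib_left sum_subtractf[symmetric]
        by (intro sum.cong refl) (simp add: UNIV_bool d_def w_def a_def[symmetric] b_def[symmetric] algebra_simps)
      then have "(\<Sum>j<k. ?N 0 j * c j) = 0" by (simp add: a_def b_def)
      then show ?thesis by simp
    qed
    have "(\<Sum>j<k. ?N i j * c j) = 0" if "i < k" for i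
      using c[of i] that 0 by (cases "i = 0") (simp_all add: mult.commute)
    then show "Matrix.mat k k (\<lambda>(i, j). ?N i j) *\<^sub>v Matrix.vec k c = 0\<^sub>v k"
      by (intro eq_vecI) (auto simp: scalar_prod_def atLeast0LessThan)
  qed
  finally show ?thesis by simp
qed

section \<open>The determinant of a bounded Littlewood sum\<close>

text \<open>A kernel of Cauchy type in an auxiliary variable y. For n variables, y^(-n) times it is
  invariant under y -> 1/y.\<close>

definition ker :: "('i \<Rightarrow> complex) \<Rightarrow> 'i set \<Rightarrow> complex poly" where
  "ker x S = (\<Prod>l\<in>S. [:1, x l:] * [:x l, 1:])"

section \<open>Palindromic polynomials\<close>

lemma coeff_reflect:
  fixes p r :: "complex poly"
  assumes d: "degree p \<le> m" and F: "finite F" and eq: "\<And>y. y \<notin> F \<Longrightarrow> y \<noteq> 0 \<Longrightarrow> y ^ m * poly p (1 / y) = poly r y"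
    and i: "i \<le> m"
  shows "coeff r i = coeff p (m - i)"
proof -
  define q where "q = (\<Sum>i\<le>m. monom (coeff p i) (m - i))"
  have "poly q y = poly r y" if "y \<notin> insert 0 F" for y
  proof -
    have 1: "poly p (1 / y) = (\<Sum>i\<le>m. coeff p i * (1 / y) ^ i)"
      unfolding poly_altdef by (rule sum.mono_neutral_left) (use d in \<open>auto simp: coeff_eq_0\<close>)
    have "y ^ m * poly p (1 / y) = (\<Sum>i\<le>m. coeff p i * y ^ (m - i))"
      unfolding 1 sum_distrib_left
      by (intro sum.cong refl) (use that in \<open>simp add: power_diff field_simps\<close>)
    also have "\<dots> = poly q y" by (simp add: q_def poly_sum poly_monom)
    finally show ?thesis using eq[of y] that by simp
  qed
  then have sub: "- insert 0 F \<subseteq> {y. poly (q - r) y = 0}" by auto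
  have "infinite (- insert 0 F)" using F by (simp add: finite_compl infinite_UNIV_char_0)
  then have "q - r = 0" using poly_roots_finite[of "q - r"] finite_subset[OF sub] by blast
  then have "coeff r i = coeff q i" by simp
  also have "\<dots> = (\<Sum>l\<in>{..m}. if l = m - i then coeff p l else 0)"
    unfolding q_def coeff_sum by (intro sum.cong refl) (use i in \<open>auto simp: coeff_monom\<close>)
  also have "\<dots> = coeff p (m - i)" by simp
  finally show ?thesis .
qed

definition pal :: "nat \<Rightarrow> complex poly \<Rightarrow> bool" where
  "pal m p \<longleftrightarrow> degree p \<le> m \<and> (\<forall>y. y \<noteq> 0 \<longrightarrow> y ^ m * poly p (1 / y) = poly p y)"

lemma pal_coeff: "pal m p \<Longrightarrow> i \<le> m \<Longrightarrow> coeff p i = coeff p (m - i)"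
  using coeff_reflect[of p m "{}" p i] by (auto simp: pal_def)

text \<open>A finite exceptional set is allowed because for a quotient of polynomials the functional
  equation is obtained only away from the zeros of the divisor.\<close>

lemma palI:
  assumes d: "degree p \<le> m" and F: "finite F" and eq: "\<And>y. y \<notin> F \<Longrightarrow> y \<noteq> 0 \<Longrightarrow> y ^ m * poly p (1 / y) = poly p y"
  shows "pal m p"
proof -
  have c: "coeff p i = coeff p (m - i)" if "i \<le> m" for i using coeff_reflect[OF d F eq that] by simp
  have alt: "poly p y = (\<Sum>i\<le>m. coeff p i * y ^ i)" for y
    unfolding poly_altdef by (rule sum.mono_neutral_left) (use d in \<open>auto simp: coeff_eq_0\<close>)
  have "y ^ m * poly p (1 / y) = poly p y" if "y \<noteq> 0" for y
  proof -
    have "y ^ m * poly p (1 / y) = (\<Sum>i\<le>m. coeff p (m - i) * y ^ (m - i))"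
      unfolding alt sum_distrib_left using that
      by (intro sum.cong refl) (auto simp: power_diff field_simps c[symmetric])
    also have "\<dots> = poly p y" unfolding alt atMost_atLeast0
      by (subst sum.atLeastAtMost_rev[of "\<lambda>i. coeff p i * y ^ i"]) simp
    finally show ?thesis .
  qed
  then show ?thesis using d by (simp add: pal_def)
qed

lemma pal_diff: "pal m p \<Longrightarrow> pal m q \<Longrightarrow> pal m (p - q)"
  by (auto simp: pal_def right_diff_distrib intro: degree_diff_le)

lemma pal_smult: "pal m p \<Longrightarrow> pal m (Polynomial.smult c p)"
  by (auto simp: pal_def mult.left_commute order_trans[OF degree_smult_le])

lemma pal_power: "pal (2 * d) ([:1, 0, 1:] ^ d)"
proof -
  have "degree ([:1, 0, 1 :: complex:] ^ d) = 2 * d" by (simp add: degree_power_eq mult.commute)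
  moreover have "y ^ (2 * d) * (1 + 1 / y * (1 / y)) ^ d = (1 + y * y) ^ d" if "y \<noteq> 0" for y :: complex
  proof -
    have "y ^ 2 * (1 + 1 / y * (1 / y)) = 1 + y * y" using that by (simp add: field_simps power2_eq_square)
    then show ?thesis by (simp only: power_mult power_mult_distrib[symmetric])
  qed
  ultimately show ?thesis by (auto simp: pal_def)
qed

text \<open>A palindromic polynomial of degree 2d is y^d times a polynomial in y + 1/y. Identifying
  the top coefficient with p(0) later decides whether the last basis element occurs, and with which
  coefficient.\<close>

lemma pal_expand:
  assumes "pal (2 * d) p"
  shows "\<exists>r. p = (\<Sum>b\<le>d. Polynomial.smult (r b) ([:1, 0, 1:] ^ b * monom 1 (d - b))) \<and> r d = coeff p 0"
  using assms
proof (induction d arbitrary: p)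
  case 0
  then have "p = [:coeff p 0:]" by (simp add: pal_def degree_eq_zeroE)
     (metis degree_eq_zeroE le_zero_eq coeff_pCons_0 pal_def "0" mult_0_right)
  then show ?case by (intro exI[of _ "\<lambda>_. coeff p 0"]) (simp add: monom_0)
next
  case (Suc d)
  define c where "c = coeff p 0"
  define q where "q = p - Polynomial.smult c ([:1, 0, 1:] ^ Suc d)"
  have q: "pal (2 * Suc d) q" unfolding q_def by (intro pal_diff pal_smult pal_power Suc.prems)
  have q0: "coeff q 0 = 0" by (simp add: q_def c_def coeff_0_power del: power_Suc)
  then have top: "coeff q (2 * Suc d) = 0" using pal_coeff[OF q, of 0] by simp
  obtain q' where q': "q = pCons 0 q'" using q0 by (metis coeff_pCons_0 pCons_cases)
  have "degree q' \<le> 2 * d"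
  proof (rule degree_le, intro allI impI)
    fix i assume i: "2 * d < i"
    have "coeff q (Suc i) = 0"
    proof (cases "i = Suc (2 * d)")
      case True
      then show ?thesis using top by simp
    next
      case False
      then show ?thesis using i q by (intro coeff_eq_0) (auto simp: pal_def)
    qed
    then show "coeff q' i = 0" by (simp add: q')
  qed
  moreover have "y ^ (2 * d) * poly q' (1 / y) = poly q' y" if "y \<noteq> 0" for y
  proof -
    have "y ^ (2 * Suc d) * poly q (1 / y) = poly q y" using q that by (simp add: pal_def)
    then show ?thesis using that by (simp add: q')
  qed
  ultimately have "pal (2 * d) q'" by (simp add: pal_def)
  then obtain r where r: "q' = (\<Sum>b\<le>d. Polynomial.smult (r b) ([:1, 0, 1:] ^ b * monom 1 (d - b)))"
    using Suc.IH by blast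
  define r' where "r' b = (if b = Suc d then c else r b)" for b
  have X: "q = monom 1 1 * q'" by (simp add: q' monom_altdef)
  have "q = (\<Sum>b\<le>d. Polynomial.smult (r b) ([:1, 0, 1:] ^ b * monom 1 (Suc d - b)))"
    unfolding X r sum_distrib_left
  proof (intro sum.cong refl)
    fix b assume "b \<in> {..d}"
    then have "monom 1 (Suc d - b) = monom (1 :: complex) 1 * monom 1 (d - b)" by (simp add: mult_monom Suc_diff_le)
    then show "monom 1 1 * Polynomial.smult (r b) ([:1, 0, 1:] ^ b * monom 1 (d - b)) = Polynomial.smult (r b) ([:1, 0, 1:] ^ b * monom 1 (Suc d - b))"
      by (simp add: mult_ac)
  qed
  also have "\<dots> = (\<Sum>b\<le>d. Polynomial.smult (r' b) ([:1, 0, 1:] ^ b * monom 1 (Suc d - b)))"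
    by (intro sum.cong refl) (simp add: r'_def)
  finally have "p = (\<Sum>b\<le>Suc d. Polynomial.smult (r' b) ([:1, 0, 1:] ^ b * monom 1 (Suc d - b)))"
    by (simp add: q_def r'_def monom_0 algebra_simps del: power_Suc)
  then show ?case by (intro exI[of _ r']) (simp add: r'_def c_def)
qed

lemma prod_roots_dvd:
  fixes p :: "complex poly"
  assumes "finite A" "\<And>a. a \<in> A \<Longrightarrow> poly p a = 0"
  shows "(\<Prod>a\<in>A. [:- a, 1:]) dvd p"
  using assms
proof (induction A rule: finite_induct)
  case (insert a A)
  then obtain q where q: "p = (\<Prod>a\<in>A. [:- a, 1:]) * q" by (auto elim: dvdE)
  have "poly (\<Prod>a\<in>A. [:- a, 1:]) a \<noteq> 0" using insert.hyps by (auto simp: poly_prod)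
  then have "poly q a = 0" using insert.prems[of a] by (simp add: q)
  then obtain u where u: "q = [:- a, 1:] * u" unfolding poly_eq_0_iff_dvd by (elim dvdE)
  show ?case unfolding q u prod.insert[OF insert.hyps] by (rule dvdI[of _ _ u]) (simp only: mult_ac)
qed simp

lemma ker_insert: "finite S \<Longrightarrow> a \<notin> S \<Longrightarrow> ker x (insert a S) = [:1, x a:] * [:x a, 1:] * ker x S"
  by (simp add: ker_def)

lemma poly_ker: "poly (ker x S) y = (\<Prod>l\<in>S. (1 + x l * y) * (x l + y))"
  by (simp add: ker_def poly_prod algebra_simps)

lemma degree_prod_le:
  fixes f :: "'a \<Rightarrow> complex poly"
  shows "(\<And>l. l \<in> S \<Longrightarrow> degree (f l) \<le> c) \<Longrightarrow> degree (\<Prod>l\<in>S. f l) \<le> c * card S"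
proof (induction S rule: infinite_finite_induct)
  case (insert a S)
  have "degree (f a * prod f S) \<le> c + c * card S"
    using insert by (intro order_trans[OF degree_mult_le] add_mono) auto
  then show ?case using insert by simp
qed auto

lemma degree_quad_le: "degree ([:a, b:] * [:c, d :: complex:]) \<le> 2"
  by (rule order_trans[OF degree_mult_le]) (auto intro: order_trans[OF add_mono[OF degree_pCons_le degree_pCons_le]])

lemma degree_ker_le: "degree (ker x S) \<le> 2 * card S"
  unfolding ker_def by (rule degree_prod_le) (rule degree_quad_le)

lemma pal_ker: "pal (2 * card S) (ker x S)"
proof (cases "finite S")
  case True
  have "y ^ (2 * card S) * (\<Prod>l\<in>S. (1 + x l * (1 / y)) * (x l + 1 / y)) = (\<Prod>l\<in>S. (1 + x l * y) * (x l + y))"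
    if "y \<noteq> 0" for y
  proof -
    have "y ^ (2 * card S) = (\<Prod>l\<in>S. y\<^sup>2)" by (simp add: power_mult)
    then show ?thesis unfolding prod.distrib[symmetric]
      by (simp only: prod.distrib[symmetric]) (intro prod.cong refl, use that in \<open>simp add: field_simps power2_eq_square\<close>)
  qed
  then show ?thesis by (simp add: pal_def degree_ker_le poly_ker)
qed (simp add: ker_def pal_def)

text \<open>This is \<open>ker\<close> at t y. Its counterpart \<open>ker_dn\<close> is t^(2n) times
  \<open>ker\<close> at y / t, cleared of denominators so that it makes sense at t = 0.\<close>

definition ker_up :: "complex \<Rightarrow> ('i \<Rightarrow> complex) \<Rightarrow> 'i set \<Rightarrow> complex poly" where
  "ker_up t x S = (\<Prod>l\<in>S. [:1, t * x l:] * [:x l, t:])"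

definition ker_dn :: "complex \<Rightarrow> ('i \<Rightarrow> complex) \<Rightarrow> 'i set \<Rightarrow> complex poly" where
  "ker_dn t x S = (\<Prod>l\<in>S. [:t, x l:] * [:t * x l, 1:])"

lemma poly_ker_up: "poly (ker_up t x S) y = (\<Prod>l\<in>S. (1 + t * x l * y) * (x l + t * y))"
  by (simp add: ker_up_def poly_prod algebra_simps)

lemma poly_ker_dn: "poly (ker_dn t x S) y = (\<Prod>l\<in>S. (t + x l * y) * (t * x l + y))"
  by (simp add: ker_dn_def poly_prod algebra_simps)

lemma degree_ker_up_le: "degree (ker_up t x S) \<le> 2 * card S"
  unfolding ker_up_def by (rule degree_prod_le) (rule degree_quad_le)

lemma degree_ker_dn_le: "degree (ker_dn t x S) \<le> 2 * card S"
  unfolding ker_dn_def by (rule degree_prod_le) (rule degree_quad_le)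

lemma reflect_ker_up:
  assumes "finite S" "y \<noteq> 0"
  shows "y ^ (2 * card S) * poly (ker_up t x S) (1 / y) = poly (ker_dn t x S) y"
    "y ^ (2 * card S) * poly (ker_dn t x S) (1 / y) = poly (ker_up t x S) y"
proof -
  have *: "y ^ (2 * card S) = (\<Prod>l\<in>S. y\<^sup>2)" by (simp add: power_mult)
  show "y ^ (2 * card S) * poly (ker_up t x S) (1 / y) = poly (ker_dn t x S) y"
    unfolding * poly_ker_up poly_ker_dn prod.distrib[symmetric]
    by (intro prod.cong refl) (use assms in \<open>simp add: field_simps power2_eq_square\<close>)
  show "y ^ (2 * card S) * poly (ker_dn t x S) (1 / y) = poly (ker_up t x S) y"
    unfolding * poly_ker_up poly_ker_dn prod.distrib[symmetric]
    by (intro prod.cong refl) (use assms in \<open>simp add: field_simps power2_eq_square\<close>)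
qed

lemma coeff_ker_up: "coeff (ker_up t x S) i = t ^ i * coeff (ker x S) i"
proof -
  have "pcompose (ker x S) [:0, t:] = ker_up t x S"
    unfolding ker_def ker_up_def pcompose_prod
    by (intro prod.cong refl) (simp add: pcompose_mult pcompose_pCons algebra_simps)
  moreover have "coeff (pcompose p [:0, t:]) i = t ^ i * coeff p i" for p
  proof (induction p arbitrary: i)
    case (pCons a p)
    show ?case by (cases i) (simp_all add: pcompose_pCons pCons coeff_pCons)
  qed simp
  ultimately show ?thesis by metis
qed

lemma coeff_ker_dn:
  assumes "finite S" "i \<le> 2 * card S"
  shows "coeff (ker_dn t x S) i = t ^ (2 * card S - i) * coeff (ker x S) i"
proof -
  have "coeff (ker_dn t x S) i = coeff (ker_up t x S) (2 * card S - i)"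
    by (rule coeff_reflect[OF degree_ker_up_le, of "{}"]) (use assms reflect_ker_up in auto)
  then show ?thesis using pal_coeff[OF pal_ker assms(2), of x] by (simp add: coeff_ker_up)
qed

text \<open>With \<open>e = j + 2km\<close> this is \<open>(- 1)\<^sup>m p\<^sup>k\<^sup>m\<^sup>m\<^sup>+\<^sup>j\<^sup>m\<close> (for \<open>p = t\<close>), the coefficients of a
  theta function of degree \<open>2k\<close>.\<close>

definition odd_theta_coeff :: "nat \<Rightarrow> complex \<Rightarrow> nat \<Rightarrow> int \<Rightarrow> complex" where
  "odd_theta_coeff k t j e = (if 2 * int k dvd e - int j then
     let m = (e - int j) div (2 * int k) in (if even m then 1 else - 1) * t ^ nat (m * (int k * m + int j)) else 0)"

lemma odd_theta_coeff_at: "k \<ge> 1 \<Longrightarrow> odd_theta_coeff k t j (int j + 2 * int k * m) = (if even m then 1 else - 1) * t ^ nat (m * (int k * m + int j))"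
  by (simp add: odd_theta_coeff_def Let_def)

lemma odd_theta_coeff_exponent_nonneg:
  assumes "1 \<le> j" "j \<le> k"
  shows "0 \<le> m * (int k * m + int j)"
proof (cases "m \<ge> 0")
  case False
  then have "int k * m \<le> int k * (- 1)" by (intro mult_left_mono) auto
  then show ?thesis using assms False by (intro mult_nonpos_nonpos) auto
qed auto

text \<open>Passing from m to m + 1 changes the sign and raises m (k m + j) by exactly e, the
  midpoint of the exponents e - k and e + k. The bounds on e keep both powers of t natural.\<close>

lemma odd_theta_coeff_shift:
  assumes "1 \<le> j" "j \<le> k" and e: "- int n \<le> e" "e \<le> int n"
  shows "t ^ nat (int n - e) * odd_theta_coeff k t j (e + int k) = - (t ^ n * odd_theta_coeff k t j (e - int k))"
    "t ^ nat (int n + e) * odd_theta_coeff k t j (e - int k) = - (t ^ n * odd_theta_coeff k t j (e + int k))"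
proof -
  have k: "k \<ge> 1" using assms by simp
  have iff: "2 * int k dvd e + int k - int j \<longleftrightarrow> 2 * int k dvd e - int k - int j"
  proof -
    have "e + int k - int j = (e - int k - int j) + 2 * int k" by simp
    then show ?thesis by (simp only: dvd_add_triv_right_iff)
  qed
  have "t ^ nat (int n - e) * odd_theta_coeff k t j (e + int k) = - (t ^ n * odd_theta_coeff k t j (e - int k)) \<and>
    t ^ nat (int n + e) * odd_theta_coeff k t j (e - int k) = - (t ^ n * odd_theta_coeff k t j (e + int k))"
  proof (cases "2 * int k dvd e - int k - int j")
    case False
    then show ?thesis using iff by (simp add: odd_theta_coeff_def)
  next
    case True
    then obtain m where m: "e - int k - int j = 2 * int k * m" by (elim dvdE)
    define E1 where "E1 = nat (m * (int k * m + int j))"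
    define E2 where "E2 = nat ((m + 1) * (int k * (m + 1) + int j))"
    have E: "int E1 = m * (int k * m + int j)" "int E2 = (m + 1) * (int k * (m + 1) + int j)"
      using odd_theta_coeff_exponent_nonneg[OF assms(1,2)] by (simp_all add: E1_def E2_def)
    then have d: "int E2 = int E1 + e" using m by (simp add: algebra_simps)
    have "e - int k = int j + 2 * int k * m" "e + int k = int j + 2 * int k * (m + 1)" using m by (simp_all add: algebra_simps)
    then have c: "odd_theta_coeff k t j (e - int k) = (if even m then 1 else - 1) * t ^ E1" "odd_theta_coeff k t j (e + int k) = - (if even m then 1 else - 1) * t ^ E2"
      using odd_theta_coeff_at[OF k] by (simp_all add: E1_def E2_def del: mult_minus1)
    have "nat (int n - e) + E2 = n + E1" "nat (int n + e) + E1 = n + E2" using d e by linarith+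
    then have "t ^ nat (int n - e) * t ^ E2 = t ^ n * t ^ E1" "t ^ nat (int n + e) * t ^ E1 = t ^ n * t ^ E2"
      by (simp_all only: power_add[symmetric])
    then show ?thesis unfolding c by (auto simp: mult.left_commute)
  qed
  then show "t ^ nat (int n - e) * odd_theta_coeff k t j (e + int k) = - (t ^ n * odd_theta_coeff k t j (e - int k))"
    "t ^ nat (int n + e) * odd_theta_coeff k t j (e - int k) = - (t ^ n * odd_theta_coeff k t j (e + int k))" by auto
qed

text \<open>\<open>lam k t j N p\<close> is the value on the Laurent polynomial \<open>y\<^sup>-\<^sup>N p(y)\<close> of the linear functional
  sending \<open>y\<^sup>e\<close> to \<open>odd_theta_coeff k t j e\<close>.\<close>

definition lam :: "nat \<Rightarrow> complex \<Rightarrow> nat \<Rightarrow> nat \<Rightarrow> complex poly \<Rightarrow> complex" where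
  "lam k t j N p = (\<Sum>i\<le>degree p. coeff p i * odd_theta_coeff k t j (int i - int N))"

lemma lam_alt: "degree p \<le> d \<Longrightarrow> lam k t j N p = (\<Sum>i\<le>d. coeff p i * odd_theta_coeff k t j (int i - int N))"
  unfolding lam_def by (rule sum.mono_neutral_left) (auto simp: coeff_eq_0)

lemma lam_add: "lam k t j N (p + q) = lam k t j N p + lam k t j N q"
proof -
  define d where "d = max (degree p) (degree q)"
  have "degree (p + q) \<le> d" "degree p \<le> d" "degree q \<le> d" by (auto simp: d_def degree_add_le_max)
  then show ?thesis using lam_alt[of _ d k t j N] by (simp add: distrib_right sum.distrib)
qed

lemma lam_smult: "lam k t j N (Polynomial.smult c p) = c * lam k t j N p"
  using lam_alt[OF degree_smult_le[of c p], of k t j N] by (simp add: lam_def sum_distrib_left mult.assoc)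

lemma lam_0 [simp]: "lam k t j N 0 = 0"
  by (simp add: lam_def)

lemma lam_diff: "lam k t j N (p - q) = lam k t j N p - lam k t j N q"
  using lam_add[of k t j N "p - q" q] by simp

lemma lam_sum: "lam k t j N (\<Sum>b\<in>B. f b) = (\<Sum>b\<in>B. lam k t j N (f b))"
  by (induction B rule: infinite_finite_induct) (simp_all add: lam_add)

lemma lam_pCons_0: "lam k t j (Suc N) (pCons 0 p) = lam k t j N p"
proof -
  have "degree (pCons 0 p) \<le> Suc (degree p)" by (rule degree_pCons_le)
  then show ?thesis
    unfolding lam_alt[OF \<open>degree (pCons 0 p) \<le> Suc (degree p)\<close>] sum.atMost_Suc_shift by (simp add: lam_def)
qed

lemma coeff_monom_mult': "coeff (monom 1 d * (p :: complex poly)) i = (if d \<le> i then coeff p (i - d) else 0)"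
  by (simp add: coeff_monom_mult)

lemma lam_monom_mult:
  assumes "degree p \<le> d"
  shows "lam k t j N (monom 1 c * p) = (\<Sum>i\<le>d. coeff p i * odd_theta_coeff k t j (int i + int c - int N))"
proof -
  have "degree (monom 1 c * p) \<le> c + d"
    using assms by (intro order_trans[OF degree_mult_le]) (simp add: degree_monom_eq)
  then have "lam k t j N (monom 1 c * p) = (\<Sum>i\<le>c + d. coeff (monom 1 c * p) i * odd_theta_coeff k t j (int i - int N))"
    by (rule lam_alt)
  also have "\<dots> = (\<Sum>i\<in>{c..c + d}. coeff p (i - c) * odd_theta_coeff k t j (int i - int N))"
    by (rule sum.mono_neutral_cong_right) (auto simp: coeff_monom_mult')
  also have "\<dots> = (\<Sum>i\<le>d. coeff p i * odd_theta_coeff k t j (int i + int c - int N))"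
    by (rule sum.reindex_bij_witness[where i = "\<lambda>i. i + c" and j = "\<lambda>i. i - c"]) auto
  finally show ?thesis .
qed

text \<open>This property dictates the functional: it turns the two dilated kernels, which arise as
  residues, into the undilated kernel with a factor t^n.\<close>

lemma lam_ker_shift:
  assumes "1 \<le> j" "j \<le> k" "finite S"
  shows "lam k t j (card S + k) (monom 1 (2 * k) * ker_dn t x S - ker_up t x S) =
    t ^ card S * lam k t j (card S + k) ((monom 1 (2 * k) - 1) * ker x S)"
proof -
  define n where "n = card S"
  have up: "lam k t j (n + k) (ker_up t x S) = - (t ^ n * lam k t j (n + k) (monom 1 (2 * k) * ker x S))"
  proof -
    have "lam k t j (n + k) (ker_up t x S) = (\<Sum>i\<le>2 * n. coeff (ker_up t x S) i * odd_theta_coeff k t j (int i - int (n + k)))"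
      by (rule lam_alt) (simp add: n_def degree_ker_up_le)
    also have "\<dots> = (\<Sum>i\<le>2 * n. - (t ^ n * (coeff (ker x S) i * odd_theta_coeff k t j (int i + int (2 * k) - int (n + k)))))"
    proof (intro sum.cong refl)
      fix i assume "i \<in> {..2 * n}"
      then have "t ^ nat (int n + (int i - int n)) * odd_theta_coeff k t j (int i - int n - int k) = - (t ^ n * odd_theta_coeff k t j (int i - int n + int k))"
        by (intro odd_theta_coeff_shift assms) auto
      moreover have "int i - int (n + k) = int i - int n - int k" "int i + int (2 * k) - int (n + k) = int i - int n + int k" by simp_all
      moreover have "nat (int n + (int i - int n)) = i" by simp
      ultimately have "t ^ i * odd_theta_coeff k t j (int i - int (n + k)) = - (t ^ n * odd_theta_coeff k t j (int i + int (2 * k) - int (n + k)))" by metis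
      then have "coeff (ker x S) i * (t ^ i * odd_theta_coeff k t j (int i - int (n + k))) =
        coeff (ker x S) i * - (t ^ n * odd_theta_coeff k t j (int i + int (2 * k) - int (n + k)))" by (rule arg_cong)
      then show "coeff (ker_up t x S) i * odd_theta_coeff k t j (int i - int (n + k)) =
        - (t ^ n * (coeff (ker x S) i * odd_theta_coeff k t j (int i + int (2 * k) - int (n + k))))"
        unfolding coeff_ker_up by (simp only: mult_ac mult_minus_right)
    qed
    also have "\<dots> = - (t ^ n * lam k t j (n + k) (monom 1 (2 * k) * ker x S))"
      by (subst lam_monom_mult[of _ "2 * n"]) (simp_all add: n_def degree_ker_le sum_negf sum_distrib_left)
    finally show ?thesis .
  qed
  have dn: "lam k t j (n + k) (monom 1 (2 * k) * ker_dn t x S) = - (t ^ n * lam k t j (n + k) (ker x S))"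
  proof -
    have "lam k t j (n + k) (monom 1 (2 * k) * ker_dn t x S) =
       (\<Sum>i\<le>2 * n. coeff (ker_dn t x S) i * odd_theta_coeff k t j (int i + int (2 * k) - int (n + k)))"
      by (rule lam_monom_mult) (simp add: n_def degree_ker_dn_le)
    also have "\<dots> = (\<Sum>i\<le>2 * n. - (t ^ n * (coeff (ker x S) i * odd_theta_coeff k t j (int i - int (n + k)))))"
    proof (intro sum.cong refl)
      fix i assume i: "i \<in> {..2 * n}"
      then have "t ^ nat (int n - (int i - int n)) * odd_theta_coeff k t j (int i - int n + int k) = - (t ^ n * odd_theta_coeff k t j (int i - int n - int k))"
        by (intro odd_theta_coeff_shift assms) auto
      moreover have "int i - int (n + k) = int i - int n - int k" "int i + int (2 * k) - int (n + k) = int i - int n + int k"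
        "nat (int n - (int i - int n)) = 2 * n - i" by auto
      ultimately have "t ^ (2 * n - i) * odd_theta_coeff k t j (int i + int (2 * k) - int (n + k)) = - (t ^ n * odd_theta_coeff k t j (int i - int (n + k)))" by metis
      then have "coeff (ker x S) i * (t ^ (2 * n - i) * odd_theta_coeff k t j (int i + int (2 * k) - int (n + k))) =
        coeff (ker x S) i * - (t ^ n * odd_theta_coeff k t j (int i - int (n + k)))" by (rule arg_cong)
      moreover have "coeff (ker_dn t x S) i = t ^ (2 * n - i) * coeff (ker x S) i"
        unfolding n_def by (rule coeff_ker_dn) (use i assms in \<open>auto simp: n_def\<close>)
      ultimately show "coeff (ker_dn t x S) i * odd_theta_coeff k t j (int i + int (2 * k) - int (n + k)) =
        - (t ^ n * (coeff (ker x S) i * odd_theta_coeff k t j (int i - int (n + k))))"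
        by (simp only: mult_ac mult_minus_right)
    qed
    also have "\<dots> = - (t ^ n * lam k t j (n + k) (ker x S))"
      by (subst lam_alt[of _ "2 * n"]) (simp_all add: n_def degree_ker_le sum_negf sum_distrib_left)
    finally show ?thesis .
  qed
  show ?thesis unfolding n_def[symmetric] lam_diff up dn left_diff_distrib by (simp add: algebra_simps)
qed

text \<open>This is y^k (y - 1/y) (y + 1/y)^a. For a < k these are y^k times a basis of the Laurent
  polynomials of degree at most k that are odd under y -> 1/y.\<close>

definition bas :: "nat \<Rightarrow> nat \<Rightarrow> complex poly" where
  "bas k a = [:- 1, 0, 1:] * ([:1, 0, 1:] ^ a * monom 1 (k - 1 - a))"

definition lam_det :: "nat \<Rightarrow> complex \<Rightarrow> ('i \<Rightarrow> complex) \<Rightarrow> 'i set \<Rightarrow> complex" where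
  "lam_det k t x S = detf k (\<lambda>a j. lam k t (Suc j) (card S + k) (bas k a * ker x S))"

section \<open>Partial fractions and the recursion of the determinant\<close>

lemma ker_up_residue:
  assumes "finite T" "i \<notin> T" "generic x (insert i T)"
  shows "(1 - t) * x i * (gam t x T (x i) * ((x i)\<^sup>2 - 1) * poly (ker x T) (- x i)) = - poly (ker_up t x (insert i T)) (- x i)"
proof -
  define u where "u = x i"
  have u: "u\<^sup>2 \<noteq> 1" using assms by (auto simp: generic_def u_def power2_eq_square)
  have "(\<Prod>l\<in>T. psi t u (x l) * rho t (x l) u) * poly (ker x T) (- u) = poly (ker_up t x T) (- u)"
    unfolding poly_ker poly_ker_up prod.distrib[symmetric]
  proof (intro prod.cong refl)
    fix l assume l: "l \<in> T"
    then have "1 - u * x l \<noteq> 0" "x l - u \<noteq> 0"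
      using assms by (auto simp: u_def generic_def inj_on_def)
    then show "psi t u (x l) * rho t (x l) u * ((1 + x l * - u) * (x l + - u)) = (1 + t * x l * - u) * (x l + t * - u)"
      by (simp add: psi_def rho_def mult_ac)
  qed
  then have g: "gam t x T u * poly (ker x T) (- u) = chi 1 0 (- t) u * poly (ker_up t x T) (- u)"
    by (simp add: gam_def mult.assoc)
  have c: "chi 1 0 (- t) u * (u\<^sup>2 - 1) = - (1 - t * u\<^sup>2)"
  proof -
    define w where "w = 1 - u\<^sup>2"
    have w: "u\<^sup>2 - 1 = - w" "w \<noteq> 0" using u by (auto simp: w_def)
    have "chi 1 0 (- t) u = (1 - t * u\<^sup>2) / w" by (simp add: chi_def w_def)
    then show ?thesis unfolding w(1) using w(2) by simp
  qed
  have "poly (ker_up t x (insert i T)) (- u) = (1 + t * u * - u) * (u + t * - u) * poly (ker_up t x T) (- u)"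
    using assms by (simp add: poly_ker_up u_def)
  then have e1: "poly (ker_up t x (insert i T)) (- u) = \<dots>" .
  have "(1 - t) * u * (gam t x T u * (u\<^sup>2 - 1) * poly (ker x T) (- u)) =
      (1 - t) * u * (u\<^sup>2 - 1) * (gam t x T u * poly (ker x T) (- u))"
    by (simp only: mult_ac)
  also have "\<dots> = (1 - t) * u * ((chi 1 0 (- t) u * (u\<^sup>2 - 1)) * poly (ker_up t x T) (- u))"
    unfolding g by (simp only: mult_ac)
  finally show ?thesis unfolding u_def[symmetric] c e1 by (simp add: power2_eq_square algebra_simps)
qed

lemma ker_dn_residue:
  assumes "finite T" "i \<notin> T" "generic x (insert i T)"
  shows "(1 - t) * x i * (gam t x T (1 / x i) * ((x i)\<^sup>2 - 1) * poly (ker x T) (- x i)) = poly (ker_dn t x (insert i T)) (- x i)"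
proof -
  define u where "u = x i"
  have u: "u\<^sup>2 \<noteq> 1" "u \<noteq> 0" using assms by (auto simp: generic_def u_def power2_eq_square)
  have "(\<Prod>l\<in>T. psi t (1 / u) (x l) * rho t (x l) (1 / u)) * poly (ker x T) (- u) = poly (ker_dn t x T) (- u)"
    unfolding poly_ker poly_ker_dn prod.distrib[symmetric]
  proof (intro prod.cong refl)
    fix l assume l: "l \<in> T"
    then have ne: "u * x l \<noteq> 1" "u \<noteq> x l"
      using assms by (auto simp: u_def generic_def inj_on_def)
    have "rho t (x l) (1 / u) = (x l * u - t) / (x l * u - 1)"
    proof -
      have "x l - c / u = (x l * u - c) / u" for c using u by (simp add: field_simps)
      from this[of t] this[of 1] show ?thesis using u by (simp add: rho_def)
    qed
    moreover have "psi t (1 / u) (x l) = (u - t * x l) / (u - x l)"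
      using psi_inverse(1)[OF u(2) ne(2,1), of t] by (simp add: rho_def)
    moreover have "u - x l \<noteq> 0" "x l * u - 1 \<noteq> 0" using ne by (auto simp: mult.commute)
    moreover have "(1 + x l * - u) * (x l + - u) = (x l * u - 1) * (u - x l)" by (simp add: algebra_simps)
    moreover have "(t + x l * - u) * (t * x l + - u) = (x l * u - t) * (u - t * x l)" by (simp add: algebra_simps)
    ultimately show "psi t (1 / u) (x l) * rho t (x l) (1 / u) * ((1 + x l * - u) * (x l + - u)) = (t + x l * - u) * (t * x l + - u)"
      by simp
  qed
  then have g: "gam t x T (1 / u) * poly (ker x T) (- u) = chi 1 0 (- t) (1 / u) * poly (ker_dn t x T) (- u)"
    by (simp add: gam_def mult.assoc)
  have c: "chi 1 0 (- t) (1 / u) * (u\<^sup>2 - 1) = u\<^sup>2 - t"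
  proof -
    have "1 + 0 * (1 / u) + - t * (1 / u)\<^sup>2 = (u\<^sup>2 - t) / u\<^sup>2" "1 - (1 / u)\<^sup>2 = (u\<^sup>2 - 1) / u\<^sup>2"
      using u by (simp_all add: field_simps power2_eq_square)
    then show ?thesis using u by (simp add: chi_def)
  qed
  have "poly (ker_dn t x (insert i T)) (- u) = (t + u * - u) * (t * u + - u) * poly (ker_dn t x T) (- u)"
    using assms by (simp add: poly_ker_dn u_def)
  then have e1: "poly (ker_dn t x (insert i T)) (- u) = \<dots>" .
  have "(1 - t) * u * (gam t x T (1 / u) * (u\<^sup>2 - 1) * poly (ker x T) (- u)) =
      (1 - t) * u * (u\<^sup>2 - 1) * (gam t x T (1 / u) * poly (ker x T) (- u))"
    by (simp only: mult_ac)
  also have "\<dots> = (1 - t) * u * ((chi 1 0 (- t) (1 / u) * (u\<^sup>2 - 1)) * poly (ker_dn t x T) (- u))"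
    unfolding g by (simp only: mult_ac)
  finally show ?thesis unfolding u_def[symmetric] c e1 by (simp add: power2_eq_square algebra_simps)
qed

text \<open>Without the last sum, the difference D of the two sides satisfies y^(2k + 2n) D(1/y) =
  -D(y). So it vanishes at 1 and -1, by the two residue lemmas at -x i, and hence at -1 / x i.
  Therefore (y^2 - 1) \<open>ker x S\<close> divides it, with a palindromic quotient of degree at
  most 2 (k - 1).\<close>

lemma partial_fractions:
  assumes S: "finite S" "generic x S" and k: "k \<ge> 1"
  shows "\<exists>r. (\<Sum>i\<in>S. Polynomial.smult ((1 - t) * (- 1) ^ (k - 1) / x i ^ (k - 1) *
       (gam t x (S - {i}) (x i) + x i ^ (2 * k) * gam t x (S - {i}) (1 / x i)))
       ([:- 1, 0, 1:] * monom 1 k * ker x (S - {i})))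
     = (monom 1 (2 * k) - 1) * ker x S - (monom 1 (2 * k) * ker_dn t x S - ker_up t x S)
       + (\<Sum>b<k - 1. Polynomial.smult (r b) (bas k b * ker x S))"
proof -
  define n where "n = card S"
  define pp where "pp i = [:- 1, 0, 1:] * monom 1 k * ker x (S - {i})" for i
  define c where "c i = (1 - t) * (- 1) ^ (k - 1) / x i ^ (k - 1) *
       (gam t x (S - {i}) (x i) + x i ^ (2 * k) * gam t x (S - {i}) (1 / x i))" for i
  define D where "D = (\<Sum>i\<in>S. Polynomial.smult (c i) (pp i)) - ((monom 1 (2 * k) - 1) * ker x S - (monom 1 (2 * k) * ker_dn t x S - ker_up t x S))"
  have x0: "x i \<noteq> 0" and x1: "x i * x l \<noteq> 1" if "i \<in> S" "l \<in> S" for i l using that S by (auto simp: generic_def)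
  have inj: "x i = x l \<Longrightarrow> i = l" if "i \<in> S" "l \<in> S" for i l using that S by (auto simp: generic_def inj_on_def)
  define sq where "sq = [:- 1, 0, 1 :: complex:]"
  have sqy: "poly sq y = y\<^sup>2 - 1" for y by (simp add: sq_def power2_eq_square)
  have sq0: "sq \<noteq> 0" "degree sq = 2" by (simp_all add: sq_def)
  have ppy: "poly (pp i) y = (y\<^sup>2 - 1) * y ^ k * poly (ker x (S - {i})) y" for i y
    by (simp add: pp_def poly_monom sq_def[symmetric] sqy)
  have Dy: "poly D y = (\<Sum>i\<in>S. c i * poly (pp i) y) - ((y ^ (2 * k) - 1) * poly (ker x S) y
     - (y ^ (2 * k) * poly (ker_dn t x S) y - poly (ker_up t x S) y))" for y
    by (simp add: D_def poly_sum poly_monom)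
  have kerr: "y ^ (2 * card T) * poly (ker x T) (1 / y) = poly (ker x T) y" if "y \<noteq> 0" for y T
    using pal_ker[of T x] that by (simp add: pal_def)
  have ysq: "y\<^sup>2 * ((1 / y)\<^sup>2 - 1) = - (y\<^sup>2 - 1)" if "y \<noteq> 0" for y :: complex
    using that by (simp add: field_simps power2_eq_square)
  have anti: "y ^ (2 * k + 2 * n) * poly D (1 / y) = - poly D y" if y: "y \<noteq> 0" for y
  proof -
    have p: "y ^ (2 * k + 2 * n) * poly (pp i) (1 / y) = - poly (pp i) y" if "i \<in> S" for i
    proof -
      have "card (S - {i}) = n - 1" "n > 0" using that S by (auto simp: n_def card_gt_0_iff)
      then have "2 * n = 2 + 2 * card (S - {i})" by simp
      then have e: "y ^ (2 * k + 2 * n) = y ^ (2 * k) * y\<^sup>2 * y ^ (2 * card (S - {i}))" by (simp only: power_add mult_ac)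
      have "y ^ (2 * k + 2 * n) * poly (pp i) (1 / y) = (y ^ (2 * k) * (1 / y) ^ k) * (y\<^sup>2 * ((1 / y)\<^sup>2 - 1)) *
          (y ^ (2 * card (S - {i})) * poly (ker x (S - {i})) (1 / y))"
        unfolding e ppy by (simp only: mult_ac)
      also have "y ^ (2 * k) * (1 / y) ^ k = y ^ k" using y by (simp add: mult_2 power_add power_divide)
      finally show ?thesis unfolding ysq[OF y] kerr[OF y] ppy by (simp only: mult_ac mult_minus_right)
    qed
    have yk: "y ^ (2 * k) * (1 / y) ^ (2 * k) = 1" using y by (simp add: power_divide)
    define D1 where "D1 = (\<Sum>i\<in>S. c i * poly (pp i) (1 / y))"
    have "y ^ (2 * k + 2 * n) * D1 = (\<Sum>i\<in>S. - (c i * poly (pp i) y))"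
      unfolding D1_def sum_distrib_left by (intro sum.cong refl) (simp only: mult.left_commute p mult_minus_right)
    then have "y ^ (2 * k + 2 * n) * poly D (1 / y) = - (\<Sum>i\<in>S. c i * poly (pp i) y)
       - ((y ^ (2 * k) * (1 / y) ^ (2 * k) - y ^ (2 * k)) * (y ^ (2 * n) * poly (ker x S) (1 / y))
       - (y ^ (2 * k) * (1 / y) ^ (2 * k) * (y ^ (2 * n) * poly (ker_dn t x S) (1 / y)) - y ^ (2 * k) * (y ^ (2 * n) * poly (ker_up t x S) (1 / y))))"
      unfolding Dy D1_def[symmetric] sum_negf by (simp add: right_diff_distrib left_diff_distrib power_add mult_ac)
    then show ?thesis
      unfolding yk kerr[OF y, of S, folded n_def] reflect_ker_up[OF S(1) y, folded n_def] Dy by (simp add: algebra_simps)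
  qed
  have root1: "poly D (- x i) = 0" if i: "i \<in> S" for i
  proof -
    define T where "T = S - {i}"
    have T: "S = insert i T" "i \<notin> T" "finite T" using i S by (auto simp: T_def)
    define u where "u = x i"
    have u: "u \<noteq> 0" using x0 i by (auto simp: u_def)
    have 0: "poly (ker x S) (- u) = 0" unfolding poly_ker T(1) using T by (simp add: u_def)
    have "(\<Sum>m\<in>S. c m * poly (pp m) (- u)) = (\<Sum>m\<in>S. if m = i then c i * poly (pp i) (- u) else 0)"
    proof (intro sum.cong refl)
      fix m assume m: "m \<in> S"
      show "c m * poly (pp m) (- u) = (if m = i then c i * poly (pp i) (- u) else 0)"
      proof (cases "m = i")
        case False
        then have "poly (ker x (S - {m})) (- u) = 0" unfolding poly_ker using S i by (intro prod_zero) (auto simp: u_def)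
        then show ?thesis using False by (simp add: ppy)
      qed simp
    qed
    then have 1: "(\<Sum>m\<in>S. c m * poly (pp m) (- u)) = c i * poly (pp i) (- u)" using i S by simp
    define R where "R = poly (ker x T) (- u)"
    have gT: "generic x (insert i T)" using S T by simp
    have g1: "(1 - t) * u * (gam t x T u * (u\<^sup>2 - 1) * R) = - poly (ker_up t x S) (- u)"
      using ker_up_residue[OF T(3,2) gT, of t] by (simp add: u_def R_def T(1)[symmetric])
    have g2: "(1 - t) * u * (gam t x T (1 / u) * (u\<^sup>2 - 1) * R) = poly (ker_dn t x S) (- u)"
      using ker_dn_residue[OF T(3,2) gT, of t] by (simp add: u_def R_def T(1)[symmetric])
    \<comment> \<open>The prefactor of \<open>c\<close> is chosen to cancel the factor y^k of
      \<open>pp\<close> at y = -x i, up to -x i, which is what the residue lemmas expect.\<close>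
    have s: "(- 1) ^ (k - 1) / u ^ (k - 1) * (- u) ^ k = - u"
    proof -
      obtain k' where k': "k = Suc k'" using k by (cases k) auto
      have "(- 1 / u) ^ k' * (- u) ^ k' = 1" unfolding power_mult_distrib[symmetric] using u by simp
      moreover have "(- 1) ^ k' / u ^ k' * (- u) ^ Suc k' = - u * ((- 1 / u) ^ k' * (- u) ^ k')"
        by (simp only: power_divide power_Suc mult_ac)
      ultimately show ?thesis unfolding k' by simp
    qed
    define g where "g = gam t x T u" define g' where "g' = gam t x T (1 / u)" define w where "w = u\<^sup>2 - 1"
    have "c i * poly (pp i) (- u) = ((- 1) ^ (k - 1) / u ^ (k - 1) * (- u) ^ k) * ((1 - t) * (g + u ^ (2 * k) * g') * w * R)"
      unfolding c_def ppy T_def[symmetric] u_def[symmetric] R_def[symmetric] g_def[symmetric] g'_def[symmetric] power2_minus w_def[symmetric]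
      by (simp add: mult_ac)
    also have "\<dots> = - ((1 - t) * u * (g * w * R)) - u ^ (2 * k) * ((1 - t) * u * (g' * w * R))"
      unfolding s by (simp add: algebra_simps)
    also have "\<dots> = poly (ker_up t x S) (- u) - u ^ (2 * k) * poly (ker_dn t x S) (- u)"
      unfolding g_def g'_def w_def g1 g2 by simp
    finally show ?thesis unfolding u_def[symmetric] Dy 1 0 by simp
  qed
  have root2: "poly D (- 1 / x i) = 0" if "i \<in> S" for i
    using anti[of "- x i"] root1[OF that] x0[OF that that] by simp
  have root3: "poly D 1 = 0" "poly D (- 1) = 0" using anti[of 1] anti[of "- 1"] by (simp_all add: power_add)
  define Z where "Z = {1, - 1} \<union> ((\<lambda>i. - x i) ` S \<union> (\<lambda>i. - 1 / x i) ` S)"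
  have "(\<Prod>a\<in>Z. [:- a, 1:]) dvd D"
    by (rule prod_roots_dvd) (use S root1 root2 root3 in \<open>auto simp: Z_def\<close>)
  also have "(\<Prod>a\<in>Z. [:- a, 1:]) = [:- 1, 0, 1:] * ((\<Prod>i\<in>S. [:x i, 1:]) * (\<Prod>i\<in>S. [:1 / x i, 1:]))"
  proof -
    have ne: "x i \<noteq> 1 / x l" if "i \<in> S" "l \<in> S" for i l using x0[OF that(2,2)] x1[OF that] by auto
    have n1: "x i \<noteq> 1" "x i \<noteq> - 1" if "i \<in> S" for i using x1[OF that that] by auto
    have "(\<Prod>a\<in>Z. [:- a, 1:]) = (\<Prod>a\<in>{1, - 1}. [:- a, 1:]) * (\<Prod>a\<in>(\<lambda>i. - x i) ` S \<union> (\<lambda>i. - 1 / x i) ` S. [:- a, 1:])"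
      unfolding Z_def
    proof (rule prod.union_disjoint)
      have "- x i \<noteq> 1" "- x i \<noteq> - 1" "- 1 / x i \<noteq> 1" "- 1 / x i \<noteq> - 1" if "i \<in> S" for i
      proof -
        have e: "x i = - 1 / (- 1 / x i)" using x0[OF that that] by simp
        show "- 1 / x i \<noteq> 1"
        proof
          assume "- 1 / x i = 1"
          then have "x i = - 1" using e by (simp only: div_by_1)
          then show False using n1[OF that] by simp
        qed
        show "- 1 / x i \<noteq> - 1"
        proof
          assume "- 1 / x i = - 1"
          then have "x i = 1" using e by (simp only: div_self neg_equal_0_iff_equal one_neq_zero not_False_eq_True)
          then show False using n1[OF that] by simp
        qed
        show "- x i \<noteq> 1" "- x i \<noteq> - 1" using n1[OF that] by (auto simp: minus_equation_iff[of "x i"])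
      qed
      then show "{1, - 1} \<inter> ((\<lambda>i. - x i) ` S \<union> (\<lambda>i. - 1 / x i) ` S) = {}" by auto
    qed (use S in auto)
    also have "(\<Prod>a\<in>(\<lambda>i. - x i) ` S \<union> (\<lambda>i. - 1 / x i) ` S. [:- a, 1:]) =
      (\<Prod>a\<in>(\<lambda>i. - x i) ` S. [:- a, 1:]) * (\<Prod>a\<in>(\<lambda>i. - 1 / x i) ` S. [:- a, 1:])"
      by (rule prod.union_disjoint) (use S ne in auto)
    also have "(\<Prod>a\<in>(\<lambda>i. - x i) ` S. [:- a, 1:]) = (\<Prod>i\<in>S. [:x i, 1:])"
      by (subst prod.reindex) (use inj in \<open>auto simp: inj_on_def\<close>)
    also have "(\<Prod>a\<in>(\<lambda>i. - 1 / x i) ` S. [:- a, 1:]) = (\<Prod>i\<in>S. [:1 / x i, 1:])"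
      by (subst prod.reindex) (use inj in \<open>auto simp: inj_on_def\<close>)
    finally show ?thesis by simp
  qed
  finally obtain q' where q': "D = sq * ((\<Prod>i\<in>S. [:x i, 1:]) * (\<Prod>i\<in>S. [:1 / x i, 1:])) * q'" unfolding sq_def by (elim dvdE)
  have "ker x S = Polynomial.smult (\<Prod>i\<in>S. x i) ((\<Prod>i\<in>S. [:x i, 1:]) * (\<Prod>i\<in>S. [:1 / x i, 1:]))"
  proof -
    have "ker x S = (\<Prod>i\<in>S. Polynomial.smult (x i) ([:x i, 1:] * [:1 / x i, 1:]))"
      unfolding ker_def by (intro prod.cong refl) (use x0 in \<open>auto simp: algebra_simps\<close>)
    then show ?thesis by (simp only: prod_smult prod.distrib)
  qed
  moreover have px: "(\<Prod>i\<in>S. x i) \<noteq> 0" using S x0 by auto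
  ultimately have q: "D = sq * ker x S * Polynomial.smult (1 / (\<Prod>i\<in>S. x i)) q'"
    unfolding q' by simp
  define q where "q = Polynomial.smult (1 / (\<Prod>i\<in>S. x i)) q'"
  note q = q[folded q_def]
  have kz: "ker x S \<noteq> 0" unfolding ker_def using S x0 by auto
  have degker: "degree (ker x S) = 2 * n"
  proof -
    have "degree (ker x S) = (\<Sum>l\<in>S. degree ([:1, x l:] * [:x l, 1:]))"
      unfolding ker_def by (rule degree_prod_eq_sum_degree) (use x0 in auto)
    also have "\<dots> = (\<Sum>l\<in>S. 2)"
      by (intro sum.cong refl, subst degree_mult_eq) (use x0 in auto)
    finally show ?thesis by (simp add: n_def)
  qed
  have degD: "degree D \<le> 2 * k + 2 * n"
  proof -
    have pm: "degree (Polynomial.smult (c i) (pp i)) \<le> 2 * k + 2 * n" if "i \<in> S" for i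
    proof -
      have "card (S - {i}) = n - 1" "n > 0" using that S by (auto simp: n_def card_gt_0_iff)
      then have "degree (ker x (S - {i})) \<le> 2 * n - 2" using degree_ker_le[of x "S - {i}"] by simp
      moreover have "degree (sq * monom (1 :: complex) k) \<le> 2 + k"
        by (rule order_trans[OF degree_mult_le]) (simp add: degree_monom_eq sq0)
      ultimately have "degree (pp i) \<le> (2 + k) + (2 * n - 2)"
        unfolding pp_def sq_def[symmetric] using degree_mult_le[of "sq * monom 1 k" "ker x (S - {i})"] by linarith
      then show ?thesis using \<open>n > 0\<close> k by (intro order_trans[OF degree_smult_le]) linarith
    qed
    have m1: "degree (monom (1 :: complex) (2 * k) - 1) \<le> 2 * k" by (rule degree_diff_le) (simp_all add: degree_monom_eq)
    have "degree ((monom 1 (2 * k) - 1) * ker x S) \<le> 2 * k + 2 * n"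
      unfolding n_def by (intro order_trans[OF degree_mult_le] add_mono m1 degree_ker_le)
    moreover have "degree (monom 1 (2 * k) * ker_dn t x S) \<le> 2 * k + 2 * n"
      unfolding n_def by (intro order_trans[OF degree_mult_le] add_mono degree_ker_dn_le) (simp add: degree_monom_eq)
    moreover have "degree (ker_up t x S) \<le> 2 * k + 2 * n" using degree_ker_up_le[of t x S] by (simp add: n_def)
    ultimately show ?thesis unfolding D_def
      by (intro degree_diff_le degree_sum_le S pm)
  qed
  have degq: "degree q \<le> 2 * (k - 1)"
  proof (cases "q = 0")
    case False
    then have "degree D = 2 + 2 * n + degree q"
      unfolding q using kz degker sq0 by (simp add: degree_mult_eq)
    then show ?thesis using degD by simp
  qed simp
  define F where "F = {y. poly (sq * ker x S) y = 0}"
  have palq: "pal (2 * (k - 1)) q"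
  proof (rule palI[OF degq])
    show "finite F" unfolding F_def by (rule poly_roots_finite) (use kz sq0 in auto)
    fix y assume y: "y \<notin> F" "y \<noteq> 0"
    have e: "2 * k + 2 * n = 2 + 2 * n + 2 * (k - 1)" using k by simp
    have "y ^ (2 * k + 2 * n) * poly D (1 / y) = (y\<^sup>2 * ((1 / y)\<^sup>2 - 1)) * (y ^ (2 * n) * poly (ker x S) (1 / y)) * (y ^ (2 * (k - 1)) * poly q (1 / y))"
      unfolding q e power_add poly_mult sqy by (simp only: mult_ac)
    then have "- poly D y = - (poly sq y * poly (ker x S) y) * (y ^ (2 * (k - 1)) * poly q (1 / y))"
      unfolding anti[OF y(2)] ysq[OF y(2)] kerr[OF y(2), of S, folded n_def] sqy by (simp only: mult_ac mult_minus_right mult_minus_left)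
    then have "poly (sq * ker x S) y * (y ^ (2 * (k - 1)) * poly q (1 / y)) = poly (sq * ker x S) y * poly q y"
      unfolding q poly_mult by (simp only: mult_minus_left neg_equal_iff_equal)
    then show "y ^ (2 * (k - 1)) * poly q (1 / y) = poly q y"
      using y(1) unfolding F_def mem_Collect_eq mult_cancel_left by blast
  qed
  \<comment> \<open>A vanishing constant term removes the element b = k - 1, so that the remainder
    involves only those basis elements that occur in the other rows of the determinant.\<close>
  have q0: "coeff q 0 = 0"
  proof -
    have "poly D 0 = 0" unfolding Dy ppy using k by (simp add: poly_ker poly_ker_up power_0_left)
    moreover have "poly (ker x S) 0 \<noteq> 0" using S x0 by (simp add: poly_ker)
    ultimately show ?thesis unfolding q poly_mult sqy by (simp add: poly_0_coeff_0)
  qed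
  obtain r where r: "q = (\<Sum>b\<le>k - 1. Polynomial.smult (r b) ([:1, 0, 1:] ^ b * monom 1 (k - 1 - b)))" "r (k - 1) = coeff q 0"
    using pal_expand[OF palq] by blast
  have "{..k - 1} = insert (k - 1) {..<k - 1}" by auto
  then have "q = (\<Sum>b<k - 1. Polynomial.smult (r b) ([:1, 0, 1:] ^ b * monom 1 (k - 1 - b)))"
    using r(1) unfolding r(2)[unfolded q0] by (simp add: r(2)[unfolded q0, simplified])
  then have "D = (\<Sum>b<k - 1. Polynomial.smult (r b) (bas k b * ker x S))"
    unfolding q bas_def sq_def by (simp only: sum_distrib_left mult_smult_right mult_smult_left mult_ac)
  then have "(\<Sum>i\<in>S. Polynomial.smult (c i) (pp i)) = (monom 1 (2 * k) - 1) * ker x S - (monom 1 (2 * k) * ker_dn t x S - ker_up t x S)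
       + (\<Sum>b<k - 1. Polynomial.smult (r b) (bas k b * ker x S))"
    unfolding D_def by (simp add: diff_eq_eq add.commute)
  then show ?thesis unfolding c_def pp_def by blast
qed

text \<open>A second basis of the space spanned by \<open>bas\<close>. Apart from (1 + y)^\<sigma>
  its elements are binomials, so their functionals have two terms; the factor 1 + y fills the gap in
  the roots of the kernel when \<sigma> = 1 (see \<open>kerp\<close>).\<close>

definition basis_poly :: "nat \<Rightarrow> nat \<Rightarrow> nat \<Rightarrow> complex poly" where
  "basis_poly \<sigma> k a = [:1, 1:] ^ \<sigma> * (monom 1 (k + a + 1 - \<sigma>) - monom 1 (k - 1 - a))"

lemma pal_geometric: "d * n = 2 * a \<Longrightarrow> pal (2 * a) (\<Sum>r\<le>n. monom 1 (d * r))"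
proof -
  assume dn: "d * n = 2 * a"
  have "degree (\<Sum>r\<le>n. monom (1 :: complex) (d * r)) \<le> 2 * a"
    by (rule degree_sum_le) (auto simp: degree_monom_eq dn[symmetric])
  moreover have "y ^ (2 * a) * (\<Sum>r\<le>n. (1 / y) ^ (d * r)) = (\<Sum>r\<le>n. y ^ (d * r))" if "y \<noteq> 0" for y :: complex
  proof -
    have "y ^ (2 * a) * (\<Sum>r\<le>n. (1 / y) ^ (d * r)) = (\<Sum>r\<le>n. y ^ (d * (n - r)))"
      unfolding sum_distrib_left
    proof (intro sum.cong refl)
      fix r assume r: "r \<in> {..n}"
      have "d * n = d * (n - r) + d * r" using r by (simp flip: distrib_left)
      then have "y ^ (2 * a) = y ^ (d * (n - r)) * y ^ (d * r)" unfolding dn[symmetric] by (simp only: power_add)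
      then show "y ^ (2 * a) * (1 / y) ^ (d * r) = y ^ (d * (n - r))" using that by (simp add: power_divide)
    qed
    also have "\<dots> = (\<Sum>r\<le>n. y ^ (d * r))"
      unfolding atMost_atLeast0 by (subst (2) sum.atLeastAtMost_rev) simp
    finally show ?thesis .
  qed
  ultimately show ?thesis by (simp add: pal_def poly_sum poly_monom)
qed

lemma geometric_poly: "(monom 1 d - 1) * (\<Sum>r\<le>n. monom 1 (d * r)) = monom 1 (d * Suc n) - (1 :: complex poly)"
  by (induction n) (simp_all add: algebra_simps mult_monom monom_0)

lemma basis_poly_expand:
  assumes "\<sigma> \<in> {0, 1}" "a < k"
  obtains r where "basis_poly \<sigma> k a = (\<Sum>b\<le>a. Polynomial.smult (r b) (bas k b))" "r a = 1"
proof -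
  define p where "p = (if \<sigma> = 0 then \<Sum>r\<le>a. monom (1 :: complex) (2 * r) else \<Sum>r\<le>2 * a. monom 1 (1 * r))"
  have pal: "pal (2 * a) p" using pal_geometric[of 2 a a] pal_geometric[of 1 "2 * a" a] by (simp add: p_def)
  have c0: "coeff p 0 = 1"
    by (simp add: p_def coeff_sum coeff_monom)
  have sq: "monom 1 2 - 1 = [:- 1, 0, 1 :: complex:]" "monom 1 1 - 1 = [:- 1, 1 :: complex:]"
    by (simp_all add: monom_altdef power2_eq_square one_pCons)
  have "basis_poly \<sigma> k a = [:- 1, 0, 1:] * (p * monom 1 (k - 1 - a))"
  proof (cases "\<sigma> = 0")
    case True
    have "[:- 1, 0, 1:] * p = monom 1 (2 * Suc a) - 1"
      using geometric_poly[of 2 a] True unfolding sq by (simp add: p_def)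
    then have "[:- 1, 0, 1:] * (p * monom 1 (k - 1 - a)) = (monom 1 (2 * Suc a) - 1) * monom 1 (k - 1 - a)"
      by (simp only: mult.assoc[symmetric])
    also have "\<dots> = monom 1 (k + a + 1) - monom 1 (k - 1 - a)"
      using assms by (simp add: left_diff_distrib mult_monom add.commute)
    finally show ?thesis using True by (simp add: basis_poly_def)
  next
    case False
    then have s: "\<sigma> = 1" using assms by auto
    have "[:- 1, 1:] * p = monom 1 (Suc (2 * a)) - 1"
      using geometric_poly[of 1 "2 * a"] s unfolding sq by (simp add: p_def)
    moreover have "[:- 1, 0, 1:] = [:1, 1:] * [:- 1, 1 :: complex:]" by simp
    ultimately have "[:- 1, 0, 1:] * (p * monom 1 (k - 1 - a)) = [:1, 1:] * ((monom 1 (Suc (2 * a)) - 1) * monom 1 (k - 1 - a))"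
      by (simp only: mult.assoc[symmetric]) (simp only: mult.assoc)
    also have "(monom 1 (Suc (2 * a)) - 1) * monom (1 :: complex) (k - 1 - a) = monom 1 (k + a) - monom 1 (k - 1 - a)"
      using assms by (simp add: left_diff_distrib mult_monom add.commute)
    finally show ?thesis using s by (simp add: basis_poly_def)
  qed
  moreover obtain r where r: "p = (\<Sum>b\<le>a. Polynomial.smult (r b) ([:1, 0, 1:] ^ b * monom 1 (a - b)))" "r a = coeff p 0"
    using pal_expand[OF pal] by blast
  ultimately have "basis_poly \<sigma> k a = (\<Sum>b\<le>a. [:- 1, 0, 1:] * (Polynomial.smult (r b) ([:1, 0, 1:] ^ b * monom 1 (a - b)) * monom 1 (k - 1 - a)))"
    by (simp only: sum_distrib_left sum_distrib_right)
  also have "\<dots> = (\<Sum>b\<le>a. Polynomial.smult (r b) (bas k b))"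
  proof (intro sum.cong refl)
    fix b assume b: "b \<in> {..a}"
    have "monom 1 (a - b) * monom (1 :: complex) (k - 1 - a) = monom 1 (k - 1 - b)" using b assms by (simp add: mult_monom)
    then show "[:- 1, 0, 1:] * (Polynomial.smult (r b) ([:1, 0, 1:] ^ b * monom 1 (a - b)) * monom 1 (k - 1 - a)) = Polynomial.smult (r b) (bas k b)"
      unfolding bas_def by (simp only: mult_smult_left mult_smult_right mult.assoc)
  qed
  finally show ?thesis using that[of r] r(2) c0 by simp
qed

text \<open>The change of basis is unitriangular, by \<open>r a = 1\<close> in
  \<open>basis_poly_expand\<close>.\<close>

lemma lam_det_basis:
  assumes "\<sigma> \<in> {0, 1}"
  shows "lam_det k t x S = detf k (\<lambda>a j. lam k t (Suc j) (card S + k) (basis_poly \<sigma> k a * ker x S))"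
proof -
  have "\<forall>a. \<exists>r. a < k \<longrightarrow> basis_poly \<sigma> k a = (\<Sum>b\<le>a. Polynomial.smult (r b) (bas k b)) \<and> r a = 1"
    using basis_poly_expand[OF assms] by metis
  then obtain r where r: "\<And>a. a < k \<Longrightarrow> basis_poly \<sigma> k a = (\<Sum>b\<le>a. Polynomial.smult (r a b) (bas k b))" "\<And>a. a < k \<Longrightarrow> r a a = 1"
    by metis
  define L where "L a b = (if b \<le> a then r a b else 0)" for a b
  have "detf k (\<lambda>a j. lam k t (Suc j) (card S + k) (basis_poly \<sigma> k a * ker x S)) =
    detf k (\<lambda>a j. \<Sum>b<k. L a b * lam k t (Suc j) (card S + k) (bas k b * ker x S))"
  proof (rule detf_cong)
    fix a j assume a: "a < k"
    have "lam k t (Suc j) (card S + k) (basis_poly \<sigma> k a * ker x S) = (\<Sum>b\<le>a. r a b * lam k t (Suc j) (card S + k) (bas k b * ker x S))"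
      unfolding r(1)[OF a] sum_distrib_right lam_sum mult_smult_left lam_smult ..
    also have "\<dots> = (\<Sum>b<k. L a b * lam k t (Suc j) (card S + k) (bas k b * ker x S))"
      by (rule sum.mono_neutral_cong_left) (use a in \<open>auto simp: L_def\<close>)
    finally show "lam k t (Suc j) (card S + k) (basis_poly \<sigma> k a * ker x S) = \<dots>" .
  qed
  also have "\<dots> = detf k L * lam_det k t x S" unfolding detf_mult lam_det_def ..
  also have "detf k L = (\<Prod>i<k. L i i)" by (rule detf_lower_triangular) (simp add: L_def)
  also have "\<dots> = 1" by (rule prod.neutral) (simp add: L_def r(2))
  finally show ?thesis by simp
qed

lemma lam_monom: "lam k t j N (monom 1 c) = odd_theta_coeff k t j (int c - int N)"
  using lam_monom_mult[of 1 0 k t j N c] by simp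

lemma odd_theta_coeff_small:
  assumes "a < k" "j < k"
  shows "odd_theta_coeff k t (Suc j) (int a + 1) = of_bool (a = j)" "odd_theta_coeff k t (Suc j) (- int a - 1) = - of_bool (a = j \<and> j = k - 1)"
proof -
  have k: "k \<ge> 1" using assms by simp
  show "odd_theta_coeff k t (Suc j) (int a + 1) = of_bool (a = j)"
  proof (cases "a = j")
    case True
    then show ?thesis using odd_theta_coeff_at[OF k, of t "Suc j" 0] by (simp add: add.commute)
  next
    case False
    have "\<not> 2 * int k dvd int a + 1 - int (Suc j)"
    proof
      assume d: "2 * int k dvd int a + 1 - int (Suc j)"
      have "\<bar>2 * int k\<bar> \<le> \<bar>int a + 1 - int (Suc j)\<bar>" by (rule dvd_imp_le_int[OF _ d]) (use False in simp)
      then show False using assms by simp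
    qed
    then show ?thesis using False by (simp add: odd_theta_coeff_def)
  qed
  show "odd_theta_coeff k t (Suc j) (- int a - 1) = - of_bool (a = j \<and> j = k - 1)"
  proof (cases "a = j \<and> j = k - 1")
    case True
    have e: "- int a - 1 = int (Suc j) + 2 * int k * (- 1)" using True k by simp
    show ?thesis unfolding e odd_theta_coeff_at[OF k] using True k by simp
  next
    case False
    have "\<not> 2 * int k dvd - int a - 1 - int (Suc j)"
    proof
      assume d: "2 * int k dvd - int a - 1 - int (Suc j)"
      have "\<bar>2 * int k\<bar> \<le> \<bar>- int a - 1 - int (Suc j)\<bar>" by (rule dvd_imp_le_int[OF _ d]) simp
      then show False using assms False by linarith
    qed
    then show ?thesis using False by (auto simp: odd_theta_coeff_def)
  qed
qed

text \<open>The matrix is diagonal. Its last entry is 2, because k and -k are congruent modulo 2k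
  and have coefficients 1 and -1. This is the factor 2 that accompanies the determinant from here
  on.\<close>

lemma lam_det_empty:
  assumes "k \<ge> 1"
  shows "lam_det k t x {} = 2"
proof -
  have "lam_det k t x {} = detf k (\<lambda>a j. lam k t (Suc j) k (basis_poly 0 k a))"
    using lam_det_basis[of 0 k t x "{}"] by (simp add: ker_def)
  also have "\<dots> = detf k (\<lambda>a j. of_bool (a = j) * (1 + of_bool (j = k - 1)))"
  proof (rule detf_cong)
    fix a j assume aj: "a < k" "j < k"
    have "lam k t (Suc j) k (basis_poly 0 k a) = odd_theta_coeff k t (Suc j) (int (k + a + 1) - int k) - odd_theta_coeff k t (Suc j) (int (k - 1 - a) - int k)"
      by (simp add: basis_poly_def lam_diff lam_monom)
    also have "int (k + a + 1) - int k = int a + 1" "int (k - 1 - a) - int k = - int a - 1" using aj by auto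
    then have "odd_theta_coeff k t (Suc j) (int (k + a + 1) - int k) - odd_theta_coeff k t (Suc j) (int (k - 1 - a) - int k) = of_bool (a = j) * (1 + of_bool (j = k - 1))"
      by (simp only: odd_theta_coeff_small[OF aj]) auto
    finally show "lam k t (Suc j) k (basis_poly 0 k a) = of_bool (a = j) * (1 + of_bool (j = k - 1))" .
  qed
  also have "\<dots> = (\<Prod>i<k. of_bool (i = i) * (1 + of_bool (i = k - 1)))"
    by (rule detf_lower_triangular) simp
  also have "\<dots> = (\<Prod>i\<in>{k - 1}. 1 + of_bool (i = k - 1))"
    by (rule prod.mono_neutral_cong_right) (use assms in auto)
  finally show ?thesis by simp
qed

lemma bas_Suc:
  assumes "Suc a < k"
  shows "[:1, 0, 1:] * bas k a = pCons 0 (bas k (Suc a))"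
proof -
  have "k - 1 - a = Suc (k - 1 - Suc a)" using assms by simp
  then have "monom (1 :: complex) (k - 1 - a) = [:0, 1:] * monom 1 (k - 1 - Suc a)" by (simp add: monom_altdef)
  then have "[:1, 0, 1:] * bas k a = [:0, 1:] * bas k (Suc a)" unfolding bas_def power_Suc by (simp only: mult_ac)
  then show ?thesis by simp
qed

text \<open>The factor of \<open>ker\<close> for x i is x i (1 + y^2) + (1 + (x i)^2) y, and 1 + y^2
  takes one basis element to y times the next (\<open>bas_Suc\<close>). With the extra row in front
  the change of rows is triangular, with diagonal 1, x i, ..., x i.\<close>

lemma lam_det_delete:
  assumes "finite S" "i \<in> S" "k \<ge> 1"
  shows "detf k (\<lambda>a j. if a = 0 then lam k t (Suc j) (card S + k) ([:- 1, 0, 1:] * monom 1 k * ker x (S - {i}))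
      else lam k t (Suc j) (card S + k) (bas k (a - 1) * ker x S)) = x i ^ (k - 1) * lam_det k t x (S - {i})"
proof -
  define T where "T = S - {i}"
  have T: "S = insert i T" "i \<notin> T" "finite T" using assms by (auto simp: T_def)
  have N: "card S + k = Suc (card T + k)" using T by simp
  define L where "L a l = (if a = 0 then of_bool (l = 0) else if l = a then x i else if l = a - 1 then 1 + (x i)\<^sup>2 else 0)" for a l :: nat
  have "detf k (\<lambda>a j. if a = 0 then lam k t (Suc j) (card S + k) ([:- 1, 0, 1:] * monom 1 k * ker x (S - {i}))
      else lam k t (Suc j) (card S + k) (bas k (a - 1) * ker x S)) =
    detf k (\<lambda>a j. \<Sum>l<k. L a l * lam k t (Suc j) (card T + k) (bas k l * ker x T))"
  proof (rule detf_cong)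
    fix a j assume a: "a < k"
    show "(if a = 0 then lam k t (Suc j) (card S + k) ([:- 1, 0, 1:] * monom 1 k * ker x (S - {i}))
      else lam k t (Suc j) (card S + k) (bas k (a - 1) * ker x S)) = (\<Sum>l<k. L a l * lam k t (Suc j) (card T + k) (bas k l * ker x T))"
    proof (cases a)
      case 0
      have "monom (1 :: complex) k = [:0, 1:] * monom 1 (k - 1)" using assms(3) by (cases k) (simp_all add: monom_altdef)
      then have "[:- 1, 0, 1:] * monom 1 k * ker x T = [:0, 1:] * (bas k 0 * ker x T)"
        unfolding bas_def power_0 mult_1_left diff_zero by (simp only: mult_ac)
      then have "lam k t (Suc j) (card S + k) ([:- 1, 0, 1:] * monom 1 k * ker x (S - {i})) = lam k t (Suc j) (card T + k) (bas k 0 * ker x T)"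
        unfolding N T_def[symmetric] by (simp add: lam_pCons_0)
      also have "\<dots> = (\<Sum>l\<in>{0}. L a l * lam k t (Suc j) (card T + k) (bas k l * ker x T))" using 0 by (simp add: L_def)
      also have "\<dots> = (\<Sum>l<k. L a l * lam k t (Suc j) (card T + k) (bas k l * ker x T))"
        by (rule sum.mono_neutral_left) (use 0 a in \<open>auto simp: L_def\<close>)
      finally show ?thesis using 0 by simp
    next
      case (Suc b)
      have "[:1, x i:] * [:x i, 1:] = Polynomial.smult (x i) [:1, 0, 1:] + Polynomial.smult (1 + (x i)\<^sup>2) [:0, 1:]"
        by (simp add: power2_eq_square)
      then have "bas k b * ker x S = Polynomial.smult (x i) (([:1, 0, 1:] * bas k b) * ker x T) + Polynomial.smult (1 + (x i)\<^sup>2) ([:0, 1:] * (bas k b * ker x T))"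
        unfolding T(1) ker_insert[OF T(3,2)] by (simp only:) (simp only: distrib_left distrib_right mult_smult_left mult_smult_right mult_ac)
      also have "([:1, 0, 1:] * bas k b) * ker x T = [:0, 1:] * (bas k a * ker x T)"
        using bas_Suc[of b k] a Suc by (simp only:) simp
      finally have "lam k t (Suc j) (card S + k) (bas k b * ker x S) =
          x i * lam k t (Suc j) (card T + k) (bas k a * ker x T) + (1 + (x i)\<^sup>2) * lam k t (Suc j) (card T + k) (bas k b * ker x T)"
        unfolding N by (simp add: lam_add lam_smult lam_pCons_0)
      also have "\<dots> = (\<Sum>l\<in>{a, b}. L a l * lam k t (Suc j) (card T + k) (bas k l * ker x T))" using Suc by (simp add: L_def)
      also have "\<dots> = (\<Sum>l<k. L a l * lam k t (Suc j) (card T + k) (bas k l * ker x T))"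
        by (rule sum.mono_neutral_left) (use Suc a in \<open>auto simp: L_def\<close>)
      finally show ?thesis using Suc by simp
    qed
  qed
  also have "\<dots> = detf k L * lam_det k t x T" unfolding detf_mult lam_det_def ..
  also have "detf k L = (\<Prod>a<k. L a a)" by (rule detf_lower_triangular) (auto simp: L_def)
  also have "\<dots> = x i ^ (k - 1)"
  proof -
    have "(\<Prod>a<k. L a a) = (\<Prod>a\<in>{1..<k}. x i)"
      by (rule prod.mono_neutral_cong_right) (auto simp: L_def)
    then show ?thesis by simp
  qed
  finally show ?thesis unfolding T_def .
qed

text \<open>Row 0 is filled with the functionals of the two sides of
  \<open>partial_fractions\<close>. On the right \<open>lam_ker_shift\<close> produces 1 - t^n, and
  the remainder is a combination of the other rows. On the left linearity gives the determinants of
  \<open>lam_det_delete\<close>.\<close>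

lemma lam_det_recursion:
  assumes S: "finite S" "generic x S" and k: "k \<ge> 1"
  shows "(1 - t ^ card S) * lam_det k t x S = (1 - t) *
    (\<Sum>i\<in>S. (gam t x (S - {i}) (x i) + x i ^ (2 * k) * gam t x (S - {i}) (1 / x i)) * lam_det k t x (S - {i}))"
proof -
  define n where "n = card S"
  define \<gamma> where "\<gamma> i = gam t x (S - {i}) (x i) + x i ^ (2 * k) * gam t x (S - {i}) (1 / x i)" for i
  define c where "c i = (1 - t) * (- 1) ^ (k - 1) / x i ^ (k - 1) * \<gamma> i" for i
  define pp where "pp i = [:- 1, 0, 1:] * monom 1 k * ker x (S - {i})" for i
  let ?lam = "\<lambda>j. lam k t (Suc j) (n + k)"
  obtain r where r: "(\<Sum>i\<in>S. Polynomial.smult (c i) (pp i))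
     = (monom 1 (2 * k) - 1) * ker x S - (monom 1 (2 * k) * ker_dn t x S - ker_up t x S)
       + (\<Sum>b<k - 1. Polynomial.smult (r b) (bas k b * ker x S))"
    using partial_fractions[OF S k, of t] unfolding c_def \<gamma>_def pp_def by blast
  have k1: "k - 1 < k" using k by simp
  obtain r' where r': "basis_poly 0 k (k - 1) = (\<Sum>b\<le>k - 1. Polynomial.smult (r' b) (bas k b))" "r' (k - 1) = 1"
    using basis_poly_expand[of 0 "k - 1" k] k1 by auto
  have basis_poly: "basis_poly 0 k (k - 1) = monom 1 (2 * k) - 1" using k by (simp add: basis_poly_def mult_2 monom_0 one_pCons)
  have "{..k - 1} = insert (k - 1) {..<k - 1}" by auto
  \<comment> \<open>Modulo the other rows y^(2k) - 1 may be replaced by the last basis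
    element.\<close>
  then have m: "monom 1 (2 * k) - 1 = bas k (k - 1) + (\<Sum>b<k - 1. Polynomial.smult (r' b) (bas k b))"
    unfolding basis_poly[symmetric] r'(1) by (simp add: r'(2)[simplified])
  define M where "M a j = (if a = 0 then ?lam j (bas k (k - 1) * ker x S) else ?lam j (bas k (a - 1) * ker x S))" for a j
  define L where "L a l = (if a = 0 then (if l = 0 then 1 - t ^ n else (1 - t ^ n) * r' (l - 1) + r (l - 1)) else of_bool (l = a))" for a l :: nat
  have row0: "(\<Sum>i\<in>S. c i * ?lam j (pp i)) = (\<Sum>l<k. L 0 l * M l j)" if j: "j < k" for j
  proof -
    have "(\<Sum>i\<in>S. c i * ?lam j (pp i)) = ?lam j (\<Sum>i\<in>S. Polynomial.smult (c i) (pp i))"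
      by (simp add: lam_sum lam_smult)
    also have "\<dots> = (1 - t ^ n) * ?lam j ((monom 1 (2 * k) - 1) * ker x S) + (\<Sum>b<k - 1. r b * ?lam j (bas k b * ker x S))"
      unfolding r lam_add lam_diff[of _ _ _ _ "(monom 1 (2 * k) - 1) * ker x S"] lam_sum lam_smult
      using lam_ker_shift[of "Suc j" k S t x] j S(1) by (simp add: n_def algebra_simps)
    also have "?lam j ((monom 1 (2 * k) - 1) * ker x S) = ?lam j (bas k (k - 1) * ker x S) + (\<Sum>b<k - 1. r' b * ?lam j (bas k b * ker x S))"
      unfolding m distrib_right sum_distrib_right lam_add lam_sum mult_smult_left lam_smult ..
    also have "(1 - t ^ n) * (?lam j (bas k (k - 1) * ker x S) + (\<Sum>b<k - 1. r' b * ?lam j (bas k b * ker x S))) + (\<Sum>b<k - 1. r b * ?lam j (bas k b * ker x S))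
        = L 0 0 * M 0 j + (\<Sum>b<k - 1. L 0 (Suc b) * M (Suc b) j)"
      by (simp add: L_def M_def distrib_left distrib_right sum_distrib_left sum.distrib mult.assoc)
    also have "\<dots> = (\<Sum>l<Suc (k - 1). L 0 l * M l j)" by (rule sum.lessThan_Suc_shift[symmetric])
    also have "Suc (k - 1) = k" using k by simp
    finally show ?thesis .
  qed
  have "(\<Sum>i\<in>S. c i * detf k (\<lambda>a j. if a = 0 then ?lam j (pp i) else ?lam j (bas k (a - 1) * ker x S))) =
    detf k (\<lambda>a j. if a = 0 then \<Sum>i\<in>S. c i * ?lam j (pp i) else ?lam j (bas k (a - 1) * ker x S))"
    by (rule detf_sum_row0[symmetric]) (use k in simp)
  also have "\<dots> = detf k (\<lambda>a j. \<Sum>l<k. L a l * M l j)"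
  proof (rule detf_cong)
    fix a j assume aj: "a < k" "j < k"
    show "(if a = 0 then \<Sum>i\<in>S. c i * ?lam j (pp i) else ?lam j (bas k (a - 1) * ker x S)) = (\<Sum>l<k. L a l * M l j)"
    proof (cases "a = 0")
      case False
      have "(\<Sum>l<k. L a l * M l j) = (\<Sum>l<k. if l = a then M a j else 0)"
        by (intro sum.cong refl) (use False in \<open>auto simp: L_def\<close>)
      then show ?thesis using False aj by (simp add: M_def)
    qed (use row0 aj in simp)
  qed
  also have "\<dots> = detf k L * detf k M" by (rule detf_mult)
  also have "detf k L = (\<Prod>a<k. L a a)" by (rule detf_upper_triangular) (auto simp: L_def)
  also have "\<dots> = (\<Prod>a\<in>{0}. L a a)" by (rule prod.mono_neutral_right) (use k in \<open>auto simp: L_def\<close>)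
  also have "\<dots> = 1 - t ^ n" by (simp add: L_def)
  also have "detf k M = (- 1) ^ (k - 1) * lam_det k t x S"
    unfolding M_def lam_det_def n_def[symmetric]
    using detf_last_row_to_front[of k "\<lambda>a j. ?lam j (bas k a * ker x S)"] k by simp
  finally have "(\<Sum>i\<in>S. c i * detf k (\<lambda>a j. if a = 0 then ?lam j (pp i) else ?lam j (bas k (a - 1) * ker x S))) =
      (1 - t ^ n) * ((- 1) ^ (k - 1) * lam_det k t x S)" .
  also have "(\<Sum>i\<in>S. c i * detf k (\<lambda>a j. if a = 0 then ?lam j (pp i) else ?lam j (bas k (a - 1) * ker x S))) =
      (- 1) ^ (k - 1) * ((1 - t) * (\<Sum>i\<in>S. \<gamma> i * lam_det k t x (S - {i})))"
    unfolding sum_distrib_left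
  proof (intro sum.cong refl)
    fix i assume i: "i \<in> S"
    then have "x i \<noteq> 0" using S by (auto simp: generic_def)
    then show "c i * detf k (\<lambda>a j. if a = 0 then ?lam j (pp i) else ?lam j (bas k (a - 1) * ker x S)) =
      (- 1) ^ (k - 1) * ((1 - t) * (\<gamma> i * lam_det k t x (S - {i})))"
      unfolding pp_def n_def lam_det_delete[OF S(1) i k] c_def by simp
  qed
  finally have "(- 1) ^ (k - 1) * ((1 - t) * (\<Sum>i\<in>S. \<gamma> i * lam_det k t x (S - {i}))) = (- 1) ^ (k - 1) * ((1 - t ^ n) * lam_det k t x S)"
    by (simp only: mult.left_commute)
  then show ?thesis unfolding \<gamma>_def n_def by (simp only: mult_cancel_left) simp
qed

text \<open>After division by 1 - t both sides satisfy the recursion of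
  \<open>sgn_sum_recursion\<close>; its coefficient [n] is nonzero for |t| < 1.\<close>

lemma lam_det_eq_sgn_sum:
  assumes "finite S" "generic x S" "k \<ge> 1" "norm t < 1"
  shows "lam_det k t x S = 2 * sgn_sum t x (2 * k) S"
  using assms(1,2)
proof (induction "card S" arbitrary: S)
  case 0
  then show ?case using lam_det_empty[OF assms(3)] by (simp add: sgn_sum_def)
next
  case (Suc n)
  have t1: "1 - t \<noteq> 0" using assms(4) by auto
  have IH: "lam_det k t x (S - {i}) = 2 * sgn_sum t x (2 * k) (S - {i})" if "i \<in> S" for i
  proof (rule Suc.hyps(1))
    show "n = card (S - {i})" using Suc.hyps(2) Suc.prems(1) that by simp
  qed (use Suc.prems generic_subset[of x S "S - {i}"] in auto)
  have "(1 - t) * ((\<Sum>i<card S. t ^ i) * lam_det k t x S) = (1 - t ^ card S) * lam_det k t x S"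
    by (simp add: one_diff_power_eq)
  also have "\<dots> = (1 - t) * (2 * ((\<Sum>i<card S. t ^ i) * sgn_sum t x (2 * k) S))"
    unfolding lam_det_recursion[OF Suc.prems assms(3)] sgn_sum_recursion[OF Suc.prems] sum_distrib_left
    by (intro sum.cong refl) (simp add: IH)
  finally have "(\<Sum>i<card S. t ^ i) * lam_det k t x S = (\<Sum>i<card S. t ^ i) * (2 * sgn_sum t x (2 * k) S)"
    using t1 by simp
  moreover have "(\<Sum>i<card S. t ^ i) \<noteq> 0" by (rule geometric_nonzero) (use assms Suc.hyps in auto)
  ultimately show ?case by simp
qed

section \<open>Hall--Littlewood polynomials as shuffle products\<close>

text \<open>The weight of a part \<open>a\<close> of multiplicity \<open>m\<close>; padding zeros and the largest part are free.\<close>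

definition bounded_wt :: "nat \<Rightarrow> complex \<Rightarrow> nat \<Rightarrow> nat \<Rightarrow> complex" where
  "bounded_wt k t a m = (if a = 0 \<or> a = 2 * k then 1 else wt t a m)"

lemma tendsto_level_shuffle:
  assumes T: "(T \<longlongrightarrow> t) F" and g: "\<And>a m. ((\<lambda>n. g n a m) \<longlongrightarrow> g0 a m) F"
  shows "((\<lambda>n. level_shuffle (T n) x (g n) K S) \<longlongrightarrow> level_shuffle t x g0 K S) F"
proof (induction K arbitrary: S)
  case (Suc K)
  show ?case unfolding level_shuffle.simps shuffle_def tau_def cross_def rho_def divide_inverse
    by (intro tendsto_intros tendsto_sum tendsto_prod Suc T g)
qed (simp add: g)

lemma tendsto_bounded_wt:
  assumes T: "(T \<longlongrightarrow> t) F"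
  shows "((\<lambda>n. bounded_wt k (T n) a m) \<longlongrightarrow> bounded_wt k t a m) F"
proof -
  have "((\<lambda>n. qpoch (T n) ((T n)\<^sup>2) m) \<longlongrightarrow> qpoch t (t\<^sup>2) m) F" for m
    unfolding qpoch_def by (intro tendsto_intros tendsto_prod T)
  then show ?thesis unfolding bounded_wt_def wt_def by (auto intro!: tendsto_intros T)
qed

lemma tendsto_lam_det:
  assumes T: "(T \<longlongrightarrow> t) F"
  shows "((\<lambda>n. lam_det k (T n) x S) \<longlongrightarrow> lam_det k t x S) F"
  unfolding lam_det_def
proof (rule tendsto_detf)
  fix a j
  have "((\<lambda>n. odd_theta_coeff k (T n) j e) \<longlongrightarrow> odd_theta_coeff k t j e) F" for j e
    unfolding odd_theta_coeff_def Let_def by (auto intro!: tendsto_intros T)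
  then show "((\<lambda>n. lam k (T n) (Suc j) (card S + k) (bas k a * ker x S)) \<longlongrightarrow> lam k t (Suc j) (card S + k) (bas k a * ker x S)) F"
    unfolding lam_def by (intro tendsto_intros tendsto_sum)
qed

text \<open>The point t = 1 is where the constant of the theta determinant will be read off. It is
  reached from inside the disc, both sides being continuous in t.\<close>

lemma lam_det_eq_level_shuffle:
  fixes x :: "nat \<Rightarrow> complex"
  assumes S: "finite S" "generic x S" and k: "k \<ge> 1" and t: "norm t < 1 \<or> t = 1"
  shows "lam_det k t x S = 2 * level_shuffle t x (bounded_wt k t) (2 * k) S"
proof -
  have *: "lam_det k t x S = 2 * level_shuffle t x (bounded_wt k t) (2 * k) S" if "norm t < 1" for t
    unfolding lam_det_eq_sgn_sum[OF S k that] bounded_littlewood[OF S that k, symmetric] bounded_wt_def ..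
  show ?thesis
  proof (cases "norm t < 1")
    case False
    then have t1: "t = 1" using t by simp
    define T where "T n = (1 :: complex) - 1 / of_nat (Suc (Suc n))" for n
    have "T \<longlonglongrightarrow> 1 - 0" unfolding T_def by (intro tendsto_intros LIMSEQ_Suc[OF LIMSEQ_Suc[OF lim_1_over_n]])
    then have T: "T \<longlonglongrightarrow> 1" by simp
    have "norm (T n) < 1" for n
    proof -
      have "T n = of_real (1 - 1 / real (Suc (Suc n)))" by (simp add: T_def)
      then have "norm (T n) = \<bar>1 - 1 / real (Suc (Suc n))\<bar>" by (simp only: norm_of_real)
      moreover have "0 < 1 / real (Suc (Suc n))" "1 / real (Suc (Suc n)) < 1" by simp_all
      ultimately show ?thesis by linarith
    qed
    then have e: "(\<lambda>n. 2 * level_shuffle (T n) x (bounded_wt k (T n)) (2 * k) S) = (\<lambda>n. lam_det k (T n) x S)" using * by simp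
    have "(\<lambda>n. 2 * level_shuffle (T n) x (bounded_wt k (T n)) (2 * k) S) \<longlonglongrightarrow> 2 * level_shuffle 1 x (bounded_wt k 1) (2 * k) S"
      by (intro tendsto_intros tendsto_level_shuffle tendsto_bounded_wt T)
    moreover have "(\<lambda>n. lam_det k (T n) x S) \<longlonglongrightarrow> lam_det k 1 x S" by (rule tendsto_lam_det[OF T])
    ultimately show ?thesis unfolding e t1 using LIMSEQ_unique by metis
  qed (rule *)
qed

lemma wt_1: "wt 1 a m = of_bool (m = 0)"
proof -
  have "qpoch 1 1 n = of_bool (n = 0)" for n by (cases n) (simp_all add: qpoch_def)
  then show ?thesis by (auto simp: wt_def elim!: evenE oddE)
qed

text \<open>At t = 1 all factors rho are 1, and a part strictly between 0 and 2k has weight 0 unless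
  its multiplicity is 0. So each variable carries the exponent 0 or 2k independently.\<close>

lemma level_shuffle_at_1:
  assumes S: "finite S" "inj_on x S" and k: "k \<ge> 1"
  shows "level_shuffle 1 x (bounded_wt k 1) (2 * k) S = (\<Prod>i\<in>S. 1 + x i ^ (2 * k))"
proof -
  have "level_shuffle 1 x (bounded_wt k 1) a T = 1" if "finite T" "a < 2 * k" for a T
    using that
  proof (induction a arbitrary: T)
    case (Suc a)
    have "tau x (Suc a) (\<lambda>A. bounded_wt k 1 (Suc a) (card A)) A = of_bool (card A = 0)" if "A \<subseteq> T" for A
      using Suc.prems finite_subset[OF that] by (auto simp: tau_def bounded_wt_def wt_1)
    then have "level_shuffle 1 x (bounded_wt k 1) (Suc a) T = shuffle 1 x (\<lambda>A. of_bool (card A = 0)) (level_shuffle 1 x (bounded_wt k 1) a) T"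
      unfolding level_shuffle.simps by (intro shuffle_cong) auto
    also have "\<dots> = 1" using Suc by (simp add: shuffle_unit_left)
    finally show ?case .
  qed (simp add: bounded_wt_def)
  moreover obtain K where K: "2 * k = Suc K" using k by (cases "2 * k") auto
  moreover have "cross 1 x A (S - A) = 1" if "A \<subseteq> S" for A
    unfolding cross_def
  proof (intro prod.neutral ballI)
    fix i j assume "i \<in> A" "j \<in> S - A"
    then have "x i \<noteq> x j" using S that by (auto simp: inj_on_def)
    then show "rho 1 (x i) (x j) = 1" by (simp add: rho_def)
  qed
  ultimately have "level_shuffle 1 x (bounded_wt k 1) (Suc K) S = (\<Sum>A\<in>Pow S. (\<Prod>i\<in>A. x i ^ Suc K) * (\<Prod>i\<in>S - A. 1))"
    unfolding level_shuffle.simps shuffle_def using S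
    by (intro sum.cong refl) (simp add: tau_def bounded_wt_def prod_power_distrib K del: power_Suc)
  also have "\<dots> = (\<Prod>i\<in>S. x i ^ Suc K + 1)" using prod_add[OF S(1), of "\<lambda>i. x i ^ Suc K" "\<lambda>_. 1"] by simp
  finally show ?thesis unfolding K by (simp add: add.commute)
qed

text \<open>Monomials are indexed by their exponents: the \<open>w\<close>-term of the symmetrization contributes to
  \<open>f i = part \<mu> (w\<^sup>-\<^sup>1 i)\<close>.\<close>

definition levels :: "nat set \<Rightarrow> nat \<Rightarrow> (nat \<Rightarrow> nat) set" where
  "levels S K = {f. (\<forall>i\<in>S. f i \<le> K) \<and> (\<forall>i. i \<notin> S \<longrightarrow> f i = 0)}"

text \<open>One term of a Hall-Littlewood polynomial for each distinct exponent vector: only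
  variables with different exponents interact, the others having been summed against the
  normalization.\<close>

definition fterm :: "complex \<Rightarrow> (nat \<Rightarrow> complex) \<Rightarrow> nat set \<Rightarrow> (nat \<Rightarrow> nat) \<Rightarrow> complex" where
  "fterm t x S f = (\<Prod>i\<in>S. x i ^ f i) * (\<Prod>i\<in>S. \<Prod>j\<in>{j\<in>S. f j < f i}. rho t (x i) (x j))"

lemma finite_levels: "finite S \<Longrightarrow> finite (levels S K)"
proof -
  assume "finite S"
  then have "finite {f. \<forall>i. (i \<in> S \<longrightarrow> f i \<in> {..K}) \<and> (i \<notin> S \<longrightarrow> f i = 0)}"
    by (intro finite_set_of_finite_funs) auto
  then show ?thesis by (rule finite_subset[rotated]) (auto simp: levels_def)
qed

lemma fterm_split:
  assumes "finite S" "A \<subseteq> S" "f \<in> levels (S - A) K"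
  defines "f' \<equiv> \<lambda>i. if i \<in> A then Suc K else f i"
  shows "fterm t x S f' = (\<Prod>i\<in>A. x i) ^ Suc K * cross t x A (S - A) * fterm t x (S - A) f"
proof -
  have A: "finite A" "finite (S - A)" "A \<inter> (S - A) = {}" "A \<union> (S - A) = S" using assms(1,2) finite_subset by auto
  have f: "f i \<le> K" for i using assms(3) by (cases "i \<in> S - A") (auto simp: levels_def)
  have "(\<Prod>i\<in>S. x i ^ f' i) = (\<Prod>i\<in>A. x i ^ f' i) * (\<Prod>i\<in>S - A. x i ^ f' i)"
    using prod.union_disjoint[OF A(1,2,3)] unfolding A(4) .
  also have "\<dots> = (\<Prod>i\<in>A. x i) ^ Suc K * (\<Prod>i\<in>S - A. x i ^ f i)"
    by (simp add: f'_def prod_power_distrib del: power_Suc)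
  finally have 1: "(\<Prod>i\<in>S. x i ^ f' i) = \<dots>" .
  let ?P = "\<lambda>i. \<Prod>j\<in>{j\<in>S. f' j < f' i}. rho t (x i) (x j)"
  have "(\<Prod>i\<in>S. ?P i) = (\<Prod>i\<in>A. ?P i) * (\<Prod>i\<in>S - A. ?P i)"
    using prod.union_disjoint[OF A(1,2,3)] unfolding A(4) .
  also have "(\<Prod>i\<in>A. ?P i) = cross t x A (S - A)"
    unfolding cross_def
  proof (intro prod.cong refl)
    fix i assume "i \<in> A"
    then show "{j\<in>S. f' j < f' i} = S - A" using f assms(2) by (auto simp: f'_def less_Suc_eq_le)
  qed
  also have "(\<Prod>i\<in>S - A. ?P i) = (\<Prod>i\<in>S - A. \<Prod>j\<in>{j\<in>S - A. f j < f i}. rho t (x i) (x j))"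
  proof (intro prod.cong refl)
    fix i assume "i \<in> S - A"
    then show "{j\<in>S. f' j < f' i} = {j\<in>S - A. f j < f i}" using f[of i] by (auto simp: f'_def)
  qed
  finally show ?thesis unfolding fterm_def 1 by (simp only: mult_ac)
qed

text \<open>The outermost shuffle factor selects the set of variables whose exponent is maximal;
  \<open>fterm_split\<close> is the matching factorization of a term.\<close>

lemma level_shuffle_eq_sum:
  assumes "finite S"
  shows "level_shuffle t x g K S = (\<Sum>f\<in>levels S K. fterm t x S f * (\<Prod>a\<le>K. g a (card {i\<in>S. f i = a})))"
  using assms
proof (induction K arbitrary: S)
  case 0
  have "levels S 0 = {\<lambda>_. 0}" by (auto simp: levels_def)
  then show ?case by (simp add: fterm_def)
next
  case (Suc K)
  define U where "U A f = (\<Prod>i\<in>A. x i) ^ Suc K * cross t x A (S - A) * fterm t x (S - A) f *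
      ((\<Prod>a\<le>K. g a (card {i\<in>S - A. f i = a})) * g (Suc K) (card A))" for A f
  have fin: "finite A" "finite (S - A)" if "A \<in> Pow S" for A using that Suc.prems finite_subset by auto
  have "level_shuffle t x g (Suc K) S = (\<Sum>A\<in>Pow S. \<Sum>f\<in>levels (S - A) K. U A f)"
    unfolding level_shuffle.simps shuffle_def
  proof (intro sum.cong refl)
    fix A assume A: "A \<in> Pow S"
    show "tau x (Suc K) (\<lambda>A. g (Suc K) (card A)) A * level_shuffle t x g K (S - A) * cross t x A (S - A) = (\<Sum>f\<in>levels (S - A) K. U A f)"
      unfolding Suc.IH[OF fin(2)[OF A]] U_def tau_def sum_distrib_left sum_distrib_right
      by (intro sum.cong refl) (simp only: mult_ac)
  qed
  also have "\<dots> = (\<Sum>(A, f)\<in>(SIGMA A:Pow S. levels (S - A) K). U A f)"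
    by (rule sum.Sigma) (use Suc.prems fin finite_levels in auto)
  also have "\<dots> = (\<Sum>f\<in>levels S (Suc K). fterm t x S f * (\<Prod>a\<le>Suc K. g a (card {i\<in>S. f i = a})))"
  proof (rule sum.reindex_bij_witness[where
      j = "\<lambda>(A, f) i. if i \<in> A then Suc K else f i" and
      i = "\<lambda>f. ({i\<in>S. f i = Suc K}, \<lambda>i. if f i = Suc K then 0 else f i)"], goal_cases)
    case (1 c)
    then obtain A f where c: "c = (A, f)" "A \<subseteq> S" "f \<in> levels (S - A) K" by auto
    have "f i \<le> K" for i using c(3) by (cases "i \<in> S - A") (auto simp: levels_def)
    then have "f i \<noteq> Suc K" for i by (metis Suc_n_not_le_n)
    moreover have "f i = 0" if "i \<in> A" for i using c(3) that by (auto simp: levels_def)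
    ultimately show ?case using c by (auto simp: fun_eq_iff)
  next
    case (2 c)
    then obtain A f where c: "c = (A, f)" "A \<subseteq> S" "f \<in> levels (S - A) K" by auto
    have "f i \<le> K" for i using c(3) by (cases "i \<in> S - A") (auto simp: levels_def)
    then show ?case using c by (auto simp: levels_def le_Suc_eq)
  next
    case (3 f)
    then show ?case by (auto simp: levels_def fun_eq_iff)
  next
    case (4 f)
    then show ?case by (auto simp: levels_def le_Suc_eq)
  next
    case (5 c)
    then obtain A f where c: "c = (A, f)" "A \<subseteq> S" "f \<in> levels (S - A) K" by auto
    define f' where "f' = (\<lambda>i. if i \<in> A then Suc K else f i)"
    have "f i \<le> K" for i using c(3) by (cases "i \<in> S - A") (auto simp: levels_def)
    then have le: "f i \<noteq> Suc K" for i by (metis Suc_n_not_le_n)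
    have "{i\<in>S. f' i = Suc K} = A" using le c(2) by (auto simp: f'_def)
    moreover have "{i\<in>S. f' i = a} = {i\<in>S - A. f i = a}" if "a \<le> K" for a
      using that by (auto simp: f'_def)
    ultimately have "(\<Prod>a\<le>Suc K. g a (card {i\<in>S. f' i = a})) = (\<Prod>a\<le>K. g a (card {i\<in>S - A. f i = a})) * g (Suc K) (card A)"
      by simp
    moreover have "fterm t x S f' = (\<Prod>i\<in>A. x i) ^ Suc K * cross t x A (S - A) * fterm t x (S - A) f"
      unfolding f'_def by (rule fterm_split[OF Suc.prems c(2,3)])
    ultimately show ?case unfolding c(1) U_def f'_def[symmetric] prod.case by simp
  qed
  finally show ?case .
qed

section \<open>Symmetrization as an iterated shuffle of single variables\<close>

definition one_elt :: "'i set \<Rightarrow> complex" where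
  "one_elt A = of_bool (card A = 1)"

primrec part_shuffle :: "complex \<Rightarrow> ('i \<Rightarrow> complex) \<Rightarrow> nat list \<Rightarrow> 'i set \<Rightarrow> complex" where
  "part_shuffle t x [] = (\<lambda>S. of_bool (card S = 0))"
| "part_shuffle t x (a # as) = shuffle t x (tau x a one_elt) (part_shuffle t x as)"

lemma shuffle_one_elt:
  assumes "finite S"
  shows "shuffle t x (tau x a one_elt) F S = (\<Sum>s\<in>S. x s ^ a * (\<Prod>j\<in>S - {s}. rho t (x s) (x j)) * F (S - {s}))"
proof -
  have "shuffle t x (tau x a one_elt) F S = (\<Sum>A\<in>(\<lambda>s. {s}) ` S. tau x a one_elt A * F (S - A) * cross t x A (S - A))"
    unfolding shuffle_def
  proof (rule sum.mono_neutral_right)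
    show "\<forall>A\<in>Pow S - (\<lambda>s. {s}) ` S. tau x a one_elt A * F (S - A) * cross t x A (S - A) = 0"
    proof
      fix A assume A: "A \<in> Pow S - (\<lambda>s. {s}) ` S"
      then have "card A \<noteq> 1" by (auto simp: card_1_singleton_iff)
      then show "tau x a one_elt A * F (S - A) * cross t x A (S - A) = 0" by (simp add: tau_def one_elt_def)
    qed
  qed (use assms in auto)
  also have "\<dots> = (\<Sum>s\<in>S. tau x a one_elt {s} * F (S - {s}) * cross t x {s} (S - {s}))"
    by (subst sum.reindex) auto
  also have "\<dots> = (\<Sum>s\<in>S. x s ^ a * (\<Prod>j\<in>S - {s}. rho t (x s) (x j)) * F (S - {s}))"
    by (intro sum.cong refl) (simp add: tau_def one_elt_def cross_def)
  finally show ?thesis .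
qed

definition lterm :: "complex \<Rightarrow> ('i \<Rightarrow> complex) \<Rightarrow> nat list \<Rightarrow> 'i list \<Rightarrow> complex" where
  "lterm t x as xs = (\<Prod>i<length xs. x (xs ! i) ^ (as ! i)) * (\<Prod>j<length xs. \<Prod>i<j. rho t (x (xs ! i)) (x (xs ! j)))"

lemma lterm_Cons:
  assumes "distinct ys"
  shows "lterm t x (a # as) (s # ys) = x s ^ a * (\<Prod>j\<in>set ys. rho t (x s) (x j)) * lterm t x as ys"
proof -
  have "(\<Prod>j\<in>set ys. rho t (x s) (x j)) = (\<Prod>j<length ys. rho t (x s) (x (ys ! j)))"
    using prod.distinct_set_conv_list[OF assms, of "\<lambda>j. rho t (x s) (x j)"]
    by (simp add: prod.list_conv_set_nth atLeast0LessThan)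
  then show ?thesis
    by (simp add: lterm_def prod.lessThan_Suc_shift prod.distrib mult_ac del: prod.lessThan_Suc)
qed

text \<open>The head of the list takes one variable, and the tail permutes the remaining
  ones.\<close>

lemma part_shuffle_eq_permutations:
  assumes "finite S" "length as = card S"
  shows "part_shuffle t x as S = (\<Sum>xs\<in>permutations_of_set S. lterm t x as xs)"
  using assms
proof (induction as arbitrary: S)
  case Nil
  then show ?case by (simp add: lterm_def)
next
  case (Cons a as)
  have ne: "S \<noteq> {}" using Cons.prems by auto
  have "part_shuffle t x (a # as) S = (\<Sum>s\<in>S. x s ^ a * (\<Prod>j\<in>S - {s}. rho t (x s) (x j)) * (\<Sum>ys\<in>permutations_of_set (S - {s}). lterm t x as ys))"
    unfolding part_shuffle.simps shuffle_one_elt[OF Cons.prems(1)]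
    by (intro sum.cong refl arg_cong2[where f = "(*)"] Cons.IH) (use Cons.prems in auto)
  also have "\<dots> = (\<Sum>s\<in>S. \<Sum>ys\<in>permutations_of_set (S - {s}). lterm t x (a # as) (s # ys))"
    unfolding sum_distrib_left
    by (intro sum.cong refl, subst lterm_Cons) (auto simp: permutations_of_set_def)
  also have "\<dots> = (\<Sum>s\<in>S. \<Sum>xs\<in>(#) s ` permutations_of_set (S - {s}). lterm t x (a # as) xs)"
    by (rule sum.cong[OF refl], subst sum.reindex) auto
  also have "\<dots> = (\<Sum>xs\<in>permutations_of_set S. lterm t x (a # as) xs)"
    unfolding permutations_of_set_nonempty[OF ne]
    by (rule sum.UNION_disjoint[symmetric]) (use Cons.prems in auto)
  finally show ?case .
qed

lemma sum_permutes_eq: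
  "(\<Sum>w | w permutes {..<n}. (\<Prod>i<n. x (w i) ^ part \<mu> i) *
      (\<Prod>j<n. \<Prod>i<j. (x (w i) - t * x (w j)) / (x (w i) - x (w j)))) = part_shuffle t x (map (part \<mu>) [0..<n]) {..<n}"
proof -
  let ?as = "map (part \<mu>) [0..<n]"
  have "part_shuffle t x ?as {..<n} = (\<Sum>xs\<in>permutations_of_set {..<n}. lterm t x ?as xs)"
    by (rule part_shuffle_eq_permutations) auto
  also have "\<dots> = (\<Sum>w | w permutes {..<n}. lterm t x ?as (map w [0..<n]))"
  proof (rule sum.reindex_bij_witness[where i = "\<lambda>w. map w [0..<n]" and j = "\<lambda>xs i. if i < n then xs ! i else i"], goal_cases)
    case (1 xs)
    then have xs: "set xs = {..<n}" "distinct xs" by (auto simp: permutations_of_set_def)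
    then have "length xs = n" using distinct_card[of xs] by simp
    then show ?case by (intro nth_equalityI) auto
  next
    case (2 xs)
    then have xs: "set xs = {..<n}" "distinct xs" by (auto simp: permutations_of_set_def)
    then have l: "length xs = n" using distinct_card[of xs] by simp
    have "bij_betw ((!) xs) {..<n} {..<n}" using bij_betw_nth[OF xs(2), of "{..<n}"] l xs by auto
    then have "bij_betw (\<lambda>i. if i < n then xs ! i else i) {..<n} {..<n}"
      by (subst bij_betw_cong[of _ _ "(!) xs"]) auto
    then show ?case by (intro CollectI bij_imp_permutes) (auto split: if_splits)
  next
    case (3 w)
    then show ?case by (auto simp: fun_eq_iff permutes_not_in)
  next
    case (4 w)
    then have w: "w permutes {..<n}" by simp
    show ?case using permutes_inj_on[OF w, of "{0..<n}"] permutes_image[OF w]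
      by (auto simp: permutations_of_set_def distinct_map atLeast0LessThan)
  next
    case (5 xs)
    then have xs: "set xs = {..<n}" "distinct xs" by (auto simp: permutations_of_set_def)
    then have "length xs = n" using distinct_card[of xs] by simp
    then have "map (\<lambda>i. if i < n then xs ! i else i) [0..<n] = xs" by (intro nth_equalityI) auto
    then show ?case by simp
  qed
  also have "\<dots> = (\<Sum>w | w permutes {..<n}. (\<Prod>i<n. x (w i) ^ part \<mu> i) *
      (\<Prod>j<n. \<Prod>i<j. (x (w i) - t * x (w j)) / (x (w i) - x (w j))))"
    unfolding lterm_def by (intro sum.cong refl arg_cong2[where f = "(*)"] prod.cong) (auto simp: rho_def)
  finally show ?thesis ..
qed

text \<open>The t-factorial (t;t)_m / (1 - t)^m, written without a denominator.\<close>

definition tfact :: "complex \<Rightarrow> nat \<Rightarrow> complex" where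
  "tfact t m = (\<Prod>i<m. \<Sum>r\<le>i. t ^ r)"

lemma conv_unit_left: "conv t (\<lambda>m. of_bool (m = 0)) g n = g n"
proof (induction n arbitrary: g)
  case (Suc n)
  have "conv t (\<lambda>m. 0) h n = 0" for h using conv_mult_left[of t 0 "\<lambda>_. 0" h n] by simp
  then show ?case using Suc by simp
qed simp

lemma conv_one_left: "conv t (\<lambda>m. of_bool (m = 1)) (\<lambda>i. of_bool (i = m)) n = of_bool (n = Suc m) * (\<Sum>r\<le>m. t ^ r)"
proof (induction n arbitrary: m)
  case (Suc n)
  have 1: "conv t (\<lambda>m. of_bool (Suc m = 1)) (\<lambda>i. t ^ i * of_bool (i = m)) n = of_bool (n = m) * t ^ m"
    by (simp add: conv_unit_left)
  show ?case
  proof (cases m)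
    case 0
    have "conv t (\<lambda>m. of_bool (m = 1)) (\<lambda>i. 0) n = 0" using conv_mult_right[of t _ 0 "\<lambda>_. 0" n] by simp
    then show ?thesis using 1 0 by simp
  next
    case (Suc m')
    have "conv t (\<lambda>m. of_bool (m = 1)) (\<lambda>i. of_bool (Suc i = m)) n = of_bool (n = m) * (\<Sum>r\<le>m'. t ^ r)"
      using Suc.IH[of m'] Suc by simp
    then show ?thesis unfolding conv.simps 1 using Suc by simp
  qed
qed simp

text \<open>At one level, m singletons shuffle to the t-factorial of m times the indicator of
  m-element sets, by \<open>shuffle_const\<close>. These are the factors that v_\<mu>(t) divides
  out.\<close>

lemma part_shuffle_replicate:
  assumes S: "finite S" "inj_on x S" "\<And>i. i \<in> S \<Longrightarrow> x i \<noteq> 0"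
  shows "part_shuffle t x (replicate m a @ bs) S = tfact t m * shuffle t x (tau x a (\<lambda>A. of_bool (card A = m))) (part_shuffle t x bs) S"
  using S
proof (induction m arbitrary: S)
  case 0
  have "shuffle t x (tau x a (\<lambda>A. of_bool (card A = 0))) (part_shuffle t x bs) S = shuffle t x (\<lambda>A. of_bool (card A = 0)) (part_shuffle t x bs) S"
    by (rule shuffle_cong) (use 0 finite_subset[of _ S] in \<open>auto simp: tau_def\<close>)
  then show ?case using shuffle_unit_left[OF 0(1)] by (simp add: tfact_def)
next
  case (Suc m)
  have sub: "finite T" "inj_on x T" "\<And>i. i \<in> T \<Longrightarrow> x i \<noteq> 0" if "T \<subseteq> S" for T
    using that Suc.prems finite_subset by (auto intro: inj_on_subset)
  have "part_shuffle t x (replicate (Suc m) a @ bs) S = shuffle t x (tau x a one_elt) (\<lambda>T. tfact t m * shuffle t x (tau x a (\<lambda>A. of_bool (card A = m))) (part_shuffle t x bs) T) S"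
    unfolding replicate_Suc append_Cons part_shuffle.simps by (rule shuffle_cong) (use Suc.IH sub in auto)
  also have "\<dots> = tfact t m * shuffle t x (tau x a one_elt) (shuffle t x (tau x a (\<lambda>A. of_bool (card A = m))) (part_shuffle t x bs)) S"
    by (simp add: shuffle_def sum_distrib_left mult_ac)
  also have "shuffle t x (tau x a one_elt) (shuffle t x (tau x a (\<lambda>A. of_bool (card A = m))) (part_shuffle t x bs)) S =
      shuffle t x (shuffle t x (tau x a one_elt) (tau x a (\<lambda>A. of_bool (card A = m)))) (part_shuffle t x bs) S"
    by (rule shuffle_assoc[symmetric]) (rule Suc.prems)
  also have "\<dots> = shuffle t x (\<lambda>A. (\<Sum>r\<le>m. t ^ r) * tau x a (\<lambda>A. of_bool (card A = Suc m)) A) (part_shuffle t x bs) S"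
  proof (rule shuffle_cong)
    fix T assume T: "T \<subseteq> S"
    have "shuffle t x one_elt (\<lambda>A. of_bool (card A = m)) T = conv t (\<lambda>m. of_bool (m = 1)) (\<lambda>i. of_bool (i = m)) (card T)"
      unfolding one_elt_def by (rule shuffle_const[OF sub[OF T]])
    then show "shuffle t x (tau x a one_elt) (tau x a (\<lambda>A. of_bool (card A = m))) T = (\<Sum>r\<le>m. t ^ r) * tau x a (\<lambda>A. of_bool (card A = Suc m)) T"
      unfolding tau_shuffle[OF sub(1)[OF T], symmetric] conv_one_left by (simp add: tau_def)
  qed simp
  also have "\<dots> = (\<Sum>r\<le>m. t ^ r) * shuffle t x (tau x a (\<lambda>A. of_bool (card A = Suc m))) (part_shuffle t x bs) S"
    by (simp add: shuffle_def sum_distrib_left mult_ac)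
  finally show ?case by (simp add: tfact_def mult_ac)
qed

primrec parts_list :: "(nat \<Rightarrow> nat) \<Rightarrow> nat \<Rightarrow> nat list" where
  "parts_list m 0 = replicate (m 0) 0"
| "parts_list m (Suc a) = replicate (m (Suc a)) (Suc a) @ parts_list m a"

lemma part_shuffle_parts_list:
  assumes "finite S" "inj_on x S" "\<And>i. i \<in> S \<Longrightarrow> x i \<noteq> 0"
  shows "part_shuffle t x (parts_list m K) S = (\<Prod>a\<le>K. tfact t (m a)) * level_shuffle t x (\<lambda>a n. of_bool (n = m a)) K S"
  using assms
proof (induction K arbitrary: S)
  case 0
  have "shuffle t x (tau x 0 (\<lambda>A. of_bool (card A = m 0))) (part_shuffle t x []) S = of_bool (card S = m 0)"
  proof -
    have "shuffle t x (tau x 0 (\<lambda>A. of_bool (card A = m 0))) (part_shuffle t x []) S = (\<Sum>A\<in>{S}. of_bool (card A = m 0))"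
      unfolding shuffle_def
    proof (rule sum.mono_neutral_cong_right)
      have "card (S - A) \<noteq> 0" if "A \<in> Pow S - {S}" for A using that 0 by auto
      then show "\<forall>A\<in>Pow S - {S}. tau x 0 (\<lambda>A. of_bool (card A = m 0)) A * part_shuffle t x [] (S - A) * cross t x A (S - A) = 0" by simp
    qed (use 0 in auto)
    then show ?thesis by simp
  qed
  then show ?case using part_shuffle_replicate[OF 0, of t "m 0" 0 "[]"] by simp
next
  case (Suc K)
  have "part_shuffle t x (parts_list m (Suc K)) S = tfact t (m (Suc K)) * shuffle t x (tau x (Suc K) (\<lambda>A. of_bool (card A = m (Suc K)))) (part_shuffle t x (parts_list m K)) S"
    unfolding parts_list.simps by (rule part_shuffle_replicate[OF Suc.prems])
  also have "shuffle t x (tau x (Suc K) (\<lambda>A. of_bool (card A = m (Suc K)))) (part_shuffle t x (parts_list m K)) S =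
    shuffle t x (tau x (Suc K) (\<lambda>A. of_bool (card A = m (Suc K)))) (\<lambda>T. (\<Prod>a\<le>K. tfact t (m a)) * level_shuffle t x (\<lambda>a n. of_bool (n = m a)) K T) S"
  proof (rule shuffle_cong)
    fix T assume T: "T \<subseteq> S"
    show "part_shuffle t x (parts_list m K) T = (\<Prod>a\<le>K. tfact t (m a)) * level_shuffle t x (\<lambda>a n. of_bool (n = m a)) K T"
      by (rule Suc.IH) (use T Suc.prems finite_subset[OF T] inj_on_subset[OF _ T] in auto)
  qed simp
  also have "\<dots> = (\<Prod>a\<le>K. tfact t (m a)) * level_shuffle t x (\<lambda>a n. of_bool (n = m a)) (Suc K) S"
    by (simp add: shuffle_def sum_distrib_left mult_ac)
  finally show ?case by (simp add: mult_ac)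
qed

lemma count_parts_list: "count (mset (parts_list m K)) a = (if a \<le> K then m a else 0)"
  by (induction K) (auto simp: le_Suc_eq)

lemma sorted_parts_list: "sorted (rev (parts_list m K))" "a \<in> set (parts_list m K) \<Longrightarrow> a \<le> K"
proof -
  have "sorted (rev (parts_list m K)) \<and> (\<forall>a\<in>set (parts_list m K). a \<le> K)"
  proof (induction K)
    case (Suc K)
    then show ?case by (auto simp: sorted_append)
  qed simp
  then show "sorted (rev (parts_list m K))" "a \<in> set (parts_list m K) \<Longrightarrow> a \<le> K" by auto
qed

lemma part_list_eq_parts_list:
  assumes "0 \<notin># \<mu>" "\<forall>i\<in>#\<mu>. i \<le> K" "size \<mu> \<le> n"
  shows "map (part \<mu>) [0..<n] = parts_list (\<lambda>a. if a = 0 then n - size \<mu> else count \<mu> a) K"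
proof -
  let ?m = "\<lambda>a. if a = 0 then n - size \<mu> else count \<mu> a"
  define l where "l = rev (sorted_list_of_multiset \<mu>) @ replicate (n - size \<mu>) 0"
  have len: "length (sorted_list_of_multiset \<mu>) = size \<mu>"
    by (metis mset_sorted_list_of_multiset size_mset)
  have "map (part \<mu>) [0..<n] = l"
    by (rule nth_equalityI) (use assms(3) len in \<open>auto simp: l_def part_def nth_append\<close>)
  moreover have "mset l = mset (parts_list ?m K)"
  proof (rule multiset_eqI)
    fix a
    have "a \<notin># \<mu>" if "a > K" using assms(2) that by auto
    then have "count \<mu> a = 0" if "a > K" using that by (simp add: not_in_iff)
    then show "count (mset l) a = count (mset (parts_list ?m K)) a"
      unfolding count_parts_list using assms(1) by (auto simp: l_def not_in_iff)
  qed
  moreover have "sorted (rev l)" by (simp add: l_def sorted_append)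
  ultimately have "rev l = rev (parts_list ?m K)"
    using properties_for_sort[of "rev l" "rev (parts_list ?m K)"] sorted_parts_list(1)[of ?m K] by (simp add: sorted_sort_id)
  then show ?thesis using \<open>map (part \<mu>) [0..<n] = l\<close> by simp
qed

lemma tfact_eq: "t \<noteq> 1 \<Longrightarrow> tfact t m = qpoch t t m / (1 - t) ^ m"
proof -
  assume t: "t \<noteq> 1"
  have "(\<Sum>r\<le>i. t ^ r) = (1 - t * t ^ i) / (1 - t)" for i
    using t sum_gp0[of t i] by simp
  then show ?thesis by (simp add: tfact_def qpoch_def prod_dividef)
qed

lemma tfact_nonzero: "norm t < 1 \<Longrightarrow> tfact t m \<noteq> 0"
  unfolding tfact_def using geometric_nonzero[of t] by (auto simp: lessThan_Suc_atMost[symmetric] simp del: sum.lessThan_Suc)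

lemma hl_norm_eq:
  assumes "0 \<notin># \<mu>" "\<forall>i\<in>#\<mu>. i \<le> K" "norm t < 1"
  shows "hl_norm n \<mu> t = (\<Prod>a\<le>K. tfact t (if a = 0 then n - size \<mu> else count \<mu> a))"
proof -
  have t: "t \<noteq> 1" using assms by auto
  have "(\<Prod>a\<le>K. tfact t (if a = 0 then n - size \<mu> else count \<mu> a)) =
      (\<Prod>a\<in>insert 0 (set_mset \<mu>). tfact t (if a = 0 then n - size \<mu> else count \<mu> a))"
    by (rule prod.mono_neutral_right) (use assms in \<open>auto simp: not_in_iff tfact_def\<close>)
  also have "\<dots> = tfact t (n - size \<mu>) * (\<Prod>a\<in>set_mset \<mu>. tfact t (count \<mu> a))"
    using assms(1) by (subst prod.insert) (auto intro!: prod.cong)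
  finally show ?thesis by (simp add: hl_norm_def tfact_eq[OF t])
qed

lemma card_level_0:
  assumes "finite S" "f \<in> levels S K"
  shows "card {i\<in>S. f i = 0} + (\<Sum>a\<in>{1..K}. card {i\<in>S. f i = a}) = card S"
proof -
  have "S = (\<Union>a\<in>{0..K}. {i\<in>S. f i = a})" using assms(2) by (auto simp: levels_def)
  then have "card S = card (\<Union>a\<in>{0..K}. {i\<in>S. f i = a})" by simp
  also have "\<dots> = (\<Sum>a\<in>{0..K}. card {i\<in>S. f i = a})"
    by (rule card_UN_disjoint) (use assms in auto)
  also have "\<dots> = card {i\<in>S. f i = 0} + (\<Sum>a\<in>{1..K}. card {i\<in>S. f i = a})"
    by (simp add: sum.atLeast_Suc_atMost)
  finally show ?thesis by simp
qed

text \<open>Level 0 is left out: its size within n variables is forced by the other levels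
  (\<open>card_level_0\<close>). The condition is thereby independent of n and survives the
  limit.\<close>

definition ftype :: "nat \<Rightarrow> nat multiset \<Rightarrow> (nat \<Rightarrow> nat) \<Rightarrow> bool" where
  "ftype K \<mu> f \<longleftrightarrow> (\<forall>a\<in>{1..K}. card {i. f i = a} = count \<mu> a)"

text \<open>The t-factorials produced by equal parts, including the padding zeros, are exactly
  v_\<mu>(t), so each distinct exponent vector remains once.\<close>

lemma hl_formula_eq_sum:
  assumes \<mu>: "0 \<notin># \<mu>" "\<forall>i\<in>#\<mu>. i \<le> K" "size \<mu> \<le> n"
    and t: "norm t < 1" and x: "inj_on x {..<n}" "\<And>i. i < n \<Longrightarrow> x i \<noteq> 0"
  shows "hl_formula n \<mu> t x = (\<Sum>f\<in>{f\<in>levels {..<n} K. ftype K \<mu> f}. fterm t x {..<n} f)"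
proof -
  define m where "m a = (if a = 0 then n - size \<mu> else count \<mu> a)" for a
  have "hl_formula n \<mu> t x = 1 / hl_norm n \<mu> t * part_shuffle t x (map (part \<mu>) [0..<n]) {..<n}"
    unfolding hl_formula_def sum_permutes_eq ..
  also have "map (part \<mu>) [0..<n] = parts_list m K" unfolding m_def by (rule part_list_eq_parts_list[OF \<mu>])
  also have "part_shuffle t x (parts_list m K) {..<n} = hl_norm n \<mu> t * level_shuffle t x (\<lambda>a n. of_bool (n = m a)) K {..<n}"
    unfolding hl_norm_eq[OF \<mu>(1,2) t] m_def by (rule part_shuffle_parts_list) (use x in auto)
  also have "1 / hl_norm n \<mu> t * (hl_norm n \<mu> t * level_shuffle t x (\<lambda>a n. of_bool (n = m a)) K {..<n}) = level_shuffle t x (\<lambda>a n. of_bool (n = m a)) K {..<n}"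
    using tfact_nonzero[OF t] by (simp add: hl_norm_eq[OF \<mu>(1,2) t])
  also have "\<dots> = (\<Sum>f\<in>levels {..<n} K. fterm t x {..<n} f * (\<Prod>a\<le>K. of_bool (card {i\<in>{..<n}. f i = a} = m a)))"
    by (rule level_shuffle_eq_sum) simp
  also have "\<dots> = (\<Sum>f\<in>{f\<in>levels {..<n} K. ftype K \<mu> f}. fterm t x {..<n} f)"
  proof (rule sum.mono_neutral_cong_right)
    have lev: "{i\<in>{..<n}. f i = a} = {i. f i = a}" if "f \<in> levels {..<n} K" "a \<noteq> 0" for f a
      using that by (auto simp: levels_def)
    have iff: "(\<forall>a\<le>K. card {i\<in>{..<n}. f i = a} = m a) \<longleftrightarrow> ftype K \<mu> f" if f: "f \<in> levels {..<n} K" for f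
    proof
      assume "\<forall>a\<le>K. card {i\<in>{..<n}. f i = a} = m a"
      then show "ftype K \<mu> f" using lev[OF f] by (auto simp: ftype_def m_def)
    next
      assume F: "ftype K \<mu> f"
      have "(\<Sum>a\<in>{1..K}. card {i\<in>{..<n}. f i = a}) = (\<Sum>a\<in>{1..K}. count \<mu> a)"
        by (intro sum.cong refl) (use F lev[OF f] in \<open>auto simp: ftype_def\<close>)
      also have "\<dots> = size \<mu>"
      proof -
        have "set_mset \<mu> \<subseteq> {1..K}"
        proof
          fix i assume i: "i \<in> set_mset \<mu>"
          then have "i \<noteq> 0" using \<mu>(1) by metis
          moreover have "i \<le> K" using i \<mu>(2) by blast
          ultimately show "i \<in> {1..K}" by simp
        qed
        then show ?thesis unfolding size_multiset_overloaded_eq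
          by (intro sum.mono_neutral_right) (auto simp: count_eq_zero_iff)
      qed
      finally have "card {i\<in>{..<n}. f i = 0} = n - size \<mu>" using card_level_0[OF _ f] by simp
      then show "\<forall>a\<le>K. card {i\<in>{..<n}. f i = a} = m a"
        using F lev[OF f] by (auto simp: ftype_def m_def)
    qed
    show "\<forall>f\<in>levels {..<n} K - {f\<in>levels {..<n} K. ftype K \<mu> f}. fterm t x {..<n} f * (\<Prod>a\<le>K. of_bool (card {i\<in>{..<n}. f i = a} = m a)) = 0"
      using iff by auto
    show "fterm t x {..<n} f * (\<Prod>a\<le>K. of_bool (card {i\<in>{..<n}. f i = a} = m a)) = fterm t x {..<n} f"
      if "f \<in> {f\<in>levels {..<n} K. ftype K \<mu> f}" for f
      using that iff[of f] by auto
  qed (auto simp: finite_levels)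
  finally show ?thesis .
qed

section \<open>Dominated convergence and infinite products\<close>

text \<open>The majorant makes the finite partial sums converge uniformly in n, so that the two
  limits may be exchanged.\<close>

lemma tannery_infsum:
  fixes f :: "nat \<Rightarrow> 'a \<Rightarrow> complex"
  assumes lim: "\<And>x. x \<in> A \<Longrightarrow> (\<lambda>n. f n x) \<longlonglongrightarrow> g x"
    and bound: "\<And>n x. x \<in> A \<Longrightarrow> norm (f n x) \<le> b x" and b: "b summable_on A"
  shows "g summable_on A" "(\<lambda>n. infsum (f n) A) \<longlonglongrightarrow> infsum g A"
proof -
  have "norm (g x) \<le> b x" if "x \<in> A" for x
    using Lim_norm_ubound[OF sequentially_bot lim[OF that]] bound[OF that] by auto
  from Infinite_Sum.abs_summable_on_comparison_test'[OF b this] have g: "g summable_on A"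
    by (rule abs_summable_summable)
  show "g summable_on A" by (fact g)
  show "(\<lambda>n. infsum (f n) A) \<longlonglongrightarrow> infsum g A"
  proof (rule swap_uniform_limit')
    show "\<forall>\<^sub>F X in finite_subsets_at_top A. ((\<lambda>n. \<Sum>x\<in>X. f n x) \<longlonglongrightarrow> (\<Sum>x\<in>X. g x))"
      by (rule eventually_finite_subsets_at_top_weakI) (auto intro!: tendsto_sum lim)
    show "((\<lambda>X. \<Sum>x\<in>X. g x) \<longlongrightarrow> infsum g A) (finite_subsets_at_top A)"
      using has_sum_infsum[OF g] by (simp add: has_sum_def)
    show "uniform_limit UNIV (\<lambda>X n. \<Sum>x\<in>X. f n x) (\<lambda>n. infsum (f n) A) (finite_subsets_at_top A)"
      using Weierstrass_m_test_general[of A UNIV "\<lambda>x n. f n x" b] bound b by simp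
  qed auto
qed

text \<open>For n >= 0 the term is (\<rho>^n A)^n, which is eventually below 2^(-n); the negative
  half is symmetric.\<close>

lemma summable_on_int_gaussian:
  fixes \<rho> A :: real
  assumes "0 \<le> \<rho>" "\<rho> < 1" "0 \<le> A"
  shows "(\<lambda>m::int. \<rho> ^ nat (m * m) * A ^ nat \<bar>m\<bar>) summable_on UNIV"
proof -
  define g where "g n = \<rho> ^ (n * n) * A ^ n" for n :: nat
  have g0: "g n \<ge> 0" for n using assms by (simp add: g_def)
  have "(\<lambda>n. \<rho> ^ n * A) \<longlonglongrightarrow> 0 * A"
    by (intro tendsto_intros LIMSEQ_power_zero) (use assms in auto)
  then have "eventually (\<lambda>n. \<rho> ^ n * A < 1 / 2) sequentially"
    by (rule order_tendstoD) simp
  then have "eventually (\<lambda>n. norm (g n) \<le> (1 / 2) ^ n) sequentially"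
  proof eventually_elim
    case (elim n)
    have "g n = (\<rho> ^ n * A) ^ n" by (simp add: g_def power_mult_distrib power_mult)
    also have "\<dots> \<le> (1 / 2) ^ n" using elim assms by (intro power_mono) auto
    finally show ?case using g0[of n] by simp
  qed
  then have "summable g" by (rule summable_comparison_test_ev) simp
  then have gs: "g summable_on UNIV" using g0 by (intro summable_nonneg_imp_summable_on) auto
  define f where "f m = \<rho> ^ nat (m * m) * A ^ nat \<bar>m\<bar>" for m :: int
  have f: "f (int n) = g n" "f (- int n) = g n" for n by (simp_all add: f_def g_def flip: of_nat_mult)
  have "f summable_on range int"
    using gs by (subst summable_on_reindex) (auto simp: o_def f)
  moreover have "f summable_on range (\<lambda>n. - int n)"
    using gs by (subst summable_on_reindex) (auto simp: o_def f inj_on_def)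
  ultimately have "f summable_on (range int \<union> range (\<lambda>n. - int n))"
    by (rule summable_on_union)
  moreover have "range int \<union> range (\<lambda>n. - int n) = UNIV"
  proof -
    have "m \<in> range int \<union> range (\<lambda>n. - int n)" for m :: int by (cases m rule: int_cases2) auto
    then show ?thesis by blast
  qed
  ultimately show ?thesis by (simp add: f_def[abs_def])
qed

lemma norm_qpoch_bounds:
  assumes "norm q < 1"
  shows "norm (qpoch a q n) \<le> exp (norm a / (1 - norm q))"
    "norm (qpoch a q n - 1) \<le> exp (norm a / (1 - norm q)) - 1"
proof -
  have "(\<Sum>i<n. norm (a * q ^ i)) = norm a * (\<Sum>i<n. norm q ^ i)"
    by (simp add: norm_mult norm_power sum_distrib_left)
  also have "\<dots> = norm a * ((1 - norm q ^ n) / (1 - norm q))" using assms by (simp add: sum_gp_strict)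
  also have "\<dots> \<le> norm a * (1 / (1 - norm q))"
    using assms by (intro mult_left_mono divide_right_mono) auto
  finally have s: "(\<Sum>i<n. norm (a * q ^ i)) \<le> norm a / (1 - norm q)" by simp
  have e: "(\<Prod>i<n. 1 + norm (- (a * q ^ i))) \<le> exp (norm a / (1 - norm q))"
    using prod_le_exp_sum[of "{..<n}" "\<lambda>i. norm (- (a * q ^ i))"] s by (auto intro: order_trans)
  show "norm (qpoch a q n - 1) \<le> exp (norm a / (1 - norm q)) - 1"
    using norm_prod_minus1_le_prod_minus1[of "\<lambda>i. - (a * q ^ i)" "{..<n}"] e by (simp add: qpoch_def)
  then show "norm (qpoch a q n) \<le> exp (norm a / (1 - norm q))"
    using norm_triangle_ineq[of "qpoch a q n - 1" 1] by simp
qed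

section \<open>Infinite products\<close>

lemma convergent_prod_qpoch:
  assumes "norm q < 1"
  shows "convergent_prod (\<lambda>i. 1 - a * q ^ i :: complex)"
proof -
  have "summable (\<lambda>i. norm (a * q ^ i))"
    using assms by (simp add: norm_mult norm_power summable_geometric)
  then show ?thesis
    by (intro abs_convergent_prod_imp_convergent_prod summable_imp_abs_convergent_prod) simp
qed

lemma qpoch_tendsto:
  assumes "norm q < 1"
  shows "(\<lambda>n. qpoch a q n) \<longlonglongrightarrow> qpoch_inf a q"
  using convergent_prod_LIMSEQ[OF convergent_prod_qpoch[OF assms, of a]]
  unfolding qpoch_def qpoch_inf_def by (simp add: LIMSEQ_lessThan_iff_atMost)

lemma norm_qpoch_inf_minus_1:
  assumes "norm q < 1"
  shows "norm (qpoch_inf a q - 1) \<le> exp (norm a / (1 - norm q)) - 1"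
  by (rule Lim_norm_ubound[OF _ tendsto_diff[OF qpoch_tendsto[OF assms] tendsto_const]])
    (use norm_qpoch_bounds[OF assms] in auto)

lemma qpoch_inf_0 [simp]: "qpoch_inf 0 q = 1"
  by (simp add: qpoch_inf_def)

lemma qpoch_inf_nonzero:
  assumes "norm q < 1" "\<And>i. a * q ^ i \<noteq> 1"
  shows "qpoch_inf a q \<noteq> 0"
  unfolding qpoch_inf_def using assms by (intro prodinf_nonzero convergent_prod_qpoch) auto

lemma qpoch_Suc_left: "qpoch a q (Suc n) = (1 - a) * qpoch (a * q) q n"
  unfolding qpoch_def prod.lessThan_Suc_shift by (simp add: mult.assoc)

lemma qpoch_inf_rec:
  assumes "norm q < 1"
  shows "qpoch_inf a q = (1 - a) * qpoch_inf (a * q) q"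
proof (rule LIMSEQ_unique)
  show "(\<lambda>n. qpoch a q (Suc n)) \<longlonglongrightarrow> qpoch_inf a q"
    using qpoch_tendsto[OF assms] by (rule LIMSEQ_Suc)
  show "(\<lambda>n. qpoch a q (Suc n)) \<longlonglongrightarrow> (1 - a) * qpoch_inf (a * q) q"
    unfolding qpoch_Suc_left by (intro tendsto_intros qpoch_tendsto assms)
qed

lemma qpoch_split: "qpoch a q (m * n) = (\<Prod>s<m. qpoch (a * q ^ s) (q ^ m) n)"
proof -
  have "qpoch a q (m * n) = (\<Prod>i<n. \<Prod>s<m. 1 - a * q ^ (m * i + s))"
    unfolding qpoch_def
  proof (induction n)
    case (Suc n)
    have "{..<m * Suc n} = {..<m * n} \<union> (\<lambda>s. m * n + s) ` {..<m}"
    proof (intro equalityI subsetI)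
      fix x assume x: "x \<in> {..<m * Suc n}"
      show "x \<in> {..<m * n} \<union> (\<lambda>s. m * n + s) ` {..<m}"
      proof (cases "x < m * n")
        case False
        then show ?thesis using x by (intro UnI2 image_eqI[of _ _ "x - m * n"]) auto
      qed auto
    qed (auto simp: less_Suc_eq)
    then have "(\<Prod>i<m * Suc n. 1 - a * q ^ i) = (\<Prod>i<m * n. 1 - a * q ^ i) * (\<Prod>i\<in>(\<lambda>s. m * n + s) ` {..<m}. 1 - a * q ^ i)"
      by (simp only:) (subst prod.union_disjoint, auto)
    then show ?case using Suc by (simp add: prod.reindex inj_on_def)
  qed simp
  also have "\<dots> = (\<Prod>s<m. qpoch (a * q ^ s) (q ^ m) n)"
    unfolding qpoch_def power_add power_mult by (subst prod.swap) (simp add: mult_ac)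
  finally show ?thesis .
qed

text \<open>The exponents are sorted by their residue modulo m.\<close>

lemma qpoch_inf_split:
  assumes "norm q < 1" "m > 0"
  shows "qpoch_inf a q = (\<Prod>s<m. qpoch_inf (a * q ^ s) (q ^ m))"
proof (rule LIMSEQ_unique)
  show "(\<lambda>n. qpoch a q (m * n)) \<longlonglongrightarrow> qpoch_inf a q"
    using LIMSEQ_subseq_LIMSEQ[OF qpoch_tendsto[OF assms(1), of a], of "\<lambda>n. m * n"] assms
    by (simp add: o_def strict_mono_def)
  have "norm (q ^ m) < 1" using assms by (simp add: norm_power power_less_one_iff)
  then show "(\<lambda>n. qpoch a q (m * n)) \<longlonglongrightarrow> (\<Prod>s<m. qpoch_inf (a * q ^ s) (q ^ m))"
    unfolding qpoch_split by (intro tendsto_prod qpoch_tendsto)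
qed

lemma power_neq_1: "norm (q :: complex) < 1 \<Longrightarrow> i > 0 \<Longrightarrow> q ^ i \<noteq> 1"
  by (metis norm_one norm_power power_less_one_iff norm_ge_zero less_irrefl)

lemma qpoch_self_nonzero:
  assumes "norm q < 1"
  shows "qpoch q q n \<noteq> 0" "qpoch_inf q q \<noteq> 0"
proof -
  have *: "q * q ^ i \<noteq> 1" for i using power_neq_1[OF assms, of "Suc i"] by simp
  show "qpoch q q n \<noteq> 0" using * by (auto simp: qpoch_def)
  show "qpoch_inf q q \<noteq> 0" using * by (intro qpoch_inf_nonzero assms) auto
qed

lemma qpoch_self_inverse_bounded:
  assumes "norm q < 1"
  obtains C where "C > 0" "\<And>n. inverse (norm (qpoch q q n)) \<le> C"
proof -
  have "(\<lambda>n. inverse (qpoch q q n)) \<longlonglongrightarrow> inverse (qpoch_inf q q)"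
    using assms qpoch_self_nonzero by (intro tendsto_inverse qpoch_tendsto) auto
  then have "Bseq (\<lambda>n. inverse (qpoch q q n))" by (rule convergent_imp_Bseq[OF convergentI])
  then show ?thesis using that by (auto simp: Bseq_def norm_inverse)
qed

section \<open>The limit of the determinant\<close>

lemma prod_lessThan_add: "(\<Prod>l<a + b. f l) = (\<Prod>l<a. f l) * (\<Prod>l<b. f (a + l))"
  for f :: "nat \<Rightarrow> 'a :: comm_monoid_mult"
  by (induction b) (simp_all add: mult.assoc)

lemma coeff_times_linear: "coeff (p * [:1, b:]) (Suc d) = coeff p (Suc d) + b * coeff p d"
  for b :: complex
  by (simp add: mult_pCons_right)

text \<open>Rothe's form of the q-binomial theorem for the half-integral progression r, r^3, r^5,
  ..., multiplied out so that no q-binomial coefficient has to be divided. The induction is the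
  q-Pascal rule.\<close>

lemma rothe:
  fixes r q :: complex
  assumes "q = r\<^sup>2" "c \<le> N"
  shows "coeff (\<Prod>l<N. [:1, r ^ (2 * l + 1):]) c * (qpoch q q c * qpoch q q (N - c)) = r ^ (c * c) * qpoch q q N"
  using assms(2)
proof (induction N arbitrary: c)
  case 0
  then show ?case by (simp add: qpoch_0)
next
  case (Suc N)
  let ?R = "\<lambda>N. \<Prod>l<N. [:1, r ^ (2 * l + 1):]"
  have deg: "degree (?R N) \<le> N" for N
  proof (induction N)
    case (Suc N)
    have "degree (?R N * [:1, r ^ (2 * N + 1):]) \<le> N + 1"
      by (rule order_trans[OF degree_mult_le add_mono[OF Suc]]) simp
    then show ?case by simp
  qed simp
  show ?case
  proof (cases c)
    case 0
    have "coeff (?R N) 0 = 1" for N by (simp flip: poly_0_coeff_0 add: poly_prod)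
    then show ?thesis using 0 by (simp add: qpoch_0)
  next
    case (Suc d)
    have R: "?R (Suc N) = ?R N * [:1, r ^ (2 * N + 1):]" by simp
    show ?thesis
    proof (cases "d = N")
      case True
      have "coeff (?R N) (Suc N) = 0" using deg[of N] by (intro coeff_eq_0) simp
      then have "coeff (?R (Suc N)) c = r ^ (2 * N + 1) * coeff (?R N) N"
        unfolding R Suc True coeff_times_linear by simp
      moreover have "coeff (?R N) N * qpoch q q N = r ^ (N * N) * qpoch q q N"
        using Suc.IH[of N] by (simp add: qpoch_0)
      moreover have "r ^ (2 * N + 1) * r ^ (N * N) = r ^ (Suc N * Suc N)"
        unfolding power_add[symmetric] by (rule arg_cong[where f = "power r"]) simp
      ultimately show ?thesis using Suc True by (simp add: qpoch_Suc qpoch_0) (metis mult.assoc mult.left_commute)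
    next
      case False
      then obtain e where e: "N = Suc (d + e)" using Suc Suc.prems less_imp_Suc_add[of d N] by auto
      define A B P Q U where "A = coeff (?R N) (Suc d)" and "B = coeff (?R N) d"
        and "P = qpoch q q d" and "Q = qpoch q q e" and "U = qpoch q q N"
      have 1: "A * (P * (1 - q * q ^ d) * Q) = r ^ (Suc d * Suc d) * U"
        using Suc.IH[of "Suc d"] by (simp add: A_def P_def Q_def U_def qpoch_Suc e)
      have 2: "B * (P * (Q * (1 - q * q ^ e))) = r ^ (d * d) * U"
        using Suc.IH[of d] by (simp add: B_def P_def Q_def U_def qpoch_Suc e)
      have "r ^ (2 * N + 1) * r ^ (d * d) = r ^ (Suc d * Suc d) * r ^ (2 * Suc e)"
        unfolding power_add[symmetric] by (rule arg_cong[where f = "power r"]) (simp add: e)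
      then have "r ^ (2 * N + 1) * r ^ (d * d) = r ^ (Suc d * Suc d) * (q * q ^ e)"
        unfolding power_mult assms(1) by simp
      then have 3: "r ^ (2 * N + 1) * (r ^ (d * d) * U) * (1 - q * q ^ d) = r ^ (Suc d * Suc d) * U * (q * q ^ e) * (1 - q * q ^ d)"
        by (metis mult.assoc mult.commute)
      have q: "(q * q ^ e) * (q * q ^ d) = q * q ^ N"
        by (simp add: e power_add mult_ac)
      have "(A + r ^ (2 * N + 1) * B) * ((P * (1 - q * q ^ d)) * (Q * (1 - q * q ^ e))) =
        A * (P * (1 - q * q ^ d) * Q) * (1 - q * q ^ e) + r ^ (2 * N + 1) * (B * (P * (Q * (1 - q * q ^ e)))) * (1 - q * q ^ d)"
        by (simp add: algebra_simps)
      also have "\<dots> = r ^ (Suc d * Suc d) * U * (1 - (q * q ^ e) * (q * q ^ d))"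
        unfolding 1 2 3 by (simp add: algebra_simps)
      also have "\<dots> = r ^ (Suc d * Suc d) * (U * (1 - q * q ^ N))" unfolding q by simp
      finally show ?thesis
        unfolding R Suc coeff_times_linear by (simp add: A_def B_def P_def Q_def U_def qpoch_Suc e)
    qed
  qed
qed

text \<open>With q = r^2 the variables are q^((\<sigma> + 1) / 2) q^l. By homogeneity they absorb
  the weight q^((\<sigma> + 1) |\<mu>| / 2).\<close>

definition geom :: "complex \<Rightarrow> nat \<Rightarrow> nat \<Rightarrow> complex" where
  "geom r \<sigma> l = r ^ (2 * l + \<sigma> + 1)"

text \<open>For nonzero r the factor (1 + y)^\<sigma> makes the roots an unbroken geometric
  progression of ratio r^2 and length 2n + \<sigma>, symmetric about -1.\<close>

definition kerp :: "complex \<Rightarrow> nat \<Rightarrow> nat \<Rightarrow> complex poly" where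
  "kerp r \<sigma> n = [:1, 1:] ^ \<sigma> * ker (geom r \<sigma>) {..<n}"

lemma degree_kerp: "degree (kerp r \<sigma> n) \<le> 2 * n + \<sigma>"
proof -
  have "degree (kerp r \<sigma> n) \<le> degree ([:1, 1:] ^ \<sigma> :: complex poly) + degree (ker (geom r \<sigma>) {..<n})"
    unfolding kerp_def by (rule degree_mult_le)
  also have "degree ([:1, 1:] ^ \<sigma> :: complex poly) \<le> \<sigma>"
    using degree_power_le[of "[:1, 1:] :: complex poly" \<sigma>] by simp
  also have "degree (ker (geom r \<sigma>) {..<n}) \<le> 2 * n"
    using degree_ker_le[of "geom r \<sigma>" "{..<n}"] by simp
  finally show ?thesis by simp
qed

text \<open>The dilation moves one end of the progression of roots to the normal form of
  \<open>rothe\<close>. The power of r in front collects the constant terms of the factors x l +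
  y.\<close>

lemma kerp_scaled:
  assumes "\<sigma> \<in> {0, 1}"
  shows "pcompose (kerp r \<sigma> n) [:0, r ^ (2 * n + \<sigma>):] =
    Polynomial.smult (r ^ (n * n + \<sigma> * n)) (\<Prod>l<2 * n + \<sigma>. [:1, r ^ (2 * l + 1):])"
proof (intro iffD1[OF poly_eq_poly_eq_iff] ext)
  fix z :: complex
  have c0: "(\<Prod>l<n. r ^ (2 * l + \<sigma> + 1)) = r ^ (n * n + \<sigma> * n)"
  proof (induction n)
    case (Suc n)
    have "r ^ (n * n + \<sigma> * n) * r ^ (2 * n + \<sigma> + 1) = r ^ (Suc n * Suc n + \<sigma> * Suc n)"
      unfolding power_add[symmetric] by (rule arg_cong[where f = "power r"]) simp
    then show ?case using Suc by simp
  qed simp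
  have rev: "(\<Prod>l<n. 1 + r ^ (2 * (n - Suc l) + 1) * z) = (\<Prod>l<n. 1 + r ^ (2 * l + 1) * z)"
    by (rule prod.nat_diff_reindex[of "\<lambda>l. 1 + r ^ (2 * l + 1) * z"])
  have "(\<Prod>l<n. (1 + geom r \<sigma> l * (r ^ (2 * n + \<sigma>) * z)) * (geom r \<sigma> l + r ^ (2 * n + \<sigma>) * z)) =
      (\<Prod>l<n. (1 + r ^ (2 * (n + \<sigma> + l) + 1) * z) * (r ^ (2 * l + \<sigma> + 1) * (1 + r ^ (2 * (n - Suc l) + 1) * z)))"
  proof (intro prod.cong refl arg_cong2[where f = "(*)"])
    fix l assume "l \<in> {..<n}"
    then obtain d where d: "n = Suc (l + d)" using less_imp_Suc_add by auto
    have "r ^ (2 * l + \<sigma> + 1) * r ^ (2 * n + \<sigma>) = r ^ (2 * (n + \<sigma> + l) + 1)"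
      unfolding power_add[symmetric] by (rule arg_cong[where f = "power r"]) simp
    then show "1 + geom r \<sigma> l * (r ^ (2 * n + \<sigma>) * z) = 1 + r ^ (2 * (n + \<sigma> + l) + 1) * z"
      unfolding geom_def by (metis mult.assoc)
    have "r ^ (2 * l + \<sigma> + 1) * r ^ (2 * (n - Suc l) + 1) = r ^ (2 * n + \<sigma>)"
      unfolding power_add[symmetric] by (rule arg_cong[where f = "power r"]) (simp add: d)
    then have *: "r ^ (2 * n + \<sigma>) * z = r ^ (2 * l + \<sigma> + 1) * (r ^ (2 * (n - Suc l) + 1) * z)"
      by (simp only: mult.assoc[symmetric])
    show "geom r \<sigma> l + r ^ (2 * n + \<sigma>) * z = r ^ (2 * l + \<sigma> + 1) * (1 + r ^ (2 * (n - Suc l) + 1) * z)"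
      by (simp only: geom_def * distrib_left mult_1_right)
  qed
  also have "\<dots> = (\<Prod>l<n. 1 + r ^ (2 * (n + \<sigma> + l) + 1) * z) * (r ^ (n * n + \<sigma> * n) * (\<Prod>l<n. 1 + r ^ (2 * l + 1) * z))"
    unfolding prod.distrib c0 rev ..
  finally have "(\<Prod>l<n. (1 + geom r \<sigma> l * (r ^ (2 * n + \<sigma>) * z)) * (geom r \<sigma> l + r ^ (2 * n + \<sigma>) * z)) = \<dots>" .
  moreover have "(\<Prod>l<2 * n + \<sigma>. 1 + r ^ (2 * l + 1) * z) =
     (\<Prod>l<n. 1 + r ^ (2 * l + 1) * z) * (1 + r ^ (2 * n + 1) * z) ^ \<sigma> * (\<Prod>l<n. 1 + r ^ (2 * (n + \<sigma> + l) + 1) * z)"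
  proof -
    have n: "2 * n + \<sigma> = (n + \<sigma>) + n" by simp
    have "(\<Prod>l<n + \<sigma>. 1 + r ^ (2 * l + 1) * z) = (\<Prod>l<n. 1 + r ^ (2 * l + 1) * z) * (1 + r ^ (2 * n + 1) * z) ^ \<sigma>"
      using assms by auto
    then show ?thesis unfolding n prod_lessThan_add by simp
  qed
  ultimately show "poly (pcompose (kerp r \<sigma> n) [:0, r ^ (2 * n + \<sigma>):]) z =
     poly (Polynomial.smult (r ^ (n * n + \<sigma> * n)) (\<Prod>l<2 * n + \<sigma>. [:1, r ^ (2 * l + 1):])) z"
    using assms by (auto simp: poly_pcompose kerp_def poly_ker poly_prod mult_ac)
qed

lemma coeff_pcompose_linear: "coeff (pcompose p [:0, b:]) c = coeff p c * b ^ c" for b :: complex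
proof (induction p arbitrary: c)
  case (pCons a p)
  then show ?case by (cases c) (simp_all add: pcompose_pCons)
qed simp

lemma kerp_coeff:
  assumes "\<sigma> \<in> {0, 1}" "c \<le> 2 * n + \<sigma>" "q = r\<^sup>2"
  shows "coeff (kerp r \<sigma> n) c * r ^ ((2 * n + \<sigma>) * c) * (qpoch q q c * qpoch q q (2 * n + \<sigma> - c)) =
    r ^ (n * n + \<sigma> * n + c * c) * qpoch q q (2 * n + \<sigma>)"
proof -
  have "coeff (kerp r \<sigma> n) c * r ^ ((2 * n + \<sigma>) * c) = r ^ (n * n + \<sigma> * n) * coeff (\<Prod>l<2 * n + \<sigma>. [:1, r ^ (2 * l + 1):]) c"
    unfolding power_mult coeff_pcompose_linear[symmetric] kerp_scaled[OF assms(1)] by simp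
  then have "coeff (kerp r \<sigma> n) c * r ^ ((2 * n + \<sigma>) * c) * (qpoch q q c * qpoch q q (2 * n + \<sigma> - c)) =
     r ^ (n * n + \<sigma> * n) * (coeff (\<Prod>l<2 * n + \<sigma>. [:1, r ^ (2 * l + 1):]) c * (qpoch q q c * qpoch q q (2 * n + \<sigma> - c)))"
    by simp
  then show ?thesis unfolding rothe[OF assms(3,2)] by (simp add: power_add)
qed

definition gauss_exponent :: "nat \<Rightarrow> int \<Rightarrow> nat" where
  "gauss_exponent \<sigma> m = nat (m * (m - int \<sigma>))"

lemma gauss_exponent_nonneg: "\<sigma> \<in> {0, 1} \<Longrightarrow> 0 \<le> m * (m - int \<sigma>)"
  by (cases "m \<le> 0") (auto simp: mult_nonpos_nonpos)

text \<open>The coefficient of \<open>y\<^sup>m\<close> in \<open>y\<^sup>-\<^sup>n\<close> times the polynomial.\<close>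

definition kerp_coeff_at :: "complex \<Rightarrow> nat \<Rightarrow> nat \<Rightarrow> int \<Rightarrow> complex" where
  "kerp_coeff_at r \<sigma> n m = (if - int n \<le> m \<and> m \<le> int n + int \<sigma> then coeff (kerp r \<sigma> n) (nat (m + int n)) else 0)"

lemma kerp_coeff_at_eq:
  assumes "\<sigma> \<in> {0, 1}" "- int n \<le> m" "m \<le> int n + int \<sigma>" and q: "q = r\<^sup>2" "norm q < 1" "r \<noteq> 0"
  shows "kerp_coeff_at r \<sigma> n m = r ^ gauss_exponent \<sigma> m * (qpoch q q (2 * n + \<sigma>) * inverse (qpoch q q (nat (m + int n))) * inverse (qpoch q q (nat (int n + int \<sigma> - m))))"
proof -
  define c where "c = nat (m + int n)"
  have c: "c \<le> 2 * n + \<sigma>" "2 * n + \<sigma> - c = nat (int n + int \<sigma> - m)" "m = int c - int n"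
    using assms by (auto simp: c_def)
  \<comment> \<open>With m = c - n the three exponents of \<open>kerp_coeff\<close> combine into m
    (m - \<sigma>), free of n.\<close>
  have "int (n * n + \<sigma> * n + c * c) = int ((2 * n + \<sigma>) * c + gauss_exponent \<sigma> m)"
    using gauss_exponent_nonneg[OF assms(1), of m] by (simp add: gauss_exponent_def c(3) algebra_simps)
  then have e: "n * n + \<sigma> * n + c * c = (2 * n + \<sigma>) * c + gauss_exponent \<sigma> m" by (rule of_nat_eq_iff[THEN iffD1])
  have "coeff (kerp r \<sigma> n) c * (qpoch q q c * qpoch q q (2 * n + \<sigma> - c)) = r ^ gauss_exponent \<sigma> m * qpoch q q (2 * n + \<sigma>)"
    using kerp_coeff[OF assms(1) c(1) q(1)] q(3) unfolding e power_add by (simp add: mult_ac)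
  then show ?thesis
    using assms qpoch_self_nonzero[OF q(2)] unfolding c(2)[symmetric] c_def[symmetric] kerp_coeff_at_def
    by (simp add: field_simps)
qed

lemma kerp_coeff_at_tendsto:
  assumes "\<sigma> \<in> {0, 1}" and q: "q = r\<^sup>2" "norm q < 1" "r \<noteq> 0"
  shows "(\<lambda>n. kerp_coeff_at r \<sigma> n m) \<longlonglongrightarrow> r ^ gauss_exponent \<sigma> m / qpoch_inf q q"
proof (rule Lim_transform_eventually)
  have Q: "(\<lambda>n. qpoch q q (g n)) \<longlonglongrightarrow> qpoch_inf q q" if "filterlim g at_top sequentially" for g
    using filterlim_compose[OF qpoch_tendsto[OF q(2)] that] .
  have "(\<lambda>n. r ^ gauss_exponent \<sigma> m * (qpoch q q (2 * n + \<sigma>) * inverse (qpoch q q (nat (m + int n))) * inverse (qpoch q q (nat (int n + int \<sigma> - m)))))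
      \<longlonglongrightarrow> r ^ gauss_exponent \<sigma> m * (qpoch_inf q q * inverse (qpoch_inf q q) * inverse (qpoch_inf q q))"
  proof (intro tendsto_intros Q qpoch_self_nonzero q)
    show "filterlim (\<lambda>n. 2 * n + \<sigma>) at_top sequentially"
      by (rule filterlim_at_top_mono[OF filterlim_ident]) (simp add: eventually_sequentially)
    have "filterlim (\<lambda>n. n - nat \<bar>m\<bar>) at_top sequentially" by (rule filterlim_minus_const_nat_at_top)
    then show "filterlim (\<lambda>n. nat (m + int n)) at_top sequentially" "filterlim (\<lambda>n. nat (int n + int \<sigma> - m)) at_top sequentially"
      by (rule filterlim_at_top_mono, intro always_eventually allI, linarith)+
  qed
  then show "(\<lambda>n. r ^ gauss_exponent \<sigma> m * (qpoch q q (2 * n + \<sigma>) * inverse (qpoch q q (nat (m + int n))) * inverse (qpoch q q (nat (int n + int \<sigma> - m)))))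
      \<longlonglongrightarrow> r ^ gauss_exponent \<sigma> m / qpoch_inf q q"
    using qpoch_self_nonzero[OF q(2)] by (simp add: field_simps)
  have "eventually (\<lambda>n. n \<ge> nat \<bar>m\<bar>) sequentially" by (rule eventually_ge_at_top)
  then show "eventually (\<lambda>n. r ^ gauss_exponent \<sigma> m * (qpoch q q (2 * n + \<sigma>) * inverse (qpoch q q (nat (m + int n))) * inverse (qpoch q q (nat (int n + int \<sigma> - m)))) = kerp_coeff_at r \<sigma> n m) sequentially"
  proof eventually_elim
    case (elim n)
    then show ?case using kerp_coeff_at_eq[OF assms(1) _ _ q, of n m] by simp
  qed
qed

text \<open>Dominated convergence requires a bound uniform in n: the q-factorials in the numerator
  are bounded and those in the denominator are bounded away from 0.\<close>

lemma kerp_coeff_at_bound: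
  assumes "\<sigma> \<in> {0, 1}" and q: "q = r\<^sup>2" "norm q < 1" "r \<noteq> 0"
  obtains C where "C > 0" "\<And>n m. norm (kerp_coeff_at r \<sigma> n m) \<le> C * norm r ^ gauss_exponent \<sigma> m"
proof -
  obtain D where D: "D > 0" "\<And>n. inverse (norm (qpoch q q n)) \<le> D"
    using qpoch_self_inverse_bounded[OF q(2)] by blast
  define E where "E = exp (norm q / (1 - norm q))"
  have "norm (kerp_coeff_at r \<sigma> n m) \<le> (E * D * D) * norm r ^ gauss_exponent \<sigma> m" for n m
  proof (cases "- int n \<le> m \<and> m \<le> int n + int \<sigma>")
    case True
    have "norm (kerp_coeff_at r \<sigma> n m) = norm r ^ gauss_exponent \<sigma> m * (norm (qpoch q q (2 * n + \<sigma>)) * inverse (norm (qpoch q q (nat (m + int n)))) * inverse (norm (qpoch q q (nat (int n + int \<sigma> - m)))))"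
      using kerp_coeff_at_eq[OF assms(1) _ _ q] True by (simp add: norm_mult norm_power norm_inverse)
    also have "\<dots> \<le> norm r ^ gauss_exponent \<sigma> m * (E * D * D)"
      using norm_qpoch_bounds(1)[OF q(2)] D unfolding E_def by (intro mult_left_mono mult_mono) auto
    finally show ?thesis by (simp add: mult_ac)
  next
    case False
    then have "kerp_coeff_at r \<sigma> n m = 0" unfolding kerp_coeff_at_def by (rule if_not_P)
    then show ?thesis using D by (simp add: E_def)
  qed
  then show ?thesis using that[of "E * D * D"] D by (simp add: E_def)
qed

lemma summable_on_gauss_exponent:
  fixes \<rho> A :: real
  assumes "\<sigma> \<in> {0, 1}" "0 < \<rho>" "\<rho> < 1" "0 \<le> A"
  shows "(\<lambda>m. \<rho> ^ gauss_exponent \<sigma> m * A ^ nat \<bar>m\<bar>) summable_on UNIV"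
proof -
  have "norm (\<rho> ^ gauss_exponent \<sigma> m * A ^ nat \<bar>m\<bar>) \<le> \<rho> ^ nat (m * m) * (A / \<rho>) ^ nat \<bar>m\<bar>" for m
  proof -
    have "nat (m * m) \<le> gauss_exponent \<sigma> m + nat \<bar>m\<bar>"
    proof -
      have "m * m \<le> m * (m - int \<sigma>) + \<bar>m\<bar>" using assms(1) by (auto simp: algebra_simps)
      then show ?thesis using gauss_exponent_nonneg[OF assms(1), of m] by (simp add: gauss_exponent_def)
    qed
    then have "\<rho> ^ (gauss_exponent \<sigma> m + nat \<bar>m\<bar>) \<le> \<rho> ^ nat (m * m)" using assms by (intro power_decreasing) auto
    then have "\<rho> ^ gauss_exponent \<sigma> m \<le> \<rho> ^ nat (m * m) / \<rho> ^ nat \<bar>m\<bar>" using assms by (simp add: power_add field_simps)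
    then have "\<rho> ^ gauss_exponent \<sigma> m * A ^ nat \<bar>m\<bar> \<le> \<rho> ^ nat (m * m) / \<rho> ^ nat \<bar>m\<bar> * A ^ nat \<bar>m\<bar>"
      using assms by (intro mult_right_mono) auto
    then show ?thesis using assms by (simp add: power_divide)
  qed
  from Infinite_Sum.abs_summable_on_comparison_test'[OF summable_on_int_gaussian this] assms
  show ?thesis by (simp add: summable_on_iff_abs_summable_on_real[symmetric])
qed

section \<open>Limits of the matrix entries\<close>

definition odd_theta :: "nat \<Rightarrow> complex \<Rightarrow> nat \<Rightarrow> complex \<Rightarrow> complex" where
  "odd_theta k p j y = (\<Sum>\<^sub>\<infinity>e. odd_theta_coeff k p j e * (y powi e - y powi (- e)))"

text \<open>Extended by 0, the sum runs over all integers and its range no longer depends on n, as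
  \<open>tannery_infsum\<close> requires.\<close>

lemma lam_kerp:
  assumes "a < k" "\<sigma> \<in> {0, 1}"
  shows "lam k t j (n + k) (basis_poly \<sigma> k a * ker (geom r \<sigma>) {..<n}) =
    (\<Sum>\<^sub>\<infinity>m. kerp_coeff_at r \<sigma> n m * (odd_theta_coeff k t j (m + int (a + 1) - int \<sigma>) - odd_theta_coeff k t j (m - int (a + 1))))"
proof -
  let ?d = "2 * n + \<sigma>"
  have "basis_poly \<sigma> k a * ker (geom r \<sigma>) {..<n} = monom 1 (k + a + 1 - \<sigma>) * kerp r \<sigma> n - monom 1 (k - 1 - a) * kerp r \<sigma> n"
    by (simp add: basis_poly_def kerp_def algebra_simps)
  then have "lam k t j (n + k) (basis_poly \<sigma> k a * ker (geom r \<sigma>) {..<n}) =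
     (\<Sum>i\<le>?d. coeff (kerp r \<sigma> n) i * (odd_theta_coeff k t j (int i + int (k + a + 1 - \<sigma>) - int (n + k)) - odd_theta_coeff k t j (int i + int (k - 1 - a) - int (n + k))))"
    by (simp add: lam_diff lam_monom_mult[OF degree_kerp] right_diff_distrib sum_subtractf)
  also have "\<dots> = (\<Sum>i\<le>?d. kerp_coeff_at r \<sigma> n (int i - int n) * (odd_theta_coeff k t j (int i - int n + int (a + 1) - int \<sigma>) - odd_theta_coeff k t j (int i - int n - int (a + 1))))"
  proof (intro sum.cong refl)
    fix i assume "i \<in> {..?d}"
    then have 1: "coeff (kerp r \<sigma> n) i = kerp_coeff_at r \<sigma> n (int i - int n)" by (simp add: kerp_coeff_at_def)
    have 2: "int i + int (k + a + 1 - \<sigma>) - int (n + k) = int i - int n + int (a + 1) - int \<sigma>"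
      "int i + int (k - 1 - a) - int (n + k) = int i - int n - int (a + 1)"
      using assms by (auto simp: of_nat_diff)
    show "coeff (kerp r \<sigma> n) i * (odd_theta_coeff k t j (int i + int (k + a + 1 - \<sigma>) - int (n + k)) - odd_theta_coeff k t j (int i + int (k - 1 - a) - int (n + k))) =
      kerp_coeff_at r \<sigma> n (int i - int n) * (odd_theta_coeff k t j (int i - int n + int (a + 1) - int \<sigma>) - odd_theta_coeff k t j (int i - int n - int (a + 1)))"
      unfolding 1 2 ..
  qed
  also have "\<dots> = (\<Sum>m\<in>(\<lambda>i. int i - int n) ` {..?d}. kerp_coeff_at r \<sigma> n m * (odd_theta_coeff k t j (m + int (a + 1) - int \<sigma>) - odd_theta_coeff k t j (m - int (a + 1))))"
    by (subst sum.reindex) (auto simp: inj_on_def)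
  also have "\<dots> = (\<Sum>\<^sub>\<infinity>m\<in>(\<lambda>i. int i - int n) ` {..?d}. kerp_coeff_at r \<sigma> n m * (odd_theta_coeff k t j (m + int (a + 1) - int \<sigma>) - odd_theta_coeff k t j (m - int (a + 1))))"
    by (rule infsum_finite[symmetric]) simp
  also have "\<dots> = (\<Sum>\<^sub>\<infinity>m. kerp_coeff_at r \<sigma> n m * (odd_theta_coeff k t j (m + int (a + 1) - int \<sigma>) - odd_theta_coeff k t j (m - int (a + 1))))"
  proof (rule infsum_cong_neutral)
    fix m assume m: "m \<in> UNIV - (\<lambda>i. int i - int n) ` {..?d}"
    have "kerp_coeff_at r \<sigma> n m = 0"
    proof (rule ccontr)
      assume "kerp_coeff_at r \<sigma> n m \<noteq> 0"
      then have "- int n \<le> m \<and> m \<le> int n + int \<sigma>" unfolding kerp_coeff_at_def by (auto split: if_splits)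
      then have "m = int (nat (m + int n)) - int n" "nat (m + int n) \<in> {..?d}" by auto
      then show False using m by blast
    qed
    then show "kerp_coeff_at r \<sigma> n m * (odd_theta_coeff k t j (m + int (a + 1) - int \<sigma>) - odd_theta_coeff k t j (m - int (a + 1))) = 0" by simp
  qed auto
  finally show ?thesis .
qed

lemma odd_theta_coeff_bound:
  assumes "norm t \<le> 1"
  shows "norm (odd_theta_coeff k t j e) \<le> 1"
  using assms by (auto simp: odd_theta_coeff_def Let_def norm_mult norm_power power_le_one)

lemma int_affine: "2 * int k dvd e - int j \<Longrightarrow> \<exists>m. e = int j + 2 * int k * m"
  by (auto simp: dvd_def algebra_simps)

text \<open>For e = j + 2 k m one has e^2 = j^2 + 4 k m (k m + j). The Gaussian r^(e^2) therefore
  multiplies the base t by r^(4k) = q^(2k), which is the origin of p.\<close>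

lemma odd_theta_coeff_gauss:
  assumes j: "1 \<le> j" "j \<le> k" and q: "q = r\<^sup>2" "r \<noteq> 0"
  shows "r ^ nat (e * e) * odd_theta_coeff k t j e = r ^ (j * j) * odd_theta_coeff k (t * q ^ (2 * k)) j e"
proof (cases "2 * int k dvd e - int j")
  case True
  then obtain m where m: "e = int j + 2 * int k * m" using int_affine by blast
  define d where "d = nat (m * (int k * m + int j))"
  have "0 \<le> m * (int k * m + int j)" by (rule odd_theta_coeff_exponent_nonneg[OF j])
  then have "int (j * j + 4 * k * d) = e * e" by (simp add: d_def m algebra_simps)
  then have "nat (e * e) = j * j + 4 * k * d" by (metis nat_int)
  then have "r ^ nat (e * e) = r ^ (j * j) * (q ^ (2 * k)) ^ d"
    by (simp add: q power_add flip: power_mult)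
  then show ?thesis using j unfolding m by (subst (1 2) odd_theta_coeff_at) (auto simp: d_def power_mult_distrib)
qed (simp add: odd_theta_coeff_def)

lemma has_sum_minus:
  fixes f g :: "'a \<Rightarrow> complex"
  assumes "(f has_sum a) A" "(g has_sum b) A"
  shows "((\<lambda>x. f x - g x) has_sum (a - b)) A"
  using has_sum_add[OF assms(1), of "\<lambda>x. - g x" "- b"] assms(2) by (simp add: has_sum_uminus)

lemma power_nat_powi: "0 \<le> m \<Longrightarrow> r ^ nat m = (r :: complex) powi m"
  by (simp add: power_int_def)

lemma gauss_exponent_shift:
  fixes r :: complex
  assumes \<sigma>: "\<sigma> \<in> {0, 1}" and i: "i \<ge> 1" and r: "r \<noteq> 0"
  shows "r ^ gauss_exponent \<sigma> (e - int i + int \<sigma>) = r ^ nat (e * e) * r ^ (i * (i - \<sigma>)) * (r ^ (2 * i - \<sigma>)) powi (- e)"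
    "r ^ gauss_exponent \<sigma> (e + int i) = r ^ nat (e * e) * r ^ (i * (i - \<sigma>)) * (r ^ (2 * i - \<sigma>)) powi e"
proof -
  have p: "r ^ (i * (i - \<sigma>)) = r powi (int i * (int i - int \<sigma>))" "r ^ (2 * i - \<sigma>) = r powi (2 * int i - int \<sigma>)"
    using \<sigma> i by (auto simp: of_nat_diff simp flip: power_int_of_nat)
  have add: "r powi (m + m') = r powi m * r powi m'" for m m' using r by (simp add: power_int_add)
  show "r ^ gauss_exponent \<sigma> (e - int i + int \<sigma>) = r ^ nat (e * e) * r ^ (i * (i - \<sigma>)) * (r ^ (2 * i - \<sigma>)) powi (- e)"
    unfolding gauss_exponent_def p power_nat_powi[OF gauss_exponent_nonneg[OF \<sigma>]] power_nat_powi[OF zero_le_square]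
      power_int_mult[symmetric] add[symmetric]
    by (rule arg_cong[where f = "\<lambda>m. r powi m"]) (simp add: algebra_simps)
  show "r ^ gauss_exponent \<sigma> (e + int i) = r ^ nat (e * e) * r ^ (i * (i - \<sigma>)) * (r ^ (2 * i - \<sigma>)) powi e"
    unfolding gauss_exponent_def p power_nat_powi[OF gauss_exponent_nonneg[OF \<sigma>]] power_nat_powi[OF zero_le_square]
      power_int_mult[symmetric] add[symmetric]
    by (rule arg_cong[where f = "\<lambda>m. r powi m"]) (simp add: algebra_simps)
qed

text \<open>In the limit the kernel has coefficients r^(m (m - \<sigma>)) / (q;q)_inf. Shifting m
  until the coefficient of the functional stands at e, and completing the square, leaves r^(e^2) and
  the power -e or e of r^(2i - \<sigma>); the two halves form an odd theta function.\<close>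

lemma entry_limit:
  assumes j: "1 \<le> j" "j \<le> k" and a: "a < k" and \<sigma>: "\<sigma> \<in> {0, 1}" and q: "q = r\<^sup>2" "norm q < 1" "r \<noteq> 0" and t: "norm t \<le> 1"
  shows "(\<lambda>n. lam k t j (n + k) (basis_poly \<sigma> k a * ker (geom r \<sigma>) {..<n})) \<longlonglongrightarrow>
    - (r ^ ((a + 1) * (a + 1 - \<sigma>)) * r ^ (j * j) / qpoch_inf q q * odd_theta k (t * q ^ (2 * k)) j (r ^ (2 * (a + 1) - \<sigma>)))"
proof -
  define i where "i = a + 1"
  have i: "i \<ge> 1" by (simp add: i_def)
  let ?d = "\<lambda>m. odd_theta_coeff k t j (m + int i - int \<sigma>) - odd_theta_coeff k t j (m - int i)"
  obtain C where C: "C > 0" "\<And>n m. norm (kerp_coeff_at r \<sigma> n m) \<le> C * norm r ^ gauss_exponent \<sigma> m" using kerp_coeff_at_bound[OF \<sigma> q] by blast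
  have "norm r ^ 2 < 1" using q by (simp add: norm_power)
  then have r: "norm r < 1" by (simp add: power_less_one_iff)
  have rs: "(\<lambda>m. norm r ^ gauss_exponent \<sigma> m) summable_on UNIV"
    using summable_on_gauss_exponent[OF \<sigma> _ r, of 1] q by simp
  have d: "norm (?d m) \<le> 2" for m
    using norm_triangle_ineq4[of "odd_theta_coeff k t j (m + int i - int \<sigma>)" "odd_theta_coeff k t j (m - int i)"] odd_theta_coeff_bound[OF t, of k j] by (smt (verit))
  have lim: "(\<lambda>n. \<Sum>\<^sub>\<infinity>m. kerp_coeff_at r \<sigma> n m * ?d m) \<longlonglongrightarrow> (\<Sum>\<^sub>\<infinity>m. r ^ gauss_exponent \<sigma> m / qpoch_inf q q * ?d m)"
  proof (rule tannery_infsum(2))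
    show "norm (kerp_coeff_at r \<sigma> n m * ?d m) \<le> C * norm r ^ gauss_exponent \<sigma> m * 2" for n m
      unfolding norm_mult by (intro mult_mono C d) (use C in auto)
    show "(\<lambda>m. C * norm r ^ gauss_exponent \<sigma> m * 2) summable_on UNIV"
      by (intro summable_on_cmult_left summable_on_cmult_right rs)
  qed (intro tendsto_intros kerp_coeff_at_tendsto \<sigma> q)
  define c where "c = r ^ (i * (i - \<sigma>)) * r ^ (j * j)"
  define y where "y = r ^ (2 * i - \<sigma>)"
  have smm: "(\<lambda>m. r ^ gauss_exponent \<sigma> m * odd_theta_coeff k t j (g m)) summable_on UNIV" for g :: "int \<Rightarrow> int"
  proof (rule abs_summable_summable, rule Infinite_Sum.abs_summable_on_comparison_test'[OF rs])
    show "norm (r ^ gauss_exponent \<sigma> m * odd_theta_coeff k t j (g m)) \<le> norm r ^ gauss_exponent \<sigma> m" for m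
      using mult_left_le[OF odd_theta_coeff_bound[OF t, of k j "g m"], of "norm r ^ gauss_exponent \<sigma> m"] by (simp add: norm_mult norm_power)
  qed
  obtain A B where A: "((\<lambda>m. r ^ gauss_exponent \<sigma> m * odd_theta_coeff k t j (m + int i - int \<sigma>)) has_sum A) UNIV"
    and B: "((\<lambda>m. r ^ gauss_exponent \<sigma> m * odd_theta_coeff k t j (m - int i)) has_sum B) UNIV"
    using smm[of "\<lambda>m. m + int i - int \<sigma>"] smm[of "\<lambda>m. m - int i"] unfolding summable_on_def by blast
  have "((\<lambda>m. inverse (qpoch_inf q q) * (r ^ gauss_exponent \<sigma> m * odd_theta_coeff k t j (m + int i - int \<sigma>) - r ^ gauss_exponent \<sigma> m * odd_theta_coeff k t j (m - int i)))
      has_sum inverse (qpoch_inf q q) * (A - B)) UNIV"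
    by (intro has_sum_cmult_right has_sum_minus A B)
  then have "(\<Sum>\<^sub>\<infinity>m. r ^ gauss_exponent \<sigma> m / qpoch_inf q q * ?d m) = inverse (qpoch_inf q q) * (A - B)"
    by (intro infsumI) (simp add: field_simps)
  moreover have "c * odd_theta k (t * q ^ (2 * k)) j y = B - A"
  proof -
    have shift: "(f has_sum S) UNIV \<Longrightarrow> ((\<lambda>m. f (m + c)) has_sum S) UNIV" for f :: "int \<Rightarrow> complex" and c S
      using has_sum_reindex_bij_betw[OF bij_betwI[of "\<lambda>m. m + c" UNIV UNIV "\<lambda>m. m - c"], of f S] by auto
    have "((\<lambda>e. c * (odd_theta_coeff k (t * q ^ (2 * k)) j e * y powi (- e))) has_sum A) UNIV"
    proof (rule has_sum_cong[THEN iffD1, OF _ shift[OF A, of "int \<sigma> - int i"]])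
      fix e
      have "r ^ gauss_exponent \<sigma> (e + (int \<sigma> - int i)) * odd_theta_coeff k t j (e + (int \<sigma> - int i) + int i - int \<sigma>) = r ^ gauss_exponent \<sigma> (e - int i + int \<sigma>) * odd_theta_coeff k t j e"
        by (simp add: add_diff_eq diff_add_eq)
      also have "\<dots> = (r ^ nat (e * e) * odd_theta_coeff k t j e) * (r ^ (i * (i - \<sigma>)) * y powi (- e))"
        unfolding gauss_exponent_shift(1)[OF \<sigma> i q(3)] y_def by (simp only: mult_ac)
      finally show "r ^ gauss_exponent \<sigma> (e + (int \<sigma> - int i)) * odd_theta_coeff k t j (e + (int \<sigma> - int i) + int i - int \<sigma>) = c * (odd_theta_coeff k (t * q ^ (2 * k)) j e * y powi (- e))"
        unfolding odd_theta_coeff_gauss[OF j q(1,3)] c_def by (simp only: mult_ac)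
    qed
    moreover have "((\<lambda>e. c * (odd_theta_coeff k (t * q ^ (2 * k)) j e * y powi e)) has_sum B) UNIV"
    proof (rule has_sum_cong[THEN iffD1, OF _ shift[OF B, of "int i"]])
      fix e
      have "r ^ gauss_exponent \<sigma> (e + int i) * odd_theta_coeff k t j (e + int i - int i) = (r ^ nat (e * e) * odd_theta_coeff k t j e) * (r ^ (i * (i - \<sigma>)) * y powi e)"
        unfolding gauss_exponent_shift(2)[OF \<sigma> i q(3)] y_def by (simp only: mult_ac add_diff_cancel_right')
      then show "r ^ gauss_exponent \<sigma> (e + int i) * odd_theta_coeff k t j (e + int i - int i) = c * (odd_theta_coeff k (t * q ^ (2 * k)) j e * y powi e)"
        unfolding odd_theta_coeff_gauss[OF j q(1,3)] c_def by (simp only: mult_ac)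
    qed
    ultimately have "((\<lambda>e. c * (odd_theta_coeff k (t * q ^ (2 * k)) j e * y powi e) - c * (odd_theta_coeff k (t * q ^ (2 * k)) j e * y powi (- e))) has_sum (B - A)) UNIV"
      by (rule has_sum_minus[rotated])
    then have "((\<lambda>e. c * (odd_theta_coeff k (t * q ^ (2 * k)) j e * (y powi e - y powi (- e)))) has_sum (B - A)) UNIV"
      by (simp only: right_diff_distrib)
    then show ?thesis unfolding odd_theta_def infsum_cmult_right'[symmetric] by (rule infsumI)
  qed
  ultimately have "(\<Sum>\<^sub>\<infinity>m. r ^ gauss_exponent \<sigma> m / qpoch_inf q q * ?d m) = - (c / qpoch_inf q q * odd_theta k (t * q ^ (2 * k)) j y)"
    by (metis (no_types, lifting) divide_inverse minus_diff_eq mult.assoc mult.commute mult_minus_right)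
  then show ?thesis using lim unfolding lam_kerp[OF a \<sigma>] i_def[symmetric] c_def y_def by (simp only:)
qed

definition theta_det :: "nat \<Rightarrow> complex \<Rightarrow> (nat \<Rightarrow> complex) \<Rightarrow> complex" where
  "theta_det k p Y = detf k (\<lambda>a j. odd_theta k p (Suc j) (Y a))"

lemma lam_det_limit:
  assumes \<sigma>: "\<sigma> \<in> {0, 1}" and q: "q = r\<^sup>2" "norm q < 1" "r \<noteq> 0" and t: "norm t \<le> 1"
  shows "(\<lambda>n. lam_det k t (geom r \<sigma>) {..<n}) \<longlonglongrightarrow>
    (\<Prod>a<k. - (r ^ ((a + 1) * (a + 1 - \<sigma>)) / qpoch_inf q q)) * (\<Prod>j<k. r ^ (Suc j * Suc j)) *
    theta_det k (t * q ^ (2 * k)) (\<lambda>a. r ^ (2 * (a + 1) - \<sigma>))"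
  unfolding lam_det_basis[OF \<sigma>] theta_det_def detf_scale[symmetric]
proof (rule tendsto_detf)
  fix a j assume "a < k" "j < k"
  then show "(\<lambda>n. lam k t (Suc j) (card {..<n} + k) (basis_poly \<sigma> k a * ker (geom r \<sigma>) {..<n}))
      \<longlonglongrightarrow> - (r ^ ((a + 1) * (a + 1 - \<sigma>)) / qpoch_inf q q) * r ^ (Suc j * Suc j) *
         odd_theta k (t * q ^ (2 * k)) (Suc j) (r ^ (2 * (a + 1) - \<sigma>))"
    using entry_limit[of "Suc j" k a, OF _ _ _ \<sigma> q t] by (simp add: mult_ac)
qed

section \<open>Theta functions\<close>

lemma powi_bound:
  fixes y :: complex
  assumes "y \<noteq> 0"
  shows "norm (y powi m) \<le> (norm y + inverse (norm y)) ^ nat \<bar>m\<bar>"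
proof (cases "m \<ge> 0")
  case True
  then show ?thesis by (auto simp: power_int_def norm_power intro!: power_mono)
next
  case False
  then show ?thesis by (auto simp: power_int_def norm_power norm_inverse power_inverse[symmetric] intro!: power_mono)
qed

text \<open>The limit of \<open>kerp r 1 n\<close> divided by y^n: as a product it is a finite form
  of the theta function, and its coefficients are known from \<open>kerp_coeff_at_tendsto\<close>.
  Here r is a square root of the nome p.\<close>

lemma jacobi_triple:
  assumes p: "p = r\<^sup>2" "norm p < 1" "r \<noteq> 0" and y: "y \<noteq> 0"
  shows "((\<lambda>m. r ^ gauss_exponent 1 m / qpoch_inf p p * y powi m) has_sum theta (- y) p) UNIV"
proof -
  have "norm r ^ 2 < 1" using p by (simp add: norm_power)
  then have r: "norm r < 1" by (simp add: power_less_one_iff)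
  obtain C where C: "C > 0" "\<And>n m. norm (kerp_coeff_at r 1 n m) \<le> C * norm r ^ gauss_exponent 1 m" using kerp_coeff_at_bound[of 1, OF _ p] by auto
  define A where "A = norm y + inverse (norm y)"
  have A: "norm (y powi m) \<le> A ^ nat \<bar>m\<bar>" for m using powi_bound[OF y] by (simp add: A_def)
  have A0: "A \<ge> 0" by (simp add: A_def)
  have pw: "(\<lambda>n. kerp_coeff_at r 1 n m * y powi m) \<longlonglongrightarrow> r ^ gauss_exponent 1 m / qpoch_inf p p * y powi m" for m
    by (intro tendsto_intros kerp_coeff_at_tendsto p) simp
  have bd: "norm (kerp_coeff_at r 1 n m * y powi m) \<le> C * norm r ^ gauss_exponent 1 m * A ^ nat \<bar>m\<bar>" for n m
    unfolding norm_mult by (intro mult_mono C A) (use C in auto)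
  have "(\<lambda>m. C * (norm r ^ gauss_exponent 1 m * A ^ nat \<bar>m\<bar>)) summable_on UNIV"
    using p r A0 by (intro summable_on_cmult_right summable_on_gauss_exponent) auto
  then have "(\<lambda>m. C * norm r ^ gauss_exponent 1 m * A ^ nat \<bar>m\<bar>) summable_on UNIV" by (simp only: mult.assoc)
  note lim = tannery_infsum[OF pw bd this]
  have "(\<Sum>\<^sub>\<infinity>m. kerp_coeff_at r 1 n m * y powi m) = qpoch (- y) p (Suc n) * qpoch (p / (- y)) p n" for n
  proof -
    let ?M = "(\<lambda>i. int i - int n) ` {..2 * n + 1}"
    have "(\<Sum>\<^sub>\<infinity>m. kerp_coeff_at r 1 n m * y powi m) = (\<Sum>\<^sub>\<infinity>m\<in>?M. kerp_coeff_at r 1 n m * y powi m)"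
    proof (rule infsum_cong_neutral)
      fix m assume m: "m \<in> UNIV - ?M"
      have "kerp_coeff_at r 1 n m = 0"
      proof (rule ccontr)
        assume "kerp_coeff_at r 1 n m \<noteq> 0"
        then have "- int n \<le> m \<and> m \<le> int n + int 1" unfolding kerp_coeff_at_def by (auto split: if_splits)
        then have "m = int (nat (m + int n)) - int n" "nat (m + int n) \<in> {..2 * n + 1}" by auto
        then show False using m by blast
      qed
      then show "kerp_coeff_at r 1 n m * y powi m = 0" by simp
    qed auto
    also have "\<dots> = (\<Sum>m\<in>?M. kerp_coeff_at r 1 n m * y powi m)" by (rule infsum_finite) simp
    also have "\<dots> = (\<Sum>i\<le>2 * n + 1. kerp_coeff_at r 1 n (int i - int n) * y powi (int i - int n))"
      by (subst sum.reindex) (auto simp: inj_on_def)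
    also have "\<dots> = (\<Sum>i\<le>2 * n + 1. coeff (kerp r 1 n) i * y ^ i) / y ^ n"
      unfolding sum_divide_distrib
    proof (intro sum.cong refl)
      fix i assume "i \<in> {..2 * n + 1}"
      then have "kerp_coeff_at r 1 n (int i - int n) = coeff (kerp r 1 n) i" by (simp add: kerp_coeff_at_def)
      then show "kerp_coeff_at r 1 n (int i - int n) * y powi (int i - int n) = coeff (kerp r 1 n) i * y ^ i / y ^ n"
        using y by (simp add: power_int_diff)
    qed
    also have "(\<Sum>i\<le>2 * n + 1. coeff (kerp r 1 n) i * y ^ i) = poly (kerp r 1 n) y"
      unfolding poly_altdef using degree_kerp[of r 1 n] by (intro sum.mono_neutral_right) (auto simp: coeff_eq_0)
    also have "\<dots> = (1 + y) * (\<Prod>l<n. (1 + p ^ Suc l * y) * (p ^ Suc l + y))"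
    proof -
      have "geom r 1 l = p ^ Suc l" for l unfolding geom_def p power_mult[symmetric] by (rule arg_cong[where f = "power r"]) simp
      then show ?thesis by (simp add: kerp_def poly_ker distrib_right)
    qed
    also have "\<dots> / y ^ n = (1 + y) * (\<Prod>l<n. (1 + p ^ Suc l * y) * ((p ^ Suc l + y) / y))"
      using y by (simp add: prod.distrib prod_dividef)
    also have "\<dots> = qpoch (- y) p (Suc n) * qpoch (p / (- y)) p n"
      using y unfolding qpoch_Suc_left prod.distrib by (simp add: qpoch_def field_simps)
    finally show ?thesis .
  qed
  then have "(\<lambda>n. qpoch (- y) p (Suc n) * qpoch (p / (- y)) p n) \<longlonglongrightarrow> (\<Sum>\<^sub>\<infinity>m. r ^ gauss_exponent 1 m / qpoch_inf p p * y powi m)"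
    using lim(2) by simp
  moreover have "(\<lambda>n. qpoch (- y) p (Suc n) * qpoch (p / (- y)) p n) \<longlonglongrightarrow> theta (- y) p"
    unfolding theta_def by (intro tendsto_mult qpoch_tendsto[THEN LIMSEQ_Suc] qpoch_tendsto p)
  ultimately have "(\<Sum>\<^sub>\<infinity>m. r ^ gauss_exponent 1 m / qpoch_inf p p * y powi m) = theta (- y) p" by (rule LIMSEQ_unique)
  then show ?thesis using has_sum_infsum[OF lim(1)] by simp
qed

text \<open>Laurent series whose coefficients satisfy a first-order recursion; for a theta function it expresses
  the quasi-periodicity \<open>f(p y) = A\<^sup>-\<^sup>1 y\<^sup>-\<^sup>u f(y)\<close> without appealing to uniqueness of the expansion.\<close>

definition qper :: "complex \<Rightarrow> int \<Rightarrow> complex \<Rightarrow> (complex \<Rightarrow> complex) \<Rightarrow> bool" where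
  "qper p u A f \<longleftrightarrow> (\<exists>a. (\<forall>y. y \<noteq> 0 \<longrightarrow> ((\<lambda>e. a e * y powi e) has_sum f y) UNIV) \<and>
     (\<forall>e. a (e + u) = A * p powi e * a e))"

lemma has_sum_product_int:
  fixes f g :: "int \<Rightarrow> complex"
  assumes f: "(f has_sum S) UNIV" and g: "(g has_sum T) UNIV"
  shows "((\<lambda>n. \<Sum>\<^sub>\<infinity>e. f e * g (n - e)) has_sum (S * T)) UNIV" "(\<lambda>e. f e * g (n - e)) summable_on UNIV"
proof -
  have af: "(\<lambda>e. norm (f e)) summable_on UNIV" and ag: "(\<lambda>e. norm (g e)) summable_on UNIV"
    using has_sum_imp_summable[OF f] has_sum_imp_summable[OF g] by (simp_all only: summable_on_iff_abs_summable_on_complex)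
  have "(\<lambda>x. norm ((\<lambda>(e, d). f e * g d) x)) summable_on (UNIV \<times> UNIV)"
    unfolding Infinite_Sum.abs_summable_on_Sigma_iff using af ag
    by (auto simp: norm_mult abs_mult infsum_cmult_right' intro!: summable_on_cmult_right summable_on_cmult_left)
  then have sm: "(\<lambda>(e, d). f e * g d) summable_on (UNIV \<times> UNIV)"
    by (rule abs_summable_summable)
  have "((\<lambda>(e, d). f e * g d) has_sum S * T) (UNIV \<times> UNIV)"
    by (rule has_sum_SigmaI[OF _ _ sm, where g = "\<lambda>e. f e * T"]) (auto intro!: has_sum_cmult_right has_sum_cmult_left f g)
  then have *: "((\<lambda>(n, e). f e * g (n - e)) has_sum S * T) (UNIV \<times> UNIV)"
    by (subst has_sum_reindex_bij_witness[of _ "\<lambda>(e, d). (e + d, e)" "\<lambda>(n, e). (e, n - e)" _ "\<lambda>(e, d). f e * g d"]) auto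
  have sm': "(\<lambda>e. f e * g (n - e)) summable_on UNIV" for n
    using summable_on_SigmaD1[of "\<lambda>n e. f e * g (n - e)" UNIV "\<lambda>_. UNIV" n] * by (auto simp: summable_on_def)
  show "((\<lambda>n. \<Sum>\<^sub>\<infinity>e. f e * g (n - e)) has_sum (S * T)) UNIV"
    by (rule has_sum_Sigma'[OF *]) (simp add: has_sum_infsum sm')
  show "(\<lambda>e. f e * g (n - e)) summable_on UNIV" by (fact sm')
qed

text \<open>Coefficients multiply by convolution. Shifting the summation index by u and the total
  exponent by u + v produces p^e p^(n - e) = p^n, independent of the summation index.\<close>

lemma qper_mult:
  assumes p: "p \<noteq> 0" and f: "qper p u A f" and g: "qper p v B g"
  shows "qper p (u + v) (A * B) (\<lambda>y. f y * g y)"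
proof -
  obtain a where a: "\<And>y. y \<noteq> 0 \<Longrightarrow> ((\<lambda>e. a e * y powi e) has_sum f y) UNIV" "\<And>e. a (e + u) = A * p powi e * a e"
    using f unfolding qper_def by blast
  obtain b where b: "\<And>y. y \<noteq> 0 \<Longrightarrow> ((\<lambda>e. b e * y powi e) has_sum g y) UNIV" "\<And>e. b (e + v) = B * p powi e * b e"
    using g unfolding qper_def by blast
  define c where "c n = (\<Sum>\<^sub>\<infinity>e. a e * b (n - e))" for n
  show ?thesis unfolding qper_def
  proof (intro exI[of _ c] conjI allI impI)
    fix y :: complex assume y: "y \<noteq> 0"
    have "(\<Sum>\<^sub>\<infinity>e. a e * y powi e * (b (n - e) * y powi (n - e))) = c n * y powi n" for n
      unfolding c_def infsum_cmult_left'[symmetric]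
    proof (intro infsum_cong)
      fix e
      have "y powi n = y powi e * y powi (n - e)" using y by (simp flip: power_int_add)
      then show "a e * y powi e * (b (n - e) * y powi (n - e)) = a e * b (n - e) * y powi n" by simp
    qed
    then show "((\<lambda>e. c e * y powi e) has_sum f y * g y) UNIV"
      using has_sum_product_int(1)[OF a(1)[OF y] b(1)[OF y]] by simp
  next
    fix n
    have "c (n + (u + v)) = (\<Sum>\<^sub>\<infinity>e. a (e + u) * b (n + (u + v) - (e + u)))"
      unfolding c_def by (rule infsum_reindex_bij_betw[symmetric]) (rule bij_betwI[of _ _ _ "\<lambda>m. m - u"], auto)
    also have "\<dots> = (\<Sum>\<^sub>\<infinity>e. A * B * p powi n * (a e * b (n - e)))"
    proof (intro infsum_cong)
      fix e
      have "b (n + (u + v) - (e + u)) = B * p powi (n - e) * b (n - e)"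
        using b(2)[of "n - e"] by (simp add: algebra_simps)
      moreover have "p powi n = p powi e * p powi (n - e)" using p by (simp flip: power_int_add)
      ultimately show "a (e + u) * b (n + (u + v) - (e + u)) = A * B * p powi n * (a e * b (n - e))"
        by (simp add: a(2) mult_ac)
    qed
    finally show "c (n + (u + v)) = A * B * p powi n * c n" by (simp add: infsum_cmult_right' c_def)
  qed
qed

lemma gauss_exponent_1_Suc:
  fixes r p :: complex
  assumes "p = r\<^sup>2" "r \<noteq> 0"
  shows "r ^ gauss_exponent 1 (e + 1) = p powi e * r ^ gauss_exponent 1 e"
proof -
  have "r ^ gauss_exponent 1 (e + 1) = r powi ((e + 1) * (e + 1 - int 1))" unfolding gauss_exponent_def
    by (rule power_nat_powi) (rule gauss_exponent_nonneg, simp)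
  also have "(e + 1) * (e + 1 - int 1) = 2 * e + e * (e - int 1)" by (simp add: algebra_simps)
  also have "r powi \<dots> = r powi (2 * e) * r powi (e * (e - int 1))" using assms(2) by (simp add: power_int_add)
  also have "r powi (e * (e - int 1)) = r ^ gauss_exponent 1 e" unfolding gauss_exponent_def
    by (rule power_nat_powi[symmetric]) (rule gauss_exponent_nonneg, simp)
  also have "r powi (2 * e) = p powi e" by (simp add: assms(1) power_int_mult)
  finally show ?thesis .
qed

lemma qper_theta:
  assumes p: "norm p < 1" "p \<noteq> 0" and c: "c \<noteq> 0"
  shows "qper p 1 (- c) (\<lambda>y. theta (c * y) p)"
proof -
  define r where "r = csqrt p"
  have r: "p = r\<^sup>2" "r \<noteq> 0" using p by (auto simp: r_def)
  show ?thesis unfolding qper_def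
  proof (intro exI[of _ "\<lambda>m. r ^ gauss_exponent 1 m / qpoch_inf p p * (- c) powi m"] conjI allI impI)
    fix y :: complex assume "y \<noteq> 0"
    then show "((\<lambda>e. r ^ gauss_exponent 1 e / qpoch_inf p p * (- c) powi e * y powi e) has_sum theta (c * y) p) UNIV"
      using jacobi_triple[OF r(1) p(1) r(2), of "- c * y"] c unfolding power_int_mult_distrib mult.assoc by simp
  next
    fix e
    show "r ^ gauss_exponent 1 (e + 1) / qpoch_inf p p * (- c) powi (e + 1) = - c * p powi e * (r ^ gauss_exponent 1 e / qpoch_inf p p * (- c) powi e)"
      using c gauss_exponent_1_Suc[OF r, of e] by (simp add: power_int_add)
  qed
qed

text \<open>Only even exponents of y occur, and a step of 2 in them is one step of the triple
  product with nome p^2.\<close>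

lemma qper_theta_square:
  assumes p: "norm p < 1" "p \<noteq> 0"
  shows "qper p 2 (- 1) (\<lambda>y. theta (y\<^sup>2) (p\<^sup>2))"
proof -
  have p2: "norm (p\<^sup>2) < 1" using p by (simp add: norm_power power_less_one_iff)
  define a where "a e = (if even e then p ^ gauss_exponent 1 (e div 2) / qpoch_inf (p\<^sup>2) (p\<^sup>2) * (- 1) powi (e div 2) else 0)" for e :: int
  show ?thesis unfolding qper_def
  proof (intro exI[of _ a] conjI allI impI)
    fix y :: complex assume y: "y \<noteq> 0"
    have "((\<lambda>m. a (2 * m) * y powi (2 * m)) has_sum theta (y\<^sup>2) (p\<^sup>2)) UNIV"
    proof (rule has_sum_cong[THEN iffD1])
      show "((\<lambda>m. p ^ gauss_exponent 1 m / qpoch_inf (p\<^sup>2) (p\<^sup>2) * (- (y\<^sup>2)) powi m) has_sum theta (y\<^sup>2) (p\<^sup>2)) UNIV"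
        using jacobi_triple[OF refl p2 p(2), of "- (y\<^sup>2)"] y by simp
      fix m
      have "(- (y\<^sup>2)) powi m = (-1) powi m * y powi (2 * m)"
        by (simp add: power_int_mult flip: power_int_mult_distrib)
      then show "p ^ gauss_exponent 1 m / qpoch_inf (p\<^sup>2) (p\<^sup>2) * (- (y\<^sup>2)) powi m = a (2 * m) * y powi (2 * m)"
        by (simp add: a_def)
    qed
    then have "((\<lambda>e. a e * y powi e) has_sum theta (y\<^sup>2) (p\<^sup>2)) (range (\<lambda>m. 2 * m))"
      by (subst has_sum_reindex) (auto simp: inj_on_def o_def)
    then show "((\<lambda>e. a e * y powi e) has_sum theta (y\<^sup>2) (p\<^sup>2)) UNIV"
      by (rule has_sum_cong_neutral[THEN iffD1, rotated -1]) (auto simp: a_def elim!: evenE)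
  next
    fix e
    show "a (e + 2) = - 1 * p powi e * a e"
    proof (cases "even e")
      case True
      then obtain m where m: "e = 2 * m" by blast
      have "a (2 * (m + 1)) = - 1 * p powi (2 * m) * a (2 * m)"
        unfolding a_def using gauss_exponent_1_Suc[OF refl p(2), of m] by (simp add: power_int_mult power_int_add)
      then show ?thesis by (simp add: m distrib_left)
    qed (simp add: a_def)
  qed
qed

section \<open>The span of the odd theta functions\<close>

lemma odd_theta_coeff_Suc_period:
  assumes j: "1 \<le> j" "j \<le> k" and p: "p \<noteq> 0"
  shows "odd_theta_coeff k p j (e + 2 * int k) = - (p powi (e + int k)) * odd_theta_coeff k p j e"
proof (cases "2 * int k dvd e - int j")
  case True
  then obtain m where m: "e = int j + 2 * int k * m" using int_affine by blast
  have e: "e + 2 * int k = int j + 2 * int k * (m + 1)" by (simp add: m algebra_simps)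
  have E: "(m + 1) * (int k * (m + 1) + int j) = (e + int k) + m * (int k * m + int j)"
    by (simp add: m algebra_simps)
  have "p ^ nat ((m + 1) * (int k * (m + 1) + int j)) = p powi ((m + 1) * (int k * (m + 1) + int j))"
    by (rule power_nat_powi) (rule odd_theta_coeff_exponent_nonneg[OF j])
  also have "\<dots> = p powi (e + int k) * p powi (m * (int k * m + int j))"
    unfolding E using p by (simp add: power_int_add)
  also have "p powi (m * (int k * m + int j)) = p ^ nat (m * (int k * m + int j))"
    by (rule power_nat_powi[symmetric]) (rule odd_theta_coeff_exponent_nonneg[OF j])
  finally have *: "p ^ nat ((m + 1) * (int k * (m + 1) + int j)) = p powi (e + int k) * p ^ nat (m * (int k * m + int j))" .
  show ?thesis unfolding e using j unfolding m
    by (subst (1 2) odd_theta_coeff_at) (auto simp: *[unfolded m])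
next
  case False
  moreover have "2 * int k dvd e + 2 * int k - int j \<longleftrightarrow> 2 * int k dvd e - int j"
  proof -
    have "e + 2 * int k - int j = (e - int j) + 2 * int k" by simp
    then show ?thesis by (simp only: dvd_add_triv_right_iff)
  qed
  ultimately show ?thesis by (simp add: odd_theta_coeff_def)
qed

text \<open>Antisymmetry extends the zeros to -k < e <= k, a complete residue system modulo 2k, and
  the recursion with step 2k carries them to all integers.\<close>

lemma antiperiodic_zero:
  fixes b :: "int \<Rightarrow> complex"
  assumes p: "p \<noteq> 0" and k: "k \<ge> 1" and anti: "\<And>e. b (- e) = - b e"
    and per: "\<And>e. b (e + 2 * int k) = - (p powi (e + int k)) * b e"
    and zero: "\<And>e. 1 \<le> e \<Longrightarrow> e \<le> int k \<Longrightarrow> b e = 0"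
  shows "b e = 0"
proof -
  have b0: "b 0 = 0" using anti[of 0] by simp
  have win: "b e = 0" if "- int k < e" "e \<le> int k" for e
  proof (cases "e \<le> 0")
    case True
    then show ?thesis using zero[of "- e"] anti[of e] b0 that by (cases "e = 0") auto
  qed (use zero that in auto)
  have iff: "b (e + 2 * int k) = 0 \<longleftrightarrow> b e = 0" for e
    using per[of e] p by simp
  have "b (e + 2 * int k * m) = 0 \<longleftrightarrow> b e = 0" for e m
  proof (induction m rule: int_induct[where k = 0])
    case (step1 i)
    then show ?case using iff[of "e + 2 * int k * i"] by (simp add: algebra_simps)
  next
    case (step2 i)
    then show ?case using iff[of "e + 2 * int k * (i - 1)"] by (simp add: algebra_simps)
  qed simp
  moreover define e0 where "e0 = (e + int k - 1) mod (2 * int k) - int k + 1"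
  moreover define m where "m = (e + int k - 1) div (2 * int k)"
  ultimately have "b (e0 + 2 * int k * m) = 0 \<longleftrightarrow> b e0 = 0" by blast
  moreover have "e0 + 2 * int k * m = e"
  proof -
    have "2 * int k * m + (e + int k - 1) mod (2 * int k) = e + int k - 1" unfolding m_def by (rule mult_div_mod_eq)
    then show ?thesis unfolding e0_def by linarith
  qed
  moreover have "- int k < e0" "e0 \<le> int k"
  proof -
    have "0 \<le> (e + int k - 1) mod (2 * int k)" "(e + int k - 1) mod (2 * int k) < 2 * int k"
      using k by (auto intro: pos_mod_sign pos_mod_bound)
    then show "- int k < e0" "e0 \<le> int k" unfolding e0_def by linarith+
  qed
  ultimately show ?thesis using win by simp
qed

text \<open>With r^(4k) = p, \<open>odd_theta_coeff_gauss\<close> at t = 1 shows the coefficients to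
  be a constant times a Gaussian times a bounded factor.\<close>

lemma odd_theta_coeff_summable:
  assumes j: "1 \<le> j" "j \<le> k" and p: "p \<noteq> 0" "norm p < 1" and y: "y \<noteq> 0"
  shows "(\<lambda>e. odd_theta_coeff k p j e * y powi e) summable_on UNIV"
proof -
  define r where "r = exp (Ln p / of_nat (4 * k))"
  have k: "k \<ge> 1" using j by simp
  have r: "r ^ (4 * k) = p" "r \<noteq> 0" using p k by (simp_all add: r_def exp_of_nat_mult[symmetric] del: of_nat_mult)
  have "norm r ^ (4 * k) < 1" using p r(1) by (metis norm_power)
  then have r1: "norm r < 1" by (simp add: power_less_one_iff k)
  define A where "A = norm y + inverse (norm y)"
  have A: "norm (y powi m) \<le> A ^ nat \<bar>m\<bar>" for m using powi_bound[OF y] by (simp add: A_def)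
  have A0: "A \<ge> 0" by (simp add: A_def)
  have g: "(\<lambda>e::int. norm r ^ nat (e * e) * A ^ nat \<bar>e\<bar>) summable_on UNIV"
    using r1 A0 by (intro summable_on_int_gaussian) auto
  have "(\<lambda>e. r ^ (j * j) * (odd_theta_coeff k p j e * y powi e)) summable_on UNIV"
  proof (rule abs_summable_summable, rule Infinite_Sum.abs_summable_on_comparison_test'[OF g])
    fix e :: int
    have "1 * (r\<^sup>2) ^ (2 * k) = p" using r(1) by (simp flip: power_mult)
    then have eq: "r ^ (j * j) * (odd_theta_coeff k p j e * y powi e) = r ^ nat (e * e) * (odd_theta_coeff k 1 j e * y powi e)"
      using odd_theta_coeff_gauss[OF j refl r(2), of e 1] by (metis mult.assoc)
    have "norm (odd_theta_coeff k 1 j e * y powi e) \<le> 1 * A ^ nat \<bar>e\<bar>"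
      unfolding norm_mult by (intro mult_mono A odd_theta_coeff_bound) auto
    then show "norm (r ^ (j * j) * (odd_theta_coeff k p j e * y powi e)) \<le> norm r ^ nat (e * e) * A ^ nat \<bar>e\<bar>"
      unfolding eq norm_mult[of "r ^ _"] norm_power by (intro mult_left_mono) auto
  qed
  then show ?thesis using r(2) by (simp add: summable_on_cmult_right')
qed

lemma odd_theta_has_sum:
  assumes j: "1 \<le> j" "j \<le> k" and p: "p \<noteq> 0" "norm p < 1" and y: "y \<noteq> 0"
  shows "((\<lambda>e. (odd_theta_coeff k p j e - odd_theta_coeff k p j (- e)) * y powi e) has_sum odd_theta k p j y) UNIV"
proof -
  obtain A where A: "((\<lambda>e. odd_theta_coeff k p j e * y powi e) has_sum A) UNIV"
    using odd_theta_coeff_summable[OF assms] unfolding summable_on_def by blast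
  obtain B where B: "((\<lambda>e. odd_theta_coeff k p j e * y powi (- e)) has_sum B) UNIV"
    using odd_theta_coeff_summable[OF j p, of "inverse y"] y unfolding summable_on_def by (auto simp: power_int_minus power_int_inverse)
  have B': "((\<lambda>e. odd_theta_coeff k p j (- e) * y powi e) has_sum B) UNIV"
    using has_sum_reindex_bij_betw[OF bij_betwI[of "uminus :: int \<Rightarrow> int" UNIV UNIV uminus], of "\<lambda>e. odd_theta_coeff k p j e * y powi (- e)" B] B by simp
  have "((\<lambda>e. odd_theta_coeff k p j e * (y powi e - y powi (- e))) has_sum A - B) UNIV"
    using has_sum_minus[OF A B] by (simp add: right_diff_distrib)
  then have "odd_theta k p j y = A - B" unfolding odd_theta_def by (rule infsumI)
  then show ?thesis using has_sum_minus[OF A B'] by (simp add: left_diff_distrib)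
qed

lemma has_sum_finite_sum:
  fixes f :: "'i \<Rightarrow> 'a \<Rightarrow> complex"
  assumes "finite I" "\<And>i. i \<in> I \<Longrightarrow> (f i has_sum S i) A"
  shows "((\<lambda>x. \<Sum>i\<in>I. f i x) has_sum (\<Sum>i\<in>I. S i)) A"
  using assms by (induction I rule: finite_induct) (auto intro: has_sum_add)

text \<open>By \<open>antiperiodic_zero\<close> the antisymmetrized coefficients of g are determined
  by their values at 1, ..., k, and each odd theta function is nonzero at exactly one of
  these.\<close>

lemma span_odd_theta:
  assumes p: "p \<noteq> 0" "norm p < 1" and k: "k \<ge> 1" and f: "qper p (2 * int k) (- 1) f"
    and anti: "\<And>y. y \<noteq> 0 \<Longrightarrow> g (inverse y) = - g y" and fg: "\<And>y. y \<noteq> 0 \<Longrightarrow> g y = f y / y ^ k"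
  obtains \<alpha> where "\<And>y. y \<noteq> 0 \<Longrightarrow> g y = (\<Sum>j<k. \<alpha> j * odd_theta k p (Suc j) y)"
proof -
  obtain a where a: "\<And>y. y \<noteq> 0 \<Longrightarrow> ((\<lambda>e. a e * y powi e) has_sum f y) UNIV" "\<And>e. a (e + 2 * int k) = - 1 * p powi e * a e"
    using f unfolding qper_def by blast
  have inv: "p powi x * p powi (- x) = 1" for x using p(1) by (simp flip: power_int_add)
  have neg: "X = - (p powi x) * Z" if "Z = - (p powi (- x)) * X" for X Z x
    unfolding that using inv[of x] by (simp flip: mult.assoc)
  \<comment> \<open>Antisymmetrizing makes \<open>b\<close> odd by construction, whichever expansion
    of f was chosen.\<close>
  define b where "b e = (a (e + int k) - a (- e + int k)) / 2" for e
  have b_anti: "b (- e) = - b e" for e by (simp add: b_def field_simps)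
  have b_per: "b (e + 2 * int k) = - (p powi (e + int k)) * b e" for e
  proof -
    have "a (e + 2 * int k + int k) = - (p powi (e + int k)) * a (e + int k)"
      using a(2)[of "e + int k"] by (simp add: algebra_simps)
    moreover have "a (- (e + 2 * int k) + int k) = - (p powi (e + int k)) * a (- e + int k)"
      by (rule neg) (use a(2)[of "- e - int k"] in \<open>simp add: algebra_simps\<close>)
    ultimately show ?thesis unfolding b_def by (simp add: field_simps)
  qed
  have b_sum: "((\<lambda>e. b e * y powi e) has_sum g y) UNIV" if y: "y \<noteq> 0" for y
  proof -
    have shift: "((\<lambda>e. a (e + int k) * y powi e) has_sum g y) UNIV" if y: "y \<noteq> 0" for y
    proof -
      have "((\<lambda>e. a (e + int k) * y powi (e + int k)) has_sum f y) UNIV"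
        using has_sum_reindex_bij_betw[OF bij_betwI[of "\<lambda>m. m + int k" UNIV UNIV "\<lambda>m. m - int k"], of "\<lambda>e. a e * y powi e" "f y"] a(1)[OF y] by simp
      from has_sum_cmult_left[OF this, of "1 / y ^ k"] show ?thesis
        using y by (simp add: fg power_int_add)
    qed
    have "((\<lambda>e. a (- e + int k) * y powi e) has_sum - g y) UNIV"
      using shift[of "inverse y"] anti[OF y] y
        has_sum_reindex_bij_betw[OF bij_betwI[of "uminus :: int \<Rightarrow> int" UNIV UNIV uminus], of "\<lambda>e. a (- e + int k) * y powi e" "- g y"]
      by (simp add: power_int_minus power_int_inverse)
    from has_sum_cmult_left[OF has_sum_minus[OF shift[OF y] this], of "1 / 2"] show ?thesis
      by (simp add: b_def left_diff_distrib diff_divide_distrib)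
  qed
  \<comment> \<open>For j = k - 1 the coefficients at k and -k belong to the same residue class, and
    their difference is 2 instead of 1.\<close>
  define \<alpha> where "\<alpha> j = b (int j + 1) / (if j = k - 1 then 2 else 1)" for j
  define d where "d e = b e - (\<Sum>j<k. \<alpha> j * (odd_theta_coeff k p (Suc j) e - odd_theta_coeff k p (Suc j) (- e)))" for e
  have "d e = 0" for e
  proof (rule antiperiodic_zero[OF p(1) k])
    show "d (- e) = - d e" for e
      by (simp add: d_def b_anti sum_negf[symmetric] algebra_simps)
    show "d (e + 2 * int k) = - (p powi (e + int k)) * d e" for e
    proof -
      have neg': "odd_theta_coeff k p (Suc j) (- (e + 2 * int k)) = - (p powi (e + int k)) * odd_theta_coeff k p (Suc j) (- e)" if "j < k" for j
        by (rule neg) (use odd_theta_coeff_Suc_period[of "Suc j" k p "- (e + 2 * int k)"] that p(1) in \<open>simp add: algebra_simps\<close>)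
      have "(\<Sum>j<k. \<alpha> j * (odd_theta_coeff k p (Suc j) (e + 2 * int k) - odd_theta_coeff k p (Suc j) (- (e + 2 * int k)))) =
        (\<Sum>j<k. - (p powi (e + int k)) * (\<alpha> j * (odd_theta_coeff k p (Suc j) e - odd_theta_coeff k p (Suc j) (- e))))"
      proof (intro sum.cong refl)
        fix j assume "j \<in> {..<k}"
        then have j: "1 \<le> Suc j" "Suc j \<le> k" "j < k" by auto
        show "\<alpha> j * (odd_theta_coeff k p (Suc j) (e + 2 * int k) - odd_theta_coeff k p (Suc j) (- (e + 2 * int k))) =
            - (p powi (e + int k)) * (\<alpha> j * (odd_theta_coeff k p (Suc j) e - odd_theta_coeff k p (Suc j) (- e)))"
          unfolding odd_theta_coeff_Suc_period[OF j(1,2) p(1)] neg'[OF j(3)] by (simp add: right_diff_distrib mult.left_commute)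
      qed
      then show ?thesis unfolding d_def b_per sum_distrib_left[symmetric] by (simp add: algebra_simps)
    qed
    show "d e = 0" if "1 \<le> e" "e \<le> int k" for e
    proof -
      define i where "i = nat (e - 1)"
      have i: "e = int i + 1" "i < k" using that by (auto simp: i_def)
      have "(\<Sum>j<k. \<alpha> j * (odd_theta_coeff k p (Suc j) e - odd_theta_coeff k p (Suc j) (- e))) = (\<Sum>j<k. if j = i then b e else 0)"
      proof (intro sum.cong refl)
        fix j assume "j \<in> {..<k}"
        then have j: "j < k" by simp
        have "- e = - int i - 1" using i by simp
        then show "\<alpha> j * (odd_theta_coeff k p (Suc j) e - odd_theta_coeff k p (Suc j) (- e)) = (if j = i then b e else 0)"
          using odd_theta_coeff_small[OF i(2) j, of p] unfolding i(1) by (auto simp: \<alpha>_def)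
      qed
      then show ?thesis using i by (simp add: d_def)
    qed
  qed
  then have b: "b e = (\<Sum>j<k. \<alpha> j * (odd_theta_coeff k p (Suc j) e - odd_theta_coeff k p (Suc j) (- e)))" for e by (simp add: d_def)
  show ?thesis
  proof (rule that)
    fix y :: complex assume y: "y \<noteq> 0"
    have "((\<lambda>e. \<Sum>j<k. \<alpha> j * ((odd_theta_coeff k p (Suc j) e - odd_theta_coeff k p (Suc j) (- e)) * y powi e)) has_sum (\<Sum>j<k. \<alpha> j * odd_theta k p (Suc j) y)) UNIV"
      by (intro has_sum_finite_sum has_sum_cmult_right odd_theta_has_sum p y) auto
    then have "((\<lambda>e. b e * y powi e) has_sum (\<Sum>j<k. \<alpha> j * odd_theta k p (Suc j) y)) UNIV"
      by (simp add: b sum_distrib_right mult.assoc)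
    then show "g y = (\<Sum>j<k. \<alpha> j * odd_theta k p (Suc j) y)" using b_sum[OF y] has_sum_unique by blast
  qed
qed

lemma theta_inverse:
  assumes "norm p < 1" "a \<noteq> 0"
  shows "theta (inverse a) p = - theta a p / a"
proof -
  define u v where "u = qpoch_inf (a * p) p" and "v = qpoch_inf (p / a) p"
  have 1: "theta (inverse a) p = (1 - inverse a) * v * u"
    unfolding theta_def by (subst qpoch_inf_rec[OF assms(1), of "inverse a"]) (simp add: divide_inverse u_def v_def mult.commute)
  have 2: "theta a p = (1 - a) * u * v"
    unfolding theta_def by (subst qpoch_inf_rec[OF assms(1), of a]) (simp add: u_def v_def)
  show ?thesis unfolding 1 2 using assms(2) by (simp add: field_simps)
qed

lemma theta_1: "norm p < 1 \<Longrightarrow> theta 1 p = 0"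
  unfolding theta_def by (subst qpoch_inf_rec) auto

lemma theta_nonzero:
  assumes p: "norm p < 1" "p \<noteq> 0" and a: "a \<noteq> 0" "\<And>m::int. a \<noteq> p powi m"
  shows "theta a p \<noteq> 0"
proof -
  have "a * p ^ i \<noteq> 1" for i
  proof
    assume "a * p ^ i = 1"
    then have "a = p powi (- int i)" using p by (simp add: power_int_minus field_simps)
    then show False using a(2) by blast
  qed
  moreover have "p / a * p ^ i \<noteq> 1" for i
  proof
    assume "p / a * p ^ i = 1"
    then have "a = p ^ Suc i" using a(1) by (simp add: field_simps)
    then have "a = p powi (int (Suc i))" by (simp only: power_int_of_nat)
    then show False using a(2) by blast
  qed
  ultimately show ?thesis unfolding theta_def using qpoch_inf_nonzero[OF p(1)] by simp
qed

text \<open>The powers of Y i balance the asymmetry between theta(Y j / Y i) and theta(Y i / Y j),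
  so that up to a constant the product is an odd function of each single argument.\<close>

definition theta_prod :: "nat \<Rightarrow> complex \<Rightarrow> (nat \<Rightarrow> complex) \<Rightarrow> complex" where
  "theta_prod k p Y = (\<Prod>i<k. theta ((Y i)\<^sup>2) (p\<^sup>2) / Y i ^ (i + 1)) * (\<Prod>j<k. \<Prod>i<j. theta (Y i * Y j) p * theta (Y j / Y i) p)"

definition theta_row :: "nat \<Rightarrow> complex \<Rightarrow> nat set \<Rightarrow> (nat \<Rightarrow> complex) \<Rightarrow> complex \<Rightarrow> complex" where
  "theta_row k p B Y y = theta (y\<^sup>2) (p\<^sup>2) * (\<Prod>b\<in>B. theta (Y b * y) p * theta (y / Y b) p) / y ^ k"

lemma prod_pairs_split:
  fixes h :: "nat \<Rightarrow> nat \<Rightarrow> complex"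
  assumes "a < k"
  shows "(\<Prod>j<k. \<Prod>i<j. h i j) = (\<Prod>j\<in>{..<k} - {a}. \<Prod>i\<in>{..<j} - {a}. h i j) * (\<Prod>b\<in>{..<k} - {a}. if b < a then h b a else h a b)"
proof -
  have "(\<Prod>j<k. \<Prod>i<j. h i j) = (\<Prod>i<a. h i a) * (\<Prod>j\<in>{..<k} - {a}. \<Prod>i<j. h i j)"
    using assms by (intro prod.remove) auto
  also have "(\<Prod>j\<in>{..<k} - {a}. \<Prod>i<j. h i j) = (\<Prod>j\<in>{..<k} - {a}. (\<Prod>i\<in>{..<j} - {a}. h i j) * (if a < j then h a j else 1))"
  proof (intro prod.cong refl)
    fix j
    show "(\<Prod>i<j. h i j) = (\<Prod>i\<in>{..<j} - {a}. h i j) * (if a < j then h a j else 1)"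
      using prod.remove[of "{..<j}" a "\<lambda>i. h i j"] by (auto simp: mult.commute)
  qed
  also have "(\<Prod>i<a. h i a) = (\<Prod>b\<in>{..<k} - {a}. if b < a then h b a else 1)"
    using assms by (intro prod.mono_neutral_cong_left) auto
  finally have "(\<Prod>j<k. \<Prod>i<j. h i j) = (\<Prod>j\<in>{..<k} - {a}. \<Prod>i\<in>{..<j} - {a}. h i j) *
     (\<Prod>b\<in>{..<k} - {a}. (if b < a then h b a else 1) * (if a < b then h a b else 1))"
    by (simp add: prod.distrib mult_ac)
  also have "(\<Prod>b\<in>{..<k} - {a}. (if b < a then h b a else 1) * (if a < b then h a b else 1)) = (\<Prod>b\<in>{..<k} - {a}. if b < a then h b a else h a b)"
    by (intro prod.cong refl) auto
  finally show ?thesis .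
qed

text \<open>Turning theta(Y b / y) into theta(y / Y b) costs a factor -Y b / y for each of the k - 1
  - a indices b > a. Together with y^(-(a + 1)) this gives y^(-k), whatever a is.\<close>

lemma theta_prod_update:
  assumes a: "a < k" and p: "norm p < 1" and Y: "\<And>b. b < k \<Longrightarrow> Y b \<noteq> 0"
  obtains C where "\<And>y. y \<noteq> 0 \<Longrightarrow> theta_prod k p (Y(a := y)) = C * theta_row k p ({..<k} - {a}) Y y"
proof -
  let ?B = "{..<k} - {a}"
  define C where "C = (\<Prod>i\<in>?B. theta ((Y i)\<^sup>2) (p\<^sup>2) / Y i ^ (i + 1)) *
    (\<Prod>j\<in>?B. \<Prod>i\<in>{..<j} - {a}. theta (Y i * Y j) p * theta (Y j / Y i) p) * (\<Prod>b\<in>?B. if b < a then 1 else - Y b)"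
  have "theta_prod k p (Y(a := y)) = C * theta_row k p ?B Y y" if y: "y \<noteq> 0" for y
  proof -
    let ?Z = "Y(a := y)"
    have 1: "(\<Prod>i<k. theta ((?Z i)\<^sup>2) (p\<^sup>2) / ?Z i ^ (i + 1)) = theta (y\<^sup>2) (p\<^sup>2) / y ^ (a + 1) * (\<Prod>i\<in>?B. theta ((Y i)\<^sup>2) (p\<^sup>2) / Y i ^ (i + 1))"
      using a by (subst prod.remove[of _ a]) auto
    have 2: "(\<Prod>j<k. \<Prod>i<j. theta (?Z i * ?Z j) p * theta (?Z j / ?Z i) p) =
      (\<Prod>j\<in>?B. \<Prod>i\<in>{..<j} - {a}. theta (Y i * Y j) p * theta (Y j / Y i) p) *
      (\<Prod>b\<in>?B. (if b < a then 1 else - Y b) * (if b < a then 1 else inverse y) * (theta (Y b * y) p * theta (y / Y b) p))"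
      unfolding prod_pairs_split[OF a]
    proof (intro arg_cong2[where f = "(*)"] prod.cong refl)
      fix b assume b: "b \<in> ?B"
      show "(if b < a then theta (?Z b * ?Z a) p * theta (?Z a / ?Z b) p else theta (?Z a * ?Z b) p * theta (?Z b / ?Z a) p) =
        (if b < a then 1 else - Y b) * (if b < a then 1 else inverse y) * (theta (Y b * y) p * theta (y / Y b) p)"
      proof (cases "b < a")
        case False
        have "theta (Y b / y) p = - Y b * inverse y * theta (y / Y b) p"
          using theta_inverse[OF p, of "y / Y b"] Y[of b] b y by (simp add: field_simps)
        then show ?thesis using False b by (simp add: mult_ac)
      qed (use b in simp)
    qed auto
    have 3: "(\<Prod>b\<in>?B. if b < a then 1 else inverse y) = inverse y ^ (k - 1 - a)"
    proof -
      have "(\<Prod>b\<in>?B. if b < a then 1 else inverse y) = (\<Prod>b\<in>{a<..<k}. inverse y)"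
        by (rule prod.mono_neutral_cong_right) auto
      then show ?thesis by simp
    qed
    have "y ^ k = y ^ (a + 1) * y ^ (k - 1 - a)" unfolding power_add[symmetric] using a by simp
    then have 4: "inverse y ^ (k - 1 - a) / y ^ (a + 1) = 1 / y ^ k" by (simp add: divide_inverse power_inverse)
    have "theta_prod k p ?Z = C * theta (y\<^sup>2) (p\<^sup>2) * (\<Prod>b\<in>?B. theta (Y b * y) p * theta (y / Y b) p) * (inverse y ^ (k - 1 - a) / y ^ (a + 1))"
      unfolding theta_prod_def 1 2 prod.distrib[of "\<lambda>b. _ b * _ b"] prod.distrib[of "\<lambda>b. if b < a then 1 else - Y b"] 3 C_def
      by (simp add: mult_ac)
    then show ?thesis unfolding 4 theta_row_def by simp
  qed
  then show ?thesis using that by blast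
qed

text \<open>Each pair theta(Y b y) theta(y / Y b) raises the step by 2, and its multiplier is (-Y b)
  (-1 / Y b) = 1.\<close>

lemma qper_theta_product:
  assumes p: "norm p < 1" "p \<noteq> 0" and B: "finite B" "\<And>b. b \<in> B \<Longrightarrow> Y b \<noteq> 0"
  shows "qper p (2 * int (card B + 1)) (- 1) (\<lambda>y. theta (y\<^sup>2) (p\<^sup>2) * (\<Prod>b\<in>B. theta (Y b * y) p * theta (y / Y b) p))"
  using B
proof (induction B rule: finite_induct)
  case empty
  then show ?case using qper_theta_square[OF p] by simp
next
  case (insert b B)
  have b: "Y b \<noteq> 0" using insert by simp
  have "qper p (1 + 1) (- Y b * - inverse (Y b)) (\<lambda>y. theta (Y b * y) p * theta (inverse (Y b) * y) p)"
    using b by (intro qper_mult[OF p(2) qper_theta[OF p] qper_theta[OF p]]) auto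
  then have "qper p (2 * int (card B + 1) + (1 + 1)) (- 1 * (- Y b * - inverse (Y b)))
    (\<lambda>y. theta (y\<^sup>2) (p\<^sup>2) * (\<Prod>b\<in>B. theta (Y b * y) p * theta (y / Y b) p) * (theta (Y b * y) p * theta (inverse (Y b) * y) p))"
    using insert by (intro qper_mult[OF p(2) insert.IH]) auto
  moreover have "2 * int (card B + 1) + (1 + 1) = 2 * int (card (insert b B) + 1)" using insert by simp
  ultimately show ?case using insert b by (simp add: mult_ac divide_inverse)
qed

lemma theta_row_inverse:
  assumes p: "norm p < 1" and B: "finite B" "\<And>b. b \<in> B \<Longrightarrow> Y b \<noteq> 0" "card B + 1 = k" and y: "y \<noteq> 0"
  shows "theta_row k p B Y (inverse y) = - theta_row k p B Y y"
proof -
  have p2: "norm (p\<^sup>2) < 1" using p by (simp add: norm_power power_less_one_iff)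
  have "(\<Prod>b\<in>B. theta (Y b * inverse y) p * theta (inverse y / Y b) p) = (\<Prod>b\<in>B. inverse y ^ 2 * (theta (Y b * y) p * theta (y / Y b) p))"
  proof (intro prod.cong refl)
    fix b assume "b \<in> B"
    then have b: "Y b \<noteq> 0" using B by simp
    have "theta (Y b * inverse y) p = - Y b * inverse y * theta (y / Y b) p"
      using theta_inverse[OF p, of "y / Y b"] b y by (simp add: field_simps)
    moreover have "theta (inverse y / Y b) p = - inverse (Y b) * inverse y * theta (Y b * y) p"
      using theta_inverse[OF p, of "Y b * y"] b y by (simp add: field_simps)
    ultimately show "theta (Y b * inverse y) p * theta (inverse y / Y b) p = inverse y ^ 2 * (theta (Y b * y) p * theta (y / Y b) p)"
      using b by (simp add: power2_eq_square)
  qed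
  also have "\<dots> = inverse y ^ (2 * card B) * (\<Prod>b\<in>B. theta (Y b * y) p * theta (y / Y b) p)"
    by (simp add: prod.distrib power_mult)
  finally have 1: "(\<Prod>b\<in>B. theta (Y b * inverse y) p * theta (inverse y / Y b) p) = \<dots>" .
  have 2: "theta ((inverse y)\<^sup>2) (p\<^sup>2) = - theta (y\<^sup>2) (p\<^sup>2) * inverse y ^ 2"
    using theta_inverse[OF p2, of "y\<^sup>2"] y by (simp add: power_inverse divide_inverse)
  have "inverse y ^ 2 * inverse y ^ (2 * card B) = inverse y ^ k * inverse y ^ k"
    unfolding power_add[symmetric] by (rule arg_cong[where f = "power (inverse y)"]) (simp add: B(3)[symmetric])
  then have 3: "inverse y ^ 2 * inverse y ^ (2 * card B) / inverse y ^ k = 1 / y ^ k"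
    using y by (simp add: power_inverse field_simps)
  show ?thesis unfolding theta_row_def 1 2
    using arg_cong[OF 3, of "\<lambda>z. - theta (y\<^sup>2) (p\<^sup>2) * (\<Prod>b\<in>B. theta (Y b * y) p * theta (y / Y b) p) * z"]
    by (simp add: mult_ac)
qed

lemma theta_row_zero: "finite B \<Longrightarrow> b \<in> B \<Longrightarrow> norm p < 1 \<Longrightarrow> Y b \<noteq> 0 \<Longrightarrow> theta_row k p B Y (Y b) = 0"
  by (auto simp: theta_row_def theta_1 intro!: prod_zero bexI[of _ b])

lemma detf_permute_rows: "\<pi> permutes {0..<k} \<Longrightarrow> detf k (\<lambda>i j. M (\<pi> i) j) = signof \<pi> * detf k M"
proof -
  assume \<pi>: "\<pi> permutes {0..<k}"
  have "Matrix.mat k k (\<lambda>(i, j). M (\<pi> i) j) = Matrix.mat k k (\<lambda>(i, j). Matrix.mat k k (\<lambda>(i, j). M i j) $$ (\<pi> i, j))"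
    using permutes_in_image[OF \<pi>] by (intro eq_matI) auto
  then show ?thesis unfolding detf_def using det_permute_rows[OF _ \<pi>, of "Matrix.mat k k (\<lambda>(i, j). M i j)"] by simp
qed

lemma detf_proportional_row:
  assumes a: "a < k" and c: "\<And>i. i < k \<Longrightarrow> i \<noteq> a \<Longrightarrow> (\<Sum>j<k. c j * M i j) = 0"
  shows "(\<Sum>j<k. c j * u j) * detf k (\<lambda>i j. if i = a then v j else M i j) =
         (\<Sum>j<k. c j * v j) * detf k (\<lambda>i j. if i = a then u j else M i j)"
proof -
  define \<pi> where "\<pi> = Transposition.transpose 0 a"
  have \<pi>: "\<pi> permutes {0..<k}" unfolding \<pi>_def using a by (intro permutes_swap_id) auto
  have s: "signof \<pi> \<noteq> (0::complex)" by (simp add: sign_def)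
  have row: "\<pi> i = a \<longleftrightarrow> i = 0" for i by (auto simp: \<pi>_def Transposition.transpose_def)
  have "(\<Sum>j<k. c j * u j) * detf k (\<lambda>i j. if i = 0 then v j else M (\<pi> i) j) =
        (\<Sum>j<k. c j * v j) * detf k (\<lambda>i j. if i = 0 then u j else M (\<pi> i) j)"
  proof (rule detf_proportional)
    fix i assume i: "0 < i" "i < k"
    then have "\<pi> i < k" "\<pi> i \<noteq> a" using permutes_in_image[OF \<pi>, of i] row by auto
    then show "(\<Sum>j<k. c j * M (\<pi> i) j) = 0" by (rule c)
  qed (use a in auto)
  then show ?thesis
    using detf_permute_rows[OF \<pi>, of "\<lambda>i j. if i = a then v j else M i j"]
      detf_permute_rows[OF \<pi>, of "\<lambda>i j. if i = a then u j else M i j"] s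
    by (simp add: row)
qed

text \<open>As functions of one argument both sides lie in the span of the \<open>k\<close> odd theta functions, and the
  product vanishes at the other arguments.\<close>

lemma theta_det_theta_prod_update:
  assumes a: "a < k" and p: "norm p < 1" "p \<noteq> 0" and Y: "\<And>b. b < k \<Longrightarrow> Y b \<noteq> 0" and y: "y \<noteq> 0" "z \<noteq> 0"
  shows "theta_det k p (Y(a := y)) * theta_prod k p (Y(a := z)) = theta_det k p (Y(a := z)) * theta_prod k p (Y(a := y))"
proof -
  let ?B = "{..<k} - {a}"
  have k: "k \<ge> 1" "card ?B + 1 = k" using a by auto
  obtain C where C: "\<And>y. y \<noteq> 0 \<Longrightarrow> theta_prod k p (Y(a := y)) = C * theta_row k p ?B Y y"
    using theta_prod_update[where Y = Y, OF a p(1) Y] by blast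
  have "qper p (2 * int k) (- 1) (\<lambda>y. theta (y\<^sup>2) (p\<^sup>2) * (\<Prod>b\<in>?B. theta (Y b * y) p * theta (y / Y b) p))"
    using qper_theta_product[OF p, of ?B Y] Y unfolding k(2) by simp
  then obtain \<alpha> where \<alpha>: "\<And>y. y \<noteq> 0 \<Longrightarrow> theta_row k p ?B Y y = (\<Sum>j<k. \<alpha> j * odd_theta k p (Suc j) y)"
  proof (rule span_odd_theta[OF p(2,1) k(1)])
    show "theta_row k p ?B Y (inverse y) = - theta_row k p ?B Y y" if "y \<noteq> 0" for y
      using that Y k by (intro theta_row_inverse p) auto
  qed (auto simp: theta_row_def)
  have D: "theta_det k p (Y(a := y)) = detf k (\<lambda>i j. if i = a then odd_theta k p (Suc j) y else odd_theta k p (Suc j) (Y i))" for y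
    unfolding theta_det_def by (intro detf_cong) auto
  have "(\<Sum>j<k. \<alpha> j * odd_theta k p (Suc j) z) * theta_det k p (Y(a := y)) = (\<Sum>j<k. \<alpha> j * odd_theta k p (Suc j) y) * theta_det k p (Y(a := z))"
    unfolding D
  proof (rule detf_proportional_row[OF a])
    fix i assume "i < k" "i \<noteq> a"
    then show "(\<Sum>j<k. \<alpha> j * odd_theta k p (Suc j) (Y i)) = 0"
      using \<alpha>[of "Y i"] theta_row_zero[of ?B i p Y k] Y[of i] p by simp
  qed
  then show ?thesis using y by (simp add: C \<alpha> mult_ac)
qed

section \<open>A theta determinant\<close>

text \<open>Keeps every theta factor of \<open>theta_prod\<close> away from its zeros, the integral
  powers of its nome.\<close>

definition spread :: "nat \<Rightarrow> complex \<Rightarrow> (nat \<Rightarrow> complex) \<Rightarrow> bool" where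
  "spread k p Y \<longleftrightarrow> (\<forall>i<k. Y i \<noteq> 0 \<and> (\<forall>m::int. (Y i)\<^sup>2 \<noteq> (p\<^sup>2) powi m)) \<and>
     (\<forall>j<k. \<forall>i<j. \<forall>m::int. Y i * Y j \<noteq> p powi m \<and> Y j / Y i \<noteq> p powi m)"

lemma spread_nonzero: "spread k p Y \<Longrightarrow> i < k \<Longrightarrow> Y i \<noteq> 0"
  by (simp add: spread_def)

lemma cross_cancel:
  fixes a b c x y z :: complex
  assumes "b * z = c * y" "a * y = b * x" "y \<noteq> 0"
  shows "a * z = c * x"
proof -
  have "y * (a * z) = (a * y) * z" by simp
  also have "\<dots> = (b * z) * x" by (simp add: assms(2))
  also have "\<dots> = y * (c * x)" by (simp add: assms(1))
  finally show ?thesis using assms(3) by simp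
qed

lemma theta_prod_nonzero:
  assumes p: "norm p < 1" "p \<noteq> 0" and Y: "spread k p Y"
  shows "theta_prod k p Y \<noteq> 0"
proof -
  have p2: "norm (p\<^sup>2) < 1" "p\<^sup>2 \<noteq> 0" using p by (simp_all add: norm_power power_less_one_iff)
  have "theta ((Y i)\<^sup>2) (p\<^sup>2) / Y i ^ (i + 1) \<noteq> 0" if "i < k" for i
    using theta_nonzero[OF p2, of "(Y i)\<^sup>2"] Y that unfolding spread_def by simp
  moreover have "theta (Y i * Y j) p * theta (Y j / Y i) p \<noteq> 0" if "j < k" "i < j" for i j
  proof -
    have "Y i \<noteq> 0" "Y j \<noteq> 0" using spread_nonzero[OF Y] that by auto
    then show ?thesis
      using theta_nonzero[OF p, of "Y i * Y j"] theta_nonzero[OF p, of "Y j / Y i"] Y that unfolding spread_def by simp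
  qed
  ultimately show ?thesis by (simp add: theta_prod_def)
qed

definition mixed :: "(nat \<Rightarrow> complex) \<Rightarrow> (nat \<Rightarrow> complex) \<Rightarrow> nat \<Rightarrow> nat \<Rightarrow> complex" where
  "mixed V Y a i = (if i < a then V i else Y i)"

text \<open>The arguments are exchanged one at a time. Each step cancels the product at an
  intermediate point, so all intermediate points have to be spread.\<close>

lemma theta_det_theta_prod_chain:
  assumes p: "norm p < 1" "p \<noteq> 0" and ok: "\<And>a. a \<le> k \<Longrightarrow> spread k p (mixed V Y a)" and a: "a \<le> k"
  shows "theta_det k p Y * theta_prod k p (mixed V Y a) = theta_det k p (mixed V Y a) * theta_prod k p Y"
  using a
proof (induction a)
  case 0
  have "mixed V Y 0 = Y" by (auto simp: mixed_def)
  then show ?case by simp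
next
  case (Suc a)
  let ?m = "mixed V Y a"
  have m: "\<And>b. b < k \<Longrightarrow> ?m b \<noteq> 0" using spread_nonzero[OF ok[of a]] Suc.prems by simp
  have V: "V a \<noteq> 0" using spread_nonzero[OF ok[of "Suc a"], of a] Suc.prems by (simp add: mixed_def)
  have up: "mixed V Y (Suc a) = ?m(a := V a)" "?m = ?m(a := Y a)" by (auto simp: mixed_def less_Suc_eq)
  have Ya: "Y a \<noteq> 0" using m[of a] Suc.prems by (simp add: mixed_def)
  have "theta_det k p ?m * theta_prod k p (mixed V Y (Suc a)) = theta_det k p (mixed V Y (Suc a)) * theta_prod k p ?m"
    using theta_det_theta_prod_update[of a k p ?m, OF _ p m Ya V] Suc.prems unfolding up(1) up(2)[symmetric] by simp
  moreover have "theta_det k p Y * theta_prod k p ?m = theta_det k p ?m * theta_prod k p Y" using Suc by simp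
  moreover have "theta_prod k p ?m \<noteq> 0" using theta_prod_nonzero[OF p ok[of a]] Suc.prems by simp
  ultimately show ?case by (rule cross_cancel)
qed

text \<open>Supplies the generic point \<open>(w, w\<^sup>2, \<dots>)\<close> through which the arguments are exchanged one at a time.\<close>

lemma generic_root:
  fixes C :: "complex set"
  assumes "countable C"
  obtains w where "w \<noteq> 0" "\<And>n c. n \<ge> 1 \<Longrightarrow> c \<in> C \<Longrightarrow> w ^ n \<noteq> c"
proof -
  have "countable (insert 0 (\<Union>n\<in>{1..}. \<Union>c\<in>C. {w. w ^ n = c}))"
    using assms by (intro countable_insert countable_UN countableI_type assms) (auto intro!: countable_finite finite_nth_roots)
  then obtain w where "w \<notin> insert 0 (\<Union>n\<in>{1..}. \<Union>c\<in>C. {w. w ^ n = c})"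
    using uncountable_UNIV_complex by (metis UNIV_eq_I)
  then show ?thesis using that[of w] by auto
qed

text \<open>A mixture of Y and Z may be degenerate, so both are compared with one generic point
  V.\<close>

lemma theta_determinant:
  assumes p: "norm p < 1" "p \<noteq> 0" and Y: "spread k p Y" and Z: "spread k p Z"
  shows "theta_det k p Y * theta_prod k p Z = theta_det k p Z * theta_prod k p Y"
proof -
  \<comment> \<open>Mixtures with V stay spread if no positive power of w has the form p^m u, with u
    equal to 1, one of the given arguments or an inverse of one. This excludes countably many
    values.\<close>
  define U where "U = (insert 1 (\<Union>i<k. {Y i, inverse (Y i), Z i, inverse (Z i)}))"
  define C where "C = (\<lambda>(m::int, u). p powi m * u) ` (UNIV \<times> U)"
  have "finite U" by (simp add: U_def)
  then have "countable C" unfolding C_def by (intro countable_image countable_SIGMA countableI_type) (simp add: countable_finite)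
  then obtain w where w: "w \<noteq> 0" "\<And>n c. n \<ge> 1 \<Longrightarrow> c \<in> C \<Longrightarrow> w ^ n \<noteq> c"
    using generic_root by blast
  have wC: "w ^ n \<noteq> p powi m * u" if "u \<in> U" "n \<ge> 1" for n m u
  proof (rule w(2)[OF that(2)])
    show "p powi m * u \<in> C" unfolding C_def using that(1) by (intro image_eqI[of _ _ "(m, u)"]) auto
  qed
  define V where "V i = w ^ (i + 1)" for i
  have mix: "spread k p (mixed V X a)"
    if X: "spread k p X" "\<And>i. i < k \<Longrightarrow> X i \<in> U" "\<And>i. i < k \<Longrightarrow> inverse (X i) \<in> U" for X a
  proof -
    have one: "1 \<in> U" by (simp add: U_def)
    note X0 = spread_nonzero[OF X(1)]
    show ?thesis unfolding spread_def
    proof (intro conjI allI impI)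
      fix i assume i: "i < k"
      show "mixed V X a i \<noteq> 0" using X0[OF i] w(1) by (simp add: mixed_def V_def)
      fix m :: int
      have "(V i)\<^sup>2 \<noteq> (p\<^sup>2) powi m"
        using wC[OF one, of "(i + 1) * 2" "2 * m"] unfolding V_def power_mult[symmetric] power_int_mult by simp
      then show "(mixed V X a i)\<^sup>2 \<noteq> (p\<^sup>2) powi m" using X(1) i by (auto simp: mixed_def spread_def)
    next
      fix j i m assume ij: "j < k" "i < j"
      have 1: "V i * V j \<noteq> p powi m"
        using wC[OF one, of "(i + 1) + (j + 1)" m] unfolding V_def power_add by simp
      have 2: "V i * X j \<noteq> p powi m"
        using wC[OF X(3)[OF ij(1)], of "i + 1" m] X0[OF ij(1)] unfolding V_def by (auto simp: field_simps)
      have 3: "X i * X j \<noteq> p powi m" "X j / X i \<noteq> p powi m"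
        using X(1) ij by (auto simp: spread_def)
      show "mixed V X a i * mixed V X a j \<noteq> p powi m"
        using 1 2 3 ij by (auto simp: mixed_def)
      have "V j = w ^ (j - i) * V i" using ij by (simp add: V_def flip: power_add)
      then have 4: "V j / V i \<noteq> p powi m"
        using wC[OF one, of "j - i" m] ij w(1) by (simp add: V_def)
      have 5: "X j / V i \<noteq> p powi m"
      proof
        assume "X j / V i = p powi m"
        then have "V i = p powi (- m) * X j" using w(1) X0[OF ij(1)] p(2)
          by (simp add: power_int_minus field_simps V_def)
        then show False using wC[OF X(2)[OF ij(1)], of "i + 1" "- m"] by (simp add: V_def)
      qed
      show "mixed V X a j / mixed V X a i \<noteq> p powi m"
        using 3 4 5 ij by (auto simp: mixed_def)
    qed
  qed
  have D: "theta_det k p (mixed V X k) = theta_det k p V" for X unfolding theta_det_def by (intro detf_cong) (simp add: mixed_def)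
  have P: "theta_prod k p (mixed V X k) = theta_prod k p V" for X unfolding theta_prod_def by (intro arg_cong2[where f = "(*)"] prod.cong refl) (auto simp: mixed_def)
  have Ym: "spread k p (mixed V Y a)" and Zm: "spread k p (mixed V Z a)" for a
    using Y Z by (auto intro!: mix simp: U_def)
  have "theta_det k p Y * theta_prod k p V = theta_det k p V * theta_prod k p Y" "theta_det k p Z * theta_prod k p V = theta_det k p V * theta_prod k p Z"
    using theta_det_theta_prod_chain[OF p Ym, of k] theta_det_theta_prod_chain[OF p Zm, of k] by (simp_all add: D P)
  moreover have "theta_prod k p V \<noteq> 0" using theta_prod_nonzero[OF p Ym[of k]] by (simp add: P)
  ultimately show ?thesis using cross_cancel by metis
qed

section \<open>Evaluation at geometric arguments and the constant\<close>

definition theta_prod_geometric :: "nat \<Rightarrow> complex \<Rightarrow> complex \<Rightarrow> nat \<Rightarrow> complex" where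
  "theta_prod_geometric k q p \<sigma> = (\<Prod>a<k. theta (q ^ (2 * (a + 1) - \<sigma>)) (p\<^sup>2)) *
     (\<Prod>j<k. \<Prod>i<j. theta (q ^ (i + j + 2 - \<sigma>)) p * theta (q ^ (j - i)) p)"

text \<open>The scalings of rows and columns from \<open>lam_det_limit\<close> are exactly the
  denominators of \<open>theta_prod\<close>: (a + 1)(a + 1 - \<sigma>) + (a + 1)^2 = (a + 1)(2 (a +
  1) - \<sigma>).\<close>

lemma theta_prod_geometric:
  assumes \<sigma>: "\<sigma> \<in> {0, 1}" and q: "q = r\<^sup>2" "r \<noteq> 0"
  shows "(\<Prod>a<k. - (r ^ ((a + 1) * (a + 1 - \<sigma>)) / Q)) * (\<Prod>j<k. r ^ (Suc j * Suc j)) * theta_prod k p (\<lambda>a. r ^ (2 * (a + 1) - \<sigma>)) =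
    (- 1 / Q) ^ k * theta_prod_geometric k q p \<sigma>"
proof -
  have 1: "(\<Prod>i<k. theta ((r ^ (2 * (i + 1) - \<sigma>))\<^sup>2) (p\<^sup>2) / (r ^ (2 * (i + 1) - \<sigma>)) ^ (i + 1)) =
     (\<Prod>i<k. theta (q ^ (2 * (i + 1) - \<sigma>)) (p\<^sup>2)) / (\<Prod>i<k. (r ^ (2 * (i + 1) - \<sigma>)) ^ (i + 1))"
    unfolding prod_dividef q(1) by (simp only: power_mult[symmetric] mult.commute)
  have 2: "(\<Prod>j<k. \<Prod>i<j. theta (r ^ (2 * (i + 1) - \<sigma>) * r ^ (2 * (j + 1) - \<sigma>)) p * theta (r ^ (2 * (j + 1) - \<sigma>) / r ^ (2 * (i + 1) - \<sigma>)) p) =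
    (\<Prod>j<k. \<Prod>i<j. theta (q ^ (i + j + 2 - \<sigma>)) p * theta (q ^ (j - i)) p)"
  proof (intro prod.cong refl arg_cong2[where f = "(*)"] arg_cong[where f = "\<lambda>z. theta z p"])
    fix j i :: nat assume "i \<in> {..<j}"
    then have ij: "i < j" by simp
    show "r ^ (2 * (i + 1) - \<sigma>) * r ^ (2 * (j + 1) - \<sigma>) = q ^ (i + j + 2 - \<sigma>)"
      unfolding power_add[symmetric] q(1) power_mult[symmetric] by (rule arg_cong[where f = "power r"]) (use \<sigma> in auto)
    have "r ^ (2 * (j + 1) - \<sigma>) = q ^ (j - i) * r ^ (2 * (i + 1) - \<sigma>)"
      unfolding power_add[symmetric] q(1) power_mult[symmetric] by (rule arg_cong[where f = "power r"]) (use \<sigma> ij in auto)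
    then show "r ^ (2 * (j + 1) - \<sigma>) / r ^ (2 * (i + 1) - \<sigma>) = q ^ (j - i)" using q(2) by simp
  qed
  have 3: "(\<Prod>a<k. r ^ ((a + 1) * (a + 1 - \<sigma>))) * (\<Prod>j<k. r ^ (Suc j * Suc j)) = (\<Prod>i<k. (r ^ (2 * (i + 1) - \<sigma>)) ^ (i + 1))"
    unfolding prod.distrib[symmetric]
  proof (intro prod.cong refl)
    fix a
    show "r ^ ((a + 1) * (a + 1 - \<sigma>)) * r ^ (Suc a * Suc a) = (r ^ (2 * (a + 1) - \<sigma>)) ^ (a + 1)"
      unfolding power_add[symmetric] power_mult[symmetric] by (rule arg_cong[where f = "power r"]) (use \<sigma> in auto)
  qed
  have 4: "(\<Prod>a<k. - (r ^ ((a + 1) * (a + 1 - \<sigma>)) / Q)) = (- 1 / Q) ^ k * (\<Prod>a<k. r ^ ((a + 1) * (a + 1 - \<sigma>)))"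
  proof -
    have "(\<Prod>a<k. - (r ^ ((a + 1) * (a + 1 - \<sigma>)) / Q)) = (\<Prod>a<k. (- 1 / Q) * r ^ ((a + 1) * (a + 1 - \<sigma>)))" by simp
    then show ?thesis unfolding prod.distrib by simp
  qed
  have nz: "(\<Prod>i<k. (r ^ (2 * (i + 1) - \<sigma>)) ^ (i + 1)) \<noteq> 0" using q(2) by simp
  have "X * A * B * (T1 / C * T2) = X * (T1 * T2)" if "A * B = C" "C \<noteq> 0" for X A B T1 C T2 :: complex
    using that by (simp add: mult.assoc[of _ A B])
  from this[OF 3 nz] show ?thesis unfolding theta_prod_def 1 2 4 theta_prod_geometric_def by simp
qed

lemma not_powi_between:
  fixes z P :: complex
  assumes "z \<noteq> 0" "norm z < 1" "norm P < norm z"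
  shows "z \<noteq> P powi m"
proof
  assume eq: "z = P powi m"
  have P: "P \<noteq> 0 \<or> m = 0" using eq assms(1) by (cases "m = 0") auto
  have P1: "norm P < 1" using assms by simp
  show False
  proof (cases "m \<le> 0")
    case True
    then have "norm z = inverse (norm P) ^ nat (- m)" unfolding eq by (auto simp: power_int_def norm_power norm_inverse power_inverse)
    moreover have "inverse (norm P) ^ nat (- m) \<ge> 1" using P P1 by (cases "m = 0") (auto intro!: one_le_power simp: one_le_inverse)
    ultimately show False using assms(2) by simp
  next
    case False
    then have "norm z = norm P ^ nat m" unfolding eq by (simp add: power_int_def norm_power)
    also have "\<dots> \<le> norm P ^ 1" using P1 False by (intro power_decreasing) auto
    finally show False using assms(3) by simp
  qed
qed

text \<open>The powers of q that occur have modulus below 1 and above that of the nome in question,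
  p or p^2, so they cannot be integral powers of it.\<close>

lemma spread_geometric:
  assumes \<sigma>: "\<sigma> \<in> {0, 1}" and q: "q = r\<^sup>2" "r \<noteq> 0" "norm q < 1" and p: "p \<noteq> 0" "norm p \<le> norm q ^ (2 * k)"
  shows "spread k p (\<lambda>a. r ^ (2 * (a + 1) - \<sigma>))"
proof -
  have q0: "q \<noteq> 0" using q by simp
  have pow: "q ^ c \<noteq> 0" "c \<ge> 1 \<Longrightarrow> norm (q ^ c) < 1" "c < d \<Longrightarrow> norm q ^ d < norm (q ^ c)" for c d
    using q0 q(3) by (auto simp: norm_power power_less_one_iff intro: power_strict_decreasing)
  have A: "q ^ c \<noteq> p powi m" if "1 \<le> c" "c < 2 * k" for c m
    by (rule not_powi_between) (use pow(1,2)[of c] pow(3)[of c "2 * k"] p that in auto)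
  have B: "q ^ c \<noteq> (p\<^sup>2) powi m" if "1 \<le> c" "c \<le> 2 * k" for c m
  proof (rule not_powi_between)
    have "norm (p\<^sup>2) \<le> (norm q ^ (2 * k)) ^ 2" unfolding norm_power using p by (intro power_mono) auto
    also have "\<dots> = norm q ^ (4 * k)" by (simp flip: power_mult)
    finally show "norm (p\<^sup>2) < norm (q ^ c)" using pow(3)[of c "4 * k"] that by simp
  qed (use pow(1,2)[of c] that in auto)
  show ?thesis unfolding spread_def
  proof (intro conjI allI impI)
    fix i m assume "i < k"
    then show "(r ^ (2 * (i + 1) - \<sigma>))\<^sup>2 \<noteq> (p\<^sup>2) powi m"
      using B[of "2 * (i + 1) - \<sigma>" m] \<sigma> unfolding q(1) power_mult[symmetric] by (auto simp: mult.commute)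
  next
    fix j i m assume ij: "j < k" "i < j"
    have e: "r ^ (2 * (i + 1) - \<sigma>) * r ^ (2 * (j + 1) - \<sigma>) = q ^ (i + j + 2 - \<sigma>)"
      unfolding power_add[symmetric] q(1) power_mult[symmetric] by (rule arg_cong[where f = "power r"]) (use \<sigma> in auto)
    then show "r ^ (2 * (i + 1) - \<sigma>) * r ^ (2 * (j + 1) - \<sigma>) \<noteq> p powi m"
      using A[of "i + j + 2 - \<sigma>" m] \<sigma> ij by auto
    have "r ^ (2 * (j + 1) - \<sigma>) = q ^ (j - i) * r ^ (2 * (i + 1) - \<sigma>)"
      unfolding power_add[symmetric] q(1) power_mult[symmetric] by (rule arg_cong[where f = "power r"]) (use \<sigma> ij in auto)
    then show "r ^ (2 * (j + 1) - \<sigma>) / r ^ (2 * (i + 1) - \<sigma>) \<noteq> p powi m"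
      using A[of "j - i" m] ij q(2) by auto
  qed (use q in auto)
qed

text \<open>With u(s) = (q^s; p)_inf, a theta value of nome p is u(s) u(2k - s), and those of nome
  p^2 together give the u(s) with s odd. All factors regroup into k copies of u(1) ... u(2k - 1),
  which is (q;q)_inf / (p;p)_inf by dissection modulo 2k.\<close>

lemma theta_prod_geometric_root:
  assumes q: "norm q < 1" "q \<noteq> 0" and k: "k \<ge> 1" and p: "p = q ^ (2 * k)"
  shows "theta_prod_geometric k q p 1 = qpoch_inf q q ^ k / qpoch_inf p p ^ k"
proof -
  define u where "u s = qpoch_inf (q ^ s) p" for s
  have p1: "norm p < 1" using q k by (simp add: p norm_power power_less_one_iff)
  have th: "theta (q ^ s) p = u s * u (2 * k - s)" if "s \<le> 2 * k" for s
    unfolding theta_def u_def using that q by (simp add: p power_diff)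
  have odd: "theta (q ^ (2 * a + 1)) (p\<^sup>2) = qpoch_inf (q ^ (2 * a + 1)) (p\<^sup>2) * qpoch_inf (q ^ (2 * (k - Suc a) + 1) * p) (p\<^sup>2)" if "a < k" for a
  proof -
    have "p\<^sup>2 / q ^ (2 * a + 1) = q ^ (4 * k - (2 * a + 1))"
      using q that by (simp add: p power_diff flip: power_mult)
    also have "\<dots> = q ^ (2 * (k - Suc a) + 1) * p" unfolding p power_add[symmetric]
      by (rule arg_cong[where f = "power q"]) (use that in auto)
    finally show ?thesis by (simp add: theta_def)
  qed
  have "(\<Prod>a<k. theta (q ^ (2 * a + 1)) (p\<^sup>2)) = (\<Prod>a<k. qpoch_inf (q ^ (2 * a + 1)) (p\<^sup>2)) * (\<Prod>a<k. qpoch_inf (q ^ (2 * (k - Suc a) + 1) * p) (p\<^sup>2))"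
    unfolding prod.distrib[symmetric] by (intro prod.cong refl odd) simp
  also have "(\<Prod>a<k. qpoch_inf (q ^ (2 * (k - Suc a) + 1) * p) (p\<^sup>2)) = (\<Prod>a<k. qpoch_inf (q ^ (2 * a + 1) * p) (p\<^sup>2))"
    by (rule prod.nat_diff_reindex[of "\<lambda>a. qpoch_inf (q ^ (2 * a + 1) * p) (p\<^sup>2)"])
  also have "(\<Prod>a<k. qpoch_inf (q ^ (2 * a + 1)) (p\<^sup>2)) * \<dots> = (\<Prod>a<k. u (2 * a + 1))"
    unfolding prod.distrib[symmetric] u_def
  proof (intro prod.cong refl)
    fix a show "qpoch_inf (q ^ (2 * a + 1)) (p\<^sup>2) * qpoch_inf (q ^ (2 * a + 1) * p) (p\<^sup>2) = qpoch_inf (q ^ (2 * a + 1)) p"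
      using qpoch_inf_split[OF p1, of 2 "q ^ (2 * a + 1)"] by (simp add: numeral_2_eq_2)
  qed
  finally have O: "(\<Prod>a<k. theta (q ^ (2 * a + 1)) (p\<^sup>2)) = (\<Prod>a<k. u (2 * a + 1))" .
  have row: "(\<Prod>i<j. theta (q ^ (i + j + 1)) p * theta (q ^ (j - i)) p) = (\<Prod>s\<in>{1..2 * j}. u s) * (\<Prod>s\<in>{2 * k - 2 * j..2 * k - 1}. u s)" if j: "j < k" for j
  proof -
    have "(\<Prod>i<j. theta (q ^ (i + j + 1)) p) = (\<Prod>s\<in>{j + 1..2 * j}. theta (q ^ s) p)"
      by (rule prod.reindex_bij_witness[of _ "\<lambda>s. s - j - 1" "\<lambda>i. i + j + 1"]) auto
    moreover have "(\<Prod>i<j. theta (q ^ (j - i)) p) = (\<Prod>s\<in>{1..j}. theta (q ^ s) p)"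
      by (rule prod.reindex_bij_witness[of _ "\<lambda>s. j - s" "\<lambda>i. j - i"]) auto
    moreover have "(\<Prod>s\<in>{1..j}. theta (q ^ s) p) * (\<Prod>s\<in>{j + 1..2 * j}. theta (q ^ s) p) = (\<Prod>s\<in>{1..2 * j}. theta (q ^ s) p)"
      by (subst prod.union_disjoint[symmetric]) (auto intro: prod.cong)
    ultimately have "(\<Prod>i<j. theta (q ^ (i + j + 1)) p * theta (q ^ (j - i)) p) = (\<Prod>s\<in>{1..2 * j}. theta (q ^ s) p)"
      by (simp add: prod.distrib mult.commute)
    also have "\<dots> = (\<Prod>s\<in>{1..2 * j}. u s * u (2 * k - s))" by (intro prod.cong refl th) (use j in auto)
    also have "(\<Prod>s\<in>{1..2 * j}. u s * u (2 * k - s)) = (\<Prod>s\<in>{1..2 * j}. u s) * (\<Prod>s\<in>{1..2 * j}. u (2 * k - s))" by (rule prod.distrib)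
    also have "(\<Prod>s\<in>{1..2 * j}. u (2 * k - s)) = (\<Prod>s\<in>{2 * k - 2 * j..2 * k - 1}. u s)"
      by (rule prod.reindex_bij_witness[of _ "\<lambda>s. 2 * k - s" "\<lambda>s. 2 * k - s"]) (use j in auto)
    finally show ?thesis .
  qed
  \<comment> \<open>Reversing the order of the rows in this half pairs each block {1..2j} with {2j +
    2..2k - 1}; the missing index 2j + 1 comes from the factors of nome p^2.\<close>
  have "(\<Prod>j<k. \<Prod>s\<in>{2 * k - 2 * j..2 * k - 1}. u s) = (\<Prod>j<k. \<Prod>s\<in>{2 * k - 2 * (k - Suc j)..2 * k - 1}. u s)"
    by (rule prod.nat_diff_reindex[symmetric])
  also have "\<dots> = (\<Prod>j<k. \<Prod>s\<in>{2 * j + 2..2 * k - 1}. u s)"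
    by (intro prod.cong refl) auto
  finally have R: "(\<Prod>j<k. \<Prod>s\<in>{2 * k - 2 * j..2 * k - 1}. u s) = (\<Prod>j<k. \<Prod>s\<in>{2 * j + 2..2 * k - 1}. u s)" .
  have "theta_prod_geometric k q p 1 = (\<Prod>a<k. u (2 * a + 1)) * (\<Prod>j<k. (\<Prod>s\<in>{1..2 * j}. u s) * (\<Prod>s\<in>{2 * k - 2 * j..2 * k - 1}. u s))"
    unfolding theta_prod_geometric_def O[symmetric] using row by simp
  also have "\<dots> = (\<Prod>j<k. u (2 * j + 1) * ((\<Prod>s\<in>{1..2 * j}. u s) * (\<Prod>s\<in>{2 * j + 2..2 * k - 1}. u s)))"
    unfolding prod.distrib R ..
  also have "\<dots> = (\<Prod>j<k. \<Prod>s\<in>{1..2 * k - 1}. u s)"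
  proof (intro prod.cong refl)
    fix j assume "j \<in> {..<k}"
    then have "{1..2 * k - 1} = insert (2 * j + 1) ({1..2 * j} \<union> {2 * j + 2..2 * k - 1})" by auto
    then show "u (2 * j + 1) * ((\<Prod>s\<in>{1..2 * j}. u s) * (\<Prod>s\<in>{2 * j + 2..2 * k - 1}. u s)) = (\<Prod>s\<in>{1..2 * k - 1}. u s)"
      by (simp add: prod.union_disjoint)
  qed
  also have "\<dots> = (\<Prod>s\<in>{1..2 * k - 1}. u s) ^ k" by simp
  also have "(\<Prod>s\<in>{1..2 * k - 1}. u s) = qpoch_inf q q / qpoch_inf p p"
  proof -
    have "qpoch_inf q q = (\<Prod>s<2 * k. qpoch_inf (q * q ^ s) (q ^ (2 * k)))" by (rule qpoch_inf_split[OF q(1)]) (use k in simp)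
    also have "\<dots> = (\<Prod>s\<in>{1..2 * k}. u s)" unfolding u_def p
      by (rule prod.reindex_bij_witness[of _ "\<lambda>s. s - 1" "\<lambda>s. s + 1"]) auto
    also have "{1..2 * k} = insert (2 * k) {1..2 * k - 1}" using k by auto
    also have "(\<Prod>s\<in>insert (2 * k) {1..2 * k - 1}. u s) = u (2 * k) * (\<Prod>s\<in>{1..2 * k - 1}. u s)" using k by (subst prod.insert) auto
    also have "u (2 * k) = qpoch_inf p p" by (simp add: u_def p)
    finally show ?thesis using qpoch_self_nonzero[OF p1] by simp
  qed
  finally show ?thesis by (simp add: power_divide)
qed

lemma qpoch_inf_square:
  assumes "norm p < 1"
  shows "qpoch_inf (- p) p * qpoch_inf p p = qpoch_inf (p\<^sup>2) (p\<^sup>2)"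
proof (rule LIMSEQ_unique)
  have "norm (p\<^sup>2) < 1" using assms by (simp add: norm_power power_less_one_iff)
  then show "(\<lambda>n. qpoch (p\<^sup>2) (p\<^sup>2) n) \<longlonglongrightarrow> qpoch_inf (p\<^sup>2) (p\<^sup>2)" by (rule qpoch_tendsto)
  have "qpoch (- p) p n * qpoch p p n = qpoch (p\<^sup>2) (p\<^sup>2) n" for n
    unfolding qpoch_def prod.distrib[symmetric]
    by (intro prod.cong refl) (simp add: algebra_simps power2_eq_square power_mult_distrib)
  then show "(\<lambda>n. qpoch (p\<^sup>2) (p\<^sup>2) n) \<longlonglongrightarrow> qpoch_inf (- p) p * qpoch_inf p p"
    using tendsto_mult[OF qpoch_tendsto[OF assms, of "- p"] qpoch_tendsto[OF assms, of p]] by simp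
qed

lemma generic_geom:
  assumes "norm r < 1" "r \<noteq> 0"
  shows "generic (geom r \<sigma>) {..<n}"
  unfolding generic_def
proof (intro conjI ballI)
  have lt: "norm (geom r \<sigma> j) < norm (geom r \<sigma> i)" if "i < j" for i j
    unfolding geom_def norm_power using assms that by (intro power_strict_decreasing) auto
  show "inj_on (geom r \<sigma>) {..<n}"
    by (rule inj_onI) (metis lt less_irrefl linorder_neqE_nat)
  fix i j
  show "geom r \<sigma> i \<noteq> 0" using assms by (simp add: geom_def)
  have "norm (geom r \<sigma> i) < 1" for i unfolding geom_def norm_power using assms power_less_one_iff[of "norm r" "2 * i + \<sigma> + 1"] by simp
  then have "norm (geom r \<sigma> i * geom r \<sigma> j) < 1" unfolding norm_mult
    using mult_strict_mono[of "norm (geom r \<sigma> i)" 1 "norm (geom r \<sigma> j)" 1] by simp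
  then show "geom r \<sigma> i * geom r \<sigma> j \<noteq> 1" by auto
qed

definition product_side :: "nat \<Rightarrow> complex \<Rightarrow> complex \<Rightarrow> nat \<Rightarrow> complex" where
  "product_side k q p \<sigma> = qpoch_inf (p\<^sup>2) (p\<^sup>2) * qpoch_inf p p ^ (k - 1) / qpoch_inf q q ^ k * theta_prod_geometric k q p \<sigma>"

text \<open>At \<open>t = 1\<close> only parts \<open>2k\<close> survive; this fixes the constant in the theta determinant.\<close>

lemma lam_det_limit_at_1:
  assumes q: "norm q < 1" "q \<noteq> 0" and r: "q = r\<^sup>2" and k: "k \<ge> 1"
  shows "(\<lambda>n. lam_det k 1 (geom r 1) {..<n}) \<longlonglongrightarrow> 2 * qpoch_inf (- (q ^ (2 * k))) (q ^ (2 * k))"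
proof -
  have "norm r ^ 2 < 1" using q r by (simp add: norm_power)
  then have r1: "norm r < 1" "r \<noteq> 0" using q r by (auto simp: power_less_one_iff)
  have p1: "norm (q ^ (2 * k)) < 1" using q k by (simp add: norm_power power_less_one_iff)
  have "lam_det k 1 (geom r 1) {..<n} = 2 * qpoch (- (q ^ (2 * k))) (q ^ (2 * k)) n" for n
  proof -
    have gen: "generic (geom r 1) {..<n}" by (rule generic_geom[OF r1])
    have "geom r 1 i ^ (2 * k) = q ^ (2 * k) * (q ^ (2 * k)) ^ i" for i
      unfolding geom_def r power_mult[symmetric] power_add[symmetric] by (rule arg_cong[where f = "power r"]) (simp add: algebra_simps)
    then have "(\<Prod>i<n. 1 + geom r 1 i ^ (2 * k)) = qpoch (- (q ^ (2 * k))) (q ^ (2 * k)) n"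
      by (simp add: qpoch_def)
    then show ?thesis
      using lam_det_eq_level_shuffle[OF _ gen k, of 1] level_shuffle_at_1[of "{..<n}" "geom r 1" k] gen k by (simp add: generic_def)
  qed
  then show ?thesis using tendsto_mult[OF tendsto_const qpoch_tendsto[OF p1]] by simp
qed

text \<open>The theta determinant knows t and q only through p and its arguments. So it is compared
  with the one at the arguments Z built from a base q0 with q0^(2k) = p, which belongs to t = 1,
  where \<open>lam_det_limit_at_1\<close> gives its value.\<close>

lemma lam_det_limit_value:
  assumes \<sigma>: "\<sigma> \<in> {0, 1}" and q: "q = r\<^sup>2" "norm q < 1" "r \<noteq> 0" and t: "norm t \<le> 1" "t \<noteq> 0" and k: "k \<ge> 1"
  shows "(\<lambda>n. lam_det k t (geom r \<sigma>) {..<n}) \<longlonglongrightarrow> 2 * product_side k q (t * q ^ (2 * k)) \<sigma>"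
proof -
  define p where "p = t * q ^ (2 * k)"
  define q0 where "q0 = exp (Ln p / of_nat (2 * k))"
  define s where "s = csqrt q0"
  have "norm q ^ (2 * k) < 1" using q(2) k by (simp add: power_less_one_iff)
  moreover have pq: "norm p \<le> norm q ^ (2 * k)" unfolding p_def norm_mult norm_power using t by (simp add: mult_left_le_one_le)
  ultimately have p: "norm p < 1" by simp
  have p0: "p \<noteq> 0" using t q by (simp add: p_def)
  have q0: "q0 ^ (2 * k) = p" "q0 \<noteq> 0" using p0 k by (simp_all add: q0_def exp_of_nat_mult[symmetric] del: of_nat_mult)
  have "norm q0 ^ (2 * k) < 1" using p q0(1) by (metis norm_power)
  then have q1: "norm q0 < 1" using k by (simp add: power_less_one_iff)
  have s: "q0 = s\<^sup>2" "s \<noteq> 0" using q0 by (auto simp: s_def)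
  define Y where "Y a = r ^ (2 * (a + 1) - \<sigma>)" for a
  define Z where "Z a = s ^ (2 * (a + 1) - 1)" for a
  define A where "A = (\<Prod>a<k. - (r ^ ((a + 1) * (a + 1 - \<sigma>)) / qpoch_inf q q)) * (\<Prod>j<k. r ^ (Suc j * Suc j))"
  define B where "B = (\<Prod>a<k. - (s ^ ((a + 1) * (a + 1 - 1)) / qpoch_inf q0 q0)) * (\<Prod>j<k. s ^ (Suc j * Suc j))"
  have L: "(\<lambda>n. lam_det k t (geom r \<sigma>) {..<n}) \<longlonglongrightarrow> A * theta_det k p Y"
    using lam_det_limit[OF \<sigma> q t(1), of k] unfolding A_def p_def Y_def .
  have "(\<lambda>n. lam_det k 1 (geom s 1) {..<n}) \<longlonglongrightarrow> B * theta_det k p Z"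
    using lam_det_limit[of 1 q0 s 1 k] s q1 q0(1) unfolding B_def Z_def by simp
  \<comment> \<open>Two expressions for the same limit: the general one, with t = 1 and base q0, and
    the direct evaluation.\<close>
  then have BD: "B * theta_det k p Z = 2 * qpoch_inf (- p) p"
    using lam_det_limit_at_1[OF q1 q0(2) s(1) k] q0(1) LIMSEQ_unique by metis
  define e where "e = (- 1 :: complex) ^ k"
  have e: "e \<noteq> 0" by (simp add: e_def)
  have AP: "A * theta_prod k p Y = e / qpoch_inf q q ^ k * theta_prod_geometric k q p \<sigma>"
    unfolding e_def power_divide[symmetric] A_def Y_def by (rule theta_prod_geometric[OF \<sigma> q(1,3)])
  have "B * theta_prod k p Z = e / qpoch_inf q0 q0 ^ k * theta_prod_geometric k q0 p 1"
    unfolding e_def power_divide[symmetric] B_def Z_def by (rule theta_prod_geometric[OF _ s]) simp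
  also have "\<dots> = e / qpoch_inf p p ^ k"
    using theta_prod_geometric_root[OF q1 q0(2) k q0(1)[symmetric]] qpoch_self_nonzero[OF q1] by (simp add: power_divide)
  finally have BP: "B * theta_prod k p Z = e / qpoch_inf p p ^ k" .
  have "theta_det k p Y * theta_prod k p Z = theta_det k p Z * theta_prod k p Y"
    unfolding Y_def Z_def
    by (intro theta_determinant p p0 spread_geometric[OF \<sigma> q(1,3,2)] spread_geometric[OF _ s q1] pq)
      (use q0(1) in \<open>auto simp: norm_power[symmetric]\<close>)
  then have "(A * theta_det k p Y) * (B * theta_prod k p Z) = (A * theta_prod k p Y) * (B * theta_det k p Z)" by (simp add: mult_ac)
  then have "A * theta_det k p Y * (e / qpoch_inf p p ^ k) = e / qpoch_inf q q ^ k * theta_prod_geometric k q p \<sigma> * (2 * qpoch_inf (- p) p)"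
    unfolding AP BP BD .
  then have "A * theta_det k p Y = 2 * (qpoch_inf (- p) p * qpoch_inf p p ^ k / qpoch_inf q q ^ k * theta_prod_geometric k q p \<sigma>)"
    using qpoch_self_nonzero(2)[OF p] qpoch_self_nonzero(2)[OF q(2)] e by (simp add: field_simps)
  also have "qpoch_inf (- p) p * qpoch_inf p p ^ k = qpoch_inf (p\<^sup>2) (p\<^sup>2) * qpoch_inf p p ^ (k - 1)"
    unfolding qpoch_inf_square[OF p, symmetric] using k by (cases k) auto
  finally have "A * theta_det k p Y = 2 * product_side k q p \<sigma>" unfolding product_side_def .
  then show ?thesis using L unfolding p_def by simp
qed

text \<open>Multiplied by r^(j^2), the coefficients become those at t, bounded by 1, times a
  Gaussian free of t; the Gaussian is a majorant uniform in n.\<close>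

lemma odd_theta_tendsto:
  assumes j: "1 \<le> j" "j \<le> k" and q: "q = r\<^sup>2" "norm q < 1" "r \<noteq> 0" and y: "y \<noteq> 0"
    and T: "\<And>n. norm (T n) \<le> 1" "T \<longlonglongrightarrow> t"
  shows "(\<lambda>n. odd_theta k (T n * q ^ (2 * k)) j y) \<longlonglongrightarrow> odd_theta k (t * q ^ (2 * k)) j y"
proof -
  have "norm r ^ 2 < 1" using q by (simp add: norm_power)
  then have r: "norm r < 1" by (simp add: power_less_one_iff)
  define A where "A = norm y + inverse (norm y)"
  have A0: "A \<ge> 0" by (simp add: A_def)
  have A: "norm (y powi e - y powi (- e)) \<le> 2 * A ^ nat \<bar>e\<bar>" for e
    using norm_triangle_ineq4[of "y powi e" "y powi (- e)"] powi_bound[OF y, of e] powi_bound[OF y, of "- e"] by (simp add: A_def)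
  have eq: "r ^ (j * j) * odd_theta k (t * q ^ (2 * k)) j y = (\<Sum>\<^sub>\<infinity>e. r ^ nat (e * e) * odd_theta_coeff k t j e * (y powi e - y powi (- e)))" for t
    unfolding odd_theta_def infsum_cmult_right'[symmetric] odd_theta_coeff_gauss[OF j q(1,3)] by (simp only: mult.assoc)
  have "(\<lambda>n. \<Sum>\<^sub>\<infinity>e. r ^ nat (e * e) * odd_theta_coeff k (T n) j e * (y powi e - y powi (- e))) \<longlonglongrightarrow>
      (\<Sum>\<^sub>\<infinity>e. r ^ nat (e * e) * odd_theta_coeff k t j e * (y powi e - y powi (- e)))"
  proof (rule tannery_infsum(2))
    show "(\<lambda>n. r ^ nat (e * e) * odd_theta_coeff k (T n) j e * (y powi e - y powi (- e))) \<longlonglongrightarrow> r ^ nat (e * e) * odd_theta_coeff k t j e * (y powi e - y powi (- e))" for e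
      unfolding odd_theta_coeff_def Let_def by (cases "2 * int k dvd e - int j") (auto intro!: tendsto_intros T)
    show "norm (r ^ nat (e * e) * odd_theta_coeff k (T n) j e * (y powi e - y powi (- e))) \<le> norm r ^ nat (e * e) * 1 * (2 * A ^ nat \<bar>e\<bar>)" for n e
      unfolding norm_mult norm_power by (intro mult_mono A odd_theta_coeff_bound T) auto
    have "(\<lambda>e. 2 * (norm r ^ nat (e * e) * A ^ nat \<bar>e\<bar>)) summable_on UNIV"
      using r A0 by (intro summable_on_cmult_right summable_on_int_gaussian) auto
    then show "(\<lambda>e. norm r ^ nat (e * e) * 1 * (2 * A ^ nat \<bar>e\<bar>)) summable_on UNIV" by (simp add: mult_ac)
  qed
  then have "(\<lambda>n. inverse (r ^ (j * j)) * (r ^ (j * j) * odd_theta k (T n * q ^ (2 * k)) j y)) \<longlonglongrightarrow> inverse (r ^ (j * j)) * (r ^ (j * j) * odd_theta k (t * q ^ (2 * k)) j y)"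
    unfolding eq by (rule tendsto_mult[OF tendsto_const])
  then show ?thesis using q(3) by simp
qed

lemma qpoch_inf_tendsto_1:
  assumes b: "b \<longlonglongrightarrow> 0" and P: "P \<longlonglongrightarrow> 0" "\<And>n. norm (P n) < 1"
  shows "(\<lambda>n. qpoch_inf (b n) (P n)) \<longlonglongrightarrow> 1"
proof -
  have "(\<lambda>n. exp (norm (b n) / (1 - norm (P n))) - 1) \<longlonglongrightarrow> exp (norm (0::complex) / (1 - norm (0::complex))) - 1"
    by (intro tendsto_intros b P) simp
  then have "(\<lambda>n. exp (norm (b n) / (1 - norm (P n))) - 1) \<longlonglongrightarrow> 0" by simp
  then have "(\<lambda>n. qpoch_inf (b n) (P n) - 1) \<longlonglongrightarrow> 0"
  proof (rule tendsto_0_le[where K = 1], intro always_eventually allI)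
    fix n
    show "norm (qpoch_inf (b n) (P n) - 1) \<le> norm (exp (norm (b n) / (1 - norm (P n))) - 1) * 1"
      using order_trans[OF norm_qpoch_inf_minus_1[OF P(2), of "b n" n] abs_ge_self] by simp
  qed
  then show ?thesis using tendsto_add[OF _ tendsto_const[of 1]] by fastforce
qed

text \<open>Only the leading factor 1 - a does not tend to 1; in the remaining products both the
  argument and the nome tend to 0.\<close>

lemma theta_tendsto_0:
  assumes P: "P \<longlonglongrightarrow> 0" "\<And>n. norm (P n) < 1"
  shows "(\<lambda>n. theta a (P n)) \<longlonglongrightarrow> theta a 0"
proof -
  have "(\<lambda>n. (1 - a) * qpoch_inf (a * P n) (P n) * qpoch_inf (P n / a) (P n)) \<longlonglongrightarrow> (1 - a) * 1 * 1"
  proof (intro tendsto_mult[OF tendsto_mult[OF tendsto_const]] qpoch_inf_tendsto_1 P)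
    show "(\<lambda>n. a * P n) \<longlonglongrightarrow> 0" using tendsto_mult[OF tendsto_const P(1), of a] by simp
    show "(\<lambda>n. P n / a) \<longlonglongrightarrow> 0" using tendsto_mult[OF P(1) tendsto_const, of "inverse a"] by (simp add: divide_inverse)
  qed
  moreover have "theta a (P n) = (1 - a) * qpoch_inf (a * P n) (P n) * qpoch_inf (P n / a) (P n)" for n
    unfolding theta_def by (subst qpoch_inf_rec[OF P(2)]) simp
  moreover have "theta a 0 = 1 - a" unfolding theta_def by (subst qpoch_inf_rec) simp_all
  ultimately show ?thesis by simp
qed

text \<open>The comparison of theta determinants is made at a nonzero nome, so t = 0 is approached
  along 1 / (n + 1). The first member is 1, a value that \<open>lam_det_limit_value\<close>
  admits.\<close>

lemma lam_det_limit_value_0: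
  assumes \<sigma>: "\<sigma> \<in> {0, 1}" and q: "q = r\<^sup>2" "norm q < 1" "r \<noteq> 0" and k: "k \<ge> 1"
  shows "(\<lambda>n. lam_det k 0 (geom r \<sigma>) {..<n}) \<longlonglongrightarrow> 2 * product_side k q 0 \<sigma>"
proof -
  define T where "T n = (1 / of_nat (Suc n) :: complex)" for n
  have T: "norm (T n) \<le> 1" "T n \<noteq> 0" "T \<longlonglongrightarrow> 0" for n
  proof -
    show "norm (T n) \<le> 1" "T n \<noteq> 0" by (simp_all add: T_def norm_divide del: of_nat_Suc)
    show "T \<longlonglongrightarrow> 0" unfolding T_def by (rule LIMSEQ_Suc[OF lim_1_over_n])
  qed
  define P where "P n = T n * q ^ (2 * k)" for n
  have P0: "P \<longlonglongrightarrow> 0" using tendsto_mult[OF T(3) tendsto_const, of "q ^ (2 * k)"] by (simp add: P_def[abs_def])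
  have "norm (P n) < 1" for n
  proof -
    have "norm (P n) \<le> 1 * norm q ^ (2 * k)" unfolding P_def norm_mult norm_power by (intro mult_right_mono T) auto
    also have "\<dots> < 1" using q(2) k by (simp add: power_less_one_iff)
    finally show ?thesis .
  qed
  note P = P0 this
  have P2: "(\<lambda>n. (P n)\<^sup>2) \<longlonglongrightarrow> 0" "\<And>n. norm ((P n)\<^sup>2) < 1"
    using tendsto_power[OF P(1), of 2] P(2) by (simp_all add: norm_power power_less_one_iff)
  define Y where "Y a = r ^ (2 * (a + 1) - \<sigma>)" for a
  define A where "A = (\<Prod>a<k. - (r ^ ((a + 1) * (a + 1 - \<sigma>)) / qpoch_inf q q)) * (\<Prod>j<k. r ^ (Suc j * Suc j))"
  have L: "(\<lambda>n. lam_det k t (geom r \<sigma>) {..<n}) \<longlonglongrightarrow> A * theta_det k (t * q ^ (2 * k)) Y" if "norm t \<le> 1" for t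
    using lam_det_limit[OF \<sigma> q that, of k] unfolding A_def Y_def .
  have e1: "A * theta_det k (P n) Y = 2 * product_side k q (P n) \<sigma>" for n
    using LIMSEQ_unique[OF L[OF T(1)] lam_det_limit_value[OF \<sigma> q T(1,2) k]] unfolding P_def .
  have e2: "(\<lambda>n. A * theta_det k (P n) Y) \<longlonglongrightarrow> A * theta_det k (0 * q ^ (2 * k)) Y"
    unfolding theta_det_def P_def
    by (intro tendsto_mult[OF tendsto_const] tendsto_detf odd_theta_tendsto q T) (auto simp: Y_def q)
  have e3: "(\<lambda>n. 2 * product_side k q (P n) \<sigma>) \<longlonglongrightarrow> 2 * product_side k q 0 \<sigma>"
  proof -
    have "(\<lambda>n. qpoch_inf (P n ^ 2) (P n ^ 2) * qpoch_inf (P n) (P n) ^ (k - 1) / qpoch_inf q q ^ k *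
        ((\<Prod>a<k. theta (q ^ (2 * (a + 1) - \<sigma>)) (P n ^ 2)) * (\<Prod>j<k. \<Prod>i<j. theta (q ^ (i + j + 2 - \<sigma>)) (P n) * theta (q ^ (j - i)) (P n)))) \<longlonglongrightarrow>
      1 * 1 ^ (k - 1) / qpoch_inf q q ^ k *
        ((\<Prod>a<k. theta (q ^ (2 * (a + 1) - \<sigma>)) 0) * (\<Prod>j<k. \<Prod>i<j. theta (q ^ (i + j + 2 - \<sigma>)) 0 * theta (q ^ (j - i)) 0))"
      using qpoch_self_nonzero(2)[OF q(2)]
      by (intro tendsto_intros qpoch_inf_tendsto_1 theta_tendsto_0 P P2) auto
    then show ?thesis unfolding product_side_def theta_prod_geometric_def by (intro tendsto_mult[OF tendsto_const]) simp
  qed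
  have "A * theta_det k (0 * q ^ (2 * k)) Y = 2 * product_side k q 0 \<sigma>"
    by (rule LIMSEQ_unique[OF e2]) (simp only: e1 e3)
  then show ?thesis using L[of 0] by simp
qed

lemma level_shuffle_limit:
  assumes \<sigma>: "\<sigma> \<in> {0, 1}" and q: "q = r\<^sup>2" "norm q < 1" "r \<noteq> 0" and t: "norm t < 1" and k: "k \<ge> 1"
  shows "(\<lambda>n. level_shuffle t (geom r \<sigma>) (bounded_wt k t) (2 * k) {..<n}) \<longlonglongrightarrow> product_side k q (t * q ^ (2 * k)) \<sigma>"
proof -
  have "norm r ^ 2 < 1" using q by (simp add: norm_power)
  then have r: "norm r < 1" by (simp add: power_less_one_iff)
  have "(\<lambda>n. lam_det k t (geom r \<sigma>) {..<n}) \<longlonglongrightarrow> 2 * product_side k q (t * q ^ (2 * k)) \<sigma>"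
    using lam_det_limit_value[OF \<sigma> q _ _ k, of t] lam_det_limit_value_0[OF \<sigma> q k] t by (cases "t = 0") auto
  moreover have "lam_det k t (geom r \<sigma>) {..<n} = 2 * level_shuffle t (geom r \<sigma>) (bounded_wt k t) (2 * k) {..<n}" for n
    using generic_geom[OF r q(3)] t k by (intro lam_det_eq_level_shuffle) auto
  ultimately have "(\<lambda>n. 2 * level_shuffle t (geom r \<sigma>) (bounded_wt k t) (2 * k) {..<n}) \<longlonglongrightarrow> 2 * product_side k q (t * q ^ (2 * k)) \<sigma>" by simp
  from tendsto_mult[OF tendsto_const[of "1 / 2"] this] show ?thesis by simp
qed

section \<open>Passing to infinitely many variables\<close>

lemma sum_geometric_le:
  fixes Q :: real
  assumes "0 \<le> Q" "Q < 1" "finite D"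
  shows "(\<Sum>d\<in>D. Q ^ d) \<le> 1 / (1 - Q)"
  using sum_le_suminf[of "\<lambda>d. Q ^ d" D] assms by (simp add: suminf_geometric summable_geometric)

definition dist_nat :: "nat \<Rightarrow> nat \<Rightarrow> nat" where
  "dist_nat i j = (if i < j then j - i else i - j)"

lemma sum_geometric_dist_le:
  fixes Q :: real
  assumes "0 \<le> Q" "Q < 1" "finite J"
  shows "(\<Sum>j\<in>J. Q ^ dist_nat i j) \<le> 2 / (1 - Q)"
proof -
  have "(\<Sum>j\<in>J. Q ^ dist_nat i j) = (\<Sum>j\<in>J \<inter> {..i}. Q ^ dist_nat i j) + (\<Sum>j\<in>J \<inter> {i<..}. Q ^ dist_nat i j)"
    by (subst sum.union_disjoint[symmetric]) (use assms in \<open>auto intro!: sum.cong\<close>)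
  moreover have "(\<Sum>j\<in>J \<inter> {..i}. Q ^ dist_nat i j) = (\<Sum>d\<in>(\<lambda>j. i - j) ` (J \<inter> {..i}). Q ^ d)"
    by (subst sum.reindex) (auto simp: inj_on_def dist_nat_def)
  moreover have "(\<Sum>j\<in>J \<inter> {i<..}. Q ^ dist_nat i j) = (\<Sum>d\<in>(\<lambda>j. j - i) ` (J \<inter> {i<..}). Q ^ d)"
    by (subst sum.reindex) (auto simp: inj_on_def dist_nat_def)
  ultimately show ?thesis
    using sum_geometric_le[OF assms(1,2), of "(\<lambda>j. i - j) ` (J \<inter> {..i})"]
      sum_geometric_le[OF assms(1,2), of "(\<lambda>j. j - i) ` (J \<inter> {i<..})"] assms(3) by simp
qed

text \<open>If z < 1 is the ratio of the smaller modulus to the larger one, |rho| is at most (1 + z)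
  / (1 - z); here z is Q to the power |i - j|.\<close>

lemma rho_geometric:
  fixes x :: "nat \<Rightarrow> complex"
  assumes x: "\<And>i. norm (x i) = c * Q ^ i" "c > 0" "0 < Q" "Q < 1" and t: "norm t \<le> 1" and ij: "i \<noteq> j"
  shows "norm (rho t (x i) (x j)) \<le> 1 + 2 / (1 - Q) * Q ^ dist_nat i j"
proof -
  define d where "d = dist_nat i j"
  have d: "d \<ge> 1" "Q ^ d \<le> Q" "Q ^ d < 1"
    using ij x power_decreasing[of 1 d Q] by (auto simp: d_def dist_nat_def power_less_one_iff)
  have main: "norm (rho t u v) \<le> (1 + z) / (1 - z)"
    if "z < 1" "z \<ge> 0" "(norm v = z * norm u \<and> u \<noteq> 0) \<or> (norm u = z * norm v \<and> v \<noteq> 0)" for u v :: complex and z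
  proof -
    define w where "w = (if norm v = z * norm u \<and> u \<noteq> 0 then u else v)"
    have w: "w \<noteq> 0" "norm u + norm v = (1 + z) * norm w" "(1 - z) * norm w \<le> norm (u - v)"
      using that norm_triangle_ineq2[of u v] norm_triangle_ineq2[of v u] by (auto simp: w_def algebra_simps norm_minus_commute split: if_splits)
    have "norm (u - t * v) \<le> norm u + norm (t * v)" by (rule norm_triangle_ineq4)
    also have "norm (t * v) \<le> norm v" using t by (simp add: norm_mult mult_left_le_one_le)
    finally have n: "norm (u - t * v) \<le> (1 + z) * norm w" using w by simp
    have "norm (rho t u v) = norm (u - t * v) / norm (u - v)" by (simp add: rho_def norm_divide)
    also have "\<dots> \<le> ((1 + z) * norm w) / ((1 - z) * norm w)"
      using n w that by (intro frac_le) auto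
    finally show ?thesis using w(1) by simp
  qed
  have x0: "x l \<noteq> 0" for l using x(1)[of l] x(2,3) by (metis mult_pos_pos norm_eq_zero less_irrefl zero_less_power)
  have "norm (rho t (x i) (x j)) \<le> (1 + Q ^ d) / (1 - Q ^ d)"
  proof (rule main)
    have "i < j \<Longrightarrow> Q ^ j = Q ^ d * Q ^ i" "\<not> i < j \<Longrightarrow> Q ^ i = Q ^ d * Q ^ j"
      by (auto simp: d_def dist_nat_def simp flip: power_add)
    then show "norm (x j) = Q ^ d * norm (x i) \<and> x i \<noteq> 0 \<or> norm (x i) = Q ^ d * norm (x j) \<and> x j \<noteq> 0"
      using x0 unfolding x(1) by auto
  qed (use d x in auto)
  also have "\<dots> = 1 + 2 * Q ^ d / (1 - Q ^ d)" using d by (simp add: field_simps)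
  also have "\<dots> \<le> 1 + 2 * Q ^ d / (1 - Q)" using d x by (intro add_left_mono divide_left_mono mult_pos_pos) auto
  finally show ?thesis by (simp add: d_def)
qed

text \<open>From rho - 1 = (1 - t) x j / (x i - x j). Only j > i is considered: variables appended
  later are smaller, and their interaction with a fixed x i tends to 1.\<close>

lemma rho_minus_1_geometric:
  fixes x :: "nat \<Rightarrow> complex"
  assumes x: "\<And>i. norm (x i) = c * Q ^ i" "c > 0" "0 < Q" "Q < 1" and t: "norm t \<le> 1" and ij: "i < j"
  shows "norm (rho t (x i) (x j) - 1) \<le> 2 / (1 - Q) * Q ^ (j - i)"
proof -
  define z where "z = Q ^ (j - i)"
  have z: "z \<le> Q" "0 \<le> z" using power_decreasing[of 1 "j - i" Q] ij x by (auto simp: z_def)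
  have "Q ^ j = z * Q ^ i" using ij by (simp add: z_def flip: power_add)
  then have v: "norm (x j) = z * norm (x i)" by (simp add: x(1))
  have u: "norm (x i) > 0" using x by simp
  have uv: "norm (x i - x j) \<ge> (1 - Q) * norm (x i)"
  proof -
    have "(1 - Q) * norm (x i) \<le> (1 - z) * norm (x i)" using z u by (intro mult_right_mono) auto
    also have "\<dots> \<le> norm (x i - x j)" using norm_triangle_ineq2[of "x i" "x j"] v by (simp add: algebra_simps)
    finally show ?thesis .
  qed
  then have ne: "x i - x j \<noteq> 0" using u x by (metis diff_gt_0_iff_gt mult_pos_pos norm_zero not_le)
  have "rho t (x i) (x j) - 1 = (1 - t) * x j / (x i - x j)" using ne by (simp add: rho_def field_simps)
  then have "norm (rho t (x i) (x j) - 1) = norm (1 - t) * norm (x j) / norm (x i - x j)" by (simp add: norm_mult norm_divide)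
  also have "\<dots> \<le> (2 * (z * norm (x i))) / ((1 - Q) * norm (x i))"
    unfolding v using norm_triangle_ineq4[of 1 t] t uv u x z by (intro frac_le mult_mono) auto
  also have "\<dots> = 2 / (1 - Q) * z" using u by simp
  finally show ?thesis by (simp add: z_def)
qed

definition finite_levels :: "nat \<Rightarrow> (nat \<Rightarrow> nat) set" where
  "finite_levels K = {f. finite {i. f i \<noteq> 0} \<and> (\<forall>i. f i \<le> K)}"

lemma levels_iff: "f \<in> levels {..<n} K \<longleftrightarrow> f \<in> finite_levels K \<and> {i. f i \<noteq> 0} \<subseteq> {..<n}"
proof
  assume f: "f \<in> levels {..<n} K"
  have sub: "{i. f i \<noteq> 0} \<subseteq> {..<n}"
  proof
    fix i assume "i \<in> {i. f i \<noteq> 0}"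
    then show "i \<in> {..<n}" using f by (cases "i < n") (auto simp: levels_def)
  qed
  moreover have "f i \<le> K" for i using f by (cases "i < n") (auto simp: levels_def)
  moreover have "finite {i. f i \<noteq> 0}" by (rule finite_subset[OF sub]) simp
  ultimately show "f \<in> finite_levels K \<and> {i. f i \<noteq> 0} \<subseteq> {..<n}" by (simp add: finite_levels_def)
next
  assume "f \<in> finite_levels K \<and> {i. f i \<noteq> 0} \<subseteq> {..<n}"
  then show "f \<in> levels {..<n} K" unfolding levels_def finite_levels_def by blast
qed

lemma finite_levels_bounded: "f \<in> finite_levels K \<Longrightarrow> \<exists>N. {i. f i \<noteq> 0} \<subseteq> {..<N}"
  using finite_nat_bounded[of "{i. f i \<noteq> 0}"] unfolding finite_levels_def by blast

text \<open>A variable at a positive level interacts with all others by a factor of modulus at most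
  exp(4 / (1 - Q)^2), independent of n, as the deviations sum to at most (2 / (1 - Q))^2. Its own
  power is at most |x i|, and variables at level 0 contribute 1.\<close>

lemma fterm_bound:
  fixes x :: "nat \<Rightarrow> complex"
  assumes x: "\<And>i. norm (x i) = c * Q ^ i" "0 < c" "c \<le> 1" "0 < Q" "Q < 1" and t: "norm t \<le> 1" and f: "{i. f i \<noteq> 0} \<subseteq> {..<n}"
  shows "norm (fterm t x {..<n} f) \<le> (\<Prod>i\<in>{i. f i \<noteq> 0}. exp (4 / (1 - Q)\<^sup>2) * norm (x i))"
proof -
  let ?M = "exp (4 / (1 - Q)\<^sup>2)"
  have J: "(\<Prod>j\<in>J. norm (rho t (x i) (x j))) \<le> ?M" if "finite J" "i \<notin> J" for i J
  proof -
    have "(\<Prod>j\<in>J. norm (rho t (x i) (x j))) \<le> (\<Prod>j\<in>J. 1 + 2 / (1 - Q) * Q ^ dist_nat i j)"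
      by (intro prod_mono conjI norm_ge_zero rho_geometric[OF x(1,2,4,5) t]) (use that in auto)
    also have "\<dots> \<le> exp (\<Sum>j\<in>J. 2 / (1 - Q) * Q ^ dist_nat i j)"
      using x by (intro prod_le_exp_sum) auto
    also have "(\<Sum>j\<in>J. 2 / (1 - Q) * Q ^ dist_nat i j) = 2 / (1 - Q) * (\<Sum>j\<in>J. Q ^ dist_nat i j)"
      by (simp add: sum_distrib_left)
    also have "exp \<dots> \<le> exp (2 / (1 - Q) * (2 / (1 - Q)))"
      using x sum_geometric_dist_le[OF _ x(5) that(1), of i] by (intro exp_le_cancel_iff[THEN iffD2] mult_left_mono) auto
    finally show ?thesis by (simp add: power2_eq_square)
  qed
  have "norm (fterm t x {..<n} f) = (\<Prod>i<n. norm (x i) ^ f i * (\<Prod>j\<in>{j\<in>{..<n}. f j < f i}. norm (rho t (x i) (x j))))"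
    by (simp add: fterm_def norm_mult prod_norm[symmetric] norm_power prod.distrib)
  also have "\<dots> \<le> (\<Prod>i<n. if f i \<noteq> 0 then ?M * norm (x i) else 1)"
  proof (intro prod_mono conjI)
    fix i
    show "norm (x i) ^ f i * (\<Prod>j\<in>{j\<in>{..<n}. f j < f i}. norm (rho t (x i) (x j))) \<le> (if f i \<noteq> 0 then ?M * norm (x i) else 1)"
    proof (cases "f i = 0")
      case False
      have "norm (x i) \<le> 1" using x by (simp add: mult_le_one power_le_one)
      then have "norm (x i) ^ f i \<le> norm (x i) ^ 1" using False by (intro power_decreasing) auto
      then have "norm (x i) ^ f i * (\<Prod>j\<in>{j\<in>{..<n}. f j < f i}. norm (rho t (x i) (x j))) \<le> norm (x i) * ?M"
        by (intro mult_mono J) (auto intro!: prod_nonneg)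
      then show ?thesis using False by (simp add: mult.commute)
    qed simp
  qed (auto intro!: mult_nonneg_nonneg prod_nonneg)
  also have "\<dots> = (\<Prod>i\<in>{i. f i \<noteq> 0}. ?M * norm (x i))"
    using f by (intro prod.mono_neutral_cong_right) auto
  finally show ?thesis .
qed

text \<open>Once n exceeds the support of f, new variables sit at level 0 and only lengthen finitely
  many products of rho, which converge by \<open>rho_minus_1_geometric\<close>.\<close>

lemma fterm_converges:
  fixes x :: "nat \<Rightarrow> complex"
  assumes x: "\<And>i. norm (x i) = c * Q ^ i" "0 < c" "0 < Q" "Q < 1" and t: "norm t \<le> 1" and f: "f \<in> finite_levels K"
  shows "convergent (\<lambda>n. fterm t x {..<n} f)"
proof -
  obtain N where N: "{i. f i \<noteq> 0} \<subseteq> {..<N}" using finite_levels_bounded[OF f] by blast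
  define h where "h i j = (if f j < f i then rho t (x i) (x j) else 1)" for i j
  have h: "convergent (\<lambda>n. \<Prod>j<n. h i j)" for i
  proof -
    have "summable (\<lambda>j. norm (h i j - 1))"
    proof (rule summable_comparison_test_ev)
      show "eventually (\<lambda>j. norm (norm (h i j - 1)) \<le> 2 / (1 - Q) * Q ^ (j - i)) sequentially"
        using eventually_gt_at_top[of i]
      proof eventually_elim
        case (elim j)
        show ?case using rho_minus_1_geometric[OF x t elim] x elim by (auto simp: h_def)
      qed
      have "summable (\<lambda>j. 2 / (1 - Q) * Q ^ (j + i - i))" using x by (simp add: summable_geometric summable_mult)
      then show "summable (\<lambda>j. 2 / (1 - Q) * Q ^ (j - i))" by (subst (asm) summable_iff_shift[of "\<lambda>j. 2 / (1 - Q) * Q ^ (j - i)" i])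
    qed
    then have "convergent_prod (h i)" by (intro abs_convergent_prod_imp_convergent_prod summable_imp_abs_convergent_prod)
    then have "convergent (\<lambda>n. \<Prod>j\<le>n. h i j)" by (rule convergent_prod_imp_convergent)
    then show ?thesis unfolding convergent_def using LIMSEQ_lessThan_iff_atMost by blast
  qed
  have "convergent (\<lambda>n. (\<Prod>i<N. x i ^ f i) * (\<Prod>i<N. \<Prod>j<n. h i j))"
    by (rule convergentI, rule tendsto_mult[OF tendsto_const tendsto_prod]) (use h in \<open>simp add: convergent_LIMSEQ_iff\<close>)
  moreover have ev: "eventually (\<lambda>n. fterm t x {..<n} f = (\<Prod>i<N. x i ^ f i) * (\<Prod>i<N. \<Prod>j<n. h i j)) sequentially"
    using eventually_ge_at_top[of N]
  proof eventually_elim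
    case (elim n)
    have z: "f i = 0" if "\<not> i < N" for i using N that by (metis (mono_tags, lifting) lessThan_iff mem_Collect_eq subsetD)
    have "(\<Prod>i<n. x i ^ f i) = (\<Prod>i<N. x i ^ f i)" using z elim by (intro prod.mono_neutral_right) auto
    moreover have "(\<Prod>i<n. \<Prod>j\<in>{j\<in>{..<n}. f j < f i}. rho t (x i) (x j)) = (\<Prod>i<N. \<Prod>j<n. h i j)"
    proof (rule prod.mono_neutral_cong_right)
      show "(\<Prod>j\<in>{j\<in>{..<n}. f j < f i}. rho t (x i) (x j)) = (\<Prod>j<n. h i j)" for i
        by (rule prod.mono_neutral_cong_left) (auto simp: h_def)
    qed (use z elim in auto)
    ultimately show ?case by (simp add: fterm_def)
  qed
  ultimately show ?thesis using convergent_cong[OF ev] by simp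
qed

lemma sum_prod_levels:
  fixes g :: "nat \<Rightarrow> nat \<Rightarrow> real"
  shows "(\<Sum>f\<in>levels {..<n} K. \<Prod>i<n. g i (f i)) = (\<Prod>i<n. \<Sum>a\<le>K. g i a)"
proof -
  have "(\<Prod>i<n. \<Sum>a\<le>K. g i a) = (\<Sum>f\<in>PiE {..<n} (\<lambda>_. {..K}). \<Prod>i<n. g i (f i))"
    by (rule prod_sum_PiE) auto
  also have "\<dots> = (\<Sum>f\<in>levels {..<n} K. \<Prod>i<n. g i (f i))"
    by (rule sum.reindex_bij_witness[of _ "\<lambda>f. restrict f {..<n}" "\<lambda>f i. if i < n then f i else 0"])
      (auto simp: levels_def PiE_def Pi_def extensional_def fun_eq_iff intro!: prod.cong)
  finally show ?thesis ..
qed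

text \<open>A finite family of assignments involves finitely many variables, where the total is at
  most the product of the factors 1 + K y i, bounded by the exponential of K times the sum of
  y.\<close>

lemma weights_summable:
  fixes y :: "nat \<Rightarrow> real"
  assumes y: "\<And>i. y i \<ge> 0" and s: "summable y"
  shows "(\<lambda>f. \<Prod>i\<in>{i. f i \<noteq> 0}. y i) summable_on finite_levels K"
proof (rule nonneg_bdd_above_summable_on)
  show "0 \<le> (\<Prod>i\<in>{i. f i \<noteq> 0}. y i)" for f :: "nat \<Rightarrow> nat" using y by (intro prod_nonneg) auto
  show "bdd_above (sum (\<lambda>f. \<Prod>i\<in>{i. f i \<noteq> 0}. y i) ` {F. F \<subseteq> finite_levels K \<and> finite F})"
  proof (rule bdd_aboveI2)
    fix F assume "F \<in> {F. F \<subseteq> finite_levels K \<and> finite F}"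
    then have F: "F \<subseteq> finite_levels K" "finite F" by auto
    have "finite (\<Union>f\<in>F. {i. f i \<noteq> 0})" using F by (auto simp: finite_levels_def)
    then obtain n where n: "(\<Union>f\<in>F. {i. f i \<noteq> 0}) \<subseteq> {..<n}" using finite_nat_bounded by blast
    have sub: "F \<subseteq> levels {..<n} K" 
    proof
      fix f assume f: "f \<in> F"
      then have "{i. f i \<noteq> 0} \<subseteq> {..<n}" using n by blast
      moreover have "f \<in> finite_levels K" using f F(1) by blast
      ultimately show "f \<in> levels {..<n} K" by (simp add: levels_iff)
    qed
    have "(\<Sum>f\<in>F. \<Prod>i\<in>{i. f i \<noteq> 0}. y i) \<le> (\<Sum>f\<in>levels {..<n} K. \<Prod>i\<in>{i. f i \<noteq> 0}. y i)"
      using sub y by (intro sum_mono2 finite_levels prod_nonneg) auto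
    also have "\<dots> = (\<Sum>f\<in>levels {..<n} K. \<Prod>i<n. if f i = 0 then 1 else y i)"
    proof (intro sum.cong refl)
      fix f assume "f \<in> levels {..<n} K"
      then have "{i. f i \<noteq> 0} \<subseteq> {..<n}" by (simp add: levels_iff)
      then show "(\<Prod>i\<in>{i. f i \<noteq> 0}. y i) = (\<Prod>i<n. if f i = 0 then 1 else y i)"
        by (intro prod.mono_neutral_cong_left) auto
    qed
    also have "\<dots> = (\<Prod>i<n. \<Sum>a\<le>K. if a = 0 then 1 else y i)"
      by (rule sum_prod_levels[of "\<lambda>i a. if a = 0 then 1 else y i"])
    also have "\<dots> = (\<Prod>i<n. 1 + real K * y i)"
      by (simp add: sum.atMost_shift)
    also have "\<dots> \<le> exp (\<Sum>i<n. real K * y i)" using y by (intro prod_le_exp_sum) auto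
    also have "(\<Sum>i<n. real K * y i) \<le> real K * suminf y"
      unfolding sum_distrib_left[symmetric] using sum_le_suminf[OF s, of "{..<n}"] y by (intro mult_left_mono) auto
    finally show "(\<Sum>f\<in>F. \<Prod>i\<in>{i. f i \<noteq> 0}. y i) \<le> exp (real K * suminf y)" by simp
  qed
qed

lemma infsum_levels:
  fixes F :: "(nat \<Rightarrow> nat) \<Rightarrow> complex"
  shows "(\<Sum>\<^sub>\<infinity>f\<in>{f\<in>finite_levels K. P f}. if f \<in> levels {..<n} K then F f else 0) = (\<Sum>f\<in>{f\<in>levels {..<n} K. P f}. F f)"
proof -
  have "(\<Sum>\<^sub>\<infinity>f\<in>{f\<in>finite_levels K. P f}. if f \<in> levels {..<n} K then F f else 0) = (\<Sum>\<^sub>\<infinity>f\<in>{f\<in>levels {..<n} K. P f}. F f)"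
    by (rule infsum_cong_neutral) (auto simp: levels_iff)
  also have "\<dots> = (\<Sum>f\<in>{f\<in>levels {..<n} K. P f}. F f)"
    by (rule infsum_finite) (simp add: finite_levels)
  finally show ?thesis .
qed

definition fterm_limit :: "complex \<Rightarrow> (nat \<Rightarrow> complex) \<Rightarrow> (nat \<Rightarrow> nat) \<Rightarrow> complex" where
  "fterm_limit t x f = lim (\<lambda>n. fterm t x {..<n} f)"

text \<open>The predicate \<open>P\<close> serves two uses: a fixed type, for one Hall-Littlewood
  polynomial, and the trivial predicate, for the whole weighted sum.\<close>

lemma fterm_sum_limit:
  fixes x :: "nat \<Rightarrow> complex" and W :: "(nat \<Rightarrow> nat) \<Rightarrow> complex"
  assumes x: "\<And>i. norm (x i) = c * Q ^ i" "0 < c" "c \<le> 1" "0 < Q" "Q < 1" and t: "norm t \<le> 1"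
    and W: "\<And>f. norm (W f) \<le> C"
  shows "(\<lambda>f. fterm_limit t x f * W f) summable_on {f\<in>finite_levels K. P f}"
    "(\<lambda>n. \<Sum>f\<in>{f\<in>levels {..<n} K. P f}. fterm t x {..<n} f * W f) \<longlonglongrightarrow> (\<Sum>\<^sub>\<infinity>f\<in>{f\<in>finite_levels K. P f}. fterm_limit t x f * W f)"
proof -
  define M where "M = exp (4 / (1 - Q)\<^sup>2)"
  define a where "a n f = (if f \<in> levels {..<n} K then fterm t x {..<n} f * W f else 0)" for n f
  have C: "C \<ge> 0" using order_trans[OF norm_ge_zero W] by simp
  have pw: "(\<lambda>n. a n f) \<longlonglongrightarrow> fterm_limit t x f * W f" if f: "f \<in> {f\<in>finite_levels K. P f}" for f
  proof -
    have "(\<lambda>n. fterm t x {..<n} f) \<longlonglongrightarrow> fterm_limit t x f"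
      using fterm_converges[OF x(1,2,4,5) t, of f K] f by (simp add: fterm_limit_def convergent_LIMSEQ_iff)
    then have "(\<lambda>n. fterm t x {..<n} f * W f) \<longlonglongrightarrow> fterm_limit t x f * W f" by (intro tendsto_intros)
    moreover obtain N where N: "{i. f i \<noteq> 0} \<subseteq> {..<N}" using finite_levels_bounded[of f K] f by auto
    have "eventually (\<lambda>n. fterm t x {..<n} f * W f = a n f) sequentially"
      using eventually_ge_at_top[of N]
    proof eventually_elim
      case (elim n)
      then have "f \<in> levels {..<n} K" using N f by (auto simp: levels_iff)
      then show ?case by (simp add: a_def)
    qed
    ultimately show ?thesis by (rule Lim_transform_eventually)
  qed
  have bd: "norm (a n f) \<le> (\<Prod>i\<in>{i. f i \<noteq> 0}. M * norm (x i)) * C" for n f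
  proof (cases "f \<in> levels {..<n} K")
    case True
    then have "norm (fterm t x {..<n} f * W f) \<le> (\<Prod>i\<in>{i. f i \<noteq> 0}. M * norm (x i)) * C"
      unfolding norm_mult M_def using W
      by (intro mult_mono fterm_bound[OF x t]) (auto simp: levels_iff intro!: prod_nonneg)
    then show ?thesis using True by (simp add: a_def)
  next
    case False
    then show ?thesis using C unfolding a_def by (auto simp: M_def intro!: mult_nonneg_nonneg prod_nonneg)
  qed
  have "summable (\<lambda>i. M * norm (x i))" unfolding x(1) using x by (intro summable_mult summable_geometric) auto
  then have "(\<lambda>f. \<Prod>i\<in>{i. f i \<noteq> 0}. M * norm (x i)) summable_on finite_levels K"
    by (intro weights_summable) (auto simp: M_def)
  then have "(\<lambda>f. \<Prod>i\<in>{i. f i \<noteq> 0}. M * norm (x i)) summable_on {f\<in>finite_levels K. P f}"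
    by (rule summable_on_subset_banach) blast
  then have "(\<lambda>f. (\<Prod>i\<in>{i. f i \<noteq> 0}. M * norm (x i)) * C) summable_on {f\<in>finite_levels K. P f}"
    by (rule summable_on_cmult_left)
  note T = tannery_infsum[of "{f\<in>finite_levels K. P f}" a, OF pw bd this]
  show "(\<lambda>f. fterm_limit t x f * W f) summable_on {f\<in>finite_levels K. P f}" by (rule T(1))
  show "(\<lambda>n. \<Sum>f\<in>{f\<in>levels {..<n} K. P f}. fterm t x {..<n} f * W f) \<longlonglongrightarrow> (\<Sum>\<^sub>\<infinity>f\<in>{f\<in>finite_levels K. P f}. fterm_limit t x f * W f)"
    using T(2) unfolding a_def infsum_levels .
qed

section \<open>Summation over partitions\<close>

definition level_type :: "(nat \<Rightarrow> nat) \<Rightarrow> nat multiset" where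
  "level_type f = image_mset f (mset_set {i. f i \<noteq> 0})"

definition bounded_partitions :: "nat \<Rightarrow> nat multiset set" where
  "bounded_partitions K = {\<mu>. 0 \<notin># \<mu> \<and> (\<forall>i\<in>#\<mu>. i \<le> K)}"

lemma count_level_type:
  assumes "f \<in> finite_levels K" "a \<noteq> 0"
  shows "count (level_type f) a = card {i. f i = a}"
proof -
  have "finite {i. f i \<noteq> 0}" using assms(1) by (simp add: finite_levels_def)
  then have "count (level_type f) a = card {i\<in>{i. f i \<noteq> 0}. f i = a}"
    unfolding level_type_def by (rule count_image_mset_eq_card_vimage)
  also have "{i\<in>{i. f i \<noteq> 0}. f i = a} = {i. f i = a}" using assms(2) by auto
  finally show ?thesis .
qed

lemma level_type_bounded_partitions: "f \<in> finite_levels K \<Longrightarrow> level_type f \<in> bounded_partitions K"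
  by (auto simp: level_type_def bounded_partitions_def finite_levels_def)

lemma ftype_iff_level_type:
  assumes "\<mu> \<in> bounded_partitions K" "f \<in> finite_levels K"
  shows "ftype K \<mu> f \<longleftrightarrow> level_type f = \<mu>"
proof
  assume F: "ftype K \<mu> f"
  show "level_type f = \<mu>"
  proof (rule multiset_eqI)
    fix a
    show "count (level_type f) a = count \<mu> a"
    proof (cases "a \<in> {1..K}")
      case True
      then show ?thesis using F count_level_type[OF assms(2), of a] by (simp add: ftype_def)
    next
      case False
      then have "a \<notin># \<nu>" if "\<nu> \<in> bounded_partitions K" for \<nu>
        using that unfolding bounded_partitions_def by (cases "a = 0") auto
      then have "a \<notin># \<mu>" "a \<notin># level_type f" using assms(1) level_type_bounded_partitions[OF assms(2)] by auto
      then show ?thesis by (simp add: not_in_iff)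
    qed
  qed
next
  assume "level_type f = \<mu>"
  then show "ftype K \<mu> f" using count_level_type[OF assms(2)] by (auto simp: ftype_def)
qed

lemma sum_eq_level_type:
  assumes "f \<in> levels {..<n} K"
  shows "(\<Sum>i<n. f i) = sum_mset (level_type f)"
proof -
  have "(\<Sum>i<n. f i) = (\<Sum>i\<in>{i. f i \<noteq> 0}. f i)"
    using assms by (intro sum.mono_neutral_right) (auto simp: levels_iff)
  then show ?thesis by (simp add: level_type_def sum_unfold_sum_mset)
qed

lemma fterm_scale:
  assumes "b \<noteq> 0"
  shows "fterm t (\<lambda>i. b * y i) {..<n} f = b ^ (\<Sum>i<n. f i) * fterm t y {..<n} f"
proof -
  have "rho t (b * u) (b * v) = rho t u v" for u v
  proof -
    have "b * u - t * (b * v) = b * (u - t * v)" "b * u - b * v = b * (u - v)" by (simp_all add: algebra_simps)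
    then show ?thesis using assms by (simp add: rho_def)
  qed
  then show ?thesis by (simp add: fterm_def power_mult_distrib prod.distrib power_sum)
qed

text \<open>Dominated convergence also shows that the limit in
  \<open>hall_littlewood_principal\<close> exists. The power of r is homogeneity,
  \<open>fterm_scale\<close>, applied to \<open>geom\<close>.\<close>

lemma principal_eq_infsum:
  assumes q: "q = r\<^sup>2" "norm q < 1" "r \<noteq> 0" and t: "norm t < 1" and \<mu>: "\<mu> \<in> bounded_partitions K"
  shows "(r ^ (\<sigma> + 1)) ^ sum_mset \<mu> * hall_littlewood_principal \<mu> q t = (\<Sum>\<^sub>\<infinity>f\<in>{f\<in>finite_levels K. level_type f = \<mu>}. fterm_limit t (geom r \<sigma>) f)"
proof -
  define b where "b = r ^ (\<sigma> + 1)"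
  have b: "b \<noteq> 0" using q by (simp add: b_def)
  have x: "geom r \<sigma> = (\<lambda>i. b * q ^ i)"
    unfolding geom_def b_def q(1) power_mult[symmetric] power_add[symmetric] by (simp add: add_ac)
  have "norm r ^ 2 < 1" using q by (simp add: norm_power)
  then have r1: "norm r < 1" by (simp add: power_less_one_iff)
  have inj: "inj_on (\<lambda>i. q ^ i) {..<n}" for n
  proof -
    have "inj_on (geom r \<sigma>) {..<n}" using generic_geom[OF r1 q(3), of \<sigma> n] by (simp add: generic_def)
    then show ?thesis unfolding x using b by (simp add: inj_on_def)
  qed
  have "(\<lambda>n. \<Sum>f\<in>{f\<in>levels {..<n} K. level_type f = \<mu>}. fterm t (geom r \<sigma>) {..<n} f * 1) \<longlonglongrightarrow> (\<Sum>\<^sub>\<infinity>f\<in>{f\<in>finite_levels K. level_type f = \<mu>}. fterm_limit t (geom r \<sigma>) f * 1)"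
  proof (rule fterm_sum_limit(2))
    show "norm (geom r \<sigma> i) = norm b * norm q ^ i" for i by (simp add: x norm_mult norm_power)
    show "norm b \<le> 1" using r1 unfolding b_def norm_power by (intro power_le_one) auto
    show "norm (1 :: complex) \<le> 1" by simp
  qed (use b q t in auto)
  then have "(\<lambda>n. inverse (b ^ sum_mset \<mu>) * (\<Sum>f\<in>{f\<in>levels {..<n} K. level_type f = \<mu>}. fterm t (geom r \<sigma>) {..<n} f)) \<longlonglongrightarrow>
     inverse (b ^ sum_mset \<mu>) * (\<Sum>\<^sub>\<infinity>f\<in>{f\<in>finite_levels K. level_type f = \<mu>}. fterm_limit t (geom r \<sigma>) f)"
    by (intro tendsto_mult[OF tendsto_const]) simp
  moreover have "eventually (\<lambda>n. inverse (b ^ sum_mset \<mu>) * (\<Sum>f\<in>{f\<in>levels {..<n} K. level_type f = \<mu>}. fterm t (geom r \<sigma>) {..<n} f) = hall_littlewood n \<mu> t (\<lambda>i. q ^ i)) sequentially"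
    using eventually_ge_at_top[of "size \<mu>"]
  proof eventually_elim
    case (elim n)
    have "hall_littlewood n \<mu> t (\<lambda>i. q ^ i) = hl_formula n \<mu> t (\<lambda>i. q ^ i)"
      by (rule hall_littlewood_eq_formula[OF elim inj])
    also have "\<dots> = (\<Sum>f\<in>{f\<in>levels {..<n} K. ftype K \<mu> f}. fterm t (\<lambda>i. q ^ i) {..<n} f)"
      by (rule hl_formula_eq_sum) (use \<mu> elim t q inj in \<open>auto simp: bounded_partitions_def\<close>)
    also have "{f\<in>levels {..<n} K. ftype K \<mu> f} = {f\<in>levels {..<n} K. level_type f = \<mu>}"
      using ftype_iff_level_type[OF \<mu>] by (auto simp: levels_iff)
    finally have H: "hall_littlewood n \<mu> t (\<lambda>i. q ^ i) = (\<Sum>f\<in>{f\<in>levels {..<n} K. level_type f = \<mu>}. fterm t (\<lambda>i. q ^ i) {..<n} f)" .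
    have "(\<Sum>f\<in>{f\<in>levels {..<n} K. level_type f = \<mu>}. fterm t (geom r \<sigma>) {..<n} f) =
      (\<Sum>f\<in>{f\<in>levels {..<n} K. level_type f = \<mu>}. b ^ sum_mset \<mu> * fterm t (\<lambda>i. q ^ i) {..<n} f)"
    proof (intro sum.cong refl)
      fix f assume "f \<in> {f\<in>levels {..<n} K. level_type f = \<mu>}"
      then show "fterm t (geom r \<sigma>) {..<n} f = b ^ sum_mset \<mu> * fterm t (\<lambda>i. q ^ i) {..<n} f"
        unfolding x using fterm_scale[OF b, of t "\<lambda>i. q ^ i" n f] sum_eq_level_type[of f n K] by simp
    qed
    then show ?case using b by (simp add: H sum_distrib_left[symmetric])
  qed
  ultimately have "(\<lambda>n. hall_littlewood n \<mu> t (\<lambda>i. q ^ i)) \<longlonglongrightarrow> inverse (b ^ sum_mset \<mu>) * (\<Sum>\<^sub>\<infinity>f\<in>{f\<in>finite_levels K. level_type f = \<mu>}. fterm_limit t (geom r \<sigma>) f)"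
    by (rule Lim_transform_eventually)
  then have "hall_littlewood_principal \<mu> q t = inverse (b ^ sum_mset \<mu>) * (\<Sum>\<^sub>\<infinity>f\<in>{f\<in>finite_levels K. level_type f = \<mu>}. fterm_limit t (geom r \<sigma>) f)"
    unfolding hall_littlewood_principal_def by (rule limI)
  then show ?thesis unfolding b_def[symmetric] using b by simp
qed

definition type_weight :: "nat \<Rightarrow> complex \<Rightarrow> nat multiset \<Rightarrow> complex" where
  "type_weight k t \<mu> = (\<Prod>a\<in>{1..2 * k}. bounded_wt k t a (count \<mu> a))"

lemma norm_bounded_wt_le:
  assumes "norm t < 1"
  shows "norm (bounded_wt k t a m) \<le> exp (norm t / (1 - norm (t\<^sup>2)))"
proof -
  define C where "C = exp (norm t / (1 - norm (t\<^sup>2)))"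
  have t2: "norm (t\<^sup>2) < 1" using assms by (simp add: norm_power power_less_one_iff)
  have C: "1 \<le> C" using t2 by (simp add: C_def)
  have q: "norm (qpoch t (t\<^sup>2) n) \<le> C" for n unfolding C_def by (rule norm_qpoch_bounds(1)[OF t2])
  have "norm (t ^ n * qpoch t (t\<^sup>2) n) \<le> 1 * C" for n
    unfolding norm_mult norm_power using assms q by (intro mult_mono power_le_one) auto
  then have "norm (bounded_wt k t a m) \<le> C" using q C by (auto simp: bounded_wt_def wt_def)
  then show ?thesis by (simp add: C_def)
qed

text \<open>The sum over all level assignments is known from \<open>level_shuffle_limit\<close>. It
  may be regrouped by type, and each group is a single Hall-Littlewood value.\<close>

lemma weighted_has_sum:
  assumes \<sigma>: "\<sigma> \<in> {0, 1}" and q: "q = r\<^sup>2" "norm q < 1" "r \<noteq> 0" and t: "norm t < 1" and k: "k \<ge> 1"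
  shows "((\<lambda>\<mu>. type_weight k t \<mu> * ((r ^ (\<sigma> + 1)) ^ sum_mset \<mu> * hall_littlewood_principal \<mu> q t)) has_sum product_side k q (t * q ^ (2 * k)) \<sigma>) (bounded_partitions (2 * k))"
proof -
  let ?x = "geom r \<sigma>" and ?K = "2 * k"
  define W where "W f = type_weight k t (level_type f)" for f
  define C where "C = exp (norm t / (1 - norm (t\<^sup>2)))"
  have "norm r ^ 2 < 1" using q by (simp add: norm_power)
  then have r1: "norm r < 1" by (simp add: power_less_one_iff)
  have x: "norm (?x i) = norm r ^ (\<sigma> + 1) * norm q ^ i" for i
    unfolding geom_def q(1) norm_power power_mult[symmetric] power_add[symmetric] by (simp add: add_ac)
  have W: "norm (W f) \<le> C ^ card {1..?K}" for f
    unfolding W_def type_weight_def prod_norm[symmetric] C_def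
    by (rule order_trans[OF prod_mono[where g = "\<lambda>_. exp (norm t / (1 - norm (t\<^sup>2)))"]]) (auto simp: norm_bounded_wt_le[OF t])
  have c: "0 < norm r ^ (\<sigma> + 1)" "norm r ^ (\<sigma> + 1) \<le> 1" "0 < norm q" "norm t \<le> 1"
    using r1 q t by (auto intro!: power_le_one mult_le_one)
  note lim = fterm_sum_limit[where W = W and P = "\<lambda>_. True" and K = ?K, OF x c(1,2,3) q(2) c(4) W]
  have fw: "(\<Prod>a\<le>?K. bounded_wt k t a (card {i\<in>{..<n}. f i = a})) = W f" if f: "f \<in> levels {..<n} ?K" for n f
  proof -
    have "{..?K} = insert 0 {1..?K}" by auto
    then have "(\<Prod>a\<le>?K. bounded_wt k t a (card {i\<in>{..<n}. f i = a})) = bounded_wt k t 0 (card {i\<in>{..<n}. f i = 0}) * (\<Prod>a\<in>{1..?K}. bounded_wt k t a (card {i\<in>{..<n}. f i = a}))"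
      by simp
    also have "\<dots> = (\<Prod>a\<in>{1..?K}. bounded_wt k t a (card {i\<in>{..<n}. f i = a}))" by (simp add: bounded_wt_def)
    also have "\<dots> = W f" unfolding W_def type_weight_def
    proof (intro prod.cong refl)
      fix a assume a: "a \<in> {1..?K}"
      have "{i\<in>{..<n}. f i = a} = {i. f i = a}" using f a by (auto simp: levels_def)
      then show "bounded_wt k t a (card {i\<in>{..<n}. f i = a}) = bounded_wt k t a (count (level_type f) a)"
        using count_level_type[of f ?K a] f a by (simp add: levels_iff)
    qed
    finally show ?thesis .
  qed
  have "level_shuffle t ?x (bounded_wt k t) ?K {..<n} = (\<Sum>f\<in>{f\<in>levels {..<n} ?K. True}. fterm t ?x {..<n} f * W f)" for n
    unfolding level_shuffle_eq_sum[OF finite_lessThan] using fw by simp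
  then have "(\<lambda>n. \<Sum>f\<in>{f\<in>levels {..<n} ?K. True}. fterm t ?x {..<n} f * W f) \<longlonglongrightarrow> product_side k q (t * q ^ ?K) \<sigma>"
    using level_shuffle_limit[OF \<sigma> q t k] by simp
  then have eq: "(\<Sum>\<^sub>\<infinity>f\<in>finite_levels ?K. fterm_limit t ?x f * W f) = product_side k q (t * q ^ ?K) \<sigma>"
    using LIMSEQ_unique[OF lim(2)] by simp
  have "((\<lambda>f. fterm_limit t ?x f * W f) has_sum product_side k q (t * q ^ ?K) \<sigma>) (finite_levels ?K)"
    unfolding eq[symmetric] using lim(1) by (intro has_sum_infsum) simp
  then have S: "((\<lambda>(\<mu>, f). fterm_limit t ?x f * W f) has_sum product_side k q (t * q ^ ?K) \<sigma>) (Sigma (bounded_partitions ?K) (\<lambda>\<mu>. {f\<in>finite_levels ?K. level_type f = \<mu>}))"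
    by (subst has_sum_reindex_bij_witness[of _ "\<lambda>f. (level_type f, f)" snd _ "\<lambda>f. fterm_limit t ?x f * W f"]) (auto simp: level_type_bounded_partitions)
  show ?thesis
  proof (rule has_sum_Sigma'[OF S])
    fix \<mu> assume \<mu>: "\<mu> \<in> bounded_partitions ?K"
    have sm: "(\<lambda>f. fterm_limit t ?x f * 1) summable_on {f\<in>finite_levels ?K. level_type f = \<mu>}"
      by (rule fterm_sum_limit(1)[where C = 1, OF x c(1,2,3) q(2) c(4)]) simp
    have "((\<lambda>f. type_weight k t \<mu> * fterm_limit t ?x f) has_sum type_weight k t \<mu> * ((r ^ (\<sigma> + 1)) ^ sum_mset \<mu> * hall_littlewood_principal \<mu> q t)) {f\<in>finite_levels ?K. level_type f = \<mu>}"
      unfolding principal_eq_infsum[OF q t \<mu>] using sm by (intro has_sum_cmult_right has_sum_infsum) simp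
    then show "((\<lambda>f. case (\<mu>, f) of (\<mu>, f) \<Rightarrow> fterm_limit t ?x f * W f) has_sum type_weight k t \<mu> * ((r ^ (\<sigma> + 1)) ^ sum_mset \<mu> * hall_littlewood_principal \<mu> q t)) {f\<in>finite_levels ?K. level_type f = \<mu>}"
      by (rule has_sum_cong[THEN iffD1, rotated]) (simp add: W_def mult.commute)
  qed
qed

text \<open>With even multiplicities of the odd parts this makes |\<mu>| even, so that (\<sigma> +
  1) |\<mu>| / 2 is integral and the choice of the square root r disappears.\<close>

lemma even_sum_mset_iff: "even (sum_mset \<mu>) \<longleftrightarrow> even (size (odd_parts \<mu>))"
  unfolding odd_parts_def by (induction \<mu>) auto

lemma size_odd_parts:
  assumes "\<mu> \<in> bounded_partitions (2 * k)"
  shows "size (odd_parts \<mu>) = (\<Sum>i\<in>{i\<in>{1..2 * k - 1}. odd i}. count \<mu> i)"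
proof -
  have "size (odd_parts \<mu>) = (\<Sum>i\<in>set_mset (odd_parts \<mu>). count (odd_parts \<mu>) i)"
    by (rule size_multiset_overloaded_eq)
  also have "\<dots> = (\<Sum>i\<in>{i\<in>{1..2 * k - 1}. odd i}. count \<mu> i)"
  proof (rule sum.mono_neutral_cong_left)
    show "set_mset (odd_parts \<mu>) \<subseteq> {i\<in>{1..2 * k - 1}. odd i}"
    proof
      fix i assume "i \<in> set_mset (odd_parts \<mu>)"
      then have i: "i \<in># \<mu>" "odd i" by (auto simp: odd_parts_def)
      then have "i \<le> 2 * k" "i \<noteq> 2 * k" using assms by (auto simp: bounded_partitions_def)
      then show "i \<in> {i\<in>{1..2 * k - 1}. odd i}" using i(2) by (auto simp: Suc_le_eq odd_pos)
    qed
    show "\<forall>i\<in>{i\<in>{1..2 * k - 1}. odd i} - set_mset (odd_parts \<mu>). count \<mu> i = 0"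
      by (auto simp: odd_parts_def count_eq_zero_iff)
  qed (auto simp: odd_parts_def)
  finally show ?thesis .
qed

lemma ceiling_half: "nat \<lceil>real m / 2\<rceil> = (m + 1) div 2"
proof (cases "even m")
  case True
  then obtain n where "m = 2 * n" by blast
  then show ?thesis by simp
next
  case False
  then obtain n where m: "m = 2 * n + 1" by (elim oddE)
  have "\<lceil>real m / 2\<rceil> = int n + 1" by (rule ceiling_unique) (auto simp: m)
  then show ?thesis by (simp add: m)
qed

text \<open>The restriction on the partitions is encoded in the zeros of \<open>wt\<close> at odd
  multiplicities of odd parts. The part 2k is even, so all odd parts are at most 2k - 1.\<close>

lemma type_weight_eq:
  assumes k: "k \<ge> 1" and \<mu>: "\<mu> \<in> bounded_partitions (2 * k)"
  shows "type_weight k t \<mu> = (if \<forall>i. odd i \<longrightarrow> even (count \<mu> i)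
    then t ^ (size (odd_parts \<mu>) div 2) * (\<Prod>i = 1..2 * k - 1. qpoch t (t\<^sup>2) (nat \<lceil>real (count \<mu> i) / 2\<rceil>)) else 0)"
proof -
  have "{1..2 * k} = insert (2 * k) {1..2 * k - 1}" using k by auto
  then have "type_weight k t \<mu> = bounded_wt k t (2 * k) (count \<mu> (2 * k)) * (\<Prod>a\<in>{1..2 * k - 1}. bounded_wt k t a (count \<mu> a))"
    using k unfolding type_weight_def by (simp only:) (subst prod.insert, auto)
  also have "\<dots> = (\<Prod>a\<in>{1..2 * k - 1}. wt t a (count \<mu> a))"
    by (auto simp: bounded_wt_def intro!: prod.cong)
  finally have type_weight: "type_weight k t \<mu> = \<dots>" .
  show ?thesis
  proof (cases "\<forall>i. odd i \<longrightarrow> even (count \<mu> i)")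
    case True
    have "size (odd_parts \<mu>) = 2 * (\<Sum>i\<in>{i\<in>{1..2 * k - 1}. odd i}. count \<mu> i div 2)"
      unfolding size_odd_parts[OF \<mu>] sum_distrib_left using True by (intro sum.cong refl) auto
    then have "t ^ (size (odd_parts \<mu>) div 2) = (\<Prod>i\<in>{i\<in>{1..2 * k - 1}. odd i}. t ^ (count \<mu> i div 2))"
      by (simp add: power_sum)
    also have "\<dots> = (\<Prod>i\<in>{1..2 * k - 1}. if odd i then t ^ (count \<mu> i div 2) else 1)"
      by (intro prod.mono_neutral_cong_left) auto
    finally have "t ^ (size (odd_parts \<mu>) div 2) * (\<Prod>i = 1..2 * k - 1. qpoch t (t\<^sup>2) (nat \<lceil>real (count \<mu> i) / 2\<rceil>)) =
      (\<Prod>i\<in>{1..2 * k - 1}. (if odd i then t ^ (count \<mu> i div 2) else 1) * qpoch t (t\<^sup>2) (nat \<lceil>real (count \<mu> i) / 2\<rceil>))"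
      by (simp add: prod.distrib)
    also have "\<dots> = (\<Prod>a\<in>{1..2 * k - 1}. wt t a (count \<mu> a))"
    proof (intro prod.cong refl)
      fix i
      show "(if odd i then t ^ (count \<mu> i div 2) else 1) * qpoch t (t\<^sup>2) (nat \<lceil>real (count \<mu> i) / 2\<rceil>) = wt t i (count \<mu> i)"
        unfolding ceiling_half using True by (auto simp: wt_def)
    qed
    finally show ?thesis using type_weight True by simp
  next
    case False
    then obtain i where i: "odd i" "odd (count \<mu> i)" by blast
    have "count \<mu> i \<noteq> 0" using i(2) by (cases "count \<mu> i = 0") auto
    then have "i \<in># \<mu>" by (meson not_in_iff)
    then have "i \<le> 2 * k" using \<mu> by (auto simp: bounded_partitions_def)
    moreover have "i \<noteq> 2 * k" "i \<noteq> 0" using i(1) by (auto intro: ccontr)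
    ultimately have "i \<in> {1..2 * k - 1}" by auto
    moreover have "wt t i (count \<mu> i) = 0" using i by (simp add: wt_def)
    ultimately have "(\<Prod>a\<in>{1..2 * k - 1}. wt t a (count \<mu> a)) = 0" by (intro prod_zero) auto
    then show ?thesis unfolding if_not_P[OF False] type_weight .
  qed
qed

lemma product_side_eq:
  "product_side k q p \<sigma> = qpoch_inf (p\<^sup>2) (p\<^sup>2) * qpoch_inf p p ^ (k - 1) / qpoch_inf q q ^ k *
     (\<Prod>i = 1..k. theta (q ^ (2 * i - \<sigma>)) (p\<^sup>2)) *
     (\<Prod>j = 1..k. \<Prod>i = 1..<j. theta (q ^ (j - i)) p * theta (q ^ (i + j - \<sigma>)) p)"
proof -
  have 1: "(\<Prod>i = 1..k. theta (q ^ (2 * i - \<sigma>)) (p\<^sup>2)) = (\<Prod>a<k. theta (q ^ (2 * (a + 1) - \<sigma>)) (p\<^sup>2))"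
    by (simp add: prod.atLeast1_atMost_eq)
  have "(\<Prod>j = 1..k. \<Prod>i = 1..<j. theta (q ^ (j - i)) p * theta (q ^ (i + j - \<sigma>)) p) =
     (\<Prod>j<k. \<Prod>i\<in>{1..j}. theta (q ^ (Suc j - i)) p * theta (q ^ (i + Suc j - \<sigma>)) p)"
    by (simp add: prod.atLeast1_atMost_eq atLeastLessThanSuc_atLeastAtMost)
  also have "\<dots> = (\<Prod>j<k. \<Prod>i<j. theta (q ^ (i + j + 2 - \<sigma>)) p * theta (q ^ (j - i)) p)"
    unfolding One_nat_def prod.atLeast1_atMost_eq by (intro prod.cong refl) (simp add: mult.commute)
  finally show ?thesis unfolding product_side_def theta_prod_geometric_def 1 by (simp add: mult.assoc)
qed

text \<open>The expansion \<open>hl_formula_eq_sum\<close> is available for nonzero variables; a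
  small common translation makes them so, and continuity gives the remaining points.\<close>

lemma hl_formula_empty:
  assumes t: "norm t < 1" and y: "inj_on y {..<n}"
  shows "hl_formula n {#} t y = 1"
proof -
  have nz: "hl_formula n {#} t z = 1" if z: "inj_on z {..<n}" "\<And>i. i < n \<Longrightarrow> z i \<noteq> 0" for z
  proof -
    have "hl_formula n {#} t z = (\<Sum>f\<in>{f\<in>levels {..<n} 0. ftype 0 {#} f}. fterm t z {..<n} f)"
      by (rule hl_formula_eq_sum) (use z t in auto)
    also have "{f\<in>levels {..<n} 0. ftype 0 {#} f} = {\<lambda>_. 0}" by (auto simp: levels_def ftype_def)
    finally show ?thesis by (simp add: fterm_def)
  qed
  have ne: "y (w i) \<noteq> y (w j)" if "w permutes {..<n}" "i < j" "j < n" for w i j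
  proof -
    have "w i < n" "w j < n" "w i \<noteq> w j"
      using that permutes_in_image[OF that(1)] permutes_inj[OF that(1)] by (auto dest: injD)
    then show ?thesis using y by (auto dest: inj_onD)
  qed
  have "((\<lambda>e. hl_formula n {#} t (\<lambda>i. y i + e)) \<longlongrightarrow> hl_formula n {#} t (\<lambda>i. y i + 0)) (at 0)"
    unfolding hl_formula_def by (intro tendsto_intros) (use ne in auto)
  moreover have "eventually (\<lambda>e. hl_formula n {#} t (\<lambda>i. y i + e) = 1) (at 0)"
  proof -
    have "eventually (\<lambda>e. \<forall>i\<in>{..<n}. e \<noteq> - y i) (at 0)"
      by (intro eventually_ball_finite finite_lessThan ballI eventually_neq_at_within)
    then show ?thesis
    proof eventually_elim
      case (elim e)
      show ?case
      proof (rule nz)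
        show "inj_on (\<lambda>i. y i + e) {..<n}" using y by (auto simp: inj_on_def)
        show "y i + e \<noteq> 0" if "i < n" for i using elim that by (auto simp: add_eq_0_iff)
      qed
    qed
  qed
  then have "((\<lambda>e. hl_formula n {#} t (\<lambda>i. y i + e)) \<longlongrightarrow> 1) (at 0)" by (rule tendsto_eventually)
  ultimately show ?thesis using tendsto_unique[OF at_neq_bot] by fastforce
qed

text \<open>At q = 0 the arguments are 1, 0, 0, ..., which coincide from the third variable on, so
  the value is the limit in the definition. That limit is determined because the point is a limit
  point of the set of points with distinct coordinates.\<close>

lemma principal_empty_0:
  assumes "norm t < 1"
  shows "hall_littlewood_principal {#} 0 t = 1"
proof -
  define x :: "nat \<Rightarrow> complex" where "x i = 0 ^ i" for i
  have "hall_littlewood n {#} t x = 1" for n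
  proof -
    let ?F = "at x within {y. inj_on y {..<n}}"
    \<comment> \<open>Over the denominator m + n + 1 the first n coordinates have the distinct
      numerators m + n + 1, 1, ..., n - 1, because x 0 = 0 ^ 0 = 1.\<close>
    define f where "f m i = x i + of_nat i / of_nat (Suc (m + n))" for m i
    have "(\<lambda>m. f m i) \<longlonglongrightarrow> x i" for i
    proof -
      have "(\<lambda>m. x i + of_nat i * (1 / of_nat (Suc (m + n)))) \<longlonglongrightarrow> x i + of_nat i * 0"
        by (intro tendsto_intros LIMSEQ_Suc[THEN LIMSEQ_ignore_initial_segment] lim_1_over_n)
      then show ?thesis by (simp add: f_def)
    qed
    then have lim: "f \<longlonglongrightarrow> x"
      using limitin_componentwise[of "\<lambda>_. euclidean" UNIV f x sequentially]
      by (simp add: euclidean_product_topology)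
    have inj: "inj_on (f m) {..<n}" for m
    proof (rule inj_onI)
      fix i j assume ij: "i \<in> {..<n}" "j \<in> {..<n}" "f m i = f m j"
      have v: "f m l = of_nat (if l = 0 then Suc (m + n) else l) / of_nat (Suc (m + n))" for l
        by (simp add: f_def x_def del: of_nat_Suc)
      have "(of_nat (if i = 0 then Suc (m + n) else i) :: complex) = of_nat (if j = 0 then Suc (m + n) else j)"
        using ij(3) unfolding v by (simp del: of_nat_Suc)
      then have "(if i = 0 then Suc (m + n) else i) = (if j = 0 then Suc (m + n) else j)"
        by (simp only: of_nat_eq_iff)
      then show "i = j" using ij by (auto split: if_splits)
    qed
    have "f m 1 \<noteq> x 1" for m by (simp add: f_def del: of_nat_Suc)
    then have ne: "f m \<in> {y. inj_on y {..<n}} - {x}" for m using inj by force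
    have "x islimpt {y. inj_on y {..<n}}"
      unfolding islimpt_def
    proof (intro allI impI)
      fix T assume "x \<in> T" "open T"
      then obtain m where "f m \<in> T"
        using lim by (metis eventually_sequentially topological_tendstoD order_refl)
      then show "\<exists>y\<in>{y. inj_on y {..<n}}. y \<in> T \<and> y \<noteq> x" using ne[of m] by blast
    qed
    then have "?F \<noteq> bot" by (simp add: trivial_limit_within)
    moreover have "(hl_formula n {#} t \<longlongrightarrow> 1) ?F"
      by (rule tendsto_eventually) (auto simp: eventually_at_filter hl_formula_empty[OF assms])
    ultimately show ?thesis unfolding hall_littlewood_def by (simp add: tendsto_Lim)
  qed
  then show ?thesis unfolding hall_littlewood_principal_def x_def by simp
qed

theorem theorem1p8:
  fixes q t p :: complex and k \<sigma> :: nat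
  assumes "norm q < 1" and "norm t < 1"
    and "k \<ge> 1"
    and "p = t * q ^ (2 * k)"
    and "\<sigma> \<in> {0, 1}"
  shows
    "((\<lambda>\<mu>. q ^ ((\<sigma> + 1) * sum_mset \<mu> div 2) * t ^ (size (odd_parts \<mu>) div 2) *
           (\<Prod>i = 1..2 * k - 1. qpoch t (t\<^sup>2) (nat \<lceil>real (count \<mu> i) / 2\<rceil>)) *
           hall_littlewood_principal \<mu> q t)
      has_sum
        (qpoch_inf (p\<^sup>2) (p\<^sup>2) * qpoch_inf p p ^ (k - 1) / qpoch_inf q q ^ k *
         (\<Prod>i = 1..k. theta (q ^ (2 * i - \<sigma>)) (p\<^sup>2)) *
         (\<Prod>j = 1..k. \<Prod>i = 1..<j. theta (q ^ (j - i)) p * theta (q ^ (i + j - \<sigma>)) p)))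
      {\<mu>. is_partition \<mu> \<and> (\<forall>i\<in>#\<mu>. i \<le> 2 * k) \<and> (\<forall>i. odd i \<longrightarrow> even (count \<mu> i))}"
    (is "(?f has_sum _) ?M")
proof -
  have M: "?M \<subseteq> bounded_partitions (2 * k)" by (auto simp: bounded_partitions_def is_partition_def)
  \<comment> \<open>Evenness is what makes the integer division in the exponent of q exact.\<close>
  have ev: "even (sum_mset \<mu>)" if "\<mu> \<in> ?M" for \<mu>
  proof -
    have "\<mu> \<in> bounded_partitions (2 * k)" using that M by blast
    from size_odd_parts[OF this] show ?thesis
      unfolding even_sum_mset_iff using that by (auto intro!: dvd_sum)
  qed
  have "(?f has_sum product_side k q p \<sigma>) ?M"
  proof (cases "q = 0")
    case False
    define r where "r = csqrt q"
    have r: "q = r\<^sup>2" "r \<noteq> 0" using False by (auto simp: r_def)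
    have "((\<lambda>\<mu>. type_weight k t \<mu> * ((r ^ (\<sigma> + 1)) ^ sum_mset \<mu> * hall_littlewood_principal \<mu> q t)) has_sum product_side k q p \<sigma>) (bounded_partitions (2 * k))"
      unfolding assms(4) by (rule weighted_has_sum[OF assms(5) r(1) assms(1) r(2) assms(2,3)])
    then show ?thesis
    proof (rule has_sum_cong_neutral[THEN iffD1, rotated -1])
      show "type_weight k t \<mu> * ((r ^ (\<sigma> + 1)) ^ sum_mset \<mu> * hall_littlewood_principal \<mu> q t) = 0" if "\<mu> \<in> bounded_partitions (2 * k) - ?M" for \<mu>
        using that type_weight_eq[OF assms(3), of \<mu> t] by (auto simp: bounded_partitions_def is_partition_def)
      show "type_weight k t \<mu> * ((r ^ (\<sigma> + 1)) ^ sum_mset \<mu> * hall_littlewood_principal \<mu> q t) = ?f \<mu>" if "\<mu> \<in> bounded_partitions (2 * k) \<inter> ?M" for \<mu>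
      proof -
        have "even ((\<sigma> + 1) * sum_mset \<mu>)" by (rule dvd_mult[OF ev]) (use that in blast)
        then have "(\<sigma> + 1) * sum_mset \<mu> = 2 * ((\<sigma> + 1) * sum_mset \<mu> div 2)" by simp
        then have "(r ^ (\<sigma> + 1)) ^ sum_mset \<mu> = q ^ ((\<sigma> + 1) * sum_mset \<mu> div 2)"
          unfolding r(1) power_mult[symmetric] by metis
        then show ?thesis using that type_weight_eq[OF assms(3), of \<mu> t] by (auto simp: mult_ac)
      qed
    qed (use M in auto)
  next
    case True
    have p: "p = 0" using True assms(3,4) by simp
    \<comment> \<open>For q = 0 all arguments of theta are positive powers of q, hence 0, and 0 / 0
      = 0 makes the second factor 1 as well.\<close>
    have th: "theta 0 0 = 1" by (simp add: theta_def)
    have "product_side k q p \<sigma> = 1"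
      unfolding product_side_def theta_prod_geometric_def p True using assms(5) by (auto simp: th power_0_left intro!: prod.neutral)
    moreover have "(?f has_sum ?f {#}) ?M"
    proof (rule has_sum_cong_neutral[THEN iffD1, rotated -1])
      show "(?f has_sum ?f {#}) {{#}}" by (rule has_sum_finiteI) auto
      \<comment> \<open>A nonempty partition in the range has positive even size, so q = 0 occurs
        with a positive exponent even after the division by 2.\<close>
      show "?f \<mu> = 0" if \<mu>: "\<mu> \<in> ?M - {{#}}" for \<mu>
      proof -
        have "\<mu> \<in> ?M" "\<mu> \<noteq> {#}" using \<mu> by simp_all
        then obtain x where "x \<in># \<mu>" by (auto elim: multiset_nonemptyE)
        then have "x \<in># \<mu>" "x \<noteq> 0" using \<mu> by (auto simp: is_partition_def intro!: gr0I)
        then have s: "sum_mset \<mu> \<noteq> 0" by auto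
        obtain m where m: "sum_mset \<mu> = 2 * m" using ev[OF \<open>\<mu> \<in> ?M\<close>] by (rule evenE)
        have "(\<sigma> + 1) * sum_mset \<mu> div 2 = (\<sigma> + 1) * m" unfolding m by simp
        then have "(\<sigma> + 1) * sum_mset \<mu> div 2 \<noteq> 0" using s m by simp
        then show ?thesis using True by (simp add: power_0_left)
      qed
    qed (auto simp: is_partition_def)
    moreover have "?f {#} = 1" using principal_empty_0[OF assms(2)] True by (simp add: odd_parts_def)
    ultimately show ?thesis by simp
  qed
  then show ?thesis unfolding product_side_eq .
qed

end
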